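(* Let $\Lambda$ be a finite-dimensional algebra over a field $k$ with $\Lambda/\operatorname{rad}\Lambda$ separable over $k$ and $\operatorname{gl.dim}\Lambda=d$, $1\le d<\infty$. Write $\Theta^d:=\operatorname{Ext}^d_{\Lambda^{\mathrm e}}(\Lambda,\Lambda^{\mathrm e})$. For every $\Lambda$-bimodule $X$ there are natural isomorphisms $$\operatorname{HH}^d(\Lambda,X)\cong\Theta^d\otimes_{\Lambda^{\mathrm e}}X,\qquad \operatorname{HH}_d(\Lambda,X)\cong\operatorname{Hom}_{\Lambda^{\mathrm e}}(\Theta^d,X).$$
   Context: $\Lambda^{\mathrm e}=\Lambda\otimes_k\Lambda^{\mathrm{op}}$; $\Lambda$-bimodules are identified with left $\Lambda^{\mathrm e}$-modules (and, equivalently, with right $\Lambda^{\mathrm e}$-modules), all finite-dimensional. $\Theta^d$ carries the bimodule structure induced by the right $\Lambda^{\mathrm e}$-module structure of $\Lambda^{\mathrm e}$. $\operatorname{HH}^n(\Lambda,X)=\operatorname{Ext}^n_{\Lambda^{\mathrm e}}(\Lambda,X)$ and $\operatorname{HH}_n(\Lambda,X)=\operatorname{Tor}_n^{\Lambda^{\mathrm e}}(X,\Lambda)$ are Hochschild cohomology and homology with coefficients in $X$. *)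

theory Defs
  imports
    "Jordan_Normal_Form.Missing_VectorSpace"
    "HOL-Algebra.QuotRing"
    "HOL-Library.Extended_Nat"
begin

section \<open>Algebras, modules and bimodules\<close>

text \<open>The distribution's locale \<^locale>\<open>algebra\<close> is restricted to commutative algebras and
  \<^locale>\<open>Module.module\<close> to commutative scalars, hence the two locales below.  An algebra over \<open>K\<close> is a
  record of type \<open>('k,'a) module\<close> that carries both its multiplication and the \<open>K\<close>-scalar
  multiplication.  In a module over an algebra the fields \<^const>\<open>mult\<close> and \<^const>\<open>one\<close> of the
  record are irrelevant.\<close>

locale assoc_algebra = Module.module R M + ring M for R (structure) and M (structure) +
  assumes smult_mult_left:
      "\<lbrakk>c \<in> carrier R; x \<in> carrier M; y \<in> carrier M\<rbrakk>
        \<Longrightarrow> (c \<odot>\<^bsub>M\<^esub> x) \<otimes>\<^bsub>M\<^esub> y = c \<odot>\<^bsub>M\<^esub> (x \<otimes>\<^bsub>M\<^esub> y)"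
    and smult_mult_right:
      "\<lbrakk>c \<in> carrier R; x \<in> carrier M; y \<in> carrier M\<rbrakk>
        \<Longrightarrow> x \<otimes>\<^bsub>M\<^esub> (c \<odot>\<^bsub>M\<^esub> y) = c \<odot>\<^bsub>M\<^esub> (x \<otimes>\<^bsub>M\<^esub> y)"

locale left_module = R?: ring R + M?: abelian_group M
  for R :: "('a, 'r) ring_scheme" (structure) and M :: "('a, 'm, 'z) module_scheme" (structure) +
  assumes smult_closed:
      "\<lbrakk>a \<in> carrier R; x \<in> carrier M\<rbrakk> \<Longrightarrow> a \<odot>\<^bsub>M\<^esub> x \<in> carrier M"
    and smult_l_distr:
      "\<lbrakk>a \<in> carrier R; b \<in> carrier R; x \<in> carrier M\<rbrakk>
        \<Longrightarrow> (a \<oplus>\<^bsub>R\<^esub> b) \<odot>\<^bsub>M\<^esub> x = a \<odot>\<^bsub>M\<^esub> x \<oplus>\<^bsub>M\<^esub> b \<odot>\<^bsub>M\<^esub> x"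
    and smult_r_distr:
      "\<lbrakk>a \<in> carrier R; x \<in> carrier M; y \<in> carrier M\<rbrakk>
        \<Longrightarrow> a \<odot>\<^bsub>M\<^esub> (x \<oplus>\<^bsub>M\<^esub> y) = a \<odot>\<^bsub>M\<^esub> x \<oplus>\<^bsub>M\<^esub> a \<odot>\<^bsub>M\<^esub> y"
    and smult_assoc:
      "\<lbrakk>a \<in> carrier R; b \<in> carrier R; x \<in> carrier M\<rbrakk>
        \<Longrightarrow> (a \<otimes>\<^bsub>R\<^esub> b) \<odot>\<^bsub>M\<^esub> x = a \<odot>\<^bsub>M\<^esub> (b \<odot>\<^bsub>M\<^esub> x)"
    and smult_one:
      "x \<in> carrier M \<Longrightarrow> \<one>\<^bsub>R\<^esub> \<odot>\<^bsub>M\<^esub> x = x"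

text \<open>Right modules over \<open>A\<close> are left modules over the opposite algebra: for a right module \<open>M\<close>
  the element \<open>a \<odot>\<^bsub>M\<^esub> x\<close> is \<open>x\<close> multiplied by \<open>a\<close> from the right.\<close>

definition op_algebra :: "('k, 'a) module \<Rightarrow> ('k, 'a) module" where
  "op_algebra A = A\<lparr>mult := \<lambda>x y. y \<otimes>\<^bsub>A\<^esub> x\<rparr>"

text \<open>The regular left module; also the field \<open>K\<close> as an algebra over itself.\<close>

definition regular_module :: "('a, 'z) ring_scheme \<Rightarrow> ('a, 'a) module" where
  "regular_module A =
    \<lparr>carrier = carrier A, mult = mult A, one = \<one>\<^bsub>A\<^esub>, zero = \<zero>\<^bsub>A\<^esub>, add = add A, smult = mult A\<rparr>"

text \<open>The vector space underlying a (left or right) module over the \<open>K\<close>-algebra \<open>A\<close>.\<close>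

definition scalars :: "('k, 'a) module \<Rightarrow> ('a, 'm, 'z) module_scheme \<Rightarrow> ('k, 'm) module" where
  "scalars A M =
    \<lparr>carrier = carrier M, mult = mult M, one = \<one>\<^bsub>M\<^esub>, zero = \<zero>\<^bsub>M\<^esub>, add = add M,
     smult = \<lambda>c x. (c \<odot>\<^bsub>A\<^esub> \<one>\<^bsub>A\<^esub>) \<odot>\<^bsub>M\<^esub> x\<rparr>"

definition fd_space :: "('k, 'z) ring_scheme \<Rightarrow> ('k, 'v) module \<Rightarrow> bool" where
  "fd_space K V \<longleftrightarrow> vectorspace K V \<and> vectorspace.fin_dim K V"

definition fd_algebra :: "('k, 'z) ring_scheme \<Rightarrow> ('k, 'a) module \<Rightarrow> bool" where
  "fd_algebra K A \<longleftrightarrow> assoc_algebra K A \<and> fd_space K A"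

definition fd_left_module ::
    "('k, 'z) ring_scheme \<Rightarrow> ('k, 'a) module \<Rightarrow> ('a, 'm) module \<Rightarrow> bool" where
  "fd_left_module K A M \<longleftrightarrow> left_module A M \<and> fd_space K (scalars A M)"

record ('a, 'b) bimodule = "('a, 'b) module" +
  rsmult :: "'b \<Rightarrow> 'a \<Rightarrow> 'b"

definition bimodule_right :: "('a, 'b) bimodule \<Rightarrow> ('a, 'b) module" where
  "bimodule_right X =
    \<lparr>carrier = carrier X, mult = mult X, one = \<one>\<^bsub>X\<^esub>, zero = \<zero>\<^bsub>X\<^esub>, add = add X,
     smult = \<lambda>a x. rsmult X x a\<rparr>"

text \<open>\<open>K\<close> is required to act centrally, as it does on a module over the enveloping algebra.\<close>

definition bimodule ::
    "('k, 'z) ring_scheme \<Rightarrow> ('k, 'a) module \<Rightarrow> ('a, 'b) bimodule \<Rightarrow> bool" where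
  "bimodule K A X \<longleftrightarrow>
    left_module A X \<and> left_module (op_algebra A) (bimodule_right X) \<and>
    (\<forall>a\<in>carrier A. \<forall>b\<in>carrier A. \<forall>x\<in>carrier X.
      rsmult X (a \<odot>\<^bsub>X\<^esub> x) b = a \<odot>\<^bsub>X\<^esub> rsmult X x b) \<and>
    (\<forall>c\<in>carrier K. \<forall>x\<in>carrier X. (c \<odot>\<^bsub>A\<^esub> \<one>\<^bsub>A\<^esub>) \<odot>\<^bsub>X\<^esub> x = rsmult X x (c \<odot>\<^bsub>A\<^esub> \<one>\<^bsub>A\<^esub>))"

definition fd_bimodule ::
    "('k, 'z) ring_scheme \<Rightarrow> ('k, 'a) module \<Rightarrow> ('a, 'b) bimodule \<Rightarrow> bool" where
  "fd_bimodule K A X \<longleftrightarrow> bimodule K A X \<and> fd_space K (scalars A X)"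

definition bimodule_hom ::
    "('k, 'a) module \<Rightarrow> ('a, 'x) bimodule \<Rightarrow> ('a, 'y) bimodule \<Rightarrow> ('x \<Rightarrow> 'y) set" where
  "bimodule_hom A X Y =
    LinearCombinations.module_hom A X Y \<inter>
    LinearCombinations.module_hom A (bimodule_right X) (bimodule_right Y)"

definition regular_bimodule :: "('k, 'a) module \<Rightarrow> ('a, 'a) bimodule" where
  "regular_bimodule A =
    \<lparr>carrier = carrier A, mult = mult A, one = \<one>\<^bsub>A\<^esub>, zero = \<zero>\<^bsub>A\<^esub>, add = add A,
     smult = mult A, rsmult = mult A\<rparr>"


section \<open>Subquotients, spaces of homomorphisms, tensor products\<close>

text \<open>For subspaces \<open>B \<subseteq> Z\<close> of \<open>V\<close>: the vector space \<open>Z / B\<close>, whose elements are cosets.\<close>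

definition subquotient :: "('k, 'v) module \<Rightarrow> 'v set \<Rightarrow> 'v set \<Rightarrow> ('k, 'v set) module" where
  "subquotient V Z B =
    \<lparr>carrier = (\<lambda>z. B +>\<^bsub>V\<^esub> z) ` Z, mult = undefined, one = undefined, zero = B,
     add = set_add V, smult = \<lambda>c F. (\<Union>x\<in>F. B +>\<^bsub>V\<^esub> (c \<odot>\<^bsub>V\<^esub> x))\<rparr>"

text \<open>Homomorphisms are normalised to be \<^const>\<open>undefined\<close> outside the carrier.\<close>

definition hom_space ::
    "('k, 'a) module \<Rightarrow> ('a, 'm) module \<Rightarrow> ('a, 'n) module \<Rightarrow> ('k, 'm \<Rightarrow> 'n) module" where
  "hom_space A M N =
    \<lparr>carrier = LinearCombinations.module_hom A M N \<inter> extensional (carrier M),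
     mult = undefined, one = undefined, zero = (\<lambda>x\<in>carrier M. \<zero>\<^bsub>N\<^esub>),
     add = \<lambda>f g. \<lambda>x\<in>carrier M. f x \<oplus>\<^bsub>N\<^esub> g x,
     smult = \<lambda>c f. \<lambda>x\<in>carrier M. c \<odot>\<^bsub>scalars A N\<^esub> f x\<rparr>"

definition free_space :: "('k, 'z) ring_scheme \<Rightarrow> 's set \<Rightarrow> ('k, 's \<Rightarrow> 'k) module" where
  "free_space K S =
    \<lparr>carrier = {f. range f \<subseteq> carrier K \<and> finite {s. f s \<noteq> \<zero>\<^bsub>K\<^esub>} \<and> {s. f s \<noteq> \<zero>\<^bsub>K\<^esub>} \<subseteq> S},
     mult = undefined, one = undefined, zero = (\<lambda>_. \<zero>\<^bsub>K\<^esub>),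
     add = \<lambda>f g s. f s \<oplus>\<^bsub>K\<^esub> g s, smult = \<lambda>c f s. c \<otimes>\<^bsub>K\<^esub> f s\<rparr>"

definition free_gen :: "('k, 'z) ring_scheme \<Rightarrow> 's \<Rightarrow> 's \<Rightarrow> 'k" where
  "free_gen K s = (\<lambda>t. if t = s then \<one>\<^bsub>K\<^esub> else \<zero>\<^bsub>K\<^esub>)"

text \<open>\<open>M \<otimes>\<^sub>A N\<close> for a right module \<open>M\<close> and a left module \<open>N\<close> over the \<open>K\<close>-algebra \<open>A\<close>: the
  vector space on the symbols \<open>(x, y)\<close> modulo biadditivity, \<open>A\<close>-balancedness and
  \<open>K\<close>-linearity.\<close>

definition tensor_relations ::
    "('k, 'z) ring_scheme \<Rightarrow> ('k, 'a) module \<Rightarrow> ('a, 'm) module \<Rightarrow> ('a, 'n) module \<Rightarrow>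
     ('m \<times> 'n \<Rightarrow> 'k) set" where
  "tensor_relations K A M N = (let F = free_space K (carrier M \<times> carrier N); e = free_gen K in
     {e (x \<oplus>\<^bsub>M\<^esub> x', y) \<ominus>\<^bsub>F\<^esub> (e (x, y) \<oplus>\<^bsub>F\<^esub> e (x', y)) | x x' y.
        x \<in> carrier M \<and> x' \<in> carrier M \<and> y \<in> carrier N} \<union>
     {e (x, y \<oplus>\<^bsub>N\<^esub> y') \<ominus>\<^bsub>F\<^esub> (e (x, y) \<oplus>\<^bsub>F\<^esub> e (x, y')) | x y y'.
        x \<in> carrier M \<and> y \<in> carrier N \<and> y' \<in> carrier N} \<union>
     {e (a \<odot>\<^bsub>M\<^esub> x, y) \<ominus>\<^bsub>F\<^esub> e (x, a \<odot>\<^bsub>N\<^esub> y) | a x y.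
        a \<in> carrier A \<and> x \<in> carrier M \<and> y \<in> carrier N} \<union>
     {e (c \<odot>\<^bsub>scalars A M\<^esub> x, y) \<ominus>\<^bsub>F\<^esub> (c \<odot>\<^bsub>F\<^esub> e (x, y)) | c x y.
        c \<in> carrier K \<and> x \<in> carrier M \<and> y \<in> carrier N})"

definition tensor_null ::
    "('k, 'z) ring_scheme \<Rightarrow> ('k, 'a) module \<Rightarrow> ('a, 'm) module \<Rightarrow> ('a, 'n) module \<Rightarrow>
     ('m \<times> 'n \<Rightarrow> 'k) set" where
  "tensor_null K A M N =
    LinearCombinations.module.span K (free_space K (carrier M \<times> carrier N))
      (tensor_relations K A M N)"

definition tensor_space ::
    "('k, 'z) ring_scheme \<Rightarrow> ('k, 'a) module \<Rightarrow> ('a, 'm) module \<Rightarrow> ('a, 'n) module \<Rightarrow>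
     ('k, ('m \<times> 'n \<Rightarrow> 'k) set) module" where
  "tensor_space K A M N =
    (let F = free_space K (carrier M \<times> carrier N)
     in subquotient F (carrier F) (tensor_null K A M N))"

definition pure_tensor ::
    "('k, 'z) ring_scheme \<Rightarrow> ('k, 'a) module \<Rightarrow> ('a, 'm) module \<Rightarrow> ('a, 'n) module \<Rightarrow>
     'm \<Rightarrow> 'n \<Rightarrow> ('m \<times> 'n \<Rightarrow> 'k) set" where
  "pure_tensor K A M N x y =
    tensor_null K A M N +>\<^bsub>free_space K (carrier M \<times> carrier N)\<^esub> free_gen K (x, y)"

text \<open>The value at a tensor \<open>\<xi>\<close> of the linear map to \<open>V\<close> induced by the balanced \<open>K\<close>-bilinear map
  \<open>\<phi>\<close>.  It is computed from representatives \<open>f\<close> of the coset \<open>\<xi>\<close>, all of which give the same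
  result when \<open>\<phi>\<close> is balanced and bilinear.\<close>

definition tensor_lift ::
    "('k, 'z) ring_scheme \<Rightarrow> ('k, 'v) module \<Rightarrow> ('m \<times> 'n \<Rightarrow> 'v) \<Rightarrow> ('m \<times> 'n \<Rightarrow> 'k) set \<Rightarrow> 'v" where
  "tensor_lift K V \<phi> \<xi> =
    the_elem ((\<lambda>f. \<Oplus>\<^bsub>V\<^esub> s\<in>{s. f s \<noteq> \<zero>\<^bsub>K\<^esub>}. f s \<odot>\<^bsub>V\<^esub> \<phi> s) ` \<xi>)"

text \<open>\<open>\<phi> \<otimes> \<psi>\<close> as a map into \<open>M \<otimes>\<^sub>A N\<close>.\<close>

definition tensor_map ::
    "('k, 'z) ring_scheme \<Rightarrow> ('k, 'a) module \<Rightarrow> ('a, 'm) module \<Rightarrow> ('a, 'n) module \<Rightarrow>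
     ('m' \<Rightarrow> 'm) \<Rightarrow> ('n' \<Rightarrow> 'n) \<Rightarrow> ('m' \<times> 'n' \<Rightarrow> 'k) set \<Rightarrow> ('m \<times> 'n \<Rightarrow> 'k) set" where
  "tensor_map K A M N \<phi> \<psi> =
    tensor_lift K (tensor_space K A M N) (\<lambda>(x, y). pure_tensor K A M N (\<phi> x) (\<psi> y))"


section \<open>The enveloping algebra\<close>

definition tensor_algebra ::
    "('k, 'z) ring_scheme \<Rightarrow> ('k, 'a) module \<Rightarrow> ('k, 'b) module \<Rightarrow>
     ('k, ('a \<times> 'b \<Rightarrow> 'k) set) module" where
  "tensor_algebra K A B =
    (let T = tensor_space K (regular_module K) A B;
         t = pure_tensor K (regular_module K) A B
     in T\<lparr>mult := \<lambda>\<xi> \<zeta>. tensor_lift K T (\<lambda>(a, b).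
                    tensor_lift K T (\<lambda>(a', b'). t (a \<otimes>\<^bsub>A\<^esub> a') (b \<otimes>\<^bsub>B\<^esub> b')) \<zeta>) \<xi>,
          one := t \<one>\<^bsub>A\<^esub> \<one>\<^bsub>B\<^esub>\<rparr>)"

definition enveloping_algebra ::
    "('k, 'z) ring_scheme \<Rightarrow> ('k, 'a) module \<Rightarrow> ('k, ('a \<times> 'a \<Rightarrow> 'k) set) module" where
  "enveloping_algebra K A = tensor_algebra K A (op_algebra A)"

text \<open>A bimodule \<open>X\<close> as a left module, \<open>(a \<otimes> b) x = a x b\<close>, and as a right module,
  \<open>x (a \<otimes> b) = b x a\<close>, over the enveloping algebra.\<close>

definition env_left ::
    "('k, 'z) ring_scheme \<Rightarrow> ('k, 'a) module \<Rightarrow> ('a, 'x) bimodule \<Rightarrow>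
     (('a \<times> 'a \<Rightarrow> 'k) set, 'x) module" where
  "env_left K A X =
    \<lparr>carrier = carrier X, mult = mult X, one = \<one>\<^bsub>X\<^esub>, zero = \<zero>\<^bsub>X\<^esub>, add = add X,
     smult = \<lambda>\<xi> x. tensor_lift K (scalars A X) (\<lambda>(a, b). rsmult X (a \<odot>\<^bsub>X\<^esub> x) b) \<xi>\<rparr>"

definition env_right ::
    "('k, 'z) ring_scheme \<Rightarrow> ('k, 'a) module \<Rightarrow> ('a, 'x) bimodule \<Rightarrow>
     (('a \<times> 'a \<Rightarrow> 'k) set, 'x) module" where
  "env_right K A X =
    \<lparr>carrier = carrier X, mult = mult X, one = \<one>\<^bsub>X\<^esub>, zero = \<zero>\<^bsub>X\<^esub>, add = add X,
     smult = \<lambda>\<xi> x. tensor_lift K (scalars A X) (\<lambda>(a, b). rsmult X (b \<odot>\<^bsub>X\<^esub> x) a) \<xi>\<rparr>"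


section \<open>Projective resolutions and global dimension\<close>

text \<open>All modules are finite-dimensional.  The type \<^typ>\<open>nat \<Rightarrow> 'k\<close> serves as a universe: every
  finite-dimensional \<open>K\<close>-vector space is isomorphic to one whose carrier is a set of such
  functions, so quantifying over modules on this type amounts to quantifying over all
  finite-dimensional modules.\<close>

definition projective_module ::
    "('k, 'z) ring_scheme \<Rightarrow> ('k, 'a) module \<Rightarrow> ('a, 'p) module \<Rightarrow> bool" where
  "projective_module K A P \<longleftrightarrow>
    fd_left_module K A P \<and>
    (\<forall>(M :: ('a, nat \<Rightarrow> 'k) module) (N :: ('a, nat \<Rightarrow> 'k) module) g h.
       fd_left_module K A M \<and> fd_left_module K A N \<and>
       g \<in> LinearCombinations.module_hom A M N \<and> g ` carrier M = carrier N \<and>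
       h \<in> LinearCombinations.module_hom A P N
       \<longrightarrow> (\<exists>h' \<in> LinearCombinations.module_hom A P M. \<forall>x\<in>carrier P. g (h' x) = h x))"

text \<open>The exact complex \<open>\<dots> \<rightarrow> P\<^sub>2 \<rightarrow> P\<^sub>1 \<rightarrow> P\<^sub>0 \<rightarrow> M \<rightarrow> 0\<close> with differentials
  \<open>D n : P\<^sub>n\<^sub>+\<^sub>1 \<rightarrow> P\<^sub>n\<close> and augmentation \<open>\<epsilon> : P\<^sub>0 \<rightarrow> M\<close>.\<close>

definition projective_resolution ::
    "('k, 'z) ring_scheme \<Rightarrow> ('k, 'a) module \<Rightarrow> ('a, 'm) module \<Rightarrow>
     (nat \<Rightarrow> ('a, 'p) module) \<Rightarrow> (nat \<Rightarrow> 'p \<Rightarrow> 'p) \<Rightarrow> ('p \<Rightarrow> 'm) \<Rightarrow> bool" where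
  "projective_resolution K A M P D \<epsilon> \<longleftrightarrow>
    (\<forall>n. projective_module K A (P n)) \<and>
    (\<forall>n. D n \<in> LinearCombinations.module_hom A (P (Suc n)) (P n)) \<and>
    \<epsilon> \<in> LinearCombinations.module_hom A (P 0) M \<and>
    \<epsilon> ` carrier (P 0) = carrier M \<and>
    D 0 ` carrier (P 1) = {x \<in> carrier (P 0). \<epsilon> x = \<zero>\<^bsub>M\<^esub>} \<and>
    (\<forall>n. D (Suc n) ` carrier (P (Suc (Suc n))) =
         {x \<in> carrier (P (Suc n)). D n x = \<zero>\<^bsub>P n\<^esub>})"

definition proj_dim ::
    "('k, 'z) ring_scheme \<Rightarrow> ('k, 'a) module \<Rightarrow> ('a, 'm) module \<Rightarrow> enat" where
  "proj_dim K A M =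
    Inf {enat n | n. \<exists>(P :: nat \<Rightarrow> ('a, nat \<Rightarrow> 'k) module) D \<epsilon>.
           projective_resolution K A M P D \<epsilon> \<and> (\<forall>i>n. carrier (P i) = {\<zero>\<^bsub>P i\<^esub>})}"

definition gl_dim :: "('k, 'z) ring_scheme \<Rightarrow> ('k, 'a) module \<Rightarrow> enat" where
  "gl_dim K A =
    Sup {proj_dim K A M | M :: ('a, nat \<Rightarrow> 'k) module. fd_left_module K A M}"


section \<open>Radical and separability\<close>

definition left_ideal :: "'a set \<Rightarrow> ('k, 'a) module \<Rightarrow> bool" where
  "left_ideal I A \<longleftrightarrow> Module.submodule I A (regular_module A)"

definition maximal_left_ideal :: "'a set \<Rightarrow> ('k, 'a) module \<Rightarrow> bool" where
  "maximal_left_ideal I A \<longleftrightarrow>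
    left_ideal I A \<and> I \<noteq> carrier A \<and>
    (\<forall>J. left_ideal J A \<and> I \<subseteq> J \<longrightarrow> J = I \<or> J = carrier A)"

definition jacobson_radical :: "('k, 'a) module \<Rightarrow> 'a set" where
  "jacobson_radical A = carrier A \<inter> \<Inter>{I. maximal_left_ideal I A}"

definition quotient_algebra :: "('k, 'a) module \<Rightarrow> 'a set \<Rightarrow> ('k, 'a set) module" where
  "quotient_algebra A I =
    ring.extend (A Quot I)
      (module.fields (\<lambda>c F. (\<Union>x\<in>F. I +>\<^bsub>A\<^esub> (c \<odot>\<^bsub>A\<^esub> x))))"

text \<open>A finite-dimensional algebra is separable if it is projective as a module over its
  enveloping algebra.\<close>

definition separable_algebra :: "('k, 'z) ring_scheme \<Rightarrow> ('k, 'a) module \<Rightarrow> bool" where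
  "separable_algebra K A \<longleftrightarrow>
    projective_module K (enveloping_algebra K A) (env_left K A (regular_bimodule A))"


section \<open>Ext and Tor\<close>

text \<open>Derived functors are computed from a projective resolution that is chosen once and for all
  for every module.\<close>

definition the_resolution ::
    "('k, 'z) ring_scheme \<Rightarrow> ('k, 'a) module \<Rightarrow> ('a, 'm) module \<Rightarrow>
     (nat \<Rightarrow> ('a, nat \<Rightarrow> 'k) module) \<times> (nat \<Rightarrow> (nat \<Rightarrow> 'k) \<Rightarrow> (nat \<Rightarrow> 'k)) \<times> ((nat \<Rightarrow> 'k) \<Rightarrow> 'm)"
  where
  "the_resolution K A M = (SOME (P, D, \<epsilon>). projective_resolution K A M P D \<epsilon>)"

definition res_module ::
    "('k, 'z) ring_scheme \<Rightarrow> ('k, 'a) module \<Rightarrow> ('a, 'm) module \<Rightarrow> nat \<Rightarrow>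
     ('a, nat \<Rightarrow> 'k) module" where
  "res_module K A M = fst (the_resolution K A M)"

definition res_diff ::
    "('k, 'z) ring_scheme \<Rightarrow> ('k, 'a) module \<Rightarrow> ('a, 'm) module \<Rightarrow> nat \<Rightarrow>
     (nat \<Rightarrow> 'k) \<Rightarrow> (nat \<Rightarrow> 'k)" where
  "res_diff K A M = fst (snd (the_resolution K A M))"

text \<open>\<open>Ext\<^sup>n\<^sub>A(M, N)\<close> for left modules \<open>M\<close>, \<open>N\<close>: the cohomology of \<open>Hom\<^sub>A(P, N)\<close>.\<close>

definition Ext_coboundary ::
    "('k, 'z) ring_scheme \<Rightarrow> ('k, 'a) module \<Rightarrow> ('a, 'm) module \<Rightarrow> nat \<Rightarrow>
     ((nat \<Rightarrow> 'k) \<Rightarrow> 'n) \<Rightarrow> ((nat \<Rightarrow> 'k) \<Rightarrow> 'n)" where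
  "Ext_coboundary K A M n f = compose (carrier (res_module K A M (Suc n))) f (res_diff K A M n)"

definition Ext_cocycles ::
    "('k, 'z) ring_scheme \<Rightarrow> ('k, 'a) module \<Rightarrow> nat \<Rightarrow> ('a, 'm) module \<Rightarrow> ('a, 'n) module \<Rightarrow>
     ((nat \<Rightarrow> 'k) \<Rightarrow> 'n) set" where
  "Ext_cocycles K A n M N =
    {f \<in> carrier (hom_space A (res_module K A M n) N).
       Ext_coboundary K A M n f = \<zero>\<^bsub>hom_space A (res_module K A M (Suc n)) N\<^esub>}"

definition Ext_coboundaries ::
    "('k, 'z) ring_scheme \<Rightarrow> ('k, 'a) module \<Rightarrow> nat \<Rightarrow> ('a, 'm) module \<Rightarrow> ('a, 'n) module \<Rightarrow>
     ((nat \<Rightarrow> 'k) \<Rightarrow> 'n) set" where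
  "Ext_coboundaries K A n M N =
    (case n of
       0 \<Rightarrow> {\<zero>\<^bsub>hom_space A (res_module K A M 0) N\<^esub>}
     | Suc m \<Rightarrow> Ext_coboundary K A M m ` carrier (hom_space A (res_module K A M m) N))"

definition Ext ::
    "('k, 'z) ring_scheme \<Rightarrow> ('k, 'a) module \<Rightarrow> nat \<Rightarrow> ('a, 'm) module \<Rightarrow> ('a, 'n) module \<Rightarrow>
     ('k, ((nat \<Rightarrow> 'k) \<Rightarrow> 'n) set) module" where
  "Ext K A n M N =
    subquotient (hom_space A (res_module K A M n) N)
      (Ext_cocycles K A n M N) (Ext_coboundaries K A n M N)"

text \<open>The map \<open>Ext\<^sup>n\<^sub>A(M, N) \<rightarrow> Ext\<^sup>n\<^sub>A(M, N')\<close> induced by \<open>h : N \<rightarrow> N'\<close>.\<close>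

definition Ext_map ::
    "('k, 'z) ring_scheme \<Rightarrow> ('k, 'a) module \<Rightarrow> nat \<Rightarrow> ('a, 'm) module \<Rightarrow> ('a, 'n') module \<Rightarrow>
     ('n \<Rightarrow> 'n') \<Rightarrow> ((nat \<Rightarrow> 'k) \<Rightarrow> 'n) set \<Rightarrow> ((nat \<Rightarrow> 'k) \<Rightarrow> 'n') set" where
  "Ext_map K A n M N' h \<xi> =
    (\<Union>f\<in>\<xi>. Ext_coboundaries K A n M N' +>\<^bsub>hom_space A (res_module K A M n) N'\<^esub>
            compose (carrier (res_module K A M n)) h f)"

text \<open>\<open>Ext\<^sup>n\<^sub>A(M, A)\<close> as a right module, the action being induced by right multiplications in \<open>A\<close>.\<close>

definition Ext_algebra ::
    "('k, 'z) ring_scheme \<Rightarrow> ('k, 'a) module \<Rightarrow> nat \<Rightarrow> ('a, 'm) module \<Rightarrow>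
     ('a, ((nat \<Rightarrow> 'k) \<Rightarrow> 'a) set) module" where
  "Ext_algebra K A n M =
    (let E = Ext K A n M (regular_module A)
     in \<lparr>carrier = carrier E, mult = undefined, one = undefined, zero = \<zero>\<^bsub>E\<^esub>, add = add E,
         smult = \<lambda>a \<xi>. Ext_map K A n M (regular_module A) (\<lambda>b. b \<otimes>\<^bsub>A\<^esub> a) \<xi>\<rparr>)"

text \<open>\<open>Tor\<^sub>n\<^sup>A(X, M)\<close> for a right module \<open>X\<close> and a left module \<open>M\<close>: the homology of
  \<open>X \<otimes>\<^sub>A P\<close>.\<close>

definition Tor_chains ::
    "('k, 'z) ring_scheme \<Rightarrow> ('k, 'a) module \<Rightarrow> nat \<Rightarrow> ('a, 'x) module \<Rightarrow> ('a, 'm) module \<Rightarrow>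
     ('k, ('x \<times> (nat \<Rightarrow> 'k) \<Rightarrow> 'k) set) module" where
  "Tor_chains K A n X M = tensor_space K A X (res_module K A M n)"

definition Tor_boundary ::
    "('k, 'z) ring_scheme \<Rightarrow> ('k, 'a) module \<Rightarrow> nat \<Rightarrow> ('a, 'x) module \<Rightarrow> ('a, 'm) module \<Rightarrow>
     ('x \<times> (nat \<Rightarrow> 'k) \<Rightarrow> 'k) set \<Rightarrow> ('x \<times> (nat \<Rightarrow> 'k) \<Rightarrow> 'k) set" where
  "Tor_boundary K A n X M = tensor_map K A X (res_module K A M n) (\<lambda>x. x) (res_diff K A M n)"

definition Tor_cycles ::
    "('k, 'z) ring_scheme \<Rightarrow> ('k, 'a) module \<Rightarrow> nat \<Rightarrow> ('a, 'x) module \<Rightarrow> ('a, 'm) module \<Rightarrow>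
     ('x \<times> (nat \<Rightarrow> 'k) \<Rightarrow> 'k) set set" where
  "Tor_cycles K A n X M =
    (case n of
       0 \<Rightarrow> carrier (Tor_chains K A 0 X M)
     | Suc m \<Rightarrow> {\<xi> \<in> carrier (Tor_chains K A n X M).
                 Tor_boundary K A m X M \<xi> = \<zero>\<^bsub>Tor_chains K A m X M\<^esub>})"

definition Tor_boundaries ::
    "('k, 'z) ring_scheme \<Rightarrow> ('k, 'a) module \<Rightarrow> nat \<Rightarrow> ('a, 'x) module \<Rightarrow> ('a, 'm) module \<Rightarrow>
     ('x \<times> (nat \<Rightarrow> 'k) \<Rightarrow> 'k) set set" where
  "Tor_boundaries K A n X M = Tor_boundary K A n X M ` carrier (Tor_chains K A (Suc n) X M)"

definition Tor ::
    "('k, 'z) ring_scheme \<Rightarrow> ('k, 'a) module \<Rightarrow> nat \<Rightarrow> ('a, 'x) module \<Rightarrow> ('a, 'm) module \<Rightarrow>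
     ('k, ('x \<times> (nat \<Rightarrow> 'k) \<Rightarrow> 'k) set set) module" where
  "Tor K A n X M =
    subquotient (Tor_chains K A n X M) (Tor_cycles K A n X M) (Tor_boundaries K A n X M)"

text \<open>The map \<open>Tor\<^sub>n\<^sup>A(X, M) \<rightarrow> Tor\<^sub>n\<^sup>A(X', M)\<close> induced by \<open>h : X \<rightarrow> X'\<close>.\<close>

definition Tor_map ::
    "('k, 'z) ring_scheme \<Rightarrow> ('k, 'a) module \<Rightarrow> nat \<Rightarrow> ('a, 'x') module \<Rightarrow> ('a, 'm) module \<Rightarrow>
     ('x \<Rightarrow> 'x') \<Rightarrow> ('x \<times> (nat \<Rightarrow> 'k) \<Rightarrow> 'k) set set \<Rightarrow> ('x' \<times> (nat \<Rightarrow> 'k) \<Rightarrow> 'k) set set" where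
  "Tor_map K A n X' M h \<tau> =
    (\<Union>\<xi>\<in>\<tau>. Tor_boundaries K A n X' M +>\<^bsub>Tor_chains K A n X' M\<^esub>
            tensor_map K A X' (res_module K A M n) h (\<lambda>p. p) \<xi>)"


section \<open>Hochschild cohomology and homology\<close>

definition HH_cohomology ::
    "('k, 'z) ring_scheme \<Rightarrow> ('k, 'a) module \<Rightarrow> nat \<Rightarrow> ('a, 'x) bimodule \<Rightarrow>
     ('k, ((nat \<Rightarrow> 'k) \<Rightarrow> 'x) set) module" where
  "HH_cohomology K A n X =
    Ext K (enveloping_algebra K A) n (env_left K A (regular_bimodule A)) (env_left K A X)"

definition HH_cohomology_map ::
    "('k, 'z) ring_scheme \<Rightarrow> ('k, 'a) module \<Rightarrow> nat \<Rightarrow> ('a, 'y) bimodule \<Rightarrow>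
     ('x \<Rightarrow> 'y) \<Rightarrow> ((nat \<Rightarrow> 'k) \<Rightarrow> 'x) set \<Rightarrow> ((nat \<Rightarrow> 'k) \<Rightarrow> 'y) set" where
  "HH_cohomology_map K A n Y f =
    Ext_map K (enveloping_algebra K A) n (env_left K A (regular_bimodule A)) (env_left K A Y) f"

definition HH_homology ::
    "('k, 'z) ring_scheme \<Rightarrow> ('k, 'a) module \<Rightarrow> nat \<Rightarrow> ('a, 'x) bimodule \<Rightarrow>
     ('k, ('x \<times> (nat \<Rightarrow> 'k) \<Rightarrow> 'k) set set) module" where
  "HH_homology K A n X =
    Tor K (enveloping_algebra K A) n (env_right K A X) (env_left K A (regular_bimodule A))"

definition HH_homology_map ::
    "('k, 'z) ring_scheme \<Rightarrow> ('k, 'a) module \<Rightarrow> nat \<Rightarrow> ('a, 'y) bimodule \<Rightarrow>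
     ('x \<Rightarrow> 'y) \<Rightarrow> ('x \<times> (nat \<Rightarrow> 'k) \<Rightarrow> 'k) set set \<Rightarrow> ('y \<times> (nat \<Rightarrow> 'k) \<Rightarrow> 'k) set set" where
  "HH_homology_map K A n Y f =
    Tor_map K (enveloping_algebra K A) n (env_right K A Y) (env_left K A (regular_bimodule A)) f"

text \<open>\<open>\<Theta>\<^sup>n\<close>, a right module over the enveloping algebra.\<close>

definition Theta ::
    "('k, 'z) ring_scheme \<Rightarrow> ('k, 'a) module \<Rightarrow> nat \<Rightarrow>
     (('a \<times> 'a \<Rightarrow> 'k) set, ((nat \<Rightarrow> 'k) \<Rightarrow> ('a \<times> 'a \<Rightarrow> 'k) set) set) module" where
  "Theta K A n = Ext_algebra K (enveloping_algebra K A) n (env_left K A (regular_bimodule A))"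


section \<open>Natural isomorphisms\<close>

text \<open>For functors \<open>F\<close>, \<open>G\<close> from finite-dimensional bimodules to vector spaces.  The action of \<open>F\<close>
  on a morphism \<open>f : X \<rightarrow> Y\<close> is \<open>F' Y f\<close>, likewise for \<open>G\<close>.\<close>

definition natural_iso ::
    "('k, 'z) ring_scheme \<Rightarrow> ('k, 'a) module \<Rightarrow>
     (('a, 'x) bimodule \<Rightarrow> ('k, 'u) module) \<Rightarrow> (('a, 'x) bimodule \<Rightarrow> ('x \<Rightarrow> 'x) \<Rightarrow> 'u \<Rightarrow> 'u) \<Rightarrow>
     (('a, 'x) bimodule \<Rightarrow> ('k, 'v) module) \<Rightarrow> (('a, 'x) bimodule \<Rightarrow> ('x \<Rightarrow> 'x) \<Rightarrow> 'v \<Rightarrow> 'v) \<Rightarrow>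
     (('a, 'x) bimodule \<Rightarrow> 'u \<Rightarrow> 'v) \<Rightarrow> bool" where
  "natural_iso K A F F' G G' \<eta> \<longleftrightarrow>
    (\<forall>X. fd_bimodule K A X \<longrightarrow>
       linear_map K (F X) (G X) (\<eta> X) \<and> bij_betw (\<eta> X) (carrier (F X)) (carrier (G X))) \<and>
    (\<forall>X Y f. fd_bimodule K A X \<and> fd_bimodule K A Y \<and> f \<in> bimodule_hom A X Y \<longrightarrow>
       (\<forall>u\<in>carrier (F X). \<eta> Y (F' Y f u) = G' Y f (\<eta> X u)))"

end

theory Submission
  imports Defs
begin

text \<open>A bimodule \<open>Y\<close> with \<open>Y rad = 0\<close> is a retract of the coinduced bimodule
  \<open>Hom\<^sub>K(\<Lambda> / rad, Y)\<close> because \<open>\<Lambda> / rad\<close> is separable.  Since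
  \<open>Ext\<^sup>i(\<Lambda>, Hom\<^sub>K(U, Y)) = Ext\<^sup>i\<^sub>\<Lambda>(U, Y)\<close> vanishes for \<open>i > d\<close>, so does \<open>Ext\<^sup>i(\<Lambda>, Y)\<close>, and Nakayama's
  lemma with induction on the dimension extends this to all \<open>Y\<close>.  For a projective resolution
  \<open>P\<close> of \<open>\<Lambda>\<close> over the enveloping algebra this yields a retraction \<open>g\<close> of \<open>P\<^sub>d\<close> onto the image of
  \<open>P\<^sub>d\<^sub>+\<^sub>1\<close>.

  Let \<open>(p\<^sub>i, \<phi>\<^sub>i)\<close> be a dual basis of \<open>P\<^sub>d\<close> and \<open>e = 1 - g\<close>.  Every \<open>d\<close>-cocycle \<open>f\<close> satisfies
  \<open>f = f e = \<Sum> \<phi>\<^sub>i(e(-)) f(p\<^sub>i)\<close>, so the classes \<open>\<theta>\<^sub>i\<close> of \<open>\<phi>\<^sub>i e\<close> generate \<open>\<Theta>\<close>.  The isomorphism for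
  cohomology sends the class of \<open>f\<close> to \<open>\<Sum> \<theta>\<^sub>i \<otimes> f(p\<^sub>i)\<close>.  The one for homology sends the class of
  \<open>\<Sum> x\<^sub>j \<otimes> y\<^sub>j\<close> to the homomorphism taking the class of \<open>f\<close> to \<open>\<Sum> x\<^sub>j f(y\<^sub>j)\<close>; its inverse sends \<open>h\<close> to the
  class of \<open>\<Sum> h(\<theta>\<^sub>i) \<otimes> p\<^sub>i\<close>.\<close>

text \<open>The resolution behind Ext and Tor is an arbitrary choice, of which no length is known.
  The retraction comes from applying the vanishing of the next Ext to a single cocycle: the
  differential out of \<open>P (Suc d)\<close>, with its own image as coefficients. The splitting
  stands in for right exactness of Ext and left exactness of Tor in top degree, so both isomorphisms
  are given by formulas.

  Two obstacles shape the rest. The global dimension bounds resolutions of one-sided modules,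
  whereas the result concerns bimodules; coinduction and separability are the bridge. And
  projectivity and global dimension quantify over modules on the one type
  \<open>nat \<Rightarrow> 'k\<close>, whereas quotients, Hom spaces and tensor products live on
  other types. Hence projectivity is converted to dual bases, which mention no other module, and
  modules are moved to that type only where a definition demands it.\<close>

abbreviation mhom where "mhom \<equiv> LinearCombinations.module_hom"

lemma mhomI:
  assumes "\<And>x. x \<in> carrier M \<Longrightarrow> f x \<in> carrier N"
    and "\<And>x y. \<lbrakk>x \<in> carrier M; y \<in> carrier M\<rbrakk> \<Longrightarrow> f (x \<oplus>\<^bsub>M\<^esub> y) = f x \<oplus>\<^bsub>N\<^esub> f y"
    and "\<And>a x. \<lbrakk>a \<in> carrier R; x \<in> carrier M\<rbrakk> \<Longrightarrow> f (a \<odot>\<^bsub>M\<^esub> x) = a \<odot>\<^bsub>N\<^esub> f x"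
  shows "f \<in> mhom R M N"
  using assms by (auto simp: LinearCombinations.module_hom_def)

lemma mhom_closed: "\<lbrakk>f \<in> mhom R M N; x \<in> carrier M\<rbrakk> \<Longrightarrow> f x \<in> carrier N"
  by (auto simp: LinearCombinations.module_hom_def)

lemmas mhom_add = LinearCombinations.module_hom_add
lemmas mhom_smult = LinearCombinations.module_hom_smult

lemma mhom_cong:
  assumes "left_module R M" "f \<in> mhom R M N" "\<And>x. x \<in> carrier M \<Longrightarrow> g x = f x"
  shows "g \<in> mhom R M N"
proof -
  interpret left_module R M by fact
  show ?thesis
    using assms(2,3) smult_closed
    by (auto simp: LinearCombinations.module_hom_def)
qed

lemma mhom_comp:
  assumes "f \<in> mhom R M N" "g \<in> mhom R N P"
  shows "(\<lambda>x. g (f x)) \<in> mhom R M P"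
  by (rule mhomI) (simp_all add: mhom_closed[OF assms(1)] mhom_closed[OF assms(2)]
      mhom_add[OF assms(1)] mhom_add[OF assms(2)] mhom_smult[OF assms(1)] mhom_smult[OF assms(2)])

subsection \<open>Modules\<close>

text \<open>Additivity on the carrier is all that is asked, so that this also serves evaluation of
  functions at a point and one argument of a biadditive map. For an infinite index set both sides
  are zero, because an additive map preserves zero.\<close>

lemma finsum_additive:
  assumes "abelian_group M" "abelian_group N"
    and cl: "\<And>x. x \<in> carrier M \<Longrightarrow> f x \<in> carrier N"
    and ad: "\<And>x y. \<lbrakk>x \<in> carrier M; y \<in> carrier M\<rbrakk> \<Longrightarrow> f (x \<oplus>\<^bsub>M\<^esub> y) = f x \<oplus>\<^bsub>N\<^esub> f y"
    and g: "\<And>i. i \<in> I \<Longrightarrow> g i \<in> carrier M"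
  shows "f (\<Oplus>\<^bsub>M\<^esub>i\<in>I. g i) = (\<Oplus>\<^bsub>N\<^esub>i\<in>I. f (g i))"
proof -
  interpret M: abelian_group M by fact
  interpret N: abelian_group N by fact
  have z: "f \<zero>\<^bsub>M\<^esub> = \<zero>\<^bsub>N\<^esub>"
    using ad[of "\<zero>\<^bsub>M\<^esub>" "\<zero>\<^bsub>M\<^esub>"] cl[of "\<zero>\<^bsub>M\<^esub>"] by (metis M.l_zero M.zero_closed N.add.r_cancel_one')
  show ?thesis
  proof (cases "finite I")
    case True
    then show ?thesis using g
    proof (induction I rule: finite_induct)
      case empty
      then show ?case by (simp add: z)
    next
      case (insert i I)
      have "f (\<Oplus>\<^bsub>M\<^esub>i\<in>insert i I. g i) = f (g i \<oplus>\<^bsub>M\<^esub> (\<Oplus>\<^bsub>M\<^esub>i\<in>I. g i))"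
        using insert by (subst M.finsum_insert) auto
      also have "\<dots> = f (g i) \<oplus>\<^bsub>N\<^esub> f (\<Oplus>\<^bsub>M\<^esub>i\<in>I. g i)"
        using insert by (intro ad M.finsum_closed) auto
      also have "\<dots> = (\<Oplus>\<^bsub>N\<^esub>i\<in>insert i I. f (g i))"
        using insert cl by (subst N.finsum_insert) auto
      finally show ?case .
    qed
  qed (simp add: z M.finsum_infinite N.finsum_infinite)
qed

lemma (in abelian_group) finsum_swap:
  assumes "finite I" "\<And>i j. \<lbrakk>i \<in> I; j \<in> J\<rbrakk> \<Longrightarrow> f i j \<in> carrier G"
  shows "(\<Oplus>i\<in>I. \<Oplus>j\<in>J. f i j) = (\<Oplus>j\<in>J. \<Oplus>i\<in>I. f i j)"
  using assms
proof (induction I rule: finite_induct)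
  case empty
  then show ?case by simp
next
  case (insert i I)
  have "(\<Oplus>i\<in>insert i I. \<Oplus>j\<in>J. f i j) = (\<Oplus>j\<in>J. f i j) \<oplus> (\<Oplus>i\<in>I. \<Oplus>j\<in>J. f i j)"
    using insert by (intro finsum_insert) (auto intro!: finsum_closed)
  also have "\<dots> = (\<Oplus>j\<in>J. f i j) \<oplus> (\<Oplus>j\<in>J. \<Oplus>i\<in>I. f i j)"
    using insert by simp
  also have "\<dots> = (\<Oplus>j\<in>J. f i j \<oplus> (\<Oplus>i\<in>I. f i j))"
    using insert by (intro finsum_addf[symmetric]) (auto intro!: finsum_closed)
  also have "\<dots> = (\<Oplus>j\<in>J. \<Oplus>i\<in>insert i I. f i j)"
    using insert by (intro finsum_cong' refl finsum_insert[symmetric]) (auto intro!: finsum_closed)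
  finally show ?case .
qed

context left_module
begin

lemmas [simp] = smult_closed smult_one
lemmas is_left_module = left_module_axioms

lemma smult_zero_right [simp]: "a \<in> carrier R \<Longrightarrow> a \<odot>\<^bsub>M\<^esub> \<zero>\<^bsub>M\<^esub> = \<zero>\<^bsub>M\<^esub>"
  by (metis M.add.r_cancel_one' M.r_zero M.zero_closed smult_closed smult_r_distr)

lemma smult_zero_left [simp]: "x \<in> carrier M \<Longrightarrow> \<zero>\<^bsub>R\<^esub> \<odot>\<^bsub>M\<^esub> x = \<zero>\<^bsub>M\<^esub>"
  by (metis M.add.r_cancel_one' R.r_zero R.zero_closed smult_closed smult_l_distr)

lemma smult_minus_left: "\<lbrakk>a \<in> carrier R; x \<in> carrier M\<rbrakk> \<Longrightarrow> (\<ominus>\<^bsub>R\<^esub> a) \<odot>\<^bsub>M\<^esub> x = \<ominus>\<^bsub>M\<^esub> (a \<odot>\<^bsub>M\<^esub> x)"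
  by (metis M.minus_equality R.add.inv_closed R.l_neg smult_closed smult_l_distr smult_zero_left)

lemma smult_minus_right: "\<lbrakk>a \<in> carrier R; x \<in> carrier M\<rbrakk> \<Longrightarrow> a \<odot>\<^bsub>M\<^esub> (\<ominus>\<^bsub>M\<^esub> x) = \<ominus>\<^bsub>M\<^esub> (a \<odot>\<^bsub>M\<^esub> x)"
  by (metis M.add.inv_closed M.l_neg M.minus_equality smult_closed smult_r_distr smult_zero_right)

lemma minus_one_smult: "x \<in> carrier M \<Longrightarrow> (\<ominus>\<^bsub>R\<^esub> \<one>\<^bsub>R\<^esub>) \<odot>\<^bsub>M\<^esub> x = \<ominus>\<^bsub>M\<^esub> x"
  by (simp add: smult_minus_left)

lemma smult_finsum:
  assumes "a \<in> carrier R" "\<And>i. i \<in> I \<Longrightarrow> g i \<in> carrier M"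
  shows "a \<odot>\<^bsub>M\<^esub> (\<Oplus>\<^bsub>M\<^esub>i\<in>I. g i) = (\<Oplus>\<^bsub>M\<^esub>i\<in>I. a \<odot>\<^bsub>M\<^esub> g i)"
  using assms by (intro finsum_additive M.abelian_group_axioms) (auto simp: smult_r_distr)

lemma finsum_smult:
  assumes "x \<in> carrier M" "\<And>i. i \<in> I \<Longrightarrow> g i \<in> carrier R"
  shows "(\<Oplus>\<^bsub>R\<^esub>i\<in>I. g i) \<odot>\<^bsub>M\<^esub> x = (\<Oplus>\<^bsub>M\<^esub>i\<in>I. g i \<odot>\<^bsub>M\<^esub> x)"
  using assms
  by (intro finsum_additive[where f = "\<lambda>a. a \<odot>\<^bsub>M\<^esub> x"] M.abelian_group_axioms R.abelian_group_axioms)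
    (auto simp: smult_l_distr)

end

lemma left_moduleI:
  assumes "ring R" "abelian_group M"
    and "\<And>a x. \<lbrakk>a \<in> carrier R; x \<in> carrier M\<rbrakk> \<Longrightarrow> a \<odot>\<^bsub>M\<^esub> x \<in> carrier M"
    and "\<And>a b x. \<lbrakk>a \<in> carrier R; b \<in> carrier R; x \<in> carrier M\<rbrakk>
        \<Longrightarrow> (a \<oplus>\<^bsub>R\<^esub> b) \<odot>\<^bsub>M\<^esub> x = a \<odot>\<^bsub>M\<^esub> x \<oplus>\<^bsub>M\<^esub> b \<odot>\<^bsub>M\<^esub> x"
    and "\<And>a x y. \<lbrakk>a \<in> carrier R; x \<in> carrier M; y \<in> carrier M\<rbrakk>
        \<Longrightarrow> a \<odot>\<^bsub>M\<^esub> (x \<oplus>\<^bsub>M\<^esub> y) = a \<odot>\<^bsub>M\<^esub> x \<oplus>\<^bsub>M\<^esub> a \<odot>\<^bsub>M\<^esub> y"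
    and "\<And>a b x. \<lbrakk>a \<in> carrier R; b \<in> carrier R; x \<in> carrier M\<rbrakk>
        \<Longrightarrow> (a \<otimes>\<^bsub>R\<^esub> b) \<odot>\<^bsub>M\<^esub> x = a \<odot>\<^bsub>M\<^esub> (b \<odot>\<^bsub>M\<^esub> x)"
    and "\<And>x. x \<in> carrier M \<Longrightarrow> \<one>\<^bsub>R\<^esub> \<odot>\<^bsub>M\<^esub> x = x"
  shows "left_module R M"
  using assms by (simp add: left_module_def left_module_axioms_def)

text \<open>\<open>W\<close> is a bare record of which no law is assumed; every law is checked on
  preimages under \<open>\<pi>\<close>. Quotients, structures transported along a bijection and
  records that merely share their operations all become modules in this way.\<close>

lemma left_module_surj:
  assumes "left_module R V" and surj: "\<pi> ` carrier V = carrier W"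
    and zero: "\<pi> \<zero>\<^bsub>V\<^esub> = \<zero>\<^bsub>W\<^esub>"
    and add: "\<And>x y. \<lbrakk>x \<in> carrier V; y \<in> carrier V\<rbrakk> \<Longrightarrow> \<pi> x \<oplus>\<^bsub>W\<^esub> \<pi> y = \<pi> (x \<oplus>\<^bsub>V\<^esub> y)"
    and smult: "\<And>a x. \<lbrakk>a \<in> carrier R; x \<in> carrier V\<rbrakk> \<Longrightarrow> a \<odot>\<^bsub>W\<^esub> \<pi> x = \<pi> (a \<odot>\<^bsub>V\<^esub> x)"
  shows "left_module R W"
proof -
  interpret V: left_module R V by fact
  have el: "\<exists>x\<in>carrier V. w = \<pi> x" if "w \<in> carrier W" for w
    using that surj by auto
  have cl: "\<pi> x \<in> carrier W" if "x \<in> carrier V" for x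
    using that surj by auto
  have "abelian_group W"
  proof (rule abelian_groupI)
    fix x y assume "x \<in> carrier W" "y \<in> carrier W"
    then show "x \<oplus>\<^bsub>W\<^esub> y \<in> carrier W" by (auto dest!: el simp: add cl)
  next
    show "\<zero>\<^bsub>W\<^esub> \<in> carrier W" using cl[of "\<zero>\<^bsub>V\<^esub>"] zero by simp
  next
    fix x y z assume "x \<in> carrier W" "y \<in> carrier W" "z \<in> carrier W"
    then show "(x \<oplus>\<^bsub>W\<^esub> y) \<oplus>\<^bsub>W\<^esub> z = x \<oplus>\<^bsub>W\<^esub> (y \<oplus>\<^bsub>W\<^esub> z)"
      by (auto dest!: el simp: add V.M.a_assoc)
  next
    fix x y assume "x \<in> carrier W" "y \<in> carrier W"
    then show "x \<oplus>\<^bsub>W\<^esub> y = y \<oplus>\<^bsub>W\<^esub> x" by (auto dest!: el simp: add V.M.a_comm)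
  next
    fix x assume "x \<in> carrier W"
    then show "\<zero>\<^bsub>W\<^esub> \<oplus>\<^bsub>W\<^esub> x = x" by (auto dest!: el simp: add zero[symmetric])
  next
    fix x assume "x \<in> carrier W"
    then obtain v where v: "v \<in> carrier V" "x = \<pi> v" using el by auto
    then show "\<exists>y\<in>carrier W. y \<oplus>\<^bsub>W\<^esub> x = \<zero>\<^bsub>W\<^esub>"
      by (intro bexI[of _ "\<pi> (\<ominus>\<^bsub>V\<^esub> v)"]) (auto simp: add V.M.l_neg zero cl)
  qed
  then show ?thesis
    by (intro left_moduleI V.R.ring_axioms)
      (auto dest!: el simp: add smult cl V.smult_l_distr V.smult_r_distr V.smult_assoc)
qed

lemma left_module_cong:
  assumes "left_module R M" "carrier N = carrier M" "zero N = zero M"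
    and "\<And>x y. \<lbrakk>x \<in> carrier M; y \<in> carrier M\<rbrakk> \<Longrightarrow> x \<oplus>\<^bsub>N\<^esub> y = x \<oplus>\<^bsub>M\<^esub> y"
    and "\<And>a x. \<lbrakk>a \<in> carrier R; x \<in> carrier M\<rbrakk> \<Longrightarrow> a \<odot>\<^bsub>N\<^esub> x = a \<odot>\<^bsub>M\<^esub> x"
  shows "left_module R N"
  by (rule left_module_surj[OF assms(1), where \<pi> = "\<lambda>x. x"]) (simp_all add: assms(2-))

lemma left_module_iff_module: "cring K \<Longrightarrow> left_module K V \<longleftrightarrow> Module.module K V"
  by (auto simp: left_module_def left_module_axioms_def Module.module_def module_axioms_def cring.axioms(1))

lemma vectorspace_iff: "field K \<Longrightarrow> vectorspace K V \<longleftrightarrow> left_module K V"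
proof -
  assume "field K"
  then interpret field K .
  show ?thesis
    using left_module_iff_module[OF is_cring] \<open>field K\<close> by (auto simp: vectorspace_def)
qed

lemma mhom_zero:
  assumes "left_module R M" "left_module R N" "f \<in> mhom R M N"
  shows "f \<zero>\<^bsub>M\<^esub> = \<zero>\<^bsub>N\<^esub>"
proof -
  interpret M: left_module R M by fact
  interpret N: left_module R N by fact
  show ?thesis
    using mhom_smult[OF assms(3), of "\<zero>\<^bsub>R\<^esub>" "\<zero>\<^bsub>M\<^esub>"] mhom_closed[OF assms(3), of "\<zero>\<^bsub>M\<^esub>"] by simp
qed

lemma mhom_minus:
  assumes "left_module R M" "left_module R N" "f \<in> mhom R M N" "x \<in> carrier M"
  shows "f (\<ominus>\<^bsub>M\<^esub> x) = \<ominus>\<^bsub>N\<^esub> f x"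
proof -
  interpret M: left_module R M by fact
  interpret N: left_module R N by fact
  show ?thesis
    using mhom_smult[OF assms(3), of "\<ominus>\<^bsub>R\<^esub> \<one>\<^bsub>R\<^esub>" x] mhom_closed[OF assms(3), of x] assms(4)
    by (simp add: M.minus_one_smult N.minus_one_smult)
qed

lemma mhom_diff:
  assumes "left_module R M" "left_module R N" "f \<in> mhom R M N" "x \<in> carrier M" "y \<in> carrier M"
  shows "f (x \<ominus>\<^bsub>M\<^esub> y) = f x \<ominus>\<^bsub>N\<^esub> f y"
proof -
  interpret M: left_module R M by fact
  show ?thesis
    using assms by (simp add: a_minus_def mhom_add[OF assms(3)] mhom_minus[OF assms(1-3)])
qed

lemma mhom_finsum:
  assumes "left_module R M" "left_module R N" "f \<in> mhom R M N" "\<And>i. i \<in> I \<Longrightarrow> g i \<in> carrier M"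
  shows "f (\<Oplus>\<^bsub>M\<^esub>i\<in>I. g i) = (\<Oplus>\<^bsub>N\<^esub>i\<in>I. f (g i))"
  using assms by (intro finsum_additive left_module.axioms(2)[of R]) (auto simp: mhom_closed mhom_add)

lemma mhom_plus:
  assumes "left_module R N" "f \<in> mhom R M N" "g \<in> mhom R M N"
  shows "(\<lambda>x. f x \<oplus>\<^bsub>N\<^esub> g x) \<in> mhom R M N"
proof -
  interpret N: left_module R N by fact
  note cl = mhom_closed[OF assms(2)] mhom_closed[OF assms(3)]
  show ?thesis
    by (rule mhomI)
      (simp_all add: cl mhom_add[OF assms(2)] mhom_add[OF assms(3)] mhom_smult[OF assms(2)]
        mhom_smult[OF assms(3)] N.smult_r_distr N.M.a_ac)
qed

lemma mhom_uminus:
  assumes "left_module R N" "f \<in> mhom R M N"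
  shows "(\<lambda>x. \<ominus>\<^bsub>N\<^esub> f x) \<in> mhom R M N"
proof -
  interpret N: left_module R N by fact
  note cl = mhom_closed[OF assms(2)]
  show ?thesis
    by (rule mhomI)
      (simp_all add: cl mhom_add[OF assms(2)] mhom_smult[OF assms(2)] N.smult_minus_right N.M.minus_add)
qed

lemma mhom_minus_fun:
  assumes "left_module R N" "f \<in> mhom R M N" "g \<in> mhom R M N"
  shows "(\<lambda>x. f x \<ominus>\<^bsub>N\<^esub> g x) \<in> mhom R M N"
  unfolding a_minus_def using assms by (intro mhom_plus mhom_uminus)

lemma mhom_const_zero: "left_module R N \<Longrightarrow> (\<lambda>x. \<zero>\<^bsub>N\<^esub>) \<in> mhom R M N"
proof -
  assume "left_module R N"
  then interpret N: left_module R N .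
  show ?thesis by (intro mhomI) auto
qed

lemma mhom_id: "(\<lambda>x. x) \<in> mhom R M M"
  by (intro mhomI) auto

lemma mhom_sum:
  assumes "left_module R N" "\<And>i. i \<in> I \<Longrightarrow> f i \<in> mhom R M N"
  shows "(\<lambda>x. \<Oplus>\<^bsub>N\<^esub>i\<in>I. f i x) \<in> mhom R M N"
proof -
  interpret N: left_module R N by fact
  note cl = mhom_closed[OF assms(2)]
  show ?thesis
  proof (rule mhomI)
    fix x y assume xy: "x \<in> carrier M" "y \<in> carrier M"
    have "(\<Oplus>\<^bsub>N\<^esub>i\<in>I. f i (x \<oplus>\<^bsub>M\<^esub> y)) = (\<Oplus>\<^bsub>N\<^esub>i\<in>I. f i x \<oplus>\<^bsub>N\<^esub> f i y)"
      using xy by (intro N.M.finsum_cong') (auto simp: cl mhom_add[OF assms(2)])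
    also have "\<dots> = (\<Oplus>\<^bsub>N\<^esub>i\<in>I. f i x) \<oplus>\<^bsub>N\<^esub> (\<Oplus>\<^bsub>N\<^esub>i\<in>I. f i y)"
      using xy by (intro N.M.finsum_addf) (auto simp: cl)
    finally show "(\<Oplus>\<^bsub>N\<^esub>i\<in>I. f i (x \<oplus>\<^bsub>M\<^esub> y)) = (\<Oplus>\<^bsub>N\<^esub>i\<in>I. f i x) \<oplus>\<^bsub>N\<^esub> (\<Oplus>\<^bsub>N\<^esub>i\<in>I. f i y)" .
  next
    fix a x assume ax: "a \<in> carrier R" "x \<in> carrier M"
    then show "(\<Oplus>\<^bsub>N\<^esub>i\<in>I. f i (a \<odot>\<^bsub>M\<^esub> x)) = a \<odot>\<^bsub>N\<^esub> (\<Oplus>\<^bsub>N\<^esub>i\<in>I. f i x)"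
      by (subst N.smult_finsum) (auto simp: cl mhom_smult[OF assms(2)] intro!: N.M.finsum_cong')
  qed (auto simp: cl intro!: N.M.finsum_closed)
qed

subsection \<open>Submodules and subquotients\<close>

text \<open>Negatives are absent from the list because they arise from the scalar minus one
  (\<open>submod_uminus\<close>).\<close>

definition submod :: "('a, 'r) ring_scheme \<Rightarrow> ('a, 'm, 'z) module_scheme \<Rightarrow> 'm set \<Rightarrow> bool" where
  "submod R M H \<longleftrightarrow> H \<subseteq> carrier M \<and> \<zero>\<^bsub>M\<^esub> \<in> H \<and> (\<forall>x\<in>H. \<forall>y\<in>H. x \<oplus>\<^bsub>M\<^esub> y \<in> H) \<and>
    (\<forall>a\<in>carrier R. \<forall>x\<in>H. a \<odot>\<^bsub>M\<^esub> x \<in> H)"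

lemma submodI:
  assumes "\<And>x. x \<in> H \<Longrightarrow> x \<in> carrier M" "\<zero>\<^bsub>M\<^esub> \<in> H" "\<And>x y. \<lbrakk>x \<in> H; y \<in> H\<rbrakk> \<Longrightarrow> x \<oplus>\<^bsub>M\<^esub> y \<in> H"
    and "\<And>a x. \<lbrakk>a \<in> carrier R; x \<in> H\<rbrakk> \<Longrightarrow> a \<odot>\<^bsub>M\<^esub> x \<in> H"
  shows "submod R M H"
  using assms by (auto simp: submod_def)

lemma submodD:
  assumes "submod R M H"
  shows "H \<subseteq> carrier M" "x \<in> H \<Longrightarrow> x \<in> carrier M" "\<zero>\<^bsub>M\<^esub> \<in> H" "\<lbrakk>x \<in> H; y \<in> H\<rbrakk> \<Longrightarrow> x \<oplus>\<^bsub>M\<^esub> y \<in> H"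
    "\<lbrakk>a \<in> carrier R; x \<in> H\<rbrakk> \<Longrightarrow> a \<odot>\<^bsub>M\<^esub> x \<in> H"
  using assms by (auto simp: submod_def)

context left_module
begin

lemma submod_uminus: "\<lbrakk>submod R M H; x \<in> H\<rbrakk> \<Longrightarrow> \<ominus>\<^bsub>M\<^esub> x \<in> H"
  using submodD(5)[of R M H "\<ominus>\<^bsub>R\<^esub> \<one>\<^bsub>R\<^esub>" x] submodD(2)[of R M H x] by (simp add: minus_one_smult)

lemma submod_finsum:
  assumes "submod R M H" "\<And>i. i \<in> I \<Longrightarrow> f i \<in> H"
  shows "(\<Oplus>\<^bsub>M\<^esub>i\<in>I. f i) \<in> H"
proof (cases "finite I")
  case True
  then show ?thesis using assms(2)
  proof (induction I rule: finite_induct)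
    case (insert i I)
    have "(\<Oplus>\<^bsub>M\<^esub>i\<in>insert i I. f i) = f i \<oplus>\<^bsub>M\<^esub> (\<Oplus>\<^bsub>M\<^esub>i\<in>I. f i)"
      using insert submodD(2)[OF assms(1)] by (intro M.finsum_insert) auto
    then show ?case using insert submodD(4)[OF assms(1)] by auto
  qed (simp add: submodD(3)[OF assms(1)])
qed (simp add: submodD(3)[OF assms(1)] M.finsum_infinite)

lemma left_module_sub:
  assumes "submod R M H"
  shows "left_module R (M\<lparr>carrier := H\<rparr>)"
proof -
  note s = submodD[OF assms]
  have "abelian_group (M\<lparr>carrier := H\<rparr>)"
  proof (rule abelian_groupI, goal_cases)
    case (6 x)
    then show ?case
      using submod_uminus[OF assms, of x] s(2)[of x]
      by (intro bexI[of _ "\<ominus>\<^bsub>M\<^esub> x"]) (auto simp: M.l_neg)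
  qed (auto simp: s M.a_ac)
  then show ?thesis
    by (intro left_moduleI R.ring_axioms) (auto simp: s smult_l_distr smult_r_distr smult_assoc)
qed

lemma submod_carrier: "submod R M (carrier M)"
  by (auto simp: submod_def)

lemma submod_zero: "submod R M {\<zero>\<^bsub>M\<^esub>}"
  by (auto simp: submod_def)

lemma coset_self: "\<lbrakk>submod R M B; x \<in> carrier M\<rbrakk> \<Longrightarrow> x \<in> B +>\<^bsub>M\<^esub> x"
  unfolding a_r_coset_def' using submodD(3)[of R M B] by (auto intro!: bexI[of _ "\<zero>\<^bsub>M\<^esub>"])

lemma coset_eq_iff:
  assumes B: "submod R M B" and "x \<in> carrier M" "y \<in> carrier M"
  shows "B +>\<^bsub>M\<^esub> x = B +>\<^bsub>M\<^esub> y \<longleftrightarrow> x \<ominus>\<^bsub>M\<^esub> y \<in> B"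
proof
  assume "B +>\<^bsub>M\<^esub> x = B +>\<^bsub>M\<^esub> y"
  then obtain b where b: "b \<in> B" "x = b \<oplus>\<^bsub>M\<^esub> y"
    using coset_self[OF B assms(2)] unfolding a_r_coset_def' by auto
  then have "x \<ominus>\<^bsub>M\<^esub> y = b"
    using assms submodD(2)[OF B] by (simp add: a_minus_def M.a_assoc M.r_neg)
  then show "x \<ominus>\<^bsub>M\<^esub> y \<in> B" using b by simp
next
  have *: "B +>\<^bsub>M\<^esub> x \<subseteq> B +>\<^bsub>M\<^esub> y" if "x \<ominus>\<^bsub>M\<^esub> y \<in> B" "x \<in> carrier M" "y \<in> carrier M" for x y
  proof
    fix z assume "z \<in> B +>\<^bsub>M\<^esub> x"
    then obtain b where b: "b \<in> B" "z = b \<oplus>\<^bsub>M\<^esub> x" unfolding a_r_coset_def' by auto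
    then have "z = (b \<oplus>\<^bsub>M\<^esub> (x \<ominus>\<^bsub>M\<^esub> y)) \<oplus>\<^bsub>M\<^esub> y"
      using that submodD(2)[OF B] by (simp add: a_minus_def M.a_assoc M.l_neg)
    then show "z \<in> B +>\<^bsub>M\<^esub> y"
      unfolding a_r_coset_def' using submodD(4)[OF B b(1) that(1)] by auto
  qed
  assume a: "x \<ominus>\<^bsub>M\<^esub> y \<in> B"
  then have "\<ominus>\<^bsub>M\<^esub> (x \<ominus>\<^bsub>M\<^esub> y) \<in> B" by (rule submod_uminus[OF B])
  then have "y \<ominus>\<^bsub>M\<^esub> x \<in> B"
    using assms by (simp add: a_minus_def M.minus_add M.a_comm)
  with a show "B +>\<^bsub>M\<^esub> x = B +>\<^bsub>M\<^esub> y" using * assms by blast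
qed

lemma coset_eq_zero_iff:
  assumes "submod R M B" "x \<in> carrier M"
  shows "B +>\<^bsub>M\<^esub> x = B \<longleftrightarrow> x \<in> B"
proof -
  have "B +>\<^bsub>M\<^esub> \<zero>\<^bsub>M\<^esub> = B"
    unfolding a_r_coset_def' using submodD(2)[OF assms(1)] by auto
  moreover have "x \<ominus>\<^bsub>M\<^esub> \<zero>\<^bsub>M\<^esub> = x"
  proof -
    have "\<ominus>\<^bsub>M\<^esub> \<zero>\<^bsub>M\<^esub> = \<zero>\<^bsub>M\<^esub>" by (rule M.minus_equality) simp_all
    then show ?thesis by (simp only: a_minus_def M.r_zero assms(2))
  qed
  ultimately show ?thesis
    using coset_eq_iff[OF assms(1,2) M.zero_closed] by simp
qed

lemma mem_coset_iff:
  assumes "submod R M B" "x \<in> carrier M"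
  shows "y \<in> B +>\<^bsub>M\<^esub> x \<longleftrightarrow> y \<in> carrier M \<and> B +>\<^bsub>M\<^esub> y = B +>\<^bsub>M\<^esub> x"
proof
  assume "y \<in> B +>\<^bsub>M\<^esub> x"
  then obtain b where b: "b \<in> B" "y = b \<oplus>\<^bsub>M\<^esub> x" unfolding a_r_coset_def' by auto
  have "b \<in> carrier M" using b submodD(2)[OF assms(1)] by auto
  then have "y \<in> carrier M" "y \<ominus>\<^bsub>M\<^esub> x = b"
    using b assms(2) by (auto simp: a_minus_def M.a_assoc M.r_neg)
  then show "y \<in> carrier M \<and> B +>\<^bsub>M\<^esub> y = B +>\<^bsub>M\<^esub> x"
    using coset_eq_iff[OF assms(1) _ assms(2)] b by auto
qed (use coset_self[OF assms(1)] in auto)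

lemma coset_add:
  assumes B: "submod R M B" and x: "x \<in> carrier M" and y: "y \<in> carrier M"
  shows "(B +>\<^bsub>M\<^esub> x) <+>\<^bsub>M\<^esub> (B +>\<^bsub>M\<^esub> y) = B +>\<^bsub>M\<^esub> (x \<oplus>\<^bsub>M\<^esub> y)"
proof (intro subset_antisym subsetI)
  fix z assume "z \<in> (B +>\<^bsub>M\<^esub> x) <+>\<^bsub>M\<^esub> (B +>\<^bsub>M\<^esub> y)"
  then obtain b c where bc: "b \<in> B" "c \<in> B" "z = (b \<oplus>\<^bsub>M\<^esub> x) \<oplus>\<^bsub>M\<^esub> (c \<oplus>\<^bsub>M\<^esub> y)"
    unfolding set_add_def' a_r_coset_def' by auto
  then have "z = (b \<oplus>\<^bsub>M\<^esub> c) \<oplus>\<^bsub>M\<^esub> (x \<oplus>\<^bsub>M\<^esub> y)"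
    using x y submodD(2)[OF B] by (simp add: M.a_ac)
  then show "z \<in> B +>\<^bsub>M\<^esub> (x \<oplus>\<^bsub>M\<^esub> y)"
    unfolding a_r_coset_def' using submodD(4)[OF B bc(1,2)] by auto
next
  fix z assume "z \<in> B +>\<^bsub>M\<^esub> (x \<oplus>\<^bsub>M\<^esub> y)"
  then obtain b where b: "b \<in> B" "z = b \<oplus>\<^bsub>M\<^esub> (x \<oplus>\<^bsub>M\<^esub> y)"
    unfolding a_r_coset_def' by auto
  then have "z = (b \<oplus>\<^bsub>M\<^esub> x) \<oplus>\<^bsub>M\<^esub> y"
    using x y submodD(2)[OF B] by (simp add: M.a_assoc)
  moreover have "b \<oplus>\<^bsub>M\<^esub> x \<in> B +>\<^bsub>M\<^esub> x" unfolding a_r_coset_def' using b by auto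
  ultimately show "z \<in> (B +>\<^bsub>M\<^esub> x) <+>\<^bsub>M\<^esub> (B +>\<^bsub>M\<^esub> y)"
    unfolding set_add_def' using coset_self[OF B y] by auto
qed

text \<open>All representatives give the same coset, so the union by which
  \<open>subquotient\<close> defines its scalar action collapses to one term.\<close>

lemma coset_smult:
  assumes B: "submod R M B" and a: "a \<in> carrier R" and x: "x \<in> carrier M"
  shows "(\<Union>z\<in>B +>\<^bsub>M\<^esub> x. B +>\<^bsub>M\<^esub> (a \<odot>\<^bsub>M\<^esub> z)) = B +>\<^bsub>M\<^esub> (a \<odot>\<^bsub>M\<^esub> x)"
proof -
  have "B +>\<^bsub>M\<^esub> (a \<odot>\<^bsub>M\<^esub> z) = B +>\<^bsub>M\<^esub> (a \<odot>\<^bsub>M\<^esub> x)" if z: "z \<in> B +>\<^bsub>M\<^esub> x" for z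
  proof -
    have zc: "z \<in> carrier M" and "z \<ominus>\<^bsub>M\<^esub> x \<in> B"
      using z mem_coset_iff[OF B x] coset_eq_iff[OF B _ x] by auto
    then have "a \<odot>\<^bsub>M\<^esub> (z \<ominus>\<^bsub>M\<^esub> x) \<in> B" using submodD(5)[OF B a] by auto
    then have "a \<odot>\<^bsub>M\<^esub> z \<ominus>\<^bsub>M\<^esub> a \<odot>\<^bsub>M\<^esub> x \<in> B"
      using a x zc by (simp add: a_minus_def smult_r_distr smult_minus_right)
    then show ?thesis using coset_eq_iff[OF B, of "a \<odot>\<^bsub>M\<^esub> z" "a \<odot>\<^bsub>M\<^esub> x"] a x zc by simp
  qed
  moreover have "B +>\<^bsub>M\<^esub> x \<noteq> {}" using coset_self[OF B x] by blast
  ultimately show ?thesis by (simp only: SUP_cong UN_constant if_False)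
qed

end

lemma carrier_subquotient: "carrier (subquotient V Z B) = (\<lambda>z. B +>\<^bsub>V\<^esub> z) ` Z"
  and zero_subquotient: "\<zero>\<^bsub>subquotient V Z B\<^esub> = B"
  by (simp_all add: subquotient_def)

text \<open>The ring is kept general: Ext, Tor and tensor products are subquotients over the field,
  while \<Theta> is one over the opposite algebra and the quotient by the radical is one over
  \<Lambda>.\<close>

locale subquotient_module = V: left_module R V
  for R :: "('k, 'r) ring_scheme" and V :: "('k, 'v) module" +
  fixes Z B
  assumes Z: "submod R V Z" and B: "submod R V B" and BZ: "B \<subseteq> Z"
begin

abbreviation "cls z \<equiv> B +>\<^bsub>V\<^esub> z"

lemma cls_mhom: "cls \<in> mhom R (V\<lparr>carrier := Z\<rparr>) (subquotient V Z B)"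
  using submodD[OF Z]
  by (intro mhomI) (simp_all add: subquotient_def V.coset_add[OF B] V.coset_smult[OF B])

lemma cls_add: "\<lbrakk>x \<in> Z; y \<in> Z\<rbrakk> \<Longrightarrow> cls x \<oplus>\<^bsub>subquotient V Z B\<^esub> cls y = cls (x \<oplus>\<^bsub>V\<^esub> y)"
  and cls_smult: "\<lbrakk>a \<in> carrier R; x \<in> Z\<rbrakk> \<Longrightarrow> a \<odot>\<^bsub>subquotient V Z B\<^esub> cls x = cls (a \<odot>\<^bsub>V\<^esub> x)"
  and cls_closed: "z \<in> Z \<Longrightarrow> cls z \<in> carrier (subquotient V Z B)"
  using mhom_add[OF cls_mhom, of x y] mhom_smult[OF cls_mhom, of a x] mhom_closed[OF cls_mhom, of z]
  by simp_all

lemma cls_cases: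
  assumes "\<xi> \<in> carrier (subquotient V Z B)"
  obtains z where "z \<in> Z" "\<xi> = cls z"
  using assms by (auto simp: carrier_subquotient)

lemma cls_eq_iff: "\<lbrakk>x \<in> Z; y \<in> Z\<rbrakk> \<Longrightarrow> cls x = cls y \<longleftrightarrow> x \<ominus>\<^bsub>V\<^esub> y \<in> B"
  using V.coset_eq_iff[OF B] submodD(2)[OF Z] by auto

lemma cls_eq_zero_iff: "x \<in> Z \<Longrightarrow> cls x = \<zero>\<^bsub>subquotient V Z B\<^esub> \<longleftrightarrow> x \<in> B"
  using V.coset_eq_zero_iff[OF B] submodD(2)[OF Z] by (auto simp: zero_subquotient)

lemma cls_zero: "cls \<zero>\<^bsub>V\<^esub> = \<zero>\<^bsub>subquotient V Z B\<^esub>"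
  using cls_eq_zero_iff[OF submodD(3)[OF Z]] submodD(3)[OF B] by auto

lemma left_module_subquotient: "left_module R (subquotient V Z B)"
  by (rule left_module_surj[OF V.left_module_sub[OF Z], where \<pi> = cls])
    (auto simp: carrier_subquotient cls_zero cls_add cls_smult)

lemma cls_finsum:
  assumes "\<And>i. i \<in> I \<Longrightarrow> f i \<in> Z"
  shows "cls (\<Oplus>\<^bsub>V\<^esub>i\<in>I. f i) = (\<Oplus>\<^bsub>subquotient V Z B\<^esub>i\<in>I. cls (f i))"
proof -
  interpret Q: left_module R "subquotient V Z B" by (rule left_module_subquotient)
  show ?thesis
  proof (cases "finite I")
    case True
    then show ?thesis using assms
    proof (induction I rule: finite_induct)
      case (insert i I)
      have "cls (\<Oplus>\<^bsub>V\<^esub>i\<in>insert i I. f i) = cls (f i \<oplus>\<^bsub>V\<^esub> (\<Oplus>\<^bsub>V\<^esub>i\<in>I. f i))"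
        using insert submodD(2)[OF Z] by (subst V.M.finsum_insert) auto
      also have "\<dots> = cls (f i) \<oplus>\<^bsub>subquotient V Z B\<^esub> cls (\<Oplus>\<^bsub>V\<^esub>i\<in>I. f i)"
        using insert V.submod_finsum[OF Z, of I f] by (subst cls_add) auto
      also have "\<dots> = (\<Oplus>\<^bsub>subquotient V Z B\<^esub>i\<in>insert i I. cls (f i))"
        using insert cls_closed by (subst Q.M.finsum_insert) auto
      finally show ?case .
    qed (simp add: cls_zero)
  qed (simp add: cls_zero V.M.finsum_infinite Q.M.finsum_infinite)
qed

text \<open>A map that kills \<open>B\<close> is constant on each coset, so the image of a coset is
  a singleton and \<open>the_elem\<close> reads off its value. \<open>tensor_lift\<close> and both
  final isomorphisms are maps of this shape.\<close>

lemma induced_map: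
  assumes W: "left_module R W" and H: "H \<in> mhom R (V\<lparr>carrier := Z\<rparr>) W" and HB: "\<And>b. b \<in> B \<Longrightarrow> H b = \<zero>\<^bsub>W\<^esub>"
  shows "(\<lambda>\<xi>. the_elem (H ` \<xi>)) \<in> mhom R (subquotient V Z B) W"
    and "z \<in> Z \<Longrightarrow> the_elem (H ` cls z) = H z"
proof -
  interpret W: left_module R W by fact
  have eq: "the_elem (H ` cls z) = H z" if z: "z \<in> Z" for z
  proof -
    have "H ` cls z = {H z}"
    proof (intro subset_antisym subsetI)
      fix w assume "w \<in> H ` cls z"
      then obtain b where b: "b \<in> B" "w = H (b \<oplus>\<^bsub>V\<^esub> z)" unfolding a_r_coset_def' by auto
      then show "w \<in> {H z}"
        using mhom_add[OF H, of b z] mhom_closed[OF H, of z] HB[of b] z BZ by auto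
    next
      fix w assume "w \<in> {H z}"
      then show "w \<in> H ` cls z" using V.coset_self[OF B, of z] z submodD(2)[OF Z] by auto
    qed
    then show ?thesis by simp
  qed
  then show "z \<in> Z \<Longrightarrow> the_elem (H ` cls z) = H z" .
  show "(\<lambda>\<xi>. the_elem (H ` \<xi>)) \<in> mhom R (subquotient V Z B) W"
  proof (rule mhomI)
    fix \<xi> assume "\<xi> \<in> carrier (subquotient V Z B)"
    then show "the_elem (H ` \<xi>) \<in> carrier W"
      using mhom_closed[OF H] by (auto elim!: cls_cases simp: eq)
  next
    fix \<xi> \<zeta> assume "\<xi> \<in> carrier (subquotient V Z B)" "\<zeta> \<in> carrier (subquotient V Z B)"
    then show "the_elem (H ` (\<xi> \<oplus>\<^bsub>subquotient V Z B\<^esub> \<zeta>)) = the_elem (H ` \<xi>) \<oplus>\<^bsub>W\<^esub> the_elem (H ` \<zeta>)"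
      using mhom_add[OF H] submodD(4)[OF Z] by (auto elim!: cls_cases simp: eq cls_add)
  next
    fix a \<xi> assume "a \<in> carrier R" "\<xi> \<in> carrier (subquotient V Z B)"
    then show "the_elem (H ` (a \<odot>\<^bsub>subquotient V Z B\<^esub> \<xi>)) = a \<odot>\<^bsub>W\<^esub> the_elem (H ` \<xi>)"
      using mhom_smult[OF H] submodD(5)[OF Z] by (auto elim!: cls_cases simp: eq cls_smult)
  qed
qed

end

lemma submod_ker:
  assumes "left_module R M" "left_module R N" "f \<in> mhom R M N"
  shows "submod R M {x \<in> carrier M. f x = \<zero>\<^bsub>N\<^esub>}"
proof -
  interpret M: left_module R M by fact
  interpret N: left_module R N by fact
  show ?thesis
    by (rule submodI) (auto simp: mhom_zero[OF assms] mhom_add[OF assms(3)] mhom_smult[OF assms(3)])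
qed

lemma submod_image:
  assumes "left_module R M" "left_module R N" "f \<in> mhom R M N" "submod R M H"
  shows "submod R N (f ` H)"
proof -
  interpret M: left_module R M by fact
  note s = submodD[OF assms(4)]
  show ?thesis
  proof (rule submodI)
    show "\<zero>\<^bsub>N\<^esub> \<in> f ` H" using mhom_zero[OF assms(1-3)] s(3) by (metis imageI)
  next
    fix x y assume "x \<in> f ` H" "y \<in> f ` H"
    then obtain u v where uv: "u \<in> H" "v \<in> H" "x = f u" "y = f v" by auto
    then have "x \<oplus>\<^bsub>N\<^esub> y = f (u \<oplus>\<^bsub>M\<^esub> v)" using s(2) mhom_add[OF assms(3)] by simp
    then show "x \<oplus>\<^bsub>N\<^esub> y \<in> f ` H" using uv s(4) by auto
  next
    fix a x assume a: "a \<in> carrier R" and "x \<in> f ` H"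
    then obtain u where u: "u \<in> H" "x = f u" by auto
    then have "a \<odot>\<^bsub>N\<^esub> x = f (a \<odot>\<^bsub>M\<^esub> u)" using s(2) a mhom_smult[OF assms(3)] by simp
    then show "a \<odot>\<^bsub>N\<^esub> x \<in> f ` H" using u a s(5) by auto
  qed (use s mhom_closed[OF assms(3)] in auto)
qed

lemma submod_vimage:
  assumes "left_module R M" "left_module R N" "f \<in> mhom R M N" "submod R N H"
  shows "submod R M {x \<in> carrier M. f x \<in> H}"
proof -
  interpret M: left_module R M by fact
  note s = submodD[OF assms(4)]
  show ?thesis
    by (rule submodI)
      (auto simp: mhom_zero[OF assms(1-3)] mhom_add[OF assms(3)] mhom_smult[OF assms(3)] s)
qed

text \<open>Injectivity of \<open>i\<close> makes the chosen preimages unique, and uniqueness turns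
  the pointwise choice into a homomorphism.\<close>

lemma mhom_factor:
  assumes "left_module R M" "left_module R N" "left_module R N'" "f \<in> mhom R M N"
    and i: "i \<in> mhom R N' N" "inj_on i (carrier N')" and im: "\<And>x. x \<in> carrier M \<Longrightarrow> f x \<in> i ` carrier N'"
  obtains f' where "f' \<in> mhom R M N'" "\<And>x. x \<in> carrier M \<Longrightarrow> i (f' x) = f x"
proof -
  interpret M: left_module R M by fact
  interpret N: left_module R N by fact
  interpret N': left_module R N' by fact
  define f' where "f' x = inv_into (carrier N') i (f x)" for x
  have f': "f' x \<in> carrier N'" "i (f' x) = f x" if "x \<in> carrier M" for x
    using im[OF that] by (auto simp: f'_def inv_into_into f_inv_into_f)
  have eq: "f' x = y" if "x \<in> carrier M" "y \<in> carrier N'" "f x = i y" for x y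
    using that f'[of x] i(2) by (auto dest: inj_onD)
  have "f' \<in> mhom R M N'"
    by (rule mhomI) (auto intro!: eq simp: f' mhom_add[OF i(1)] mhom_smult[OF i(1)]
        mhom_add[OF assms(4)] mhom_smult[OF assms(4)])
  with f' that show ?thesis by auto
qed

subsection \<open>Algebras and change of rings\<close>

lemma regular_module_simps [simp]:
  "carrier (regular_module A) = carrier A" "mult (regular_module A) = mult A"
  "one (regular_module A) = \<one>\<^bsub>A\<^esub>" "zero (regular_module A) = \<zero>\<^bsub>A\<^esub>"
  "add (regular_module A) = add A" "smult (regular_module A) = mult A"
  by (simp_all add: regular_module_def)

lemma scalars_simps [simp]:
  "carrier (scalars A M) = carrier M" "zero (scalars A M) = \<zero>\<^bsub>M\<^esub>" "add (scalars A M) = add M"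
  "c \<odot>\<^bsub>scalars A M\<^esub> x = (c \<odot>\<^bsub>A\<^esub> \<one>\<^bsub>A\<^esub>) \<odot>\<^bsub>M\<^esub> x"
  by (simp_all add: scalars_def)

lemma op_algebra_simps [simp]:
  "carrier (op_algebra A) = carrier A" "x \<otimes>\<^bsub>op_algebra A\<^esub> y = y \<otimes>\<^bsub>A\<^esub> x"
  "one (op_algebra A) = \<one>\<^bsub>A\<^esub>" "zero (op_algebra A) = \<zero>\<^bsub>A\<^esub>"
  "add (op_algebra A) = add A" "smult (op_algebra A) = smult A"
  by (simp_all add: op_algebra_def)

lemma scalars_op_algebra [simp]: "scalars (op_algebra A) M = scalars A M"
  by (simp add: scalars_def)

text \<open>Restriction of scalars along \<open>\<theta>\<close>. It yields the underlying vector
  space of a module (\<open>scalars\<close>) and the separate left and right \<Lambda>-actions on a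
  module over the enveloping algebra.\<close>

definition pullback :: "('b \<Rightarrow> 'a) \<Rightarrow> ('a, 'm, 'z) module_scheme \<Rightarrow> ('b, 'm) module" where
  "pullback \<theta> M =
    \<lparr>carrier = carrier M, mult = mult M, one = \<one>\<^bsub>M\<^esub>, zero = \<zero>\<^bsub>M\<^esub>, add = add M,
     smult = \<lambda>b x. \<theta> b \<odot>\<^bsub>M\<^esub> x\<rparr>"

lemma pullback_simps [simp]:
  "carrier (pullback \<theta> M) = carrier M" "zero (pullback \<theta> M) = \<zero>\<^bsub>M\<^esub>" "add (pullback \<theta> M) = add M"
  "b \<odot>\<^bsub>pullback \<theta> M\<^esub> x = \<theta> b \<odot>\<^bsub>M\<^esub> x"
  by (simp_all add: pullback_def)

lemma abelian_group_cong:
  assumes "abelian_group M" "carrier N = carrier M" "zero N = zero M" "add N = add M"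
  shows "abelian_group N"
proof -
  interpret M: abelian_group M by fact
  show ?thesis
  proof (rule abelian_groupI, goal_cases)
    case (6 x)
    then show ?case using assms(2-) M.l_neg[of x] by (auto intro!: bexI[of _ "\<ominus>\<^bsub>M\<^esub> x"])
  qed (use assms(2-) in \<open>auto simp: M.a_ac\<close>)
qed

lemma finsum_cong_add:
  "\<lbrakk>carrier N = carrier M; zero N = zero M; add N = add M\<rbrakk> \<Longrightarrow> finsum N f I = finsum M f I"
  by (simp add: finsum_def finprod_def)

lemma finsum_pullback [simp]: "finsum (pullback \<theta> M) f I = finsum M f I"
  and finsum_scalars [simp]: "finsum (scalars A M) f I = finsum M f I"
  by (rule finsum_cong_add; simp)+

lemma left_module_pullback:
  assumes "left_module A M" "ring R" "\<theta> \<in> ring_hom R A"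
  shows "left_module R (pullback \<theta> M)"
proof -
  interpret M: left_module A M by fact
  note h = ring_hom_closed[OF assms(3)] ring_hom_add[OF assms(3)] ring_hom_mult[OF assms(3)]
    ring_hom_one[OF assms(3)]
  show ?thesis
    by (intro left_moduleI assms(2) abelian_group_cong[OF M.M.abelian_group_axioms])
      (simp_all add: h M.smult_l_distr M.smult_r_distr M.smult_assoc)
qed

lemma mhom_pullback:
  assumes "f \<in> mhom A M N" "\<And>b. b \<in> carrier R \<Longrightarrow> \<theta> b \<in> carrier A"
  shows "f \<in> mhom R (pullback \<theta> M) (pullback \<theta> N)"
  by (rule mhomI) (simp_all add: mhom_closed[OF assms(1)] mhom_add[OF assms(1)] mhom_smult[OF assms(1)] assms(2))

lemma submod_pullback:
  assumes "submod A M H" "\<And>b. b \<in> carrier R \<Longrightarrow> \<theta> b \<in> carrier A"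
  shows "submod R (pullback \<theta> M) H"
  using assms by (auto simp: submod_def)

lemma scalars_eq_pullback: "scalars A M = pullback (\<lambda>c. c \<odot>\<^bsub>A\<^esub> \<one>\<^bsub>A\<^esub>) M"
  by (simp add: scalars_def pullback_def)

lemma left_module_regular: "ring A \<Longrightarrow> left_module A (regular_module A)"
proof -
  assume "ring A"
  then interpret ring A .
  show ?thesis
    by (intro left_moduleI ring_axioms abelian_group_cong[OF abelian_group_axioms])
      (simp_all add: l_distr r_distr m_assoc)
qed

lemma ring_op_algebra: "ring A \<Longrightarrow> ring (op_algebra A)"
proof -
  assume "ring A"
  then interpret ring A .
  show ?thesis
    by (intro ringI abelian_group_cong[OF abelian_group_axioms] monoidI)
      (simp_all add: l_distr r_distr m_assoc)
qed

locale algebra_over_field = K: field K + A: assoc_algebra K A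
  for K :: "('k, 'z) ring_scheme" and A :: "('k, 'a) module"
begin

lemma is_ring_A: "ring A" by (rule A.ring_axioms)

lemma left_module_self: "left_module K A"
  using left_module_iff_module[OF K.is_cring] A.module_axioms by blast

lemma unit_hom: "(\<lambda>c. c \<odot>\<^bsub>A\<^esub> \<one>\<^bsub>A\<^esub>) \<in> ring_hom K A"
  by (rule ring_hom_memI)
    (simp_all add: A.smult_mult_left A.smult_l_distr A.smult_assoc1)

lemma unit_closed [simp]: "c \<in> carrier K \<Longrightarrow> c \<odot>\<^bsub>A\<^esub> \<one>\<^bsub>A\<^esub> \<in> carrier A"
  by simp

lemma unit_mult [simp]: "\<lbrakk>c \<in> carrier K; x \<in> carrier A\<rbrakk> \<Longrightarrow> (c \<odot>\<^bsub>A\<^esub> \<one>\<^bsub>A\<^esub>) \<otimes>\<^bsub>A\<^esub> x = c \<odot>\<^bsub>A\<^esub> x"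
  and mult_unit [simp]: "\<lbrakk>c \<in> carrier K; x \<in> carrier A\<rbrakk> \<Longrightarrow> x \<otimes>\<^bsub>A\<^esub> (c \<odot>\<^bsub>A\<^esub> \<one>\<^bsub>A\<^esub>) = c \<odot>\<^bsub>A\<^esub> x"
  by (simp_all add: A.smult_mult_left A.smult_mult_right)

lemma left_module_scalars:
  "left_module A M \<Longrightarrow> left_module K (scalars A M)"
  unfolding scalars_eq_pullback by (rule left_module_pullback[OF _ K.ring_axioms unit_hom])

lemma mhom_scalars: "f \<in> mhom A M N \<Longrightarrow> f \<in> mhom K (scalars A M) (scalars A N)"
  unfolding scalars_eq_pullback by (rule mhom_pullback) auto

lemma submod_scalars: "submod A M H \<Longrightarrow> submod K (scalars A M) H"
  unfolding scalars_eq_pullback by (rule submod_pullback) auto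

lemma algebra_op: "algebra_over_field K (op_algebra A)"
proof -
  interpret op: ring "op_algebra A" by (rule ring_op_algebra) (rule is_ring_A)
  have "Module.module K (op_algebra A)"
    by (intro moduleI K.is_cring op.is_abelian_group)
      (simp_all add: A.smult_l_distr A.smult_r_distr A.smult_assoc1)
  then show ?thesis
    by (intro algebra_over_field.intro K.field_axioms assoc_algebra.intro op.ring_axioms assoc_algebra_axioms.intro)
      (simp_all add: A.smult_mult_left A.smult_mult_right)
qed

lemma left_module_scalars_regular: "left_module K (scalars A (regular_module A))"
  by (rule left_module_scalars[OF left_module_regular[OF is_ring_A]])

end

subsection \<open>Finite dimension\<close>

text \<open>Spanning is expressed by subspaces: one that contains \<open>B\<close> is everything.
  This form passes through images and tensor products by taking preimages of subspaces, without any
  linear combination.\<close>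

lemma fd_spaceI:
  assumes "field K" "left_module K V" "finite B" "B \<subseteq> carrier V"
    and S: "\<And>S. \<lbrakk>submod K V S; B \<subseteq> S\<rbrakk> \<Longrightarrow> carrier V \<subseteq> S"
  shows "fd_space K V"
proof -
  interpret vectorspace K V using assms(1,2) vectorspace_iff by blast
  have "submodule K (span B) V" by (rule span_is_submodule[OF assms(4)])
  then have "submod K V (span B)" by (auto simp: submodule_def submod_def)
  then have "span B = carrier V"
    using S[of "span B"] in_own_span[OF assms(4)] span_is_subset2[OF assms(4)] by blast
  then show ?thesis
    using assms(3,4) vectorspace_axioms by (auto simp: fd_space_def fin_dim_def)
qed

lemma fd_space_left_module: "fd_space K V \<Longrightarrow> left_module K V"
  using vectorspace_iff vectorspace.axioms(2) unfolding fd_space_def by blast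

lemma fd_space_field: "fd_space K V \<Longrightarrow> field K"
  using vectorspace.axioms(2) unfolding fd_space_def by blast

lemma submod_span_subset:
  assumes "vectorspace K V" "submod K V S" "B \<subseteq> S"
  shows "LinearCombinations.module.span K V B \<subseteq> S"
proof -
  interpret vectorspace K V by fact
  have "submodule K S V" using assms(2) module_axioms by (auto simp: submodule_def submod_def)
  then show ?thesis using span_is_subset assms(3) by blast
qed

lemma fd_space_spanning:
  assumes "fd_space K V"
  obtains B where "finite B" "B \<subseteq> carrier V" "\<And>S. \<lbrakk>submod K V S; B \<subseteq> S\<rbrakk> \<Longrightarrow> carrier V \<subseteq> S"
proof -
  interpret vectorspace K V using assms by (simp add: fd_space_def)
  obtain B where "finite B" "B \<subseteq> carrier V" "span B = carrier V"
    using assms by (auto simp: fd_space_def fin_dim_def)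
  then show ?thesis using that[of B] submod_span_subset[OF vectorspace_axioms, of _ B] by auto
qed

text \<open>\<open>r W\<close> is the largest size of a linearly independent subset of
  \<open>W\<close>, in effect its dimension. It increases strictly because an independent subset of
  maximal size in \<open>W\<close> can be enlarged by a vector of \<open>W'\<close> outside
  \<open>W\<close>; by the same maximality such a subset spans \<open>W\<close>. Strictness and the
  bound provide both chain conditions.\<close>

lemma fd_space_rank:
  assumes "fd_space K V"
  obtains r :: "'v set \<Rightarrow> nat" and N where
    "\<And>W W'. \<lbrakk>submod K V W; submod K V W'; W \<subset> W'\<rbrakk> \<Longrightarrow> r W < r W'"
    "\<And>W. submod K V W \<Longrightarrow> r W \<le> N"
    "\<And>W. submod K V W \<Longrightarrow> \<exists>B. finite B \<and> B \<subseteq> W \<and> (\<forall>S. submod K V S \<longrightarrow> B \<subseteq> S \<longrightarrow> W \<subseteq> S)"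
proof -
  interpret vectorspace K V using assms by (simp add: fd_space_def)
  have fd: fin_dim using assms by (simp add: fd_space_def)
  define C where "C W = {B. B \<subseteq> W \<and> lin_indpt B}" for W
  define r where "r W = Max (card ` C W)" for W
  have le: "finite B" "card B \<le> dim" if "submod K V W" "B \<in> C W" for B W
    using that li_le_dim[OF fd, of B] submodD(1)[of K V W] by (auto simp: C_def)
  have fin: "finite (card ` C W)" if "submod K V W" for W
    by (rule finite_subset[of _ "{..dim}"]) (use le[OF that] in auto)
  have ne: "{} \<in> C W" for W by (auto simp: C_def lin_dep_def)
  have max: "\<exists>B\<in>C W. card B = r W" if "submod K V W" for W
    using Max_in[OF fin[OF that]] ne[of W] unfolding r_def by fastforce
  have ext: "insert x B \<in> C W' \<and> x \<notin> B" if "B \<in> C W" "submod K V W" "W \<subseteq> W'" "submod K V W'" "x \<in> W'" "x \<notin> span B" for x B W W'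
  proof -
    have B: "B \<subseteq> carrier V" "lin_indpt B" "x \<in> carrier V"
      using that submodD(1)[of K V W] submodD(2)[of K V W'] by (auto simp: C_def)
    have "x \<notin> B" using in_own_span[OF B(1)] that by auto
    then have "lin_indpt (insert x B)"
      using lin_dep_iff_in_span[OF B(1,2,3)] that by auto
    then show ?thesis using that \<open>x \<notin> B\<close> by (auto simp: C_def)
  qed
  show ?thesis
  proof (rule that[of r dim])
    fix W W' assume W: "submod K V W" "submod K V W'" "W \<subset> W'"
    obtain B where B: "B \<in> C W" "card B = r W" using max[OF W(1)] by auto
    obtain x where x: "x \<in> W'" "x \<notin> W" using W(3) by auto
    have "span B \<subseteq> W" using submod_span_subset[OF vectorspace_axioms W(1)] B by (auto simp: C_def)
    then have "insert x B \<in> C W'" "x \<notin> B" using ext[OF B(1) W(1) _ W(2)] x W(3) by auto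
    then have "card (insert x B) \<le> r W'" using Max_ge[OF fin[OF W(2)]] by (auto simp: r_def)
    then show "r W < r W'" using B \<open>x \<notin> B\<close> le(1)[OF W(1) B(1)] by simp
  next
    fix W assume W: "submod K V W"
    then show "r W \<le> dim" using max[OF W] le(2)[OF W] by metis
    obtain B where B: "B \<in> C W" "card B = r W" using max[OF W] by auto
    have "W \<subseteq> span B"
    proof
      fix x assume x: "x \<in> W"
      show "x \<in> span B"
      proof (rule ccontr)
        assume "x \<notin> span B"
        then have "insert x B \<in> C W" "x \<notin> B" using ext[OF B(1) W _ W x] by auto
        then have "card (insert x B) \<le> r W" using Max_ge[OF fin[OF W]] by (auto simp: r_def)
        then show False using B \<open>x \<notin> B\<close> le(1)[OF W B(1)] by simp
      qed
    qed
    then have "\<forall>S. submod K V S \<longrightarrow> B \<subseteq> S \<longrightarrow> W \<subseteq> S"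
      using submod_span_subset[OF vectorspace_axioms] by blast
    then show "\<exists>B. finite B \<and> B \<subseteq> W \<and> (\<forall>S. submod K V S \<longrightarrow> B \<subseteq> S \<longrightarrow> W \<subseteq> S)"
      using B le(1)[OF W B(1)] by (auto simp: C_def)
  qed
qed

text \<open>The ascending chain condition: a member of largest rank is maximal. It provides maximal
  left ideals and maximal right submodules.\<close>

lemma fd_space_maximal:
  assumes "fd_space K V" "W0 \<in> \<S>" "\<And>W. W \<in> \<S> \<Longrightarrow> submod K V W"
  obtains W where "W \<in> \<S>" "\<And>W'. \<lbrakk>W' \<in> \<S>; W \<subseteq> W'\<rbrakk> \<Longrightarrow> W' = W"
proof -
  obtain r :: "_ \<Rightarrow> nat" and N where r: "\<And>W W'. \<lbrakk>submod K V W; submod K V W'; W \<subset> W'\<rbrakk> \<Longrightarrow> r W < r W'"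
    "\<And>W. submod K V W \<Longrightarrow> r W \<le> N"
    using fd_space_rank[OF assms(1)] by metis
  obtain W where W: "W \<in> \<S>" "\<And>W'. W' \<in> \<S> \<Longrightarrow> r W' \<le> r W"
    using ex_has_greatest_nat[of "\<lambda>W. W \<in> \<S>" W0 r "Suc N"] assms(2,3) r(2) by (auto simp: less_Suc_eq_le)
  show ?thesis
  proof (rule that[OF W(1)])
    fix W' assume W': "W' \<in> \<S>" "W \<subseteq> W'"
    have "\<not> W \<subset> W'" using r(1)[of W W'] W(2)[OF W'(1)] assms(3) W(1) W'(1) by (meson leD)
    then show "W' = W" using W'(2) by blast
  qed
qed

text \<open>The descending chain condition, by a member of least rank. It serves to pick a minimal
  counterexample among submodules.\<close>

lemma fd_space_minimal:
  assumes "fd_space K V" "W0 \<in> \<S>" "\<And>W. W \<in> \<S> \<Longrightarrow> submod K V W"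
  obtains W where "W \<in> \<S>" "\<And>W'. \<lbrakk>W' \<in> \<S>; W' \<subseteq> W\<rbrakk> \<Longrightarrow> W' = W"
proof -
  obtain r :: "_ \<Rightarrow> nat" and N where r: "\<And>W W'. \<lbrakk>submod K V W; submod K V W'; W \<subset> W'\<rbrakk> \<Longrightarrow> r W < r W'"
    "\<And>W. submod K V W \<Longrightarrow> r W \<le> N"
    using fd_space_rank[OF assms(1)] by metis
  obtain W where W: "W \<in> \<S>" "\<And>W'. W' \<in> \<S> \<Longrightarrow> r W \<le> r W'"
    using ex_has_least_nat[of "\<lambda>W. W \<in> \<S>" W0 r] assms(2) by auto
  show ?thesis
  proof (rule that[OF W(1)])
    fix W' assume W': "W' \<in> \<S>" "W' \<subseteq> W"
    have "\<not> W' \<subset> W" using r(1)[of W' W] W(2)[OF W'(1)] assms(3) W(1) W'(1) by (meson leD)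
    then show "W' = W" using W'(2) by blast
  qed
qed

lemma fd_space_sub:
  assumes "fd_space K V" "submod K V W"
  shows "fd_space K (V\<lparr>carrier := W\<rparr>)"
proof -
  interpret V: left_module K V by (rule fd_space_left_module[OF assms(1)])
  obtain B where B: "finite B" "B \<subseteq> W" "\<And>S. submod K V S \<Longrightarrow> B \<subseteq> S \<Longrightarrow> W \<subseteq> S"
    using fd_space_rank[OF assms(1)] assms(2) by metis
  show ?thesis
  proof (rule fd_spaceI[OF fd_space_field[OF assms(1)] V.left_module_sub[OF assms(2)], of B])
    fix S assume "submod K (V\<lparr>carrier := W\<rparr>) S" "B \<subseteq> S"
    then have "submod K V S" using submodD[OF assms(2)] by (auto simp: submod_def)
    then show "carrier (V\<lparr>carrier := W\<rparr>) \<subseteq> S" using B(3) \<open>B \<subseteq> S\<close> by simp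
  qed (use B in auto)
qed

lemma fd_space_image:
  assumes "fd_space K V" "left_module K W" "f \<in> mhom K V W" "f ` carrier V = carrier W"
  shows "fd_space K W"
proof -
  obtain B where B: "finite B" "B \<subseteq> carrier V" "\<And>S. submod K V S \<Longrightarrow> B \<subseteq> S \<Longrightarrow> carrier V \<subseteq> S"
    using fd_space_spanning[OF assms(1)] by blast
  note lV = fd_space_left_module[OF assms(1)]
  show ?thesis
  proof (rule fd_spaceI[OF fd_space_field[OF assms(1)] assms(2), of "f ` B"])
    fix S assume S: "submod K W S" "f ` B \<subseteq> S"
    then have "carrier V \<subseteq> {x \<in> carrier V. f x \<in> S}"
      by (intro B(3) submod_vimage[OF lV assms(2,3)]) (use B(2) in auto)
    then have "f ` carrier V \<subseteq> S" by auto
    then show "carrier W \<subseteq> S" using assms(4) by simp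
  qed (use B assms(4) in auto)
qed

lemma fd_left_moduleD: "fd_left_module K A M \<Longrightarrow> left_module A M" "fd_left_module K A M \<Longrightarrow> fd_space K (scalars A M)"
  by (simp_all add: fd_left_module_def)

lemma (in algebra_over_field) fd_left_module_image:
  assumes "fd_left_module K A M" "left_module A N" "f \<in> mhom A M N" "f ` carrier M = carrier N"
  shows "fd_left_module K A N"
  using assms fd_space_image[OF fd_left_moduleD(2)[OF assms(1)] left_module_scalars[OF assms(2)] mhom_scalars[OF assms(3)]]
  by (simp add: fd_left_module_def)

lemma (in algebra_over_field) fd_left_module_sub:
  assumes "fd_left_module K A M" "submod A M H"
  shows "fd_left_module K A (M\<lparr>carrier := H\<rparr>)"
proof -
  have "scalars A (M\<lparr>carrier := H\<rparr>) = (scalars A M)\<lparr>carrier := H\<rparr>" by (simp add: scalars_def)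
  then show ?thesis
    using fd_space_sub[OF fd_left_moduleD(2)[OF assms(1)] submod_scalars[OF assms(2)]]
      left_module.left_module_sub[OF fd_left_moduleD(1)[OF assms(1)] assms(2)]
    by (simp add: fd_left_module_def)
qed

subsection \<open>Projective modules and dual bases\<close>

text \<open>The dual basis property. In contrast to \<open>projective_module\<close> it does not
  quantify over modules on a fixed type, so it gives lifts against modules on every type.\<close>

definition fg_projective :: "('a, 'r) ring_scheme \<Rightarrow> ('a, 'p, 'z) module_scheme \<Rightarrow> bool" where
  "fg_projective A P \<longleftrightarrow> (\<exists>(n::nat) p \<phi>.
     (\<forall>i<n. p i \<in> carrier P \<and> \<phi> i \<in> mhom A P (regular_module A)) \<and>
     (\<forall>x\<in>carrier P. (\<Oplus>\<^bsub>P\<^esub>i\<in>{..<n}. \<phi> i x \<odot>\<^bsub>P\<^esub> p i) = x))"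

lemma fg_projectiveE:
  assumes "fg_projective A P"
  obtains n :: nat and p \<phi> where "\<And>i. i < n \<Longrightarrow> p i \<in> carrier P"
    "\<And>i. i < n \<Longrightarrow> \<phi> i \<in> mhom A P (regular_module A)"
    "\<And>x. x \<in> carrier P \<Longrightarrow> (\<Oplus>\<^bsub>P\<^esub>i\<in>{..<n}. \<phi> i x \<odot>\<^bsub>P\<^esub> p i) = x"
  using assms unfolding fg_projective_def by blast

lemma fg_projectiveI:
  assumes "left_module A P" "finite I" "\<And>i. i \<in> I \<Longrightarrow> p i \<in> carrier P"
    and \<phi>: "\<And>i. i \<in> I \<Longrightarrow> \<phi> i \<in> mhom A P (regular_module A)"
    and eq: "\<And>x. x \<in> carrier P \<Longrightarrow> (\<Oplus>\<^bsub>P\<^esub>i\<in>I. \<phi> i x \<odot>\<^bsub>P\<^esub> p i) = x"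
  shows "fg_projective A P"
proof -
  interpret P: left_module A P by fact
  obtain e where e: "bij_betw e {0..<card I} I"
    using ex_bij_betw_nat_finite[OF assms(2)] by blast
  then have e': "inj_on e {..<card I}" "e ` {..<card I} = I"
    by (auto simp: bij_betw_def atLeast0LessThan)
  have "(\<Oplus>\<^bsub>P\<^esub>i\<in>{..<card I}. \<phi> (e i) x \<odot>\<^bsub>P\<^esub> p (e i)) = x" if x: "x \<in> carrier P" for x
  proof -
    have "(\<Oplus>\<^bsub>P\<^esub>i\<in>I. \<phi> i x \<odot>\<^bsub>P\<^esub> p i) = (\<Oplus>\<^bsub>P\<^esub>i\<in>e ` {..<card I}. \<phi> i x \<odot>\<^bsub>P\<^esub> p i)"
      by (simp only: e'(2))
    also have "\<dots> = (\<Oplus>\<^bsub>P\<^esub>i\<in>{..<card I}. \<phi> (e i) x \<odot>\<^bsub>P\<^esub> p (e i))"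
      using e' mhom_closed[OF \<phi>] x assms(3) by (intro P.M.finsum_reindex) auto
    finally show ?thesis using eq[OF x] by simp
  qed
  moreover have "\<forall>i<card I. p (e i) \<in> carrier P \<and> \<phi> (e i) \<in> mhom A P (regular_module A)"
    using e' assms(3) \<phi> by auto
  ultimately show ?thesis
    unfolding fg_projective_def
    by (intro exI[of _ "card I"] exI[of _ "\<lambda>i. p (e i)"] exI[of _ "\<lambda>i. \<phi> (e i)"] conjI ballI)
qed

lemma mhom_smult_const:
  assumes "left_module A M" "\<phi> \<in> mhom A P (regular_module A)" "m \<in> carrier M"
  shows "(\<lambda>x. \<phi> x \<odot>\<^bsub>M\<^esub> m) \<in> mhom A P M"
proof -
  interpret M: left_module A M by fact
  show ?thesis
    using mhom_closed[OF assms(2)] assms(3)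
    by (intro mhomI) (simp_all add: mhom_add[OF assms(2)] mhom_smult[OF assms(2)] M.smult_l_distr M.smult_assoc)
qed

text \<open>Choose a preimage \<open>m i\<close> of each \<open>h (p i)\<close> and combine these
  with the coefficients \<open>\<phi> i x\<close>. Only the values of \<open>h\<close> have to lie
  in the image of \<open>g\<close>.\<close>

lemma fg_projective_lift:
  assumes "left_module A P" "left_module A M" "left_module A N" "fg_projective A P"
    and g: "g \<in> mhom A M N" and h: "h \<in> mhom A P N" and im: "\<And>x. x \<in> carrier P \<Longrightarrow> h x \<in> g ` carrier M"
  obtains h' where "h' \<in> mhom A P M" "\<And>x. x \<in> carrier P \<Longrightarrow> g (h' x) = h x"
proof -
  interpret P: left_module A P by fact
  interpret M: left_module A M by fact
  interpret N: left_module A N by fact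
  obtain n p \<phi> where p: "\<And>i. i < n \<Longrightarrow> p i \<in> carrier P" "\<And>i. i < n \<Longrightarrow> \<phi> i \<in> mhom A P (regular_module A)"
    and eq: "\<And>x. x \<in> carrier P \<Longrightarrow> (\<Oplus>\<^bsub>P\<^esub>i\<in>{..<n::nat}. \<phi> i x \<odot>\<^bsub>P\<^esub> p i) = x"
    by (rule fg_projectiveE[OF assms(4)]) blast
  have "\<exists>m\<in>carrier M. g m = h (p i)" if "i < n" for i
    using im[OF p(1)[OF that]] by (metis imageE)
  then obtain m where m: "\<And>i. i < n \<Longrightarrow> m i \<in> carrier M" "\<And>i. i < n \<Longrightarrow> g (m i) = h (p i)" by metis
  have \<phi>c: "\<phi> i x \<in> carrier A" if "i < n" "x \<in> carrier P" for i x
    using mhom_closed[OF p(2)[OF that(1)] that(2)] by simp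
  define h' where "h' x = (\<Oplus>\<^bsub>M\<^esub>i\<in>{..<n}. \<phi> i x \<odot>\<^bsub>M\<^esub> m i)" for x
  have "h' \<in> mhom A P M"
    unfolding h'_def by (intro mhom_sum mhom_smult_const assms(2)) (simp_all add: p m)
  moreover have "g (h' x) = h x" if x: "x \<in> carrier P" for x
  proof -
    have "g (h' x) = (\<Oplus>\<^bsub>N\<^esub>i\<in>{..<n}. g (\<phi> i x \<odot>\<^bsub>M\<^esub> m i))"
      unfolding h'_def by (rule mhom_finsum[OF assms(2,3) g]) (simp add: \<phi>c x m)
    also have "\<dots> = (\<Oplus>\<^bsub>N\<^esub>i\<in>{..<n}. h (\<phi> i x \<odot>\<^bsub>P\<^esub> p i))"
      by (intro N.M.finsum_cong') (auto simp: mhom_smult[OF g] mhom_smult[OF h] \<phi>c x m p mhom_closed[OF h])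
    also have "\<dots> = h (\<Oplus>\<^bsub>P\<^esub>i\<in>{..<n}. \<phi> i x \<odot>\<^bsub>P\<^esub> p i)"
      by (rule mhom_finsum[OF assms(1,3) h, symmetric]) (simp add: \<phi>c x p)
    finally show ?thesis using eq[OF x] by simp
  qed
  ultimately show ?thesis by (rule that)
qed

lemma mhom_inv_into:
  assumes "left_module A M" "h \<in> mhom A M N" "bij_betw h (carrier M) (carrier N)"
  shows "inv_into (carrier M) h \<in> mhom A N M"
proof -
  interpret M: left_module A M by fact
  let ?k = "inv_into (carrier M) h"
  have k: "?k y \<in> carrier M" "h (?k y) = y" if "y \<in> carrier N" for y
    using that assms(3) by (auto simp: bij_betw_def inv_into_into f_inv_into_f)
  have eq: "?k y = x" if "x \<in> carrier M" "y = h x" for x y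
    using that assms(3) by (auto simp: bij_betw_def)
  show ?thesis
    by (rule mhomI) (auto intro!: eq simp: k mhom_add[OF assms(2)] mhom_smult[OF assms(2)])
qed

lemma fg_projective_iso:
  assumes "left_module A P" "left_module A Q" "fg_projective A P" "h \<in> mhom A P Q" "bij_betw h (carrier P) (carrier Q)"
  shows "fg_projective A Q"
proof -
  interpret P: left_module A P by fact
  interpret Q: left_module A Q by fact
  obtain n p \<phi> where p: "\<And>i. i < n \<Longrightarrow> p i \<in> carrier P" "\<And>i. i < n \<Longrightarrow> \<phi> i \<in> mhom A P (regular_module A)"
    and eq: "\<And>x. x \<in> carrier P \<Longrightarrow> (\<Oplus>\<^bsub>P\<^esub>i\<in>{..<n::nat}. \<phi> i x \<odot>\<^bsub>P\<^esub> p i) = x"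
    by (rule fg_projectiveE[OF assms(3)]) blast
  let ?k = "inv_into (carrier P) h"
  have k: "?k \<in> mhom A Q P" by (rule mhom_inv_into[OF assms(1,4,5)])
  show ?thesis
  proof (rule fg_projectiveI[OF assms(2), of "{..<n}" "\<lambda>i. h (p i)" "\<lambda>i x. \<phi> i (?k x)"])
    fix x assume x: "x \<in> carrier Q"
    have "x = h (?k x)" using x assms(5) by (auto simp: bij_betw_def f_inv_into_f)
    also have "\<dots> = h (\<Oplus>\<^bsub>P\<^esub>i\<in>{..<n}. \<phi> i (?k x) \<odot>\<^bsub>P\<^esub> p i)"
      using eq[OF mhom_closed[OF k x]] by simp
    also have "\<dots> = (\<Oplus>\<^bsub>Q\<^esub>i\<in>{..<n}. h (\<phi> i (?k x) \<odot>\<^bsub>P\<^esub> p i))"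
      using mhom_closed[OF p(2)] mhom_closed[OF k x] p(1) by (intro mhom_finsum[OF assms(1,2,4)]) auto
    also have "\<dots> = (\<Oplus>\<^bsub>Q\<^esub>i\<in>{..<n}. \<phi> i (?k x) \<odot>\<^bsub>Q\<^esub> h (p i))"
      using mhom_closed[OF p(2)] mhom_closed[OF k x] p(1) mhom_closed[OF assms(4)]
      by (intro Q.M.finsum_cong') (auto simp: mhom_smult[OF assms(4)])
    finally show "(\<Oplus>\<^bsub>Q\<^esub>i\<in>{..<n}. \<phi> i (?k x) \<odot>\<^bsub>Q\<^esub> h (p i)) = x" by (rule sym)
  next
    fix i assume i: "i \<in> {..<n}"
    then show "h (p i) \<in> carrier Q" "(\<lambda>x. \<phi> i (?k x)) \<in> mhom A Q (regular_module A)"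
      using p mhom_closed[OF assms(4)] mhom_comp[OF k p(2)] by simp_all
  qed simp
qed

text \<open>A finite basis with its coordinate functions is a dual basis. It later provides linear
  sections, coordinates that embed a module into functions on \<open>nat\<close>, and a basis of the
  enveloping algebra over \<Lambda>. Linearity of the coordinates follows from uniqueness of the
  expansion.\<close>

lemma fd_space_fg_projective:
  assumes "fd_space K V"
  shows "fg_projective K V"
proof -
  interpret V: left_module K V by (rule fd_space_left_module[OF assms])
  interpret vectorspace K V using assms by (simp add: fd_space_def)
  obtain \<beta> where \<beta>: "finite \<beta>" "basis \<beta>" using finite_basis_exists assms by (auto simp: fd_space_def)
  have \<beta>c: "\<beta> \<subseteq> carrier V" using \<beta> by (simp add: basis_def)
  define c where "c v = (THE a. a \<in> \<beta> \<rightarrow>\<^sub>E carrier K \<and> lincomb a \<beta> = v)" for v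
  have ex1: "\<exists>!a. a \<in> \<beta> \<rightarrow>\<^sub>E carrier K \<and> lincomb a \<beta> = v" if "v \<in> carrier V" for v
    using basis_criterion[OF \<beta>(1) \<beta>c] \<beta>(2) that by blast
  have c: "c v \<in> \<beta> \<rightarrow>\<^sub>E carrier K" "lincomb (c v) \<beta> = v" if "v \<in> carrier V" for v
    using theI'[OF ex1[OF that]] by (auto simp: c_def)
  have cc: "c v b \<in> carrier K" if "v \<in> carrier V" "b \<in> \<beta>" for v b
    using c(1)[OF that(1)] that(2) by auto
  have uniq: "c v b = a b" if "v \<in> carrier V" "\<And>b. b \<in> \<beta> \<Longrightarrow> a b \<in> carrier K" "b \<in> \<beta>"
    "v = (\<Oplus>\<^bsub>V\<^esub>b\<in>\<beta>. a b \<odot>\<^bsub>V\<^esub> b)" for v a b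
  proof -
    have "lincomb (restrict a \<beta>) \<beta> = v"
      unfolding lincomb_def that(4) using that(2) \<beta>c by (intro V.M.finsum_cong') auto
    moreover have "restrict a \<beta> \<in> \<beta> \<rightarrow>\<^sub>E carrier K" using that(2) by auto
    ultimately have "c v = restrict a \<beta>" using ex1[OF that(1)] c[OF that(1)] by blast
    then show ?thesis using that(3) by simp
  qed
  have eq: "(\<Oplus>\<^bsub>V\<^esub>b\<in>\<beta>. c v b \<odot>\<^bsub>V\<^esub> b) = v" if "v \<in> carrier V" for v
    using c(2)[OF that] by (simp add: lincomb_def)
  show ?thesis
  proof (rule fg_projectiveI[OF V.is_left_module \<beta>(1), of "\<lambda>b. b" "\<lambda>b v. c v b"])
    fix b assume b: "b \<in> \<beta>"
    show "(\<lambda>v. c v b) \<in> mhom K V (regular_module K)"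
    proof (rule mhomI)
      fix x y assume x: "x \<in> carrier V" and y: "y \<in> carrier V"
      have "x \<oplus>\<^bsub>V\<^esub> y = (\<Oplus>\<^bsub>V\<^esub>b\<in>\<beta>. c x b \<odot>\<^bsub>V\<^esub> b) \<oplus>\<^bsub>V\<^esub> (\<Oplus>\<^bsub>V\<^esub>b\<in>\<beta>. c y b \<odot>\<^bsub>V\<^esub> b)"
        using eq[OF x] eq[OF y] by simp
      also have "\<dots> = (\<Oplus>\<^bsub>V\<^esub>b\<in>\<beta>. c x b \<odot>\<^bsub>V\<^esub> b \<oplus>\<^bsub>V\<^esub> c y b \<odot>\<^bsub>V\<^esub> b)"
        using cc x y \<beta>c by (intro V.M.finsum_addf[symmetric]) auto
      also have "\<dots> = (\<Oplus>\<^bsub>V\<^esub>b\<in>\<beta>. (c x b \<oplus>\<^bsub>K\<^esub> c y b) \<odot>\<^bsub>V\<^esub> b)"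
        using cc x y \<beta>c by (intro V.M.finsum_cong') (auto simp: V.smult_l_distr)
      finally have eqn: "x \<oplus>\<^bsub>V\<^esub> y = (\<Oplus>\<^bsub>V\<^esub>b\<in>\<beta>. (c x b \<oplus>\<^bsub>K\<^esub> c y b) \<odot>\<^bsub>V\<^esub> b)" .
      have "c (x \<oplus>\<^bsub>V\<^esub> y) b = c x b \<oplus>\<^bsub>K\<^esub> c y b"
        by (rule uniq[of "x \<oplus>\<^bsub>V\<^esub> y" "\<lambda>b. c x b \<oplus>\<^bsub>K\<^esub> c y b" b, OF _ _ _ eqn]) (simp_all add: x y b cc)
      then show "c (x \<oplus>\<^bsub>V\<^esub> y) b = c x b \<oplus>\<^bsub>regular_module K\<^esub> c y b" by simp
    next
      fix a x assume a: "a \<in> carrier K" and x: "x \<in> carrier V"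
      have "a \<odot>\<^bsub>V\<^esub> x = a \<odot>\<^bsub>V\<^esub> (\<Oplus>\<^bsub>V\<^esub>b\<in>\<beta>. c x b \<odot>\<^bsub>V\<^esub> b)" using eq[OF x] by simp
      also have "\<dots> = (\<Oplus>\<^bsub>V\<^esub>b\<in>\<beta>. a \<odot>\<^bsub>V\<^esub> (c x b \<odot>\<^bsub>V\<^esub> b))"
        using cc x a \<beta>c by (intro V.smult_finsum) auto
      also have "\<dots> = (\<Oplus>\<^bsub>V\<^esub>b\<in>\<beta>. (a \<otimes>\<^bsub>K\<^esub> c x b) \<odot>\<^bsub>V\<^esub> b)"
        using cc x a \<beta>c by (intro V.M.finsum_cong') (auto simp: V.smult_assoc)
      finally have eqn: "a \<odot>\<^bsub>V\<^esub> x = (\<Oplus>\<^bsub>V\<^esub>b\<in>\<beta>. (a \<otimes>\<^bsub>K\<^esub> c x b) \<odot>\<^bsub>V\<^esub> b)" .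
      have "c (a \<odot>\<^bsub>V\<^esub> x) b = a \<otimes>\<^bsub>K\<^esub> c x b"
        by (rule uniq[of "a \<odot>\<^bsub>V\<^esub> x" "\<lambda>b. a \<otimes>\<^bsub>K\<^esub> c x b" b, OF _ _ _ eqn]) (simp_all add: x a b cc)
      then show "c (a \<odot>\<^bsub>V\<^esub> x) b = a \<odot>\<^bsub>regular_module K\<^esub> c x b" by simp
    qed (simp add: cc b)
  qed (use \<beta>c eq in auto)
qed

section \<open>Transport to the universe type, free modules and existence of projective
  resolutions\<close>

lemma transport_module:
  assumes "left_module A M" "inj_on h (carrier M)"
  obtains N :: "('a, 'n) module" where "left_module A N" "h \<in> mhom A M N" "bij_betw h (carrier M) (carrier N)"
proof -
  interpret M: left_module A M by fact
  let ?k = "inv_into (carrier M) h"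
  define N :: "('a, 'n) module" where "N = \<lparr>carrier = h ` carrier M, mult = undefined, one = undefined, zero = h \<zero>\<^bsub>M\<^esub>,
    add = \<lambda>u v. h (?k u \<oplus>\<^bsub>M\<^esub> ?k v), smult = \<lambda>a u. h (a \<odot>\<^bsub>M\<^esub> ?k u)\<rparr>"
  have "left_module A N"
    by (rule left_module_surj[OF assms(1), where \<pi> = h]) (simp_all add: N_def inv_into_f_f[OF assms(2)])
  moreover have "h \<in> mhom A M N"
    by (rule mhomI) (simp_all add: N_def inv_into_f_f[OF assms(2)])
  moreover have "bij_betw h (carrier M) (carrier N)" using assms(2) by (simp add: N_def bij_betw_def)
  ultimately show ?thesis by (rule that)
qed

definition free_module :: "('k, 'a) module \<Rightarrow> nat \<Rightarrow> ('a, nat \<Rightarrow> 'a) module" where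
  "free_module A n =
    \<lparr>carrier = {f. \<forall>i. f i \<in> carrier A \<and> (i \<ge> n \<longrightarrow> f i = \<zero>\<^bsub>A\<^esub>)}, mult = undefined, one = undefined,
     zero = \<lambda>_. \<zero>\<^bsub>A\<^esub>, add = \<lambda>f g i. f i \<oplus>\<^bsub>A\<^esub> g i, smult = \<lambda>a f i. a \<otimes>\<^bsub>A\<^esub> f i\<rparr>"

context algebra_over_field
begin

text \<open>Coordinates with respect to a dual basis over the field, padded by zero, embed the
  carrier into \<open>nat \<Rightarrow> 'k\<close>; the module structure is carried along the
  embedding.\<close>

lemma fd_transport:
  assumes "fd_left_module K A M"
  obtains N :: "('a, nat \<Rightarrow> 'k) module" and h where "fd_left_module K A N" "h \<in> mhom A M N"
    "bij_betw h (carrier M) (carrier N)"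
proof -
  note lM = fd_left_moduleD(1)[OF assms]
  interpret M: left_module A M by (rule lM)
  obtain n :: nat and b \<phi> where b: "\<And>i. i < n \<Longrightarrow> b i \<in> carrier (scalars A M)"
    and \<phi>: "\<And>i. i < n \<Longrightarrow> \<phi> i \<in> mhom K (scalars A M) (regular_module K)"
    and eq: "\<And>x. x \<in> carrier (scalars A M) \<Longrightarrow>
      (\<Oplus>\<^bsub>scalars A M\<^esub>i\<in>{..<n}. \<phi> i x \<odot>\<^bsub>scalars A M\<^esub> b i) = x"
    by (rule fg_projectiveE[OF fd_space_fg_projective[OF fd_left_moduleD(2)[OF assms]]]) blast
  have \<phi>c: "\<phi> i x \<in> carrier K" if "i < n" "x \<in> carrier M" for i x
    using mhom_closed[OF \<phi>[OF that(1)], of x] that by simp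
  define h where "h x = (\<lambda>i. if i < n then \<phi> i x else \<zero>\<^bsub>K\<^esub>)" for x
  have "inj_on h (carrier M)"
  proof (rule inj_onI)
    fix x y assume xy: "x \<in> carrier M" "y \<in> carrier M" "h x = h y"
    have "\<phi> i x = \<phi> i y" if "i < n" for i
      using fun_cong[OF xy(3), of i] that by (simp add: h_def)
    then have "(\<Oplus>\<^bsub>scalars A M\<^esub>i\<in>{..<n}. \<phi> i x \<odot>\<^bsub>scalars A M\<^esub> b i) =
        (\<Oplus>\<^bsub>scalars A M\<^esub>i\<in>{..<n}. \<phi> i y \<odot>\<^bsub>scalars A M\<^esub> b i)"
      using b \<phi>c xy(1,2) by (simp, intro M.M.finsum_cong') auto
    then show "x = y" using eq[of x] eq[of y] xy(1,2) by simp
  qed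
  then obtain N :: "('a, nat \<Rightarrow> 'k) module" where N: "left_module A N" "h \<in> mhom A M N" "bij_betw h (carrier M) (carrier N)"
    using transport_module[OF lM] by blast
  then show ?thesis
    using that[OF fd_left_module_image[OF assms N(1,2)] N(2,3)] by (simp add: bij_betw_def)
qed

lemma left_module_free: "left_module A (free_module A n)"
proof -
  interpret R: left_module A "regular_module A" by (rule left_module_regular[OF is_ring_A])
  have "abelian_group (free_module A n)"
  proof (rule abelian_groupI, goal_cases)
    case (6 x)
    then show ?case
      by (intro bexI[of _ "\<lambda>i. \<ominus>\<^bsub>A\<^esub> x i"]) (auto simp: free_module_def A.l_neg)
  qed (auto simp: free_module_def fun_eq_iff A.a_ac)
  then show ?thesis
    by (intro left_moduleI is_ring_A) (auto simp: free_module_def A.l_distr A.r_distr A.m_assoc)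
qed

definition "single i a = (\<lambda>j::nat. if j = i then a else \<zero>\<^bsub>A\<^esub>)"

lemma free_module_expand:
  assumes "f \<in> carrier (free_module A n)"
  shows "(\<Oplus>\<^bsub>free_module A n\<^esub>i\<in>{..<n}. single i (f i)) = f"
proof
  fix j
  interpret F: left_module A "free_module A n" by (rule left_module_free)
  have c: "single i (f i) \<in> carrier (free_module A n)" if "i < n" for i
    using assms that by (auto simp: free_module_def single_def)
  have fj: "f i \<in> carrier A" for i using assms by (auto simp: free_module_def)
  have "(\<Oplus>\<^bsub>free_module A n\<^esub>i\<in>{..<n}. single i (f i)) j = (\<Oplus>\<^bsub>A\<^esub>i\<in>{..<n}. single i (f i) j)"
    by (rule finsum_additive[OF F.M.abelian_group_axioms A.M.abelian_group_axioms, where f = "\<lambda>f. f j"])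
      (auto simp: c, auto simp: free_module_def)
  also have "\<dots> = (\<Oplus>\<^bsub>A\<^esub>i\<in>{..<n}. if j = i then f i else \<zero>\<^bsub>A\<^esub>)"
    by (intro A.finsum_cong') (auto simp: single_def fj)
  also have "\<dots> = f j"
  proof (cases "j < n")
    case True
    then show ?thesis using A.finsum_singleton[of j "{..<n}" f] fj by simp
  next
    case False
    then have "(\<Oplus>\<^bsub>A\<^esub>i\<in>{..<n}. if j = i then f i else \<zero>\<^bsub>A\<^esub>) = (\<Oplus>\<^bsub>A\<^esub>i\<in>{..<n}. \<zero>\<^bsub>A\<^esub>)"
      by (intro A.finsum_cong') auto
    then show ?thesis using False assms by (simp add: free_module_def)
  qed
  finally show "(\<Oplus>\<^bsub>free_module A n\<^esub>i\<in>{..<n}. single i (f i)) j = f j" .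
qed

lemma fg_projective_free: "fg_projective A (free_module A n)"
proof (rule fg_projectiveI[OF left_module_free[of n], of "{..<n}" "\<lambda>i. single i \<one>\<^bsub>A\<^esub>" "\<lambda>i f. f i"])
  fix f assume f: "f \<in> carrier (free_module A n)"
  have "f i \<odot>\<^bsub>free_module A n\<^esub> single i \<one>\<^bsub>A\<^esub> = single i (f i)" for i
    using f by (auto simp: free_module_def single_def)
  then show "(\<Oplus>\<^bsub>free_module A n\<^esub>i\<in>{..<n}. f i \<odot>\<^bsub>free_module A n\<^esub> single i \<one>\<^bsub>A\<^esub>) = f"
    using free_module_expand[OF f] by simp
next
  fix i show "(\<lambda>f. f i) \<in> mhom A (free_module A n) (regular_module A)"
    by (rule mhomI) (auto simp: free_module_def)
qed (auto simp: free_module_def single_def)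

lemma fd_free_module:
  assumes "fd_space K A"
  shows "fd_left_module K A (free_module A n)"
proof -
  interpret F: left_module A "free_module A n" by (rule left_module_free)
  note lS = left_module_scalars[OF F.is_left_module]
  interpret S: left_module K "scalars A (free_module A n)" by (rule lS)
  obtain B where B: "finite B" "B \<subseteq> carrier A" "\<And>S. submod K A S \<Longrightarrow> B \<subseteq> S \<Longrightarrow> carrier A \<subseteq> S"
    using fd_space_spanning[OF assms] by blast
  have hom: "single i \<in> mhom K A (scalars A (free_module A n))" if "i < n" for i
    using that by (intro mhomI) (auto simp: free_module_def single_def fun_eq_iff)
  have "fd_space K (scalars A (free_module A n))"
  proof (rule fd_spaceI[OF K.field_axioms lS, of "(\<lambda>(i, b). single i b) ` ({..<n} \<times> B)"])
    fix S assume S: "submod K (scalars A (free_module A n)) S" "(\<lambda>(i, b). single i b) ` ({..<n} \<times> B) \<subseteq> S"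
    have s: "single i a \<in> S" if "i < n" "a \<in> carrier A" for i a
    proof -
      have "carrier A \<subseteq> {a \<in> carrier A. single i a \<in> S}"
        using S(2) that(1) B(2)
        by (intro B(3) submod_vimage[OF left_module_self lS hom[OF that(1)] S(1)]) auto
      then show ?thesis using that(2) by auto
    qed
    show "carrier (scalars A (free_module A n)) \<subseteq> S"
    proof
      fix f assume "f \<in> carrier (scalars A (free_module A n))"
      then have f: "f \<in> carrier (free_module A n)" by simp
      then have "(\<Oplus>\<^bsub>scalars A (free_module A n)\<^esub>i\<in>{..<n}. single i (f i)) \<in> S"
        by (intro S.submod_finsum[OF S(1)] s) (auto simp: free_module_def)
      then show "f \<in> S" using free_module_expand[OF f] by simp
    qed
  qed (use B in \<open>auto simp: free_module_def single_def\<close>)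
  then show ?thesis by (simp add: fd_left_module_def left_module_free)
qed

lemma fg_projective_imp_projective:
  assumes "fd_left_module K A P" "fg_projective A P"
  shows "projective_module K A P"
  unfolding projective_module_def
proof (intro conjI assms(1) allI impI)
  fix M N :: "('a, nat \<Rightarrow> 'k) module" and g h
  assume a: "fd_left_module K A M \<and> fd_left_module K A N \<and> g \<in> mhom A M N \<and>
    g ` carrier M = carrier N \<and> h \<in> mhom A P N"
  then obtain h' where "h' \<in> mhom A P M" "\<And>x. x \<in> carrier P \<Longrightarrow> g (h' x) = h x"
    using fg_projective_lift[of A P M N g h] assms mhom_closed[of h A P N] by (auto simp: fd_left_module_def)
  then show "\<exists>h'\<in>mhom A P M. \<forall>x\<in>carrier P. g (h' x) = h x" by blast
qed

text \<open>The generators \<open>b\<close> generate the module already over the field, so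
  coefficients that are scalar multiples of the unit of \<open>A\<close> reach every
  element.\<close>

lemma free_cover:
  assumes "fd_space K A" "fd_left_module K A M"
  obtains n b where "\<And>i. i < n \<Longrightarrow> b i \<in> carrier M"
    "(\<lambda>f. \<Oplus>\<^bsub>M\<^esub>i\<in>{..<n}. f i \<odot>\<^bsub>M\<^esub> b i) \<in> mhom A (free_module A n) M"
    "(\<lambda>f. \<Oplus>\<^bsub>M\<^esub>i\<in>{..<n}. f i \<odot>\<^bsub>M\<^esub> b i) ` carrier (free_module A n) = carrier M"
proof -
  note lM = fd_left_moduleD(1)[OF assms(2)]
  interpret M: left_module A M by (rule lM)
  obtain n :: nat and b \<phi> where b': "\<And>i. i < n \<Longrightarrow> b i \<in> carrier (scalars A M)"
    and \<phi>: "\<And>i. i < n \<Longrightarrow> \<phi> i \<in> mhom K (scalars A M) (regular_module K)"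
    and eq: "\<And>x. x \<in> carrier (scalars A M) \<Longrightarrow>
      (\<Oplus>\<^bsub>scalars A M\<^esub>i\<in>{..<n}. \<phi> i x \<odot>\<^bsub>scalars A M\<^esub> b i) = x"
    by (rule fg_projectiveE[OF fd_space_fg_projective[OF fd_left_moduleD(2)[OF assms(2)]]]) blast
  have b: "b i \<in> carrier M" if "i < n" for i using b'[OF that] by simp
  let ?g = "\<lambda>f. \<Oplus>\<^bsub>M\<^esub>i\<in>{..<n}. f i \<odot>\<^bsub>M\<^esub> b i"
  have g: "?g \<in> mhom A (free_module A n) M"
    by (intro mhom_sum lM mhom_smult_const mhomI) (auto simp: b, auto simp: free_module_def)
  have "?g ` carrier (free_module A n) = carrier M"
  proof (intro subset_antisym subsetI)
    fix x assume x: "x \<in> carrier M"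
    let ?f = "\<lambda>i. if i < n then \<phi> i x \<odot>\<^bsub>A\<^esub> \<one>\<^bsub>A\<^esub> else \<zero>\<^bsub>A\<^esub>"
    have \<phi>c: "\<phi> i x \<in> carrier K" if "i < n" for i using mhom_closed[OF \<phi>[OF that]] x by simp
    have "?f \<in> carrier (free_module A n)" by (auto simp: free_module_def \<phi>c)
    moreover have "?g ?f = (\<Oplus>\<^bsub>M\<^esub>i\<in>{..<n}. (\<phi> i x \<odot>\<^bsub>A\<^esub> \<one>\<^bsub>A\<^esub>) \<odot>\<^bsub>M\<^esub> b i)"
      by (intro M.M.finsum_cong') (auto simp: \<phi>c b)
    ultimately show "x \<in> ?g ` carrier (free_module A n)"
      using eq[of x] x by (intro image_eqI[of _ _ ?f]) simp_all
  qed (use mhom_closed[OF g] in auto)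
  with b g that show ?thesis by blast
qed

text \<open>A free cover has to be split, but \<open>projective_module\<close> permits test modules
  on the universe type only. So both \<open>P\<close> and the free module are transported there,
  \<open>h\<close> is lifted along the transported cover, and the coordinates of the lift together
  with the generators, brought back to \<open>P\<close>, form the dual basis.\<close>

lemma projective_imp_fg_projective:
  assumes fd: "fd_space K A" and P: "projective_module K A P"
  shows "fg_projective A P"
proof -
  have fP: "fd_left_module K A P" using P by (simp add: projective_module_def)
  note lP = fd_left_moduleD(1)[OF fP]
  interpret P: left_module A P by (rule lP)
  obtain P' :: "('a, nat \<Rightarrow> 'k) module" and h where P': "fd_left_module K A P'" "h \<in> mhom A P P'"
    "bij_betw h (carrier P) (carrier P')" using fd_transport[OF fP] by blast
  note lP' = fd_left_moduleD(1)[OF P'(1)]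
  interpret P': left_module A P' by (rule lP')
  obtain n b where b: "\<And>i. i < n \<Longrightarrow> b i \<in> carrier P'" and
    g: "(\<lambda>f. \<Oplus>\<^bsub>P'\<^esub>i\<in>{..<n}. f i \<odot>\<^bsub>P'\<^esub> b i) \<in> mhom A (free_module A n) P'" and
    gs: "(\<lambda>f. \<Oplus>\<^bsub>P'\<^esub>i\<in>{..<n}. f i \<odot>\<^bsub>P'\<^esub> b i) ` carrier (free_module A n) = carrier P'"
    by (rule free_cover[OF fd P'(1)]) (rule that; assumption)
  let ?g = "\<lambda>f. \<Oplus>\<^bsub>P'\<^esub>i\<in>{..<n}. f i \<odot>\<^bsub>P'\<^esub> b i"
  obtain F' :: "('a, nat \<Rightarrow> 'k) module" and k where F': "fd_left_module K A F'" "k \<in> mhom A (free_module A n) F'"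
    "bij_betw k (carrier (free_module A n)) (carrier F')" using fd_transport[OF fd_free_module[OF fd]] by blast
  let ?k = "inv_into (carrier (free_module A n)) k"
  have k: "?k \<in> mhom A F' (free_module A n)" by (rule mhom_inv_into[OF left_module_free F'(2,3)])
  have "(\<lambda>x. ?g (?k x)) \<in> mhom A F' P'" by (rule mhom_comp[OF k g])
  moreover have "(\<lambda>x. ?g (?k x)) ` carrier F' = carrier P'"
    using bij_betw_inv_into[OF F'(3)] gs by (auto simp: bij_betw_def image_image[symmetric, of ?g ?k])
  ultimately obtain h' where h': "h' \<in> mhom A P F'" "\<And>x. x \<in> carrier P \<Longrightarrow> ?g (?k (h' x)) = h x"
    using P P' F'(1) unfolding projective_module_def by blast
  let ?h = "inv_into (carrier P) h"
  have hi: "?h \<in> mhom A P' P" by (rule mhom_inv_into[OF lP P'(2,3)])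
  have ev: "(\<lambda>f. f i) \<in> mhom A (free_module A n) (regular_module A)" for i
    by (rule mhomI) (auto simp: free_module_def)
  have kc: "?k (h' x) i \<in> carrier A" if "x \<in> carrier P" for x i
    using mhom_closed[OF ev mhom_closed[OF k mhom_closed[OF h'(1) that]]] by simp
  show ?thesis
  proof (rule fg_projectiveI[OF lP, of "{..<n}" "\<lambda>i. ?h (b i)" "\<lambda>i x. ?k (h' x) i"])
    fix i assume "i \<in> {..<n}"
    then show "?h (b i) \<in> carrier P" using mhom_closed[OF hi b] by auto
    show "(\<lambda>x. ?k (h' x) i) \<in> mhom A P (regular_module A)"
      by (rule mhom_comp[OF mhom_comp[OF h'(1) k] ev])
  next
    fix x assume x: "x \<in> carrier P"
    have "x = ?h (h x)" using x P'(3) by (simp add: bij_betw_def)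
    also have "\<dots> = ?h (?g (?k (h' x)))" using h'(2)[OF x] by simp
    also have "\<dots> = (\<Oplus>\<^bsub>P\<^esub>i\<in>{..<n}. ?h (?k (h' x) i \<odot>\<^bsub>P'\<^esub> b i))"
      by (rule mhom_finsum[OF lP' lP hi]) (auto simp: kc x b)
    also have "\<dots> = (\<Oplus>\<^bsub>P\<^esub>i\<in>{..<n}. ?k (h' x) i \<odot>\<^bsub>P\<^esub> ?h (b i))"
      by (intro P.M.finsum_cong') (auto simp: kc x b mhom_smult[OF hi] mhom_closed[OF hi])
    finally show "(\<Oplus>\<^bsub>P\<^esub>i\<in>{..<n}. ?k (h' x) i \<odot>\<^bsub>P\<^esub> ?h (b i)) = x" by (rule sym)
  qed simp
qed

text \<open>Any surjection from a projective on the universe type will do; minimality in the sense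
  of a projective cover is not claimed.\<close>

lemma projective_cover:
  assumes "fd_space K A" "fd_left_module K A M"
  obtains P :: "('a, nat \<Rightarrow> 'k) module" and \<epsilon> where
    "projective_module K A P" "\<epsilon> \<in> mhom A P M" "\<epsilon> ` carrier P = carrier M"
proof -
  obtain n b where b: "\<And>i. i < n \<Longrightarrow> b i \<in> carrier M" and
    g: "(\<lambda>f. \<Oplus>\<^bsub>M\<^esub>i\<in>{..<n}. f i \<odot>\<^bsub>M\<^esub> b i) \<in> mhom A (free_module A n) M" and
    gs: "(\<lambda>f. \<Oplus>\<^bsub>M\<^esub>i\<in>{..<n}. f i \<odot>\<^bsub>M\<^esub> b i) ` carrier (free_module A n) = carrier M"
    by (rule free_cover[OF assms]) (rule that; assumption)
  let ?g = "\<lambda>f. \<Oplus>\<^bsub>M\<^esub>i\<in>{..<n}. f i \<odot>\<^bsub>M\<^esub> b i"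
  obtain F' :: "('a, nat \<Rightarrow> 'k) module" and k where F': "fd_left_module K A F'" "k \<in> mhom A (free_module A n) F'"
    "bij_betw k (carrier (free_module A n)) (carrier F')" using fd_transport[OF fd_free_module[OF assms(1)]] by blast
  let ?k = "inv_into (carrier (free_module A n)) k"
  have k: "?k \<in> mhom A F' (free_module A n)" by (rule mhom_inv_into[OF left_module_free F'(2,3)])
  have "fg_projective A F'"
    by (rule fg_projective_iso[OF left_module_free fd_left_moduleD(1)[OF F'(1)] fg_projective_free F'(2,3)])
  then have "projective_module K A F'" by (rule fg_projective_imp_projective[OF F'(1)])
  moreover have "(\<lambda>x. ?g (?k x)) \<in> mhom A F' M" by (rule mhom_comp[OF k g])
  moreover have "(\<lambda>x. ?g (?k x)) ` carrier F' = carrier M"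
    using bij_betw_inv_into[OF F'(3)] gs by (auto simp: bij_betw_def image_image[symmetric, of ?g ?k])
  ultimately show ?thesis by (rule that)
qed

lemma projective_resolution_exists:
  assumes fd: "fd_space K A" and M: "fd_left_module K A M"
  shows "\<exists>(P :: nat \<Rightarrow> ('a, nat \<Rightarrow> 'k) module) D \<epsilon>. projective_resolution K A M P D \<epsilon>"
proof -
  obtain P0 :: "('a, nat \<Rightarrow> 'k) module" and \<epsilon> where P0: "projective_module K A P0" "\<epsilon> \<in> mhom A P0 M" "\<epsilon> ` carrier P0 = carrier M"
    using projective_cover[OF assms] by blast
  have fdP: "fd_left_module K A P" if "projective_module K A P" for P :: "('a, nat \<Rightarrow> 'k) module"
    using that by (simp add: projective_module_def)
  \<comment> \<open>The state at stage \<open>n\<close> is a projective with the submodule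
    \<open>H\<close> of cycles, which the next differential must have as its image. At stage zero
    \<open>H\<close> is the kernel of the augmentation.\<close>
  let ?good = "\<lambda>(n::nat) (P :: ('a, nat \<Rightarrow> 'k) module, H). projective_module K A P \<and> submod A P H \<and>
    (n = 0 \<longrightarrow> P = P0 \<and> H = {x \<in> carrier P0. \<epsilon> x = \<zero>\<^bsub>M\<^esub>})"
  let ?step = "\<lambda>(n::nat) (P :: ('a, nat \<Rightarrow> 'k) module, H) (P' :: ('a, nat \<Rightarrow> 'k) module, H').
    \<exists>D\<in>mhom A P' P. D ` carrier P' = H \<and> H' = {x \<in> carrier P'. D x = \<zero>\<^bsub>P\<^esub>}"
  have "\<exists>f. \<forall>n. ?good n (f n) \<and> ?step n (f n) (f (Suc n))"
  proof (rule dependent_nat_choice)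
    show "\<exists>x. ?good 0 x"
      using P0 submod_ker[OF fd_left_moduleD(1)[OF fdP[OF P0(1)]] fd_left_moduleD(1)[OF M] P0(2)]
      by (intro exI[of _ "(P0, {x \<in> carrier P0. \<epsilon> x = \<zero>\<^bsub>M\<^esub>})"]) auto
  next
    fix x n assume good: "?good n x"
    obtain P :: "('a, nat \<Rightarrow> 'k) module" and H where x: "x = (P, H)" by force
    have P: "projective_module K A P" "submod A P H" using good x by auto
    obtain P' :: "('a, nat \<Rightarrow> 'k) module" and D where
      P': "projective_module K A P'" "D \<in> mhom A P' (P\<lparr>carrier := H\<rparr>)" "D ` carrier P' = carrier (P\<lparr>carrier := H\<rparr>)"
      using projective_cover[OF fd fd_left_module_sub[OF fdP[OF P(1)] P(2)]] by blast
    have D: "D \<in> mhom A P' P"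
      using P'(2) submodD(1)[OF P(2)] by (auto simp: LinearCombinations.module_hom_def)
    have "submod A P' {x \<in> carrier P'. D x = \<zero>\<^bsub>P\<^esub>}"
      by (rule submod_ker[OF fd_left_moduleD(1)[OF fdP[OF P'(1)]] fd_left_moduleD(1)[OF fdP[OF P(1)]] D])
    then show "\<exists>y. ?good (Suc n) y \<and> ?step n x y"
      using P' D x by (intro exI[of _ "(P', {x \<in> carrier P'. D x = \<zero>\<^bsub>P\<^esub>})"]) auto
  qed
  then obtain f where f: "\<forall>n. ?good n (f n) \<and> ?step n (f n) (f (Suc n))" ..
  define P where "P n = fst (f n)" for n
  define H where "H n = snd (f n)" for n
  have good: "projective_module K A (P n)" for n
    using f[THEN spec, THEN conjunct1, of n] by (simp add: P_def split_beta)
  have zero: "P 0 = P0" "H 0 = {x \<in> carrier P0. \<epsilon> x = \<zero>\<^bsub>M\<^esub>}"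
    using f[THEN spec, THEN conjunct1, of 0] by (simp_all add: P_def H_def split_beta)
  have "\<forall>n. \<exists>D. D \<in> mhom A (P (Suc n)) (P n) \<and> D ` carrier (P (Suc n)) = H n \<and>
      H (Suc n) = {x \<in> carrier (P (Suc n)). D x = \<zero>\<^bsub>P n\<^esub>}"
  proof
    fix n show "\<exists>D. D \<in> mhom A (P (Suc n)) (P n) \<and> D ` carrier (P (Suc n)) = H n \<and>
      H (Suc n) = {x \<in> carrier (P (Suc n)). D x = \<zero>\<^bsub>P n\<^esub>}"
      using f[THEN spec, THEN conjunct2, of n] by (simp add: P_def H_def split_beta Bex_def)
  qed
  from choice[OF this] obtain D where D: "\<forall>n. D n \<in> mhom A (P (Suc n)) (P n) \<and> D n ` carrier (P (Suc n)) = H n \<and>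
      H (Suc n) = {x \<in> carrier (P (Suc n)). D n x = \<zero>\<^bsub>P n\<^esub>}" ..
  have "projective_resolution K A M P D \<epsilon>"
    unfolding projective_resolution_def
    using D[THEN spec, of 0] D zero good P0 by simp
  then show ?thesis by blast
qed

end

subsection \<open>Tensor products\<close>

lemma free_space_simps:
  "carrier (free_space K S) = {f. range f \<subseteq> carrier K \<and> finite {s. f s \<noteq> \<zero>\<^bsub>K\<^esub>} \<and> {s. f s \<noteq> \<zero>\<^bsub>K\<^esub>} \<subseteq> S}"
  "\<zero>\<^bsub>free_space K S\<^esub> = (\<lambda>_. \<zero>\<^bsub>K\<^esub>)"
  "f \<oplus>\<^bsub>free_space K S\<^esub> g = (\<lambda>s. f s \<oplus>\<^bsub>K\<^esub> g s)"
  "c \<odot>\<^bsub>free_space K S\<^esub> f = (\<lambda>s. c \<otimes>\<^bsub>K\<^esub> f s)"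
  by (simp_all add: free_space_def)

lemma left_module_free_space:
  assumes "field K"
  shows "left_module K (free_space K S)"
proof -
  interpret K: field K by fact
  have sub: "{s. f s \<oplus>\<^bsub>K\<^esub> g s \<noteq> \<zero>\<^bsub>K\<^esub>} \<subseteq> {s. f s \<noteq> \<zero>\<^bsub>K\<^esub>} \<union> {s. g s \<noteq> \<zero>\<^bsub>K\<^esub>}" for f g
    by auto
  have c_add: "f \<oplus>\<^bsub>free_space K S\<^esub> g \<in> carrier (free_space K S)"
    if "f \<in> carrier (free_space K S)" "g \<in> carrier (free_space K S)" for f g
    using that sub[of f g] finite_subset[OF sub[of f g]] unfolding free_space_simps
    by (auto simp: image_subset_iff)
  have c_smult: "c \<odot>\<^bsub>free_space K S\<^esub> f \<in> carrier (free_space K S)"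
    if "c \<in> carrier K" "f \<in> carrier (free_space K S)" for c f
  proof -
    have "{s. c \<otimes>\<^bsub>K\<^esub> f s \<noteq> \<zero>\<^bsub>K\<^esub>} \<subseteq> {s. f s \<noteq> \<zero>\<^bsub>K\<^esub>}" using that(1) by auto
    then show ?thesis
      using that finite_subset[of "{s. c \<otimes>\<^bsub>K\<^esub> f s \<noteq> \<zero>\<^bsub>K\<^esub>}" "{s. f s \<noteq> \<zero>\<^bsub>K\<^esub>}"]
      unfolding free_space_simps by (auto simp: image_subset_iff)
  qed
  have val: "f s \<in> carrier K" if "f \<in> carrier (free_space K S)" for f s
    using that by (auto simp: free_space_simps)
  have "abelian_group (free_space K S)"
  proof (rule abelian_groupI, goal_cases)
    case (1 f g) then show ?case by (rule c_add)
  next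
    case 2 then show ?case by (simp add: free_space_simps)
  next
    case (3 f g h) then show ?case using val[OF 3(1)] val[OF 3(2)] val[OF 3(3)] by (simp add: free_space_simps(2-) K.a_assoc)
  next
    case (4 f g) then show ?case using val[OF 4(1)] val[OF 4(2)] by (simp add: free_space_simps(2-) K.a_comm)
  next
    case (5 f) then show ?case using val[OF 5] by (simp add: free_space_simps(2-))
  next
    case (6 f)
    show ?case
    proof (intro bexI)
      show "(\<ominus>\<^bsub>K\<^esub> \<one>\<^bsub>K\<^esub>) \<odot>\<^bsub>free_space K S\<^esub> f \<in> carrier (free_space K S)"
        by (intro c_smult 6) simp
      show "(\<ominus>\<^bsub>K\<^esub> \<one>\<^bsub>K\<^esub>) \<odot>\<^bsub>free_space K S\<^esub> f \<oplus>\<^bsub>free_space K S\<^esub> f = \<zero>\<^bsub>free_space K S\<^esub>"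
        using val[OF 6] by (simp add: free_space_simps(2-) K.l_minus K.l_neg)
    qed
  qed
  then show ?thesis
    using val by (intro left_moduleI K.ring_axioms c_smult)
      (simp_all add: free_space_simps(2-) K.l_distr K.r_distr K.m_assoc)
qed

lemma free_gen_closed: "\<lbrakk>field K; s \<in> S\<rbrakk> \<Longrightarrow> free_gen K s \<in> carrier (free_space K S)"
proof -
  assume "field K" "s \<in> S"
  then interpret field K by simp
  have "{t. free_gen K s t \<noteq> \<zero>\<^bsub>K\<^esub>} = {s}" by (auto simp: free_gen_def)
  then show ?thesis using \<open>s \<in> S\<close> by (auto simp: free_space_simps free_gen_def)
qed

text \<open>The linear map determined by its values \<open>\<phi>\<close> on the basis of a free space, in the form in
  which it occurs in \<^const>\<open>tensor_lift\<close>.\<close>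

definition free_lift where
  "free_lift K V \<phi> f = (\<Oplus>\<^bsub>V\<^esub> s\<in>{s. f s \<noteq> \<zero>\<^bsub>K\<^esub>}. f s \<odot>\<^bsub>V\<^esub> \<phi> s)"

lemma free_lift:
  assumes "field K" "left_module K V" and \<phi>: "\<And>s. s \<in> S \<Longrightarrow> \<phi> s \<in> carrier V"
  shows "free_lift K V \<phi> \<in> mhom K (free_space K S) V"
    and "s \<in> S \<Longrightarrow> free_lift K V \<phi> (free_gen K s) = \<phi> s"
proof -
  interpret K: field K by fact
  interpret V: left_module K V by fact
  \<comment> \<open>The support may be enlarged to any finite set, so that the sums for two
    functions and for their sum run over the same index set although the supports differ.\<close>
  have sup: "free_lift K V \<phi> f = (\<Oplus>\<^bsub>V\<^esub> s\<in>T. f s \<odot>\<^bsub>V\<^esub> \<phi> s)"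
    if "f \<in> carrier (free_space K S)" "finite T" "{s. f s \<noteq> \<zero>\<^bsub>K\<^esub>} \<subseteq> T" "T \<subseteq> S" for f T
    unfolding free_lift_def using that \<phi>
    by (intro V.M.add.finprod_mono_neutral_cong_left) (auto simp: free_space_simps image_subset_iff)
  show "free_lift K V \<phi> \<in> mhom K (free_space K S) V"
  proof (rule mhomI)
    fix f assume "f \<in> carrier (free_space K S)"
    then show "free_lift K V \<phi> f \<in> carrier V"
      unfolding free_lift_def using \<phi> by (intro V.M.finsum_closed) (auto simp: free_space_simps image_subset_iff)
  next
    fix f g assume fg: "f \<in> carrier (free_space K S)" "g \<in> carrier (free_space K S)"
    let ?T = "{s. f s \<noteq> \<zero>\<^bsub>K\<^esub>} \<union> {s. g s \<noteq> \<zero>\<^bsub>K\<^esub>}"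
    have T: "finite ?T" "?T \<subseteq> S" using fg by (auto simp: free_space_simps)
    have v: "f s \<in> carrier K" "g s \<in> carrier K" for s using fg by (auto simp: free_space_simps)
    have "f \<oplus>\<^bsub>free_space K S\<^esub> g \<in> carrier (free_space K S)"
      using fg left_module.axioms(2)[OF left_module_free_space[OF assms(1)], of S]
      by (intro abelian_monoid.a_closed abelian_group.axioms(1))
    then have "free_lift K V \<phi> (f \<oplus>\<^bsub>free_space K S\<^esub> g) = (\<Oplus>\<^bsub>V\<^esub> s\<in>?T. (f s \<oplus>\<^bsub>K\<^esub> g s) \<odot>\<^bsub>V\<^esub> \<phi> s)"
      by (subst sup[OF _ T(1) _ T(2)]) (auto simp: free_space_simps(3))
    also have "\<dots> = (\<Oplus>\<^bsub>V\<^esub> s\<in>?T. f s \<odot>\<^bsub>V\<^esub> \<phi> s \<oplus>\<^bsub>V\<^esub> g s \<odot>\<^bsub>V\<^esub> \<phi> s)"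
      using T(2) \<phi> v by (intro V.M.finsum_cong') (auto simp: V.smult_l_distr)
    also have "\<dots> = (\<Oplus>\<^bsub>V\<^esub> s\<in>?T. f s \<odot>\<^bsub>V\<^esub> \<phi> s) \<oplus>\<^bsub>V\<^esub> (\<Oplus>\<^bsub>V\<^esub> s\<in>?T. g s \<odot>\<^bsub>V\<^esub> \<phi> s)"
      using T(2) \<phi> v by (intro V.M.finsum_addf) auto
    also have "\<dots> = free_lift K V \<phi> f \<oplus>\<^bsub>V\<^esub> free_lift K V \<phi> g"
      using sup[OF fg(1) T(1) _ T(2)] sup[OF fg(2) T(1) _ T(2)] by simp
    finally show "free_lift K V \<phi> (f \<oplus>\<^bsub>free_space K S\<^esub> g) = free_lift K V \<phi> f \<oplus>\<^bsub>V\<^esub> free_lift K V \<phi> g" .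
  next
    fix c f assume c: "c \<in> carrier K" and f: "f \<in> carrier (free_space K S)"
    let ?T = "{s. f s \<noteq> \<zero>\<^bsub>K\<^esub>}"
    have T: "finite ?T" "?T \<subseteq> S" using f by (auto simp: free_space_simps)
    have v: "f s \<in> carrier K" for s using f by (auto simp: free_space_simps)
    have "c \<odot>\<^bsub>free_space K S\<^esub> f \<in> carrier (free_space K S)"
      using c f left_module.smult_closed[OF left_module_free_space[OF assms(1)], of c f S] by simp
    then have "free_lift K V \<phi> (c \<odot>\<^bsub>free_space K S\<^esub> f) = (\<Oplus>\<^bsub>V\<^esub> s\<in>?T. (c \<otimes>\<^bsub>K\<^esub> f s) \<odot>\<^bsub>V\<^esub> \<phi> s)"
      using c by (subst sup[OF _ T(1) _ T(2)]) (auto simp: free_space_simps(4))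
    also have "\<dots> = (\<Oplus>\<^bsub>V\<^esub> s\<in>?T. c \<odot>\<^bsub>V\<^esub> (f s \<odot>\<^bsub>V\<^esub> \<phi> s))"
      using T(2) \<phi> v c by (intro V.M.finsum_cong') (auto simp: V.smult_assoc)
    also have "\<dots> = c \<odot>\<^bsub>V\<^esub> free_lift K V \<phi> f"
      unfolding free_lift_def using T(2) \<phi> v c by (intro V.smult_finsum[symmetric]) auto
    finally show "free_lift K V \<phi> (c \<odot>\<^bsub>free_space K S\<^esub> f) = c \<odot>\<^bsub>V\<^esub> free_lift K V \<phi> f" .
  qed
  assume s: "s \<in> S"
  have "free_lift K V \<phi> (free_gen K s) = (\<Oplus>\<^bsub>V\<^esub> t\<in>{s}. free_gen K s t \<odot>\<^bsub>V\<^esub> \<phi> t)"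
    using s by (intro sup free_gen_closed assms(1)) (auto simp: free_gen_def)
  then show "free_lift K V \<phi> (free_gen K s) = \<phi> s"
    using \<phi>[OF s] by (simp add: free_gen_def)
qed

text \<open>The conditions match the four families in \<open>tensor_relations\<close>. Linearity in
  the second argument follows from linearity in the first by balance with respect to scalars in
  \<open>A\<close>.\<close>

definition balanced ::
    "('k, 'z) ring_scheme \<Rightarrow> ('k, 'a) module \<Rightarrow> ('a, 'm) module \<Rightarrow> ('a, 'n) module \<Rightarrow>
     ('k, 'v) module \<Rightarrow> ('m \<Rightarrow> 'n \<Rightarrow> 'v) \<Rightarrow> bool" where
  "balanced K A M N V \<phi> \<longleftrightarrow>
    (\<forall>x\<in>carrier M. \<forall>y\<in>carrier N. \<phi> x y \<in> carrier V) \<and>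
    (\<forall>x\<in>carrier M. \<forall>x'\<in>carrier M. \<forall>y\<in>carrier N. \<phi> (x \<oplus>\<^bsub>M\<^esub> x') y = \<phi> x y \<oplus>\<^bsub>V\<^esub> \<phi> x' y) \<and>
    (\<forall>x\<in>carrier M. \<forall>y\<in>carrier N. \<forall>y'\<in>carrier N. \<phi> x (y \<oplus>\<^bsub>N\<^esub> y') = \<phi> x y \<oplus>\<^bsub>V\<^esub> \<phi> x y') \<and>
    (\<forall>a\<in>carrier A. \<forall>x\<in>carrier M. \<forall>y\<in>carrier N. \<phi> (a \<odot>\<^bsub>M\<^esub> x) y = \<phi> x (a \<odot>\<^bsub>N\<^esub> y)) \<and>
    (\<forall>c\<in>carrier K. \<forall>x\<in>carrier M. \<forall>y\<in>carrier N. \<phi> ((c \<odot>\<^bsub>A\<^esub> \<one>\<^bsub>A\<^esub>) \<odot>\<^bsub>M\<^esub> x) y = c \<odot>\<^bsub>V\<^esub> \<phi> x y)"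

lemma balancedI:
  assumes "\<And>x y. \<lbrakk>x \<in> carrier M; y \<in> carrier N\<rbrakk> \<Longrightarrow> \<phi> x y \<in> carrier V"
    "\<And>x x' y. \<lbrakk>x \<in> carrier M; x' \<in> carrier M; y \<in> carrier N\<rbrakk> \<Longrightarrow> \<phi> (x \<oplus>\<^bsub>M\<^esub> x') y = \<phi> x y \<oplus>\<^bsub>V\<^esub> \<phi> x' y"
    "\<And>x y y'. \<lbrakk>x \<in> carrier M; y \<in> carrier N; y' \<in> carrier N\<rbrakk> \<Longrightarrow> \<phi> x (y \<oplus>\<^bsub>N\<^esub> y') = \<phi> x y \<oplus>\<^bsub>V\<^esub> \<phi> x y'"
    "\<And>a x y. \<lbrakk>a \<in> carrier A; x \<in> carrier M; y \<in> carrier N\<rbrakk> \<Longrightarrow> \<phi> (a \<odot>\<^bsub>M\<^esub> x) y = \<phi> x (a \<odot>\<^bsub>N\<^esub> y)"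
    "\<And>c x y. \<lbrakk>c \<in> carrier K; x \<in> carrier M; y \<in> carrier N\<rbrakk> \<Longrightarrow> \<phi> ((c \<odot>\<^bsub>A\<^esub> \<one>\<^bsub>A\<^esub>) \<odot>\<^bsub>M\<^esub> x) y = c \<odot>\<^bsub>V\<^esub> \<phi> x y"
  shows "balanced K A M N V \<phi>"
  using assms by (simp add: balanced_def)

lemma balancedD:
  assumes "balanced K A M N V \<phi>"
  shows "\<lbrakk>x \<in> carrier M; y \<in> carrier N\<rbrakk> \<Longrightarrow> \<phi> x y \<in> carrier V"
    "\<lbrakk>x \<in> carrier M; x' \<in> carrier M; y \<in> carrier N\<rbrakk> \<Longrightarrow> \<phi> (x \<oplus>\<^bsub>M\<^esub> x') y = \<phi> x y \<oplus>\<^bsub>V\<^esub> \<phi> x' y"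
    "\<lbrakk>x \<in> carrier M; y \<in> carrier N; y' \<in> carrier N\<rbrakk> \<Longrightarrow> \<phi> x (y \<oplus>\<^bsub>N\<^esub> y') = \<phi> x y \<oplus>\<^bsub>V\<^esub> \<phi> x y'"
    "\<lbrakk>a \<in> carrier A; x \<in> carrier M; y \<in> carrier N\<rbrakk> \<Longrightarrow> \<phi> (a \<odot>\<^bsub>M\<^esub> x) y = \<phi> x (a \<odot>\<^bsub>N\<^esub> y)"
    "\<lbrakk>c \<in> carrier K; x \<in> carrier M; y \<in> carrier N\<rbrakk> \<Longrightarrow> \<phi> ((c \<odot>\<^bsub>A\<^esub> \<one>\<^bsub>A\<^esub>) \<odot>\<^bsub>M\<^esub> x) y = c \<odot>\<^bsub>V\<^esub> \<phi> x y"
  using assms by (simp_all add: balanced_def)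

locale tensor_pair = algebra_over_field K A
  for K :: "('k, 'z) ring_scheme" and A :: "('k, 'a) module" +
  fixes M :: "('a, 'm) module" and N :: "('a, 'n) module"
  assumes left_module_M: "left_module (op_algebra A) M" and left_module_N: "left_module A N"
begin

sublocale M: left_module "op_algebra A" M by (rule left_module_M)
sublocale N: left_module A N by (rule left_module_N)

abbreviation "F \<equiv> free_space K (carrier M \<times> carrier N)"
abbreviation "null \<equiv> tensor_null K A M N"
abbreviation "T \<equiv> tensor_space K A M N"
abbreviation "pt \<equiv> pure_tensor K A M N"

sublocale F: left_module K F by (rule left_module_free_space[OF K.field_axioms])

lemma gen_closed: "\<lbrakk>x \<in> carrier M; y \<in> carrier N\<rbrakk> \<Longrightarrow> free_gen K (x, y) \<in> carrier F"
  by (rule free_gen_closed[OF K.field_axioms]) simp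

lemma relations_subset: "tensor_relations K A M N \<subseteq> carrier F"
  unfolding tensor_relations_def Let_def
  by (auto intro!: F.M.minus_closed F.M.a_closed gen_closed F.smult_closed M.smult_closed N.smult_closed
      M.M.a_closed N.M.a_closed)

lemma vectorspace_F: "vectorspace K F"
  using vectorspace_iff[OF K.field_axioms] F.is_left_module by blast

lemma submod_null: "submod K F null"
  and relations_null: "tensor_relations K A M N \<subseteq> null"
  and null_least: "\<lbrakk>submod K F S; tensor_relations K A M N \<subseteq> S\<rbrakk> \<Longrightarrow> null \<subseteq> S"
proof -
  interpret V: vectorspace K F by (rule vectorspace_F)
  have "submodule K null F" unfolding tensor_null_def by (rule V.span_is_submodule[OF relations_subset])
  then show "submod K F null" by (auto simp: submodule_def submod_def)
  show "tensor_relations K A M N \<subseteq> null" unfolding tensor_null_def by (rule V.in_own_span[OF relations_subset])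
  show "\<lbrakk>submod K F S; tensor_relations K A M N \<subseteq> S\<rbrakk> \<Longrightarrow> null \<subseteq> S"
    unfolding tensor_null_def by (rule submod_span_subset[OF vectorspace_F])
qed

sublocale Q: subquotient_module K F "carrier F" null
  by (intro subquotient_module.intro F.is_left_module subquotient_module_axioms.intro F.submod_carrier
      submod_null submodD(1)[OF submod_null])

lemma T_eq: "T = subquotient F (carrier F) null"
  by (simp add: tensor_space_def Let_def)

lemma left_module_T: "left_module K T"
  unfolding T_eq by (rule Q.left_module_subquotient)

sublocale T: left_module K T by (rule left_module_T)

lemma pt_eq: "pt x y = Q.cls (free_gen K (x, y))"
  by (simp add: pure_tensor_def)

lemma pt_closed [simp]: "\<lbrakk>x \<in> carrier M; y \<in> carrier N\<rbrakk> \<Longrightarrow> pt x y \<in> carrier T"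
  unfolding pt_eq T_eq by (intro Q.cls_closed gen_closed)

lemma relD: "r \<in> tensor_relations K A M N \<Longrightarrow> r \<in> null"
  using relations_null by blast

lemma pt_add_left:
  assumes "x \<in> carrier M" "x' \<in> carrier M" "y \<in> carrier N"
  shows "pt (x \<oplus>\<^bsub>M\<^esub> x') y = pt x y \<oplus>\<^bsub>T\<^esub> pt x' y"
proof -
  have "free_gen K (x \<oplus>\<^bsub>M\<^esub> x', y) \<ominus>\<^bsub>F\<^esub> (free_gen K (x, y) \<oplus>\<^bsub>F\<^esub> free_gen K (x', y)) \<in> null"
    by (rule relD) (unfold tensor_relations_def Let_def, use assms in blast)
  then have "pt (x \<oplus>\<^bsub>M\<^esub> x') y = Q.cls (free_gen K (x, y) \<oplus>\<^bsub>F\<^esub> free_gen K (x', y))"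
    unfolding pt_eq using assms by (subst Q.cls_eq_iff) (simp_all add: gen_closed)
  then show ?thesis
    unfolding pt_eq T_eq using assms by (simp add: Q.cls_add gen_closed)
qed

lemma pt_add_right:
  assumes "x \<in> carrier M" "y \<in> carrier N" "y' \<in> carrier N"
  shows "pt x (y \<oplus>\<^bsub>N\<^esub> y') = pt x y \<oplus>\<^bsub>T\<^esub> pt x y'"
proof -
  have "free_gen K (x, y \<oplus>\<^bsub>N\<^esub> y') \<ominus>\<^bsub>F\<^esub> (free_gen K (x, y) \<oplus>\<^bsub>F\<^esub> free_gen K (x, y')) \<in> null"
    by (rule relD) (unfold tensor_relations_def Let_def, use assms in blast)
  then have "pt x (y \<oplus>\<^bsub>N\<^esub> y') = Q.cls (free_gen K (x, y) \<oplus>\<^bsub>F\<^esub> free_gen K (x, y'))"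
    unfolding pt_eq using assms by (subst Q.cls_eq_iff) (simp_all add: gen_closed)
  then show ?thesis
    unfolding pt_eq T_eq using assms by (simp add: Q.cls_add gen_closed)
qed

lemma pt_middle:
  assumes "a \<in> carrier A" "x \<in> carrier M" "y \<in> carrier N"
  shows "pt (a \<odot>\<^bsub>M\<^esub> x) y = pt x (a \<odot>\<^bsub>N\<^esub> y)"
proof -
  have "free_gen K (a \<odot>\<^bsub>M\<^esub> x, y) \<ominus>\<^bsub>F\<^esub> free_gen K (x, a \<odot>\<^bsub>N\<^esub> y) \<in> null"
    by (rule relD) (unfold tensor_relations_def Let_def, use assms in blast)
  then show ?thesis
    unfolding pt_eq using assms M.smult_closed[of a x] by (subst Q.cls_eq_iff) (simp_all add: gen_closed)
qed

lemma pt_smult: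
  assumes "c \<in> carrier K" "x \<in> carrier M" "y \<in> carrier N"
  shows "pt ((c \<odot>\<^bsub>A\<^esub> \<one>\<^bsub>A\<^esub>) \<odot>\<^bsub>M\<^esub> x) y = c \<odot>\<^bsub>T\<^esub> pt x y"
proof -
  have c1: "(c \<odot>\<^bsub>A\<^esub> \<one>\<^bsub>A\<^esub>) \<odot>\<^bsub>M\<^esub> x \<in> carrier M" using M.smult_closed[of "c \<odot>\<^bsub>A\<^esub> \<one>\<^bsub>A\<^esub>" x] assms by simp
  have "free_gen K (c \<odot>\<^bsub>scalars A M\<^esub> x, y) \<ominus>\<^bsub>F\<^esub> (c \<odot>\<^bsub>F\<^esub> free_gen K (x, y)) \<in> null"
    by (rule relD) (unfold tensor_relations_def Let_def, use assms in blast)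
  then have "pt ((c \<odot>\<^bsub>A\<^esub> \<one>\<^bsub>A\<^esub>) \<odot>\<^bsub>M\<^esub> x) y = Q.cls (c \<odot>\<^bsub>F\<^esub> free_gen K (x, y))"
    unfolding pt_eq using assms c1 by (subst Q.cls_eq_iff) (simp_all add: gen_closed)
  then show ?thesis
    unfolding pt_eq T_eq using assms by (simp add: Q.cls_smult gen_closed)
qed

lemma pt_smult_right:
  assumes "c \<in> carrier K" "x \<in> carrier M" "y \<in> carrier N"
  shows "pt x ((c \<odot>\<^bsub>A\<^esub> \<one>\<^bsub>A\<^esub>) \<odot>\<^bsub>N\<^esub> y) = c \<odot>\<^bsub>T\<^esub> pt x y"
  using pt_smult[OF assms] pt_middle[of "c \<odot>\<^bsub>A\<^esub> \<one>\<^bsub>A\<^esub>" x y] assms by simp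

lemma pt_zero_left: "y \<in> carrier N \<Longrightarrow> pt \<zero>\<^bsub>M\<^esub> y = \<zero>\<^bsub>T\<^esub>"
  using pt_add_left[of "\<zero>\<^bsub>M\<^esub>" "\<zero>\<^bsub>M\<^esub>" y] T.M.add.r_cancel_one'[of "pt \<zero>\<^bsub>M\<^esub> y" "pt \<zero>\<^bsub>M\<^esub> y"] by simp

lemma pt_zero_right: "x \<in> carrier M \<Longrightarrow> pt x \<zero>\<^bsub>N\<^esub> = \<zero>\<^bsub>T\<^esub>"
  using pt_add_right[of x "\<zero>\<^bsub>N\<^esub>" "\<zero>\<^bsub>N\<^esub>"] T.M.add.r_cancel_one'[of "pt x \<zero>\<^bsub>N\<^esub>" "pt x \<zero>\<^bsub>N\<^esub>"] by simp

lemma pt_finsum_right: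
  assumes "x \<in> carrier M" "\<And>i. i \<in> I \<Longrightarrow> y i \<in> carrier N"
  shows "pt x (\<Oplus>\<^bsub>N\<^esub>i\<in>I. y i) = (\<Oplus>\<^bsub>T\<^esub>i\<in>I. pt x (y i))"
  using assms
  by (intro finsum_additive N.M.abelian_group_axioms T.M.abelian_group_axioms) (auto simp: pt_add_right)

lemma pt_finsum_left:
  assumes "y \<in> carrier N" "\<And>i. i \<in> I \<Longrightarrow> x i \<in> carrier M"
  shows "pt (\<Oplus>\<^bsub>M\<^esub>i\<in>I. x i) y = (\<Oplus>\<^bsub>T\<^esub>i\<in>I. pt (x i) y)"
  using assms
  by (intro finsum_additive[where f = "\<lambda>x. pt x y"] M.M.abelian_group_axioms T.M.abelian_group_axioms)
    (auto simp: pt_add_left)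

text \<open>Neither zero nor scalar multiples need a case of their own: zero is a pure tensor, and a
  scalar is absorbed by the first factor. The proof removes one point of the support of a
  representative at a time.\<close>

lemma tensor_induct [consumes 1, case_names pure add]:
  assumes "\<xi> \<in> carrier T"
    and pure: "\<And>x y. \<lbrakk>x \<in> carrier M; y \<in> carrier N\<rbrakk> \<Longrightarrow> Pr (pt x y)"
    and add: "\<And>\<xi> \<zeta>. \<lbrakk>\<xi> \<in> carrier T; \<zeta> \<in> carrier T; Pr \<xi>; Pr \<zeta>\<rbrakk> \<Longrightarrow> Pr (\<xi> \<oplus>\<^bsub>T\<^esub> \<zeta>)"
  shows "Pr \<xi>"
proof -
  have zero: "Pr \<zero>\<^bsub>T\<^esub>" using pure[of "\<zero>\<^bsub>M\<^esub>" "\<zero>\<^bsub>N\<^esub>"] by (simp add: pt_zero_left)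
  have main: "Pr (Q.cls f)" if "finite U" "f \<in> carrier F" "{s. f s \<noteq> \<zero>\<^bsub>K\<^esub>} \<subseteq> U" for U f
    using that
  proof (induction U arbitrary: f rule: finite_induct)
    case empty
    then have "f = \<zero>\<^bsub>F\<^esub>" by (auto simp: free_space_simps)
    then show ?case using zero Q.cls_zero by (simp add: T_eq)
  next
    case (insert s U)
    have v: "f t \<in> carrier K" for t using insert.prems(1) by (auto simp: free_space_simps)
    show ?case
    proof (cases "f s = \<zero>\<^bsub>K\<^esub>")
      case True
      then show ?thesis using insert.prems by (intro insert.IH) auto
    next
      case False
      then have s: "s \<in> carrier M \<times> carrier N" using insert.prems(1) by (auto simp: free_space_simps)
      then obtain x y where xy: "s = (x, y)" "x \<in> carrier M" "y \<in> carrier N" by auto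
      let ?g = "f(s := \<zero>\<^bsub>K\<^esub>)"
      have sub: "{t. ?g t \<noteq> \<zero>\<^bsub>K\<^esub>} \<subseteq> {t. f t \<noteq> \<zero>\<^bsub>K\<^esub>}" by auto
      have f: "finite {t. f t \<noteq> \<zero>\<^bsub>K\<^esub>}" "{t. f t \<noteq> \<zero>\<^bsub>K\<^esub>} \<subseteq> carrier M \<times> carrier N"
        using insert.prems(1) by (simp_all add: free_space_simps)
      have g: "?g \<in> carrier F"
        unfolding free_space_simps mem_Collect_eq
        using finite_subset[OF sub f(1)] subset_trans[OF sub f(2)] v by (intro conjI) auto
      have "f = f s \<odot>\<^bsub>F\<^esub> free_gen K s \<oplus>\<^bsub>F\<^esub> ?g"
        using v by (auto simp: free_space_simps(3,4) free_gen_def fun_eq_iff)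
      then have "Q.cls f = Q.cls (f s \<odot>\<^bsub>F\<^esub> free_gen K s) \<oplus>\<^bsub>T\<^esub> Q.cls ?g"
        using g v xy by (metis F.smult_closed Q.cls_add T_eq gen_closed)
      also have "Q.cls (f s \<odot>\<^bsub>F\<^esub> free_gen K s) = f s \<odot>\<^bsub>T\<^esub> pt x y"
        using v xy by (simp add: pt_eq T_eq Q.cls_smult gen_closed)
      also have "\<dots> = pt ((f s \<odot>\<^bsub>A\<^esub> \<one>\<^bsub>A\<^esub>) \<odot>\<^bsub>M\<^esub> x) y" using v xy by (simp add: pt_smult)
      finally have eq: "Q.cls f = pt ((f s \<odot>\<^bsub>A\<^esub> \<one>\<^bsub>A\<^esub>) \<odot>\<^bsub>M\<^esub> x) y \<oplus>\<^bsub>T\<^esub> Q.cls ?g" .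
      have c: "(f s \<odot>\<^bsub>A\<^esub> \<one>\<^bsub>A\<^esub>) \<odot>\<^bsub>M\<^esub> x \<in> carrier M"
        using M.smult_closed[of "f s \<odot>\<^bsub>A\<^esub> \<one>\<^bsub>A\<^esub>" x] v xy by simp
      have "Pr (Q.cls ?g)" by (rule insert.IH[OF g]) (use insert.prems in auto)
      then show ?thesis
        unfolding eq using c xy g by (intro add pure pt_closed) (auto simp: T_eq intro!: Q.cls_closed)
    qed
  qed
  obtain f where "f \<in> carrier F" "\<xi> = Q.cls f" using assms(1) unfolding T_eq by (rule Q.cls_cases)
  then show ?thesis using main[of "{s. f s \<noteq> \<zero>\<^bsub>K\<^esub>}" f] by (auto simp: free_space_simps)
qed

lemma mhom_T_eqI:
  assumes "left_module K V" "f \<in> mhom K T V" "g \<in> mhom K T V"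
    and "\<And>x y. \<lbrakk>x \<in> carrier M; y \<in> carrier N\<rbrakk> \<Longrightarrow> f (pt x y) = g (pt x y)" and "\<xi> \<in> carrier T"
  shows "f \<xi> = g \<xi>"
  using assms(5)
  by (induction \<xi> rule: tensor_induct) (simp_all add: assms(4) mhom_add[OF assms(2)] mhom_add[OF assms(3)])

text \<open>\<open>tensor_lift\<close> is the map that \<open>free_lift\<close> induces on cosets.
  It is well defined because the kernel of \<open>free_lift\<close> is a subspace containing all
  relations, hence contains their span.\<close>

lemma tensor_lift:
  assumes V: "left_module K V" and \<phi>: "balanced K A M N V (\<lambda>x y. \<phi> (x, y))"
  shows "tensor_lift K V \<phi> \<in> mhom K T V"
    and "\<lbrakk>x \<in> carrier M; y \<in> carrier N\<rbrakk> \<Longrightarrow> tensor_lift K V \<phi> (pt x y) = \<phi> (x, y)"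
proof -
  interpret V: left_module K V by fact
  let ?S = "carrier M \<times> carrier N"
  let ?H = "free_lift K V \<phi>"
  note b = balancedD[OF \<phi>]
  have b': "\<phi> (x, (c \<odot>\<^bsub>A\<^esub> \<one>\<^bsub>A\<^esub>) \<odot>\<^bsub>N\<^esub> y) = c \<odot>\<^bsub>V\<^esub> \<phi> (x, y)"
    if "c \<in> carrier K" "x \<in> carrier M" "y \<in> carrier N" for c x y
    using b(4)[of "c \<odot>\<^bsub>A\<^esub> \<one>\<^bsub>A\<^esub>" x y] b(5)[of c x y] that by simp
  have \<phi>c: "\<And>s. s \<in> ?S \<Longrightarrow> \<phi> s \<in> carrier V" using b(1) by auto
  have H: "?H \<in> mhom K F V" by (rule free_lift(1)[OF K.field_axioms V \<phi>c])
  have Hg: "?H (free_gen K (x, y)) = \<phi> (x, y)" if "x \<in> carrier M" "y \<in> carrier N" for x y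
    using that by (intro free_lift(2)[OF K.field_axioms V \<phi>c]) auto
  have Md: "a \<odot>\<^bsub>M\<^esub> x \<in> carrier M" if "a \<in> carrier A" "x \<in> carrier M" for a x
    using M.smult_closed[of a x] that by simp
  have "tensor_relations K A M N \<subseteq> {f \<in> carrier F. ?H f = \<zero>\<^bsub>V\<^esub>}"
  proof
    fix r assume r: "r \<in> tensor_relations K A M N"
    have rF: "r \<in> carrier F" using r relations_subset by blast
    have d: "?H (u \<ominus>\<^bsub>F\<^esub> v) = \<zero>\<^bsub>V\<^esub>" if "u \<in> carrier F" "v \<in> carrier F" "?H u = ?H v" for u v
      using that mhom_closed[OF H] mhom_diff[OF F.is_left_module V H that(1,2)]
      by (simp only: a_minus_def V.M.r_neg)
    have "?H r = \<zero>\<^bsub>V\<^esub>"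
      using r unfolding tensor_relations_def Let_def
      by (auto intro!: d gen_closed M.M.a_closed N.M.a_closed F.M.a_closed F.smult_closed N.smult_closed Md
          simp: mhom_add[OF H] mhom_smult[OF H] Hg gen_closed b b' Md)
    with rF show "r \<in> {f \<in> carrier F. ?H f = \<zero>\<^bsub>V\<^esub>}" by simp
  qed
  then have "null \<subseteq> {f \<in> carrier F. ?H f = \<zero>\<^bsub>V\<^esub>}"
    by (intro null_least submod_ker[OF F.is_left_module V H])
  then have null: "\<And>b. b \<in> null \<Longrightarrow> ?H b = \<zero>\<^bsub>V\<^esub>" by auto
  have tl: "tensor_lift K V \<phi> = (\<lambda>\<xi>. the_elem (?H ` \<xi>))"
    by (simp add: tensor_lift_def free_lift_def fun_eq_iff)
  have H': "?H \<in> mhom K (F\<lparr>carrier := carrier F\<rparr>) V" using H by simp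
  show "tensor_lift K V \<phi> \<in> mhom K T V"
    unfolding tl T_eq by (rule Q.induced_map(1)[OF V H' null])
  show "tensor_lift K V \<phi> (pt x y) = \<phi> (x, y)" if "x \<in> carrier M" "y \<in> carrier N"
    unfolding tl pt_eq using that by (subst Q.induced_map(2)[OF V H' null]) (auto simp: gen_closed Hg)
qed

text \<open>For a subspace \<open>S\<close> containing the pure tensors of generators, the elements
  whose tensor with a fixed second factor lies in \<open>S\<close> form a subspace. Using this in
  the first variable and then in the second puts all pure tensors into \<open>S\<close>.\<close>

lemma fd_space_T:
  assumes "fd_space K (scalars A M)" "fd_space K (scalars A N)"
  shows "fd_space K T"
proof -
  have lM: "left_module K (scalars A M)" using fd_space_left_module[OF assms(1)] .
  have lN: "left_module K (scalars A N)" using fd_space_left_module[OF assms(2)] .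
  obtain B where B: "finite B" "B \<subseteq> carrier M" "\<And>S. submod K (scalars A M) S \<Longrightarrow> B \<subseteq> S \<Longrightarrow> carrier M \<subseteq> S"
    using fd_space_spanning[OF assms(1)] by auto
  obtain C where C: "finite C" "C \<subseteq> carrier N" "\<And>S. submod K (scalars A N) S \<Longrightarrow> C \<subseteq> S \<Longrightarrow> carrier N \<subseteq> S"
    using fd_space_spanning[OF assms(2)] by auto
  have hl: "(\<lambda>x. pt x y) \<in> mhom K (scalars A M) T" if "y \<in> carrier N" for y
    using that by (intro mhomI) (simp_all add: pt_add_left pt_smult)
  have hr: "(\<lambda>y. pt x y) \<in> mhom K (scalars A N) T" if "x \<in> carrier M" for x
    using that by (intro mhomI) (simp_all add: pt_add_right pt_smult_right)
  show ?thesis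
  proof (rule fd_spaceI[OF K.field_axioms left_module_T, of "(\<lambda>(b, c). pt b c) ` (B \<times> C)"])
    fix S assume S: "submod K T S" "(\<lambda>(b, c). pt b c) ` (B \<times> C) \<subseteq> S"
    have 1: "pt x c \<in> S" if "x \<in> carrier M" "c \<in> C" for x c
    proof -
      have "carrier M \<subseteq> {x \<in> carrier (scalars A M). pt x c \<in> S}"
        using S(2) B(2) C(2) that(2) by (intro B(3) submod_vimage[OF lM left_module_T hl S(1)]) auto
      then show ?thesis using that(1) by auto
    qed
    have 2: "pt x y \<in> S" if "x \<in> carrier M" "y \<in> carrier N" for x y
    proof -
      have "carrier N \<subseteq> {y \<in> carrier (scalars A N). pt x y \<in> S}"
        using 1 C(2) that(1) by (intro C(3) submod_vimage[OF lN left_module_T hr S(1)]) auto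
      then show ?thesis using that(2) by auto
    qed
    show "carrier T \<subseteq> S"
    proof
      fix \<xi> assume "\<xi> \<in> carrier T"
      then show "\<xi> \<in> S" by (induction \<xi> rule: tensor_induct) (use 2 submodD(4)[OF S(1)] in auto)
    qed
  qed (use B C in \<open>auto intro!: pt_closed\<close>)
qed

end

lemma tensor_map:
  assumes "tensor_pair K A M N" "tensor_pair K A M' N'"
    and f: "f \<in> mhom (op_algebra A) M' M" and g: "g \<in> mhom A N' N"
  shows "tensor_map K A M N f g \<in> mhom K (tensor_space K A M' N') (tensor_space K A M N)"
    and "\<lbrakk>x \<in> carrier M'; y \<in> carrier N'\<rbrakk> \<Longrightarrow>
      tensor_map K A M N f g (pure_tensor K A M' N' x y) = pure_tensor K A M N (f x) (g y)"
proof -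
  interpret T: tensor_pair K A M N by fact
  interpret T': tensor_pair K A M' N' by fact
  have f': "f (a \<odot>\<^bsub>M'\<^esub> x) = a \<odot>\<^bsub>M\<^esub> f x" if "a \<in> carrier A" "x \<in> carrier M'" for a x
    using mhom_smult[OF f, of a x] that by simp
  have "balanced K A M' N' T.T (\<lambda>x y. (\<lambda>(x, y). T.pt (f x) (g y)) (x, y))"
    by (rule balancedI)
      (simp_all add: mhom_closed[OF f] mhom_closed[OF g] mhom_add[OF f] mhom_add[OF g] f' mhom_smult[OF g]
        T.pt_add_left T.pt_add_right T.pt_middle T.pt_smult_right)
  note l = T'.tensor_lift[OF T.left_module_T this]
  show "tensor_map K A M N f g \<in> mhom K (tensor_space K A M' N') (tensor_space K A M N)"
    unfolding tensor_map_def by (rule l(1))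
  show "\<lbrakk>x \<in> carrier M'; y \<in> carrier N'\<rbrakk> \<Longrightarrow>
      tensor_map K A M N f g (pure_tensor K A M' N' x y) = pure_tensor K A M N (f x) (g y)"
    unfolding tensor_map_def using l(2) by simp
qed

subsection \<open>The enveloping algebra\<close>

text \<open>Needed because \<open>K\<close>, \<open>regular_module K\<close> and the opposite of the
  latter are different records with the same ring structure when \<open>K\<close> is a
  field.\<close>

lemma left_module_change_ring:
  assumes "left_module R M" "ring R'" "carrier R' = carrier R" "add R' = add R" "\<one>\<^bsub>R'\<^esub> = \<one>\<^bsub>R\<^esub>"
    and "\<And>a b. \<lbrakk>a \<in> carrier R; b \<in> carrier R\<rbrakk> \<Longrightarrow> a \<otimes>\<^bsub>R'\<^esub> b = a \<otimes>\<^bsub>R\<^esub> b"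
  shows "left_module R' M"
proof -
  interpret M: left_module R M by fact
  show ?thesis
    using assms(3-)
    by (intro left_moduleI assms(2) M.M.abelian_group_axioms)
      (simp_all add: M.smult_l_distr M.smult_r_distr M.smult_assoc)
qed

lemma mhom_smult_fun:
  assumes "field K" "left_module K W" "f \<in> mhom K V W" "c \<in> carrier K"
  shows "(\<lambda>x. c \<odot>\<^bsub>W\<^esub> f x) \<in> mhom K V W"
proof -
  interpret K: field K by fact
  interpret W: left_module K W by fact
  show ?thesis
  proof (rule mhomI)
    fix a x assume "a \<in> carrier K" "x \<in> carrier V"
    then show "c \<odot>\<^bsub>W\<^esub> f (a \<odot>\<^bsub>V\<^esub> x) = a \<odot>\<^bsub>W\<^esub> (c \<odot>\<^bsub>W\<^esub> f x)"
      using mhom_closed[OF assms(3)] assms(4)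
      by (simp add: mhom_smult[OF assms(3)] W.smult_assoc[symmetric] K.m_comm)
  qed (simp_all add: assms(4) mhom_closed[OF assms(3)] mhom_add[OF assms(3)] W.smult_r_distr)
qed

lemma algebra_regular_module: "field K \<Longrightarrow> algebra_over_field K (regular_module K)"
proof -
  assume "field K"
  then interpret K: field K .
  interpret R: left_module K "regular_module K" by (rule left_module_regular[OF K.ring_axioms])
  have "ring (regular_module K)"
    by (intro ringI R.M.abelian_group_axioms monoidI) (simp_all add: K.l_distr K.r_distr K.m_assoc)
  moreover have "Module.module K (regular_module K)"
    using left_module_iff_module[OF K.is_cring] R.is_left_module by blast
  ultimately show ?thesis
    by (intro algebra_over_field.intro K.field_axioms assoc_algebra.intro assoc_algebra_axioms.intro)
      (simp_all add: K.m_ac)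
qed

section \<open>The tensor product of two algebras over a field\<close>

locale two_algebras = A: algebra_over_field K A + B: algebra_over_field K B
  for K :: "('k, 'z) ring_scheme" and A :: "('k, 'a) module" and B :: "('k, 'b) module"
begin

lemma tensor_pair_AB: "tensor_pair K (regular_module K) A B"
proof -
  interpret R: algebra_over_field K "regular_module K" by (rule algebra_regular_module[OF A.K.field_axioms])
  have "left_module (op_algebra (regular_module K)) A"
    by (rule left_module_change_ring[OF A.left_module_self ring_op_algebra[OF R.is_ring_A]])
      (simp_all add: A.K.m_comm)
  moreover have "left_module (regular_module K) B"
    by (rule left_module_change_ring[OF B.left_module_self R.is_ring_A]) simp_all
  ultimately show ?thesis
    by (intro tensor_pair.intro tensor_pair_axioms.intro R.algebra_over_field_axioms)
qed

sublocale T: tensor_pair K "regular_module K" A B by (rule tensor_pair_AB)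

abbreviation "TA \<equiv> tensor_algebra K A B"

lemma TA_simps [simp]:
  "carrier TA = carrier T.T" "zero TA = \<zero>\<^bsub>T.T\<^esub>" "add TA = add T.T" "smult TA = smult T.T"
  "one TA = T.pt \<one>\<^bsub>A\<^esub> \<one>\<^bsub>B\<^esub>"
  by (simp_all add: tensor_algebra_def Let_def)

lemma pt_smult_left: "\<lbrakk>c \<in> carrier K; a \<in> carrier A; b \<in> carrier B\<rbrakk> \<Longrightarrow> T.pt (c \<odot>\<^bsub>A\<^esub> a) b = c \<odot>\<^bsub>T.T\<^esub> T.pt a b"
  using T.pt_smult[of c a b] by simp

lemma pt_smult_right: "\<lbrakk>c \<in> carrier K; a \<in> carrier A; b \<in> carrier B\<rbrakk> \<Longrightarrow> T.pt a (c \<odot>\<^bsub>B\<^esub> b) = c \<odot>\<^bsub>T.T\<^esub> T.pt a b"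
  using T.pt_smult_right[of c a b] by simp

lemma bilinearI:
  assumes "\<And>a b. \<lbrakk>a \<in> carrier A; b \<in> carrier B\<rbrakk> \<Longrightarrow> \<phi> a b \<in> carrier V"
    "\<And>a a' b. \<lbrakk>a \<in> carrier A; a' \<in> carrier A; b \<in> carrier B\<rbrakk> \<Longrightarrow> \<phi> (a \<oplus>\<^bsub>A\<^esub> a') b = \<phi> a b \<oplus>\<^bsub>V\<^esub> \<phi> a' b"
    "\<And>a b b'. \<lbrakk>a \<in> carrier A; b \<in> carrier B; b' \<in> carrier B\<rbrakk> \<Longrightarrow> \<phi> a (b \<oplus>\<^bsub>B\<^esub> b') = \<phi> a b \<oplus>\<^bsub>V\<^esub> \<phi> a b'"
    "\<And>c a b. \<lbrakk>c \<in> carrier K; a \<in> carrier A; b \<in> carrier B\<rbrakk> \<Longrightarrow> \<phi> (c \<odot>\<^bsub>A\<^esub> a) b = c \<odot>\<^bsub>V\<^esub> \<phi> a b"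
    "\<And>c a b. \<lbrakk>c \<in> carrier K; a \<in> carrier A; b \<in> carrier B\<rbrakk> \<Longrightarrow> \<phi> a (c \<odot>\<^bsub>B\<^esub> b) = c \<odot>\<^bsub>V\<^esub> \<phi> a b"
  shows "balanced K (regular_module K) A B V \<phi>"
  using assms by (intro balancedI) simp_all

text \<open>Left multiplication by a pure tensor. The product of \<open>tensor_algebra\<close> is a
  lift of this map in the pair \<open>(a, b)\<close>, so well-definedness is established in two
  layers.\<close>

definition lmul where
  "lmul a b = tensor_lift K T.T (\<lambda>(a', b'). T.pt (a \<otimes>\<^bsub>A\<^esub> a') (b \<otimes>\<^bsub>B\<^esub> b'))"

lemma lmul:
  assumes "a \<in> carrier A" "b \<in> carrier B"
  shows "lmul a b \<in> mhom K T.T T.T"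
    and "\<lbrakk>a' \<in> carrier A; b' \<in> carrier B\<rbrakk> \<Longrightarrow> lmul a b (T.pt a' b') = T.pt (a \<otimes>\<^bsub>A\<^esub> a') (b \<otimes>\<^bsub>B\<^esub> b')"
proof -
  have "balanced K (regular_module K) A B T.T (\<lambda>a' b'. (\<lambda>(a', b'). T.pt (a \<otimes>\<^bsub>A\<^esub> a') (b \<otimes>\<^bsub>B\<^esub> b')) (a', b'))"
    using assms
    by (intro bilinearI) (simp_all add: A.A.r_distr B.A.r_distr T.pt_add_left T.pt_add_right
        A.A.smult_mult_right B.A.smult_mult_right pt_smult_left pt_smult_right)
  note l = T.tensor_lift[OF T.left_module_T this]
  show "lmul a b \<in> mhom K T.T T.T" unfolding lmul_def by (rule l(1))
  show "\<lbrakk>a' \<in> carrier A; b' \<in> carrier B\<rbrakk> \<Longrightarrow> lmul a b (T.pt a' b') = T.pt (a \<otimes>\<^bsub>A\<^esub> a') (b \<otimes>\<^bsub>B\<^esub> b')"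
    unfolding lmul_def using l(2) by simp
qed

text \<open>The outer layer of well-definedness. Each identity compares two linear maps in
  \<open>\<zeta>\<close>, so it has to be checked for pure tensors \<open>\<zeta>\<close>
  only.\<close>

lemma balanced_lmul:
  assumes \<zeta>: "\<zeta> \<in> carrier T.T"
  shows "balanced K (regular_module K) A B T.T (\<lambda>a b. (\<lambda>(a, b). lmul a b \<zeta>) (a, b))"
proof (rule bilinearI, goal_cases)
  case (1 a b)
  then show ?case using mhom_closed[OF lmul(1)] \<zeta> by simp
next
  case (2 a a' b)
  have "lmul (a \<oplus>\<^bsub>A\<^esub> a') b \<zeta> = lmul a b \<zeta> \<oplus>\<^bsub>T.T\<^esub> lmul a' b \<zeta>"
    by (rule T.mhom_T_eqI[OF T.left_module_T lmul(1) mhom_plus[OF T.left_module_T lmul(1) lmul(1)] _ \<zeta>])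
      (use 2 in \<open>simp_all add: lmul(2) A.A.l_distr T.pt_add_left\<close>)
  then show ?case by simp
next
  case (3 a b b')
  have "lmul a (b \<oplus>\<^bsub>B\<^esub> b') \<zeta> = lmul a b \<zeta> \<oplus>\<^bsub>T.T\<^esub> lmul a b' \<zeta>"
    by (rule T.mhom_T_eqI[OF T.left_module_T lmul(1) mhom_plus[OF T.left_module_T lmul(1) lmul(1)] _ \<zeta>])
      (use 3 in \<open>simp_all add: lmul(2) B.A.l_distr T.pt_add_right\<close>)
  then show ?case by simp
next
  case (4 c a b)
  have "lmul (c \<odot>\<^bsub>A\<^esub> a) b \<zeta> = c \<odot>\<^bsub>T.T\<^esub> lmul a b \<zeta>"
    by (rule T.mhom_T_eqI[OF T.left_module_T lmul(1)
          mhom_smult_fun[OF A.K.field_axioms T.left_module_T lmul(1)] _ \<zeta>])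
      (use 4 in \<open>simp_all add: lmul(2) A.A.smult_mult_left pt_smult_left\<close>)
  then show ?case by simp
next
  case (5 c a b)
  have "lmul a (c \<odot>\<^bsub>B\<^esub> b) \<zeta> = c \<odot>\<^bsub>T.T\<^esub> lmul a b \<zeta>"
    by (rule T.mhom_T_eqI[OF T.left_module_T lmul(1)
          mhom_smult_fun[OF A.K.field_axioms T.left_module_T lmul(1)] _ \<zeta>])
      (use 5 in \<open>simp_all add: lmul(2) B.A.smult_mult_left pt_smult_right\<close>)
  then show ?case by simp
qed

lemma TA_mult_def: "\<xi> \<otimes>\<^bsub>TA\<^esub> \<zeta> = tensor_lift K T.T (\<lambda>(a, b). lmul a b \<zeta>) \<xi>"
  by (simp add: tensor_algebra_def Let_def lmul_def)

lemma TA_mult_hom_left: "\<zeta> \<in> carrier T.T \<Longrightarrow> (\<lambda>\<xi>. \<xi> \<otimes>\<^bsub>TA\<^esub> \<zeta>) \<in> mhom K T.T T.T"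
  unfolding TA_mult_def using T.tensor_lift(1)[OF T.left_module_T balanced_lmul] .

lemma TA_mult_pure_left:
  "\<lbrakk>a \<in> carrier A; b \<in> carrier B; \<zeta> \<in> carrier T.T\<rbrakk> \<Longrightarrow> T.pt a b \<otimes>\<^bsub>TA\<^esub> \<zeta> = lmul a b \<zeta>"
  unfolding TA_mult_def using T.tensor_lift(2)[OF T.left_module_T balanced_lmul] by simp

lemma TA_mult_pure:
  "\<lbrakk>a \<in> carrier A; b \<in> carrier B; a' \<in> carrier A; b' \<in> carrier B\<rbrakk>
    \<Longrightarrow> T.pt a b \<otimes>\<^bsub>TA\<^esub> T.pt a' b' = T.pt (a \<otimes>\<^bsub>A\<^esub> a') (b \<otimes>\<^bsub>B\<^esub> b')"
  by (simp add: TA_mult_pure_left lmul)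

lemma TA_mult_closed: "\<lbrakk>\<xi> \<in> carrier T.T; \<zeta> \<in> carrier T.T\<rbrakk> \<Longrightarrow> \<xi> \<otimes>\<^bsub>TA\<^esub> \<zeta> \<in> carrier T.T"
  using mhom_closed[OF TA_mult_hom_left] .

lemma TA_l_distr:
  "\<lbrakk>\<xi> \<in> carrier T.T; \<xi>' \<in> carrier T.T; \<zeta> \<in> carrier T.T\<rbrakk>
    \<Longrightarrow> (\<xi> \<oplus>\<^bsub>T.T\<^esub> \<xi>') \<otimes>\<^bsub>TA\<^esub> \<zeta> = \<xi> \<otimes>\<^bsub>TA\<^esub> \<zeta> \<oplus>\<^bsub>T.T\<^esub> \<xi>' \<otimes>\<^bsub>TA\<^esub> \<zeta>"
  using mhom_add[OF TA_mult_hom_left] by blast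

lemma TA_r_distr:
  assumes "\<xi> \<in> carrier T.T" "\<zeta> \<in> carrier T.T" "\<zeta>' \<in> carrier T.T"
  shows "\<xi> \<otimes>\<^bsub>TA\<^esub> (\<zeta> \<oplus>\<^bsub>T.T\<^esub> \<zeta>') = \<xi> \<otimes>\<^bsub>TA\<^esub> \<zeta> \<oplus>\<^bsub>T.T\<^esub> \<xi> \<otimes>\<^bsub>TA\<^esub> \<zeta>'"
  by (rule T.mhom_T_eqI[OF T.left_module_T TA_mult_hom_left mhom_plus[OF T.left_module_T TA_mult_hom_left TA_mult_hom_left] _ assms(1)])
    (use assms in \<open>simp_all add: TA_mult_pure_left mhom_add[OF lmul(1)]\<close>)

lemma TA_smult_right:
  assumes "c \<in> carrier K" "\<xi> \<in> carrier T.T" "\<zeta> \<in> carrier T.T"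
  shows "\<xi> \<otimes>\<^bsub>TA\<^esub> (c \<odot>\<^bsub>T.T\<^esub> \<zeta>) = c \<odot>\<^bsub>T.T\<^esub> (\<xi> \<otimes>\<^bsub>TA\<^esub> \<zeta>)"
  by (rule T.mhom_T_eqI[OF T.left_module_T TA_mult_hom_left mhom_smult_fun[OF A.K.field_axioms T.left_module_T TA_mult_hom_left] _ assms(2)])
    (use assms in \<open>simp_all add: TA_mult_pure_left mhom_smult[OF lmul(1)]\<close>)

text \<open>Three nested inductions reduce to pure tensors, where associativity holds in each
  factor.\<close>

lemma TA_assoc:
  assumes "\<xi> \<in> carrier T.T" "\<zeta> \<in> carrier T.T" "\<omega> \<in> carrier T.T"
  shows "(\<xi> \<otimes>\<^bsub>TA\<^esub> \<zeta>) \<otimes>\<^bsub>TA\<^esub> \<omega> = \<xi> \<otimes>\<^bsub>TA\<^esub> (\<zeta> \<otimes>\<^bsub>TA\<^esub> \<omega>)"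
  using assms(1)
proof (induction \<xi> rule: T.tensor_induct)
  case (pure a b)
  show ?case using assms(2)
  proof (induction \<zeta> rule: T.tensor_induct)
    case (pure a' b')
    show ?case using assms(3)
    proof (induction \<omega> rule: T.tensor_induct)
      case (pure a'' b'')
      then show ?case
        using \<open>a \<in> carrier A\<close> \<open>b \<in> carrier B\<close> \<open>a' \<in> carrier A\<close> \<open>b' \<in> carrier B\<close>
        by (simp add: TA_mult_pure A.A.m_assoc B.A.m_assoc)
    qed (use pure \<open>a \<in> carrier A\<close> \<open>b \<in> carrier B\<close> in \<open>simp add: TA_r_distr TA_mult_closed\<close>)
  qed (use pure assms(3) in \<open>simp add: TA_r_distr TA_l_distr TA_mult_closed\<close>)
qed (use assms in \<open>simp add: TA_l_distr TA_mult_closed\<close>)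

lemma algebra_TA: "algebra_over_field K TA"
proof -
  have l_one: "T.pt \<one>\<^bsub>A\<^esub> \<one>\<^bsub>B\<^esub> \<otimes>\<^bsub>TA\<^esub> \<xi> = \<xi>" if "\<xi> \<in> carrier T.T" for \<xi>
    using that by (induction \<xi> rule: T.tensor_induct) (simp_all add: TA_mult_pure TA_r_distr)
  have r_one: "\<xi> \<otimes>\<^bsub>TA\<^esub> T.pt \<one>\<^bsub>A\<^esub> \<one>\<^bsub>B\<^esub> = \<xi>" if "\<xi> \<in> carrier T.T" for \<xi>
    using that by (induction \<xi> rule: T.tensor_induct) (simp_all add: TA_mult_pure TA_l_distr)
  have m: "left_module K TA"
    by (rule left_module_cong[OF T.left_module_T]) simp_all
  then have mod: "Module.module K TA" using left_module_iff_module[OF A.K.is_cring] by blast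
  have "ring TA"
    using left_module.axioms(2)[OF m]
    by (intro ringI monoidI) (simp_all add: l_one r_one TA_assoc TA_mult_closed TA_l_distr TA_r_distr)
  then show ?thesis
    using mod by (intro algebra_over_field.intro A.K.field_axioms assoc_algebra.intro assoc_algebra_axioms.intro)
      (simp_all add: TA_smult_right mhom_smult[OF TA_mult_hom_left])
qed

lemma fd_space_TA:
  assumes "fd_space K A" "fd_space K B"
  shows "fd_space K TA"
proof -
  interpret R: algebra_over_field K "regular_module K" by (rule algebra_regular_module[OF A.K.field_axioms])
  have m: "left_module K TA"
    by (rule left_module_cong[OF T.left_module_T]) simp_all
  have "left_module K (scalars (regular_module K) A)" "left_module K (scalars (regular_module K) B)"
    by (rule left_module_cong[OF A.left_module_self]; simp) (rule left_module_cong[OF B.left_module_self]; simp)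
  then have "fd_space K (scalars (regular_module K) A)" "fd_space K (scalars (regular_module K) B)"
    using fd_space_image[OF assms(1), of "scalars (regular_module K) A" "\<lambda>x. x"]
      fd_space_image[OF assms(2), of "scalars (regular_module K) B" "\<lambda>x. x"]
    by (simp_all add: mhomI)
  then have "fd_space K T.T" by (rule T.fd_space_T)
  then show ?thesis using fd_space_image[OF _ m, of T.T "\<lambda>x. x"] by (simp add: mhomI)
qed

end

section \<open>Bimodules as modules over the enveloping algebra\<close>

lemma bimodule_right_simps [simp]:
  "carrier (bimodule_right X) = carrier X" "zero (bimodule_right X) = \<zero>\<^bsub>X\<^esub>" "add (bimodule_right X) = add X"
  "b \<odot>\<^bsub>bimodule_right X\<^esub> x = rsmult X x b"
  by (simp_all add: bimodule_right_def)

locale enveloping = L: algebra_over_field K \<Lambda>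
  for K :: "('k, 'z) ring_scheme" and \<Lambda> :: "('k, 'a) module"
begin

sublocale op: algebra_over_field K "op_algebra \<Lambda>" by (rule L.algebra_op)
sublocale TE: two_algebras K \<Lambda> "op_algebra \<Lambda>" ..

abbreviation "E \<equiv> enveloping_algebra K \<Lambda>"
abbreviation "pe \<equiv> pure_tensor K (regular_module K) \<Lambda> (op_algebra \<Lambda>)"

lemma E_eq: "E = TE.TA"
  by (simp add: enveloping_algebra_def)

sublocale E: algebra_over_field K E
  unfolding E_eq by (rule TE.algebra_TA)

lemma E_induct [consumes 1, case_names pure add]:
  assumes "\<xi> \<in> carrier E" "\<And>a b. \<lbrakk>a \<in> carrier \<Lambda>; b \<in> carrier \<Lambda>\<rbrakk> \<Longrightarrow> Pr (pe a b)"
    and "\<And>\<xi> \<zeta>. \<lbrakk>\<xi> \<in> carrier E; \<zeta> \<in> carrier E; Pr \<xi>; Pr \<zeta>\<rbrakk> \<Longrightarrow> Pr (\<xi> \<oplus>\<^bsub>E\<^esub> \<zeta>)"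
  shows "Pr \<xi>"
  using assms TE.T.tensor_induct[of \<xi> Pr] by (simp add: E_eq)

lemma pe_closed [simp]: "\<lbrakk>a \<in> carrier \<Lambda>; b \<in> carrier \<Lambda>\<rbrakk> \<Longrightarrow> pe a b \<in> carrier E"
  by (simp add: E_eq)

lemma pe_mult: "\<lbrakk>a \<in> carrier \<Lambda>; b \<in> carrier \<Lambda>; a' \<in> carrier \<Lambda>; b' \<in> carrier \<Lambda>\<rbrakk>
    \<Longrightarrow> pe a b \<otimes>\<^bsub>E\<^esub> pe a' b' = pe (a \<otimes>\<^bsub>\<Lambda>\<^esub> a') (b' \<otimes>\<^bsub>\<Lambda>\<^esub> b)"
  using TE.TA_mult_pure[of a b a' b'] by (simp add: E_eq)

lemma E_one: "\<one>\<^bsub>E\<^esub> = pe \<one>\<^bsub>\<Lambda>\<^esub> \<one>\<^bsub>\<Lambda>\<^esub>"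
  by (simp add: E_eq)

lemma pe_add_left: "\<lbrakk>a \<in> carrier \<Lambda>; a' \<in> carrier \<Lambda>; b \<in> carrier \<Lambda>\<rbrakk> \<Longrightarrow> pe (a \<oplus>\<^bsub>\<Lambda>\<^esub> a') b = pe a b \<oplus>\<^bsub>E\<^esub> pe a' b"
  and pe_add_right: "\<lbrakk>a \<in> carrier \<Lambda>; b \<in> carrier \<Lambda>; b' \<in> carrier \<Lambda>\<rbrakk> \<Longrightarrow> pe a (b \<oplus>\<^bsub>\<Lambda>\<^esub> b') = pe a b \<oplus>\<^bsub>E\<^esub> pe a b'"
  and pe_smult_left: "\<lbrakk>c \<in> carrier K; a \<in> carrier \<Lambda>; b \<in> carrier \<Lambda>\<rbrakk> \<Longrightarrow> pe (c \<odot>\<^bsub>\<Lambda>\<^esub> a) b = c \<odot>\<^bsub>E\<^esub> pe a b"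
  and pe_smult_right: "\<lbrakk>c \<in> carrier K; a \<in> carrier \<Lambda>; b \<in> carrier \<Lambda>\<rbrakk> \<Longrightarrow> pe a (c \<odot>\<^bsub>\<Lambda>\<^esub> b) = c \<odot>\<^bsub>E\<^esub> pe a b"
  using TE.T.pt_add_left[of a a' b] TE.T.pt_add_right[of a b b'] TE.pt_smult_left[of c a b] TE.pt_smult_right[of c a b]
  by (simp_all add: E_eq)

lemma E_unit: "c \<in> carrier K \<Longrightarrow> c \<odot>\<^bsub>E\<^esub> \<one>\<^bsub>E\<^esub> = pe (c \<odot>\<^bsub>\<Lambda>\<^esub> \<one>\<^bsub>\<Lambda>\<^esub>) \<one>\<^bsub>\<Lambda>\<^esub>"
  by (simp add: pe_smult_left E_one)

lemma fd_space_E: "fd_space K \<Lambda> \<Longrightarrow> fd_space K E"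
  unfolding E_eq
  using fd_space_image[of K \<Lambda> "op_algebra \<Lambda>" "\<lambda>x. x"] op.left_module_self
  by (intro TE.fd_space_TA) (simp_all add: mhomI)

text \<open>The embeddings of \<Lambda> and of its opposite into the enveloping algebra. Their
  images commute, and pulling back along them recovers the left and the right action of \<Lambda> on
  a bimodule.\<close>

definition "lft a = pe a \<one>\<^bsub>\<Lambda>\<^esub>"
definition "rgt b = pe \<one>\<^bsub>\<Lambda>\<^esub> b"

lemma lft_hom: "lft \<in> ring_hom \<Lambda> E"
  by (rule ring_hom_memI) (simp_all add: lft_def pe_mult pe_add_left E_one)

lemma rgt_hom: "rgt \<in> ring_hom (op_algebra \<Lambda>) E"
  by (rule ring_hom_memI) (simp_all add: rgt_def pe_mult pe_add_right E_one)

lemma lft_closed [simp]: "a \<in> carrier \<Lambda> \<Longrightarrow> lft a \<in> carrier E"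
  and rgt_closed [simp]: "a \<in> carrier \<Lambda> \<Longrightarrow> rgt a \<in> carrier E"
  by (simp_all add: lft_def rgt_def)

lemma pe_eq_lft_rgt: "\<lbrakk>a \<in> carrier \<Lambda>; b \<in> carrier \<Lambda>\<rbrakk> \<Longrightarrow> pe a b = lft a \<otimes>\<^bsub>E\<^esub> rgt b"
  and pe_eq_rgt_lft: "\<lbrakk>a \<in> carrier \<Lambda>; b \<in> carrier \<Lambda>\<rbrakk> \<Longrightarrow> pe a b = rgt b \<otimes>\<^bsub>E\<^esub> lft a"
  by (simp_all add: lft_def rgt_def pe_mult)

lemma E_lift:
  assumes "left_module K V" "balanced K (regular_module K) \<Lambda> (op_algebra \<Lambda>) V \<phi>"
  shows "tensor_lift K V (\<lambda>(a, b). \<phi> a b) \<in> mhom K E V"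
    and "\<lbrakk>a \<in> carrier \<Lambda>; b \<in> carrier \<Lambda>\<rbrakk> \<Longrightarrow> tensor_lift K V (\<lambda>(a, b). \<phi> a b) (pe a b) = \<phi> a b"
proof -
  have b: "balanced K (regular_module K) \<Lambda> (op_algebra \<Lambda>) V (\<lambda>x y. (\<lambda>(a, b). \<phi> a b) (x, y))"
    using assms(2) by simp
  have m: "mhom K E V = mhom K TE.T.T V"
    by (simp add: E_eq LinearCombinations.module_hom_def)
  show "tensor_lift K V (\<lambda>(a, b). \<phi> a b) \<in> mhom K E V"
    unfolding m by (rule TE.T.tensor_lift(1)[OF assms(1) b])
  show "\<lbrakk>a \<in> carrier \<Lambda>; b \<in> carrier \<Lambda>\<rbrakk> \<Longrightarrow> tensor_lift K V (\<lambda>(a, b). \<phi> a b) (pe a b) = \<phi> a b"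
    using TE.T.tensor_lift(2)[OF assms(1) b] by simp
qed

text \<open>The part common to \<open>env_left\<close> and \<open>env_right\<close>. Compatibility
  with products is left out because the order of multiplication differs between the two.\<close>

lemma E_action:
  fixes V :: "('k, 'v) module" and act :: "'a \<Rightarrow> 'a \<Rightarrow> 'v \<Rightarrow> 'v"
  defines "s \<equiv> \<lambda>\<xi> x. tensor_lift K V (\<lambda>(a, b). act a b x) \<xi>"
  assumes V: "left_module K V"
    and bal: "\<And>x. x \<in> carrier V \<Longrightarrow> balanced K (regular_module K) \<Lambda> (op_algebra \<Lambda>) V (\<lambda>a b. act a b x)"
    and add: "\<And>a b x y. \<lbrakk>a \<in> carrier \<Lambda>; b \<in> carrier \<Lambda>; x \<in> carrier V; y \<in> carrier V\<rbrakk>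
      \<Longrightarrow> act a b (x \<oplus>\<^bsub>V\<^esub> y) = act a b x \<oplus>\<^bsub>V\<^esub> act a b y"
  shows "\<lbrakk>\<xi> \<in> carrier E; x \<in> carrier V\<rbrakk> \<Longrightarrow> s \<xi> x \<in> carrier V"
    and "\<lbrakk>\<xi> \<in> carrier E; \<zeta> \<in> carrier E; x \<in> carrier V\<rbrakk> \<Longrightarrow> s (\<xi> \<oplus>\<^bsub>E\<^esub> \<zeta>) x = s \<xi> x \<oplus>\<^bsub>V\<^esub> s \<zeta> x"
    and "\<lbrakk>\<xi> \<in> carrier E; x \<in> carrier V; y \<in> carrier V\<rbrakk> \<Longrightarrow> s \<xi> (x \<oplus>\<^bsub>V\<^esub> y) = s \<xi> x \<oplus>\<^bsub>V\<^esub> s \<xi> y"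
    and "\<lbrakk>a \<in> carrier \<Lambda>; b \<in> carrier \<Lambda>; x \<in> carrier V\<rbrakk> \<Longrightarrow> s (pe a b) x = act a b x"
proof -
  interpret V: left_module K V by (rule V)
  note l = E_lift[OF V bal]
  show c: "\<lbrakk>\<xi> \<in> carrier E; x \<in> carrier V\<rbrakk> \<Longrightarrow> s \<xi> x \<in> carrier V" for \<xi> x
    unfolding s_def by (rule mhom_closed[OF l(1)])
  show a: "\<lbrakk>\<xi> \<in> carrier E; \<zeta> \<in> carrier E; x \<in> carrier V\<rbrakk> \<Longrightarrow> s (\<xi> \<oplus>\<^bsub>E\<^esub> \<zeta>) x = s \<xi> x \<oplus>\<^bsub>V\<^esub> s \<zeta> x" for \<xi> \<zeta> x
    unfolding s_def by (rule mhom_add[OF l(1)])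
  show p: "\<lbrakk>a \<in> carrier \<Lambda>; b \<in> carrier \<Lambda>; x \<in> carrier V\<rbrakk> \<Longrightarrow> s (pe a b) x = act a b x" for a b x
    unfolding s_def by (rule l(2))
  assume "\<xi> \<in> carrier E" "x \<in> carrier V" "y \<in> carrier V"
  then show "s \<xi> (x \<oplus>\<^bsub>V\<^esub> y) = s \<xi> x \<oplus>\<^bsub>V\<^esub> s \<xi> y"
    by (induction \<xi> rule: E_induct) (simp_all add: p add a c V.M.a_ac)
qed

end

lemma env_left_simps [simp]:
  "carrier (env_left K A X) = carrier X" "zero (env_left K A X) = \<zero>\<^bsub>X\<^esub>" "add (env_left K A X) = add X"
  by (simp_all add: env_left_def)

lemma env_right_simps [simp]:
  "carrier (env_right K A X) = carrier X" "zero (env_right K A X) = \<zero>\<^bsub>X\<^esub>" "add (env_right K A X) = add X"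
  by (simp_all add: env_right_def)

locale bimodule_over = enveloping K \<Lambda>
  for K :: "('k, 'z) ring_scheme" and \<Lambda> :: "('k, 'a) module" +
  fixes X :: "('a, 'x) bimodule"
  assumes bimodule: "bimodule K \<Lambda> X"
begin

sublocale X: left_module \<Lambda> X using bimodule by (simp add: bimodule_def)
sublocale XR: left_module "op_algebra \<Lambda>" "bimodule_right X" using bimodule by (simp add: bimodule_def)

lemma rsmult_closed [simp]: "\<lbrakk>x \<in> carrier X; b \<in> carrier \<Lambda>\<rbrakk> \<Longrightarrow> rsmult X x b \<in> carrier X"
  using XR.smult_closed[of b x] by simp

lemma rsmult_add: "\<lbrakk>x \<in> carrier X; y \<in> carrier X; b \<in> carrier \<Lambda>\<rbrakk> \<Longrightarrow> rsmult X (x \<oplus>\<^bsub>X\<^esub> y) b = rsmult X x b \<oplus>\<^bsub>X\<^esub> rsmult X y b"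
  using XR.smult_r_distr[of b x y] by simp

lemma rsmult_add_right: "\<lbrakk>x \<in> carrier X; a \<in> carrier \<Lambda>; b \<in> carrier \<Lambda>\<rbrakk> \<Longrightarrow> rsmult X x (a \<oplus>\<^bsub>\<Lambda>\<^esub> b) = rsmult X x a \<oplus>\<^bsub>X\<^esub> rsmult X x b"
  using XR.smult_l_distr[of a b x] by simp

lemma rsmult_assoc: "\<lbrakk>x \<in> carrier X; a \<in> carrier \<Lambda>; b \<in> carrier \<Lambda>\<rbrakk> \<Longrightarrow> rsmult X x (a \<otimes>\<^bsub>\<Lambda>\<^esub> b) = rsmult X (rsmult X x a) b"
  using XR.smult_assoc[of b a x] by simp

lemma rsmult_one: "x \<in> carrier X \<Longrightarrow> rsmult X x \<one>\<^bsub>\<Lambda>\<^esub> = x"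
  using XR.smult_one[of x] by simp

lemma rsmult_lsmult: "\<lbrakk>x \<in> carrier X; a \<in> carrier \<Lambda>; b \<in> carrier \<Lambda>\<rbrakk> \<Longrightarrow> rsmult X (a \<odot>\<^bsub>X\<^esub> x) b = a \<odot>\<^bsub>X\<^esub> rsmult X x b"
  using bimodule by (simp add: bimodule_def)

lemma central: "\<lbrakk>c \<in> carrier K; x \<in> carrier X\<rbrakk> \<Longrightarrow> rsmult X x (c \<odot>\<^bsub>\<Lambda>\<^esub> \<one>\<^bsub>\<Lambda>\<^esub>) = (c \<odot>\<^bsub>\<Lambda>\<^esub> \<one>\<^bsub>\<Lambda>\<^esub>) \<odot>\<^bsub>X\<^esub> x"
  using bimodule by (simp add: bimodule_def)

lemma smult_scalar: "\<lbrakk>c \<in> carrier K; a \<in> carrier \<Lambda>; x \<in> carrier X\<rbrakk>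
    \<Longrightarrow> (c \<odot>\<^bsub>\<Lambda>\<^esub> a) \<odot>\<^bsub>X\<^esub> x = (c \<odot>\<^bsub>\<Lambda>\<^esub> \<one>\<^bsub>\<Lambda>\<^esub>) \<odot>\<^bsub>X\<^esub> (a \<odot>\<^bsub>X\<^esub> x)"
  by (simp add: X.smult_assoc[symmetric])

lemma rsmult_scalar: "\<lbrakk>c \<in> carrier K; a \<in> carrier \<Lambda>; x \<in> carrier X\<rbrakk>
    \<Longrightarrow> rsmult X x (c \<odot>\<^bsub>\<Lambda>\<^esub> a) = (c \<odot>\<^bsub>\<Lambda>\<^esub> \<one>\<^bsub>\<Lambda>\<^esub>) \<odot>\<^bsub>X\<^esub> rsmult X x a"
  using rsmult_assoc[of x a "c \<odot>\<^bsub>\<Lambda>\<^esub> \<one>\<^bsub>\<Lambda>\<^esub>"] central[of c "rsmult X x a"] by simp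

lemma left_module_KX: "left_module K (scalars \<Lambda> X)"
  by (rule L.left_module_scalars[OF X.is_left_module])

lemma balanced_left: "x \<in> carrier X \<Longrightarrow>
    balanced K (regular_module K) \<Lambda> (op_algebra \<Lambda>) (scalars \<Lambda> X) (\<lambda>a b. rsmult X (a \<odot>\<^bsub>X\<^esub> x) b)"
proof (rule TE.bilinearI, goal_cases)
  case (4 c a b)
  then show ?case using smult_scalar[of c a x] by (simp add: rsmult_lsmult)
qed (simp_all add: X.smult_l_distr rsmult_add rsmult_add_right rsmult_scalar)

lemma balanced_right: "x \<in> carrier X \<Longrightarrow>
    balanced K (regular_module K) \<Lambda> (op_algebra \<Lambda>) (scalars \<Lambda> X) (\<lambda>a b. rsmult X (b \<odot>\<^bsub>X\<^esub> x) a)"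
proof (rule TE.bilinearI, goal_cases)
  case (5 c a b)
  then show ?case using smult_scalar[of c b x] by (simp add: rsmult_lsmult)
qed (simp_all add: X.smult_l_distr rsmult_add rsmult_add_right rsmult_scalar)

abbreviation "XL \<equiv> env_left K \<Lambda> X"
abbreviation "XE \<equiv> env_right K \<Lambda> X"

lemma env_left_pure: "\<lbrakk>a \<in> carrier \<Lambda>; b \<in> carrier \<Lambda>; x \<in> carrier X\<rbrakk> \<Longrightarrow> pe a b \<odot>\<^bsub>XL\<^esub> x = rsmult X (a \<odot>\<^bsub>X\<^esub> x) b"
  and env_left_closed: "\<lbrakk>\<xi> \<in> carrier E; x \<in> carrier X\<rbrakk> \<Longrightarrow> \<xi> \<odot>\<^bsub>XL\<^esub> x \<in> carrier X"
  and env_left_add: "\<lbrakk>\<xi> \<in> carrier E; \<zeta> \<in> carrier E; x \<in> carrier X\<rbrakk> \<Longrightarrow> (\<xi> \<oplus>\<^bsub>E\<^esub> \<zeta>) \<odot>\<^bsub>XL\<^esub> x = \<xi> \<odot>\<^bsub>XL\<^esub> x \<oplus>\<^bsub>X\<^esub> \<zeta> \<odot>\<^bsub>XL\<^esub> x"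
  and env_left_add_right: "\<lbrakk>\<xi> \<in> carrier E; x \<in> carrier X; y \<in> carrier X\<rbrakk> \<Longrightarrow> \<xi> \<odot>\<^bsub>XL\<^esub> (x \<oplus>\<^bsub>X\<^esub> y) = \<xi> \<odot>\<^bsub>XL\<^esub> x \<oplus>\<^bsub>X\<^esub> \<xi> \<odot>\<^bsub>XL\<^esub> y"
proof -
  note e = E_action[OF left_module_KX, where act = "\<lambda>a b x. rsmult X (a \<odot>\<^bsub>X\<^esub> x) b"]
  show "\<lbrakk>a \<in> carrier \<Lambda>; b \<in> carrier \<Lambda>; x \<in> carrier X\<rbrakk> \<Longrightarrow> pe a b \<odot>\<^bsub>XL\<^esub> x = rsmult X (a \<odot>\<^bsub>X\<^esub> x) b"
    using e(4) balanced_left by (simp add: env_left_def X.smult_r_distr rsmult_add)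
  show "\<lbrakk>\<xi> \<in> carrier E; x \<in> carrier X\<rbrakk> \<Longrightarrow> \<xi> \<odot>\<^bsub>XL\<^esub> x \<in> carrier X"
    using e(1) balanced_left by (simp add: env_left_def X.smult_r_distr rsmult_add)
  show "\<lbrakk>\<xi> \<in> carrier E; \<zeta> \<in> carrier E; x \<in> carrier X\<rbrakk> \<Longrightarrow> (\<xi> \<oplus>\<^bsub>E\<^esub> \<zeta>) \<odot>\<^bsub>XL\<^esub> x = \<xi> \<odot>\<^bsub>XL\<^esub> x \<oplus>\<^bsub>X\<^esub> \<zeta> \<odot>\<^bsub>XL\<^esub> x"
    using e(2) balanced_left by (simp add: env_left_def X.smult_r_distr rsmult_add)
  show "\<lbrakk>\<xi> \<in> carrier E; x \<in> carrier X; y \<in> carrier X\<rbrakk> \<Longrightarrow> \<xi> \<odot>\<^bsub>XL\<^esub> (x \<oplus>\<^bsub>X\<^esub> y) = \<xi> \<odot>\<^bsub>XL\<^esub> x \<oplus>\<^bsub>X\<^esub> \<xi> \<odot>\<^bsub>XL\<^esub> y"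
    using e(3) balanced_left by (simp add: env_left_def X.smult_r_distr rsmult_add)
qed

lemma env_right_pure: "\<lbrakk>a \<in> carrier \<Lambda>; b \<in> carrier \<Lambda>; x \<in> carrier X\<rbrakk> \<Longrightarrow> pe a b \<odot>\<^bsub>XE\<^esub> x = rsmult X (b \<odot>\<^bsub>X\<^esub> x) a"
  and env_right_closed: "\<lbrakk>\<xi> \<in> carrier E; x \<in> carrier X\<rbrakk> \<Longrightarrow> \<xi> \<odot>\<^bsub>XE\<^esub> x \<in> carrier X"
  and env_right_add: "\<lbrakk>\<xi> \<in> carrier E; \<zeta> \<in> carrier E; x \<in> carrier X\<rbrakk> \<Longrightarrow> (\<xi> \<oplus>\<^bsub>E\<^esub> \<zeta>) \<odot>\<^bsub>XE\<^esub> x = \<xi> \<odot>\<^bsub>XE\<^esub> x \<oplus>\<^bsub>X\<^esub> \<zeta> \<odot>\<^bsub>XE\<^esub> x"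
  and env_right_add_right: "\<lbrakk>\<xi> \<in> carrier E; x \<in> carrier X; y \<in> carrier X\<rbrakk> \<Longrightarrow> \<xi> \<odot>\<^bsub>XE\<^esub> (x \<oplus>\<^bsub>X\<^esub> y) = \<xi> \<odot>\<^bsub>XE\<^esub> x \<oplus>\<^bsub>X\<^esub> \<xi> \<odot>\<^bsub>XE\<^esub> y"
proof -
  note e = E_action[OF left_module_KX, where act = "\<lambda>a b x. rsmult X (b \<odot>\<^bsub>X\<^esub> x) a"]
  show "\<lbrakk>a \<in> carrier \<Lambda>; b \<in> carrier \<Lambda>; x \<in> carrier X\<rbrakk> \<Longrightarrow> pe a b \<odot>\<^bsub>XE\<^esub> x = rsmult X (b \<odot>\<^bsub>X\<^esub> x) a"
    using e(4) balanced_right by (simp add: env_right_def X.smult_r_distr rsmult_add)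
  show "\<lbrakk>\<xi> \<in> carrier E; x \<in> carrier X\<rbrakk> \<Longrightarrow> \<xi> \<odot>\<^bsub>XE\<^esub> x \<in> carrier X"
    using e(1) balanced_right by (simp add: env_right_def X.smult_r_distr rsmult_add)
  show "\<lbrakk>\<xi> \<in> carrier E; \<zeta> \<in> carrier E; x \<in> carrier X\<rbrakk> \<Longrightarrow> (\<xi> \<oplus>\<^bsub>E\<^esub> \<zeta>) \<odot>\<^bsub>XE\<^esub> x = \<xi> \<odot>\<^bsub>XE\<^esub> x \<oplus>\<^bsub>X\<^esub> \<zeta> \<odot>\<^bsub>XE\<^esub> x"
    using e(2) balanced_right by (simp add: env_right_def X.smult_r_distr rsmult_add)
  show "\<lbrakk>\<xi> \<in> carrier E; x \<in> carrier X; y \<in> carrier X\<rbrakk> \<Longrightarrow> \<xi> \<odot>\<^bsub>XE\<^esub> (x \<oplus>\<^bsub>X\<^esub> y) = \<xi> \<odot>\<^bsub>XE\<^esub> x \<oplus>\<^bsub>X\<^esub> \<xi> \<odot>\<^bsub>XE\<^esub> y"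
    using e(3) balanced_right by (simp add: env_right_def X.smult_r_distr rsmult_add)
qed

lemma left_module_env_left: "left_module E XL"
proof -
  have assoc: "(\<xi> \<otimes>\<^bsub>E\<^esub> \<zeta>) \<odot>\<^bsub>XL\<^esub> x = \<xi> \<odot>\<^bsub>XL\<^esub> (\<zeta> \<odot>\<^bsub>XL\<^esub> x)" if "\<xi> \<in> carrier E" "\<zeta> \<in> carrier E" and x: "x \<in> carrier X" for \<xi> \<zeta> x
    using that(1)
  proof (induction \<xi> rule: E_induct)
    case (pure a b)
    show ?case using that(2)
    proof (induction \<zeta> rule: E_induct)
      case (pure a' b')
      then show ?case using \<open>a \<in> carrier \<Lambda>\<close> \<open>b \<in> carrier \<Lambda>\<close> x
        by (simp add: pe_mult env_left_pure X.smult_assoc rsmult_assoc rsmult_lsmult)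
    qed (use pure x in \<open>simp add: E.A.r_distr env_left_add env_left_add_right env_left_closed\<close>)
  qed (use that in \<open>simp add: E.A.l_distr env_left_add env_left_closed\<close>)
  show ?thesis
    by (intro left_moduleI E.is_ring_A abelian_group_cong[OF X.M.abelian_group_axioms])
      (simp_all add: assoc env_left_add env_left_add_right env_left_closed E_one env_left_pure rsmult_one)
qed

text \<open>With \<open>x (a \<otimes> b) = b x a\<close>, acting by a product means acting by its
  left factor first; hence a module over the opposite of \<open>E\<close>.\<close>

lemma left_module_env_right: "left_module (op_algebra E) XE"
proof -
  have assoc: "(\<zeta> \<otimes>\<^bsub>E\<^esub> \<xi>) \<odot>\<^bsub>XE\<^esub> x = \<xi> \<odot>\<^bsub>XE\<^esub> (\<zeta> \<odot>\<^bsub>XE\<^esub> x)" if "\<xi> \<in> carrier E" "\<zeta> \<in> carrier E" and x: "x \<in> carrier X" for \<xi> \<zeta> x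
    using that(1)
  proof (induction \<xi> rule: E_induct)
    case (pure a b)
    show ?case using that(2)
    proof (induction \<zeta> rule: E_induct)
      case (pure a' b')
      then show ?case using \<open>a \<in> carrier \<Lambda>\<close> \<open>b \<in> carrier \<Lambda>\<close> x
        by (simp add: pe_mult env_right_pure X.smult_assoc rsmult_assoc rsmult_lsmult)
    qed (use pure x in \<open>simp add: E.A.l_distr env_right_add env_right_add_right env_right_closed\<close>)
  qed (use that in \<open>simp add: E.A.r_distr env_right_add env_right_closed\<close>)
  show ?thesis
    by (intro left_moduleI ring_op_algebra E.is_ring_A abelian_group_cong[OF X.M.abelian_group_axioms])
      (simp_all add: assoc env_right_add env_right_add_right env_right_closed E_one env_right_pure rsmult_one)
qed

lemma fd_env_left:
  assumes "fd_space K (scalars \<Lambda> X)"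
  shows "fd_left_module K E XL"
proof -
  have "(\<lambda>x. x) \<in> mhom K (scalars \<Lambda> X) (scalars E XL)"
    by (rule mhomI) (simp_all add: E_unit env_left_pure rsmult_one del: E.unit_closed)
  then show ?thesis
    using fd_space_image[OF assms E.left_module_scalars[OF left_module_env_left], of "\<lambda>x. x"]
    by (simp add: fd_left_module_def left_module_env_left)
qed

end

context enveloping
begin

text \<open>Linearity over the enveloping algebra need only be tested on pure tensors, by
  additivity. \<open>E\<close> and its opposite have the same carrier and the same addition, so one
  induction covers left and right modules.\<close>

lemma mhom_EI:
  assumes "\<And>x. x \<in> carrier M \<Longrightarrow> f x \<in> carrier N"
    and "\<And>x y. \<lbrakk>x \<in> carrier M; y \<in> carrier M\<rbrakk> \<Longrightarrow> f (x \<oplus>\<^bsub>M\<^esub> y) = f x \<oplus>\<^bsub>N\<^esub> f y"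
    and "\<And>a b x. \<lbrakk>a \<in> carrier \<Lambda>; b \<in> carrier \<Lambda>; x \<in> carrier M\<rbrakk> \<Longrightarrow> f (pe a b \<odot>\<^bsub>M\<^esub> x) = pe a b \<odot>\<^bsub>N\<^esub> f x"
    and R: "R = E \<or> R = op_algebra E" and M: "left_module R M" and N: "left_module R N"
  shows "f \<in> mhom R M N"
proof -
  interpret M: left_module R M by fact
  interpret N: left_module R N by fact
  have R': "carrier R = carrier E" "add R = add E" using R by auto
  show ?thesis
  proof (rule mhomI)
    fix \<xi> x assume "\<xi> \<in> carrier R" and x: "x \<in> carrier M"
    then have "\<xi> \<in> carrier E" by (simp add: R')
    then show "f (\<xi> \<odot>\<^bsub>M\<^esub> x) = \<xi> \<odot>\<^bsub>N\<^esub> f x"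
    proof (induction \<xi> rule: E_induct)
      case (add \<xi> \<zeta>)
      have "\<xi> \<in> carrier R" "\<zeta> \<in> carrier R" using add by (simp_all add: R')
      then show ?case
        using add assms(1,2) x M.smult_l_distr[of \<xi> \<zeta> x] N.smult_l_distr[of \<xi> \<zeta> "f x"] by (simp add: R')
    qed (use assms(3) x in simp)
  qed (use assms in auto)
qed

lemma bimodule_hom_env:
  assumes "bimodule K \<Lambda> X" "bimodule K \<Lambda> Y" "f \<in> bimodule_hom \<Lambda> X Y"
  shows "f \<in> mhom E (env_left K \<Lambda> X) (env_left K \<Lambda> Y)"
    and "f \<in> mhom (op_algebra E) (env_right K \<Lambda> X) (env_right K \<Lambda> Y)"
proof -
  interpret X: bimodule_over K \<Lambda> X by unfold_locales (rule assms(1))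
  interpret Y: bimodule_over K \<Lambda> Y by unfold_locales (rule assms(2))
  have f: "f \<in> mhom \<Lambda> X Y" "f \<in> mhom \<Lambda> (bimodule_right X) (bimodule_right Y)"
    using assms(3) by (simp_all add: bimodule_hom_def)
  have r: "f (rsmult X x b) = rsmult Y (f x) b" if "x \<in> carrier X" "b \<in> carrier \<Lambda>" for x b
    using mhom_smult[OF f(2), of b x] that by simp
  show "f \<in> mhom E (env_left K \<Lambda> X) (env_left K \<Lambda> Y)"
    by (rule mhom_EI[OF _ _ _ _ X.left_module_env_left Y.left_module_env_left])
      (simp_all add: mhom_closed[OF f(1)] mhom_add[OF f(1)] X.env_left_pure Y.env_left_pure r mhom_smult[OF f(1)])
  show "f \<in> mhom (op_algebra E) (env_right K \<Lambda> X) (env_right K \<Lambda> Y)"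
    by (rule mhom_EI[OF _ _ _ _ X.left_module_env_right Y.left_module_env_right])
      (simp_all add: mhom_closed[OF f(1)] mhom_add[OF f(1)] X.env_right_pure Y.env_right_pure r mhom_smult[OF f(1)])
qed

lemma bimodule_regular: "bimodule K \<Lambda> (regular_bimodule \<Lambda>)"
proof -
  have "left_module \<Lambda> (regular_bimodule \<Lambda>)"
    using left_module_cong[OF left_module_regular[OF L.is_ring_A], of "regular_bimodule \<Lambda>"]
    by (simp add: regular_bimodule_def)
  moreover have "left_module (op_algebra \<Lambda>) (bimodule_right (regular_bimodule \<Lambda>))"
    using left_module_cong[OF left_module_regular[OF op.is_ring_A], of "bimodule_right (regular_bimodule \<Lambda>)"]
    by (simp add: regular_bimodule_def)
  ultimately show ?thesis
    by (simp add: bimodule_def) (simp add: regular_bimodule_def L.A.m_assoc)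
qed

lemma fd_env_left_regular:
  assumes "fd_space K \<Lambda>"
  shows "fd_left_module K E (env_left K \<Lambda> (regular_bimodule \<Lambda>))"
proof -
  interpret X: bimodule_over K \<Lambda> "regular_bimodule \<Lambda>" by unfold_locales (rule bimodule_regular)
  have "(\<lambda>x. x) \<in> mhom K \<Lambda> (scalars \<Lambda> (regular_bimodule \<Lambda>))"
    by (rule mhomI) (simp_all add: regular_bimodule_def)
  then have "fd_space K (scalars \<Lambda> (regular_bimodule \<Lambda>))"
    using fd_space_image[OF assms X.left_module_KX, of "\<lambda>x. x"] by (simp add: regular_bimodule_def)
  then show ?thesis by (rule X.fd_env_left)
qed

end

subsection \<open>The radical\<close>

lemma left_ideal_iff: 
  assumes "ring A"
  shows "left_ideal I A \<longleftrightarrow> submod A (regular_module A) I"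
proof -
  interpret A: ring A by fact
  interpret R: left_module A "regular_module A" by (rule left_module_regular[OF assms])
  have "subgroup I (add_monoid (regular_module A))" if "submod A (regular_module A) I"
    using submodD[OF that] R.submod_uminus[OF that]
    by (intro group.subgroupI[OF R.M.a_group]) (auto simp: a_inv_def)
  then show ?thesis
    unfolding left_ideal_def Module.submodule_def Module.submodule_axioms_def
    by (auto simp: submod_def subgroup_def)
qed

context algebra_over_field
begin

abbreviation "rad \<equiv> jacobson_radical A"

lemma left_ideal_subspace: "left_ideal I A \<Longrightarrow> submod K A I"
proof (rule submodI)
  assume "left_ideal I A"
  then have I: "submod A (regular_module A) I" by (simp add: left_ideal_iff[OF is_ring_A])
  note s = submodD[OF I, simplified]
  show "x \<in> I \<Longrightarrow> x \<in> carrier A" for x using s(2) .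
  show "\<zero>\<^bsub>A\<^esub> \<in> I" using s(3) .
  show "x \<in> I \<Longrightarrow> y \<in> I \<Longrightarrow> x \<oplus>\<^bsub>A\<^esub> y \<in> I" for x y using s(4) .
  show "c \<odot>\<^bsub>A\<^esub> x \<in> I" if "c \<in> carrier K" "x \<in> I" for c x
    using s(5)[of "c \<odot>\<^bsub>A\<^esub> \<one>\<^bsub>A\<^esub>" x] s(2)[of x] that by simp
qed

lemma left_idealD:
  assumes "left_ideal I A"
  shows "I \<subseteq> carrier A" "\<zero>\<^bsub>A\<^esub> \<in> I" "\<lbrakk>x \<in> I; y \<in> I\<rbrakk> \<Longrightarrow> x \<oplus>\<^bsub>A\<^esub> y \<in> I"
    "\<lbrakk>a \<in> carrier A; x \<in> I\<rbrakk> \<Longrightarrow> a \<otimes>\<^bsub>A\<^esub> x \<in> I" "x \<in> I \<Longrightarrow> \<ominus>\<^bsub>A\<^esub> x \<in> I"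
proof -
  have I: "submod A (regular_module A) I" using assms by (simp add: left_ideal_iff[OF is_ring_A])
  note s = submodD[OF I, simplified]
  show "I \<subseteq> carrier A" "\<zero>\<^bsub>A\<^esub> \<in> I" "\<lbrakk>x \<in> I; y \<in> I\<rbrakk> \<Longrightarrow> x \<oplus>\<^bsub>A\<^esub> y \<in> I"
    "\<lbrakk>a \<in> carrier A; x \<in> I\<rbrakk> \<Longrightarrow> a \<otimes>\<^bsub>A\<^esub> x \<in> I" by (fact s)+
  show "\<ominus>\<^bsub>A\<^esub> x \<in> I" if "x \<in> I"
    using s(5)[of "\<ominus>\<^bsub>A\<^esub> \<one>\<^bsub>A\<^esub>" x] s(2)[of x] that by (simp add: A.l_minus)
qed

lemma left_idealI:
  assumes "I \<subseteq> carrier A" "\<zero>\<^bsub>A\<^esub> \<in> I" "\<And>x y. \<lbrakk>x \<in> I; y \<in> I\<rbrakk> \<Longrightarrow> x \<oplus>\<^bsub>A\<^esub> y \<in> I"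
    "\<And>a x. \<lbrakk>a \<in> carrier A; x \<in> I\<rbrakk> \<Longrightarrow> a \<otimes>\<^bsub>A\<^esub> x \<in> I"
  shows "left_ideal I A"
  unfolding left_ideal_iff[OF is_ring_A] using assms by (intro submodI) auto

lemma left_ideal_one: "\<lbrakk>left_ideal I A; \<one>\<^bsub>A\<^esub> \<in> I\<rbrakk> \<Longrightarrow> I = carrier A"
  using left_idealD(1)[of I] left_idealD(4)[of I _ "\<one>\<^bsub>A\<^esub>"] by auto

text \<open>Finite dimension takes the place of Zorn's lemma, since left ideals are
  subspaces.\<close>

lemma maximal_left_idealE:
  assumes "fd_space K A" "left_ideal I A" "\<one>\<^bsub>A\<^esub> \<notin> I"
  obtains M where "maximal_left_ideal M A" "I \<subseteq> M"
proof -
  let ?S = "{L. left_ideal L A \<and> I \<subseteq> L \<and> \<one>\<^bsub>A\<^esub> \<notin> L}"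
  obtain M where M: "M \<in> ?S" "\<And>L. \<lbrakk>L \<in> ?S; M \<subseteq> L\<rbrakk> \<Longrightarrow> L = M"
    using fd_space_maximal[OF assms(1), of I ?S] left_ideal_subspace assms(2,3) by blast
  have "J = M \<or> J = carrier A" if "left_ideal J A" "M \<subseteq> J" for J
    using M(1) M(2)[of J] that left_ideal_one[of J] by blast
  then have "maximal_left_ideal M A" using M(1) by (auto simp: maximal_left_ideal_def)
  then show ?thesis using that M(1) by blast
qed

lemma left_ideal_rad: "left_ideal rad A"
  unfolding jacobson_radical_def
  by (rule left_idealI) (auto simp: maximal_left_ideal_def dest: left_idealD)

text \<open>Otherwise the left ideal generated by \<open>1 - x\<close> lies in a maximal left ideal;
  that ideal also contains \<open>x\<close>, hence contains the unit.\<close>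

lemma rad_left_inverse:
  assumes "fd_space K A" "x \<in> rad"
  obtains v where "v \<in> carrier A" "v \<otimes>\<^bsub>A\<^esub> (\<one>\<^bsub>A\<^esub> \<ominus>\<^bsub>A\<^esub> x) = \<one>\<^bsub>A\<^esub>"
proof -
  have x: "x \<in> carrier A" using assms(2) by (simp add: jacobson_radical_def)
  let ?I = "(\<lambda>v. v \<otimes>\<^bsub>A\<^esub> (\<one>\<^bsub>A\<^esub> \<ominus>\<^bsub>A\<^esub> x)) ` carrier A"
  have I: "left_ideal ?I A"
  proof (rule left_idealI)
    show "\<zero>\<^bsub>A\<^esub> \<in> ?I" using x by (intro image_eqI[of _ _ "\<zero>\<^bsub>A\<^esub>"]) auto
  next
    fix u v assume "u \<in> ?I" "v \<in> ?I"
    then obtain a b where ab: "a \<in> carrier A" "b \<in> carrier A" "u = a \<otimes>\<^bsub>A\<^esub> (\<one>\<^bsub>A\<^esub> \<ominus>\<^bsub>A\<^esub> x)" "v = b \<otimes>\<^bsub>A\<^esub> (\<one>\<^bsub>A\<^esub> \<ominus>\<^bsub>A\<^esub> x)" by auto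
    then show "u \<oplus>\<^bsub>A\<^esub> v \<in> ?I" using x by (intro image_eqI[of _ _ "a \<oplus>\<^bsub>A\<^esub> b"]) (auto simp: A.l_distr)
  next
    fix a v assume a: "a \<in> carrier A" and "v \<in> ?I"
    then obtain b where b: "b \<in> carrier A" "v = b \<otimes>\<^bsub>A\<^esub> (\<one>\<^bsub>A\<^esub> \<ominus>\<^bsub>A\<^esub> x)" by auto
    then show "a \<otimes>\<^bsub>A\<^esub> v \<in> ?I" using a x by (intro image_eqI[of _ _ "a \<otimes>\<^bsub>A\<^esub> b"]) (auto simp: A.m_assoc)
  qed (use x in auto)
  have "\<one>\<^bsub>A\<^esub> \<in> ?I"
  proof (rule ccontr)
    assume "\<one>\<^bsub>A\<^esub> \<notin> ?I"
    then obtain M where M: "maximal_left_ideal M A" "?I \<subseteq> M" using maximal_left_idealE[OF assms(1) I] by blast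
    then have lM: "left_ideal M A" "M \<noteq> carrier A" by (simp_all add: maximal_left_ideal_def)
    have "\<one>\<^bsub>A\<^esub> \<ominus>\<^bsub>A\<^esub> x \<in> ?I" using x by (intro image_eqI[of _ _ "\<one>\<^bsub>A\<^esub>"]) auto
    then have 1: "\<one>\<^bsub>A\<^esub> \<ominus>\<^bsub>A\<^esub> x \<in> M" using M(2) by (rule rev_subsetD)
    have "x \<in> M" using assms(2) M(1) by (simp add: jacobson_radical_def)
    then have "(\<one>\<^bsub>A\<^esub> \<ominus>\<^bsub>A\<^esub> x) \<oplus>\<^bsub>A\<^esub> x \<in> M" using left_idealD(3)[OF lM(1)] 1 by blast
    also have "(\<one>\<^bsub>A\<^esub> \<ominus>\<^bsub>A\<^esub> x) \<oplus>\<^bsub>A\<^esub> x = \<one>\<^bsub>A\<^esub>" using x by (simp add: a_minus_def A.a_assoc A.l_neg)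
    finally show False using left_ideal_one[OF lM(1)] lM(2) by blast
  qed
  then obtain v where "v \<in> carrier A" "\<one>\<^bsub>A\<^esub> = v \<otimes>\<^bsub>A\<^esub> (\<one>\<^bsub>A\<^esub> \<ominus>\<^bsub>A\<^esub> x)" by blast
  then show ?thesis using that by metis
qed

text \<open>A left inverse \<open>v\<close> of \<open>1 - x\<close> satisfies
  \<open>v = 1 + v x\<close> with \<open>v x\<close> in the radical, so \<open>v\<close> has a left
  inverse \<open>w\<close> by the same lemma. Having the right inverse \<open>1 - x\<close> as well,
  \<open>v\<close> forces \<open>w = 1 - x\<close>.\<close>

lemma rad_right_inverse:
  assumes "fd_space K A" "x \<in> rad"
  obtains v where "v \<in> carrier A" "(\<one>\<^bsub>A\<^esub> \<ominus>\<^bsub>A\<^esub> x) \<otimes>\<^bsub>A\<^esub> v = \<one>\<^bsub>A\<^esub>"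
proof -
  have x: "x \<in> carrier A" using assms(2) by (simp add: jacobson_radical_def)
  obtain v where v: "v \<in> carrier A" "v \<otimes>\<^bsub>A\<^esub> (\<one>\<^bsub>A\<^esub> \<ominus>\<^bsub>A\<^esub> x) = \<one>\<^bsub>A\<^esub>"
    using rad_left_inverse[OF assms] by blast
  have "\<ominus>\<^bsub>A\<^esub> (v \<otimes>\<^bsub>A\<^esub> x) \<in> rad"
    using left_idealD(4,5)[OF left_ideal_rad] v(1) assms(2) by blast
  then obtain w where w: "w \<in> carrier A" "w \<otimes>\<^bsub>A\<^esub> (\<one>\<^bsub>A\<^esub> \<ominus>\<^bsub>A\<^esub> \<ominus>\<^bsub>A\<^esub> (v \<otimes>\<^bsub>A\<^esub> x)) = \<one>\<^bsub>A\<^esub>"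
    using rad_left_inverse[OF assms(1)] by blast
  have "v \<ominus>\<^bsub>A\<^esub> v \<otimes>\<^bsub>A\<^esub> x = \<one>\<^bsub>A\<^esub>" using v x by (simp add: a_minus_def A.r_distr A.r_minus)
  moreover have "(v \<ominus>\<^bsub>A\<^esub> v \<otimes>\<^bsub>A\<^esub> x) \<oplus>\<^bsub>A\<^esub> v \<otimes>\<^bsub>A\<^esub> x = v"
    using v(1) x by (simp add: a_minus_def A.a_assoc A.l_neg)
  ultimately have "v = \<one>\<^bsub>A\<^esub> \<oplus>\<^bsub>A\<^esub> v \<otimes>\<^bsub>A\<^esub> x" by simp
  then have wv: "w \<otimes>\<^bsub>A\<^esub> v = \<one>\<^bsub>A\<^esub>" using w v(1) x by (simp add: a_minus_def)
  have "w = w \<otimes>\<^bsub>A\<^esub> (v \<otimes>\<^bsub>A\<^esub> (\<one>\<^bsub>A\<^esub> \<ominus>\<^bsub>A\<^esub> x))" using v(2) w(1) by simp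
  also have "\<dots> = \<one>\<^bsub>A\<^esub> \<ominus>\<^bsub>A\<^esub> x" using wv v(1) w(1) x by (simp add: A.m_assoc[symmetric])
  finally have "(\<one>\<^bsub>A\<^esub> \<ominus>\<^bsub>A\<^esub> x) \<otimes>\<^bsub>A\<^esub> v = \<one>\<^bsub>A\<^esub>" using wv by simp
  with v(1) that show ?thesis by blast
qed

text \<open>The radical is defined by left ideals, so closure on the right needs an argument. If
  \<open>x a\<close> were outside a maximal left ideal \<open>I\<close>, then
  \<open>a = i + c x a\<close> for some \<open>i\<close> in \<open>I\<close>, that is
  \<open>(1 - c x) a = i\<close>. As \<open>1 - c x\<close> is left invertible, \<open>a\<close> and
  hence \<open>x a\<close> would lie in \<open>I\<close>.\<close>

lemma rad_right_ideal:
  assumes "fd_space K A" "x \<in> rad" "a \<in> carrier A"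
  shows "x \<otimes>\<^bsub>A\<^esub> a \<in> rad"
proof -
  have x: "x \<in> carrier A" using assms(2) by (simp add: jacobson_radical_def)
  have "x \<otimes>\<^bsub>A\<^esub> a \<in> I" if I: "maximal_left_ideal I A" for I
  proof (rule ccontr)
    assume xa: "x \<otimes>\<^bsub>A\<^esub> a \<notin> I"
    have lI: "left_ideal I A" using I by (simp add: maximal_left_ideal_def)
    note s = left_idealD[OF lI]
    \<comment> \<open>The left ideal generated by \<open>I\<close> and \<open>x a\<close>; by
      maximality it is the whole algebra.\<close>
    let ?L = "{i \<oplus>\<^bsub>A\<^esub> c \<otimes>\<^bsub>A\<^esub> (x \<otimes>\<^bsub>A\<^esub> a) | i c. i \<in> I \<and> c \<in> carrier A}"
    have xac: "x \<otimes>\<^bsub>A\<^esub> a \<in> carrier A" using x assms(3) by simp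
    have L: "left_ideal ?L A"
    proof (rule left_idealI)
      show "?L \<subseteq> carrier A" using s(1) xac by auto
      show "\<zero>\<^bsub>A\<^esub> \<in> ?L" using s(2) xac by (auto intro!: exI[of _ "\<zero>\<^bsub>A\<^esub>"])
    next
      fix u v assume "u \<in> ?L" "v \<in> ?L"
      then obtain i c j d where *: "i \<in> I" "c \<in> carrier A" "u = i \<oplus>\<^bsub>A\<^esub> c \<otimes>\<^bsub>A\<^esub> (x \<otimes>\<^bsub>A\<^esub> a)"
        "j \<in> I" "d \<in> carrier A" "v = j \<oplus>\<^bsub>A\<^esub> d \<otimes>\<^bsub>A\<^esub> (x \<otimes>\<^bsub>A\<^esub> a)" by auto
      have "i \<in> carrier A" "j \<in> carrier A" using s(1) * by auto
      then have "u \<oplus>\<^bsub>A\<^esub> v = (i \<oplus>\<^bsub>A\<^esub> j) \<oplus>\<^bsub>A\<^esub> (c \<oplus>\<^bsub>A\<^esub> d) \<otimes>\<^bsub>A\<^esub> (x \<otimes>\<^bsub>A\<^esub> a)"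
        using * xac by (simp add: A.l_distr A.a_ac)
      then show "u \<oplus>\<^bsub>A\<^esub> v \<in> ?L" using s(3) * by blast
    next
      fix b u assume b: "b \<in> carrier A" and "u \<in> ?L"
      then obtain i c where *: "i \<in> I" "c \<in> carrier A" "u = i \<oplus>\<^bsub>A\<^esub> c \<otimes>\<^bsub>A\<^esub> (x \<otimes>\<^bsub>A\<^esub> a)" by auto
      have "i \<in> carrier A" using s(1) * by auto
      then have "b \<otimes>\<^bsub>A\<^esub> u = b \<otimes>\<^bsub>A\<^esub> i \<oplus>\<^bsub>A\<^esub> (b \<otimes>\<^bsub>A\<^esub> c) \<otimes>\<^bsub>A\<^esub> (x \<otimes>\<^bsub>A\<^esub> a)"
        using * b xac by (simp add: A.r_distr A.m_assoc[of b c])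
      then show "b \<otimes>\<^bsub>A\<^esub> u \<in> ?L" using s(4) * b by blast
    qed
    have mx: "J = I \<or> J = carrier A" if "left_ideal J A" "I \<subseteq> J" for J
      using I that by (simp add: maximal_left_ideal_def)
    have sub: "I \<subseteq> ?L"
    proof
      fix i assume "i \<in> I"
      moreover then have "i = i \<oplus>\<^bsub>A\<^esub> \<zero>\<^bsub>A\<^esub> \<otimes>\<^bsub>A\<^esub> (x \<otimes>\<^bsub>A\<^esub> a)" using s(1) xac by auto
      ultimately show "i \<in> ?L" by blast
    qed
    have mem: "x \<otimes>\<^bsub>A\<^esub> a \<in> ?L"
    proof -
      have "x \<otimes>\<^bsub>A\<^esub> a = \<zero>\<^bsub>A\<^esub> \<oplus>\<^bsub>A\<^esub> \<one>\<^bsub>A\<^esub> \<otimes>\<^bsub>A\<^esub> (x \<otimes>\<^bsub>A\<^esub> a)" using xac by simp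
      then show ?thesis using s(2) by blast
    qed
    have ne: "?L \<noteq> I"
    proof
      assume "?L = I"
      then have "x \<otimes>\<^bsub>A\<^esub> a \<in> I" using mem by (rule subst)
      then show False using xa by simp
    qed
    have "?L = carrier A" by (rule mx[OF L sub, THEN disjE]) (erule notE[OF ne], assumption)
    then have "a \<in> ?L" using assms(3) by (rule ssubst)
    then obtain i c where ic: "i \<in> I" "c \<in> carrier A" "a = i \<oplus>\<^bsub>A\<^esub> c \<otimes>\<^bsub>A\<^esub> (x \<otimes>\<^bsub>A\<^esub> a)"
      by blast
    have i: "i \<in> carrier A" using ic(1) s(1) by auto
    have "c \<otimes>\<^bsub>A\<^esub> x \<in> rad" using left_idealD(4)[OF left_ideal_rad] ic(2) assms(2) by blast
    then obtain v where v: "v \<in> carrier A" "v \<otimes>\<^bsub>A\<^esub> (\<one>\<^bsub>A\<^esub> \<ominus>\<^bsub>A\<^esub> c \<otimes>\<^bsub>A\<^esub> x) = \<one>\<^bsub>A\<^esub>"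
      using rad_left_inverse[OF assms(1)] by blast
    have "(\<one>\<^bsub>A\<^esub> \<ominus>\<^bsub>A\<^esub> c \<otimes>\<^bsub>A\<^esub> x) \<otimes>\<^bsub>A\<^esub> a = a \<ominus>\<^bsub>A\<^esub> c \<otimes>\<^bsub>A\<^esub> (x \<otimes>\<^bsub>A\<^esub> a)"
      using ic(2) x assms(3) by (simp add: a_minus_def A.l_distr A.l_minus A.m_assoc)
    also have "\<dots> = i"
    proof -
      have "i \<oplus>\<^bsub>A\<^esub> c \<otimes>\<^bsub>A\<^esub> (x \<otimes>\<^bsub>A\<^esub> a) \<ominus>\<^bsub>A\<^esub> c \<otimes>\<^bsub>A\<^esub> (x \<otimes>\<^bsub>A\<^esub> a) = i"
        using i ic(2) xac by (simp add: a_minus_def A.a_assoc A.r_neg)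
      then show ?thesis using ic(3) by simp
    qed
    finally have "v \<otimes>\<^bsub>A\<^esub> ((\<one>\<^bsub>A\<^esub> \<ominus>\<^bsub>A\<^esub> c \<otimes>\<^bsub>A\<^esub> x) \<otimes>\<^bsub>A\<^esub> a) \<in> I" using s(4)[OF v(1) ic(1)] by simp
    also have "v \<otimes>\<^bsub>A\<^esub> ((\<one>\<^bsub>A\<^esub> \<ominus>\<^bsub>A\<^esub> c \<otimes>\<^bsub>A\<^esub> x) \<otimes>\<^bsub>A\<^esub> a) = a"
      using v ic(2) x assms(3) by (simp add: A.m_assoc[symmetric])
    finally show False using s(4)[OF x] xa by blast
  qed
  then show ?thesis using x assms(3) by (simp add: jacobson_radical_def)
qed

lemma ideal_rad:
  assumes "fd_space K A"
  shows "ideal rad A"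
proof (rule idealI[OF is_ring_A])
  show "subgroup rad (add_monoid A)"
    using left_idealD[OF left_ideal_rad]
    by (intro group.subgroupI[OF A.a_group]) (auto simp: a_inv_def)
qed (use left_idealD(4)[OF left_ideal_rad] rad_right_ideal[OF assms] in auto)

end

context enveloping
begin

abbreviation "rad \<equiv> jacobson_radical \<Lambda>"

text \<open>A maximal right submodule of \<open>Z\<close> contains \<open>Z rad\<close>, and so does the largest sub-bimodule
  inside it.\<close>

lemma nakayama:
  assumes fd: "fd_space K \<Lambda>" and Z: "fd_left_module K E Z" and nz: "carrier Z \<noteq> {\<zero>\<^bsub>Z\<^esub>}"
  obtains W where "submod E Z W" "W \<noteq> carrier Z" "\<And>j z. \<lbrakk>j \<in> rad; z \<in> carrier Z\<rbrakk> \<Longrightarrow> rgt j \<odot>\<^bsub>Z\<^esub> z \<in> W"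
proof -
  note lZ = fd_left_moduleD(1)[OF Z]
  interpret Z: left_module E Z by (rule lZ)
  let ?R = "pullback rgt Z"
  have lR: "left_module (op_algebra \<Lambda>) ?R" by (rule left_module_pullback[OF lZ op.is_ring_A rgt_hom])
  interpret R: left_module "op_algebra \<Lambda>" ?R by (rule lR)
  have radc: "j \<in> carrier \<Lambda>" if "j \<in> rad" for j using that by (simp add: jacobson_radical_def)
  \<comment> \<open>Proper right submodules. They are subspaces because the field acts on
    \<open>Z\<close> in the same way from either side, so a maximal one exists.\<close>
  let ?S = "{N. submod (op_algebra \<Lambda>) ?R N \<and> N \<noteq> carrier Z}"
  have sub: "submod K (scalars E Z) N" if "N \<in> ?S" for N
  proof -
    have N: "submod (op_algebra \<Lambda>) ?R N" using that by simp
    have "(c \<odot>\<^bsub>E\<^esub> \<one>\<^bsub>E\<^esub>) \<odot>\<^bsub>Z\<^esub> x \<in> N" if "c \<in> carrier K" "x \<in> N" for c x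
      using submodD(5)[OF N, of "c \<odot>\<^bsub>\<Lambda>\<^esub> \<one>\<^bsub>\<Lambda>\<^esub>" x] that by (simp add: rgt_def pe_smult_right E_one)
    then show ?thesis using submodD[OF N] by (intro submodI) auto
  qed
  have "{\<zero>\<^bsub>Z\<^esub>} \<in> ?S" using R.submod_zero nz by auto
  then obtain N where N: "N \<in> ?S" "\<And>N'. \<lbrakk>N' \<in> ?S; N \<subseteq> N'\<rbrakk> \<Longrightarrow> N' = N"
    using fd_space_maximal[OF fd_left_moduleD(2)[OF Z], of "{\<zero>\<^bsub>Z\<^esub>}" ?S] sub by blast
  have sN: "submod (op_algebra \<Lambda>) ?R N" using N(1) by simp
  note s = submodD[OF sN, simplified]
  \<comment> \<open>If \<open>z j\<close> is outside \<open>N\<close>, then \<open>N\<close> and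
    \<open>z j\<close> generate \<open>Z\<close>, so \<open>z = n + z j b\<close> for some
    \<open>n\<close> in \<open>N\<close>. Hence \<open>z (1 - j b) = n\<close>, and a right inverse
    of \<open>1 - j b\<close> puts \<open>z\<close> into \<open>N\<close>.\<close>
  have claim: "rgt j \<odot>\<^bsub>Z\<^esub> z \<in> N" if j: "j \<in> rad" and z: "z \<in> carrier Z" for j z
  proof (rule ccontr)
    assume y: "rgt j \<odot>\<^bsub>Z\<^esub> z \<notin> N"
    let ?y = "rgt j \<odot>\<^bsub>Z\<^esub> z"
    have yc: "?y \<in> carrier Z" using z radc[OF j] by simp
    let ?N = "{n \<oplus>\<^bsub>Z\<^esub> rgt b \<odot>\<^bsub>Z\<^esub> ?y | n b. n \<in> N \<and> b \<in> carrier \<Lambda>}"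
    have sub: "submod (op_algebra \<Lambda>) ?R ?N"
    proof (rule submodI)
      show "u \<in> carrier ?R" if "u \<in> ?N" for u using that s(2) yc by auto
    next
      have "rgt \<zero>\<^bsub>\<Lambda>\<^esub> \<odot>\<^bsub>Z\<^esub> ?y = \<zero>\<^bsub>Z\<^esub>" using R.smult_zero_left[of ?y] yc by simp
      then show "\<zero>\<^bsub>?R\<^esub> \<in> ?N" using s(3) by (auto intro!: exI[of _ "\<zero>\<^bsub>Z\<^esub>"] exI[of _ "\<zero>\<^bsub>\<Lambda>\<^esub>"])
    next
      fix u v assume "u \<in> ?N" "v \<in> ?N"
      then obtain n b n' b' where *: "n \<in> N" "b \<in> carrier \<Lambda>" "u = n \<oplus>\<^bsub>Z\<^esub> rgt b \<odot>\<^bsub>Z\<^esub> ?y"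
        "n' \<in> N" "b' \<in> carrier \<Lambda>" "v = n' \<oplus>\<^bsub>Z\<^esub> rgt b' \<odot>\<^bsub>Z\<^esub> ?y" by auto
      have "rgt (b \<oplus>\<^bsub>\<Lambda>\<^esub> b') \<odot>\<^bsub>Z\<^esub> ?y = rgt b \<odot>\<^bsub>Z\<^esub> ?y \<oplus>\<^bsub>Z\<^esub> rgt b' \<odot>\<^bsub>Z\<^esub> ?y"
        using R.smult_l_distr[of b b' ?y] * yc by simp
      then have "u \<oplus>\<^bsub>Z\<^esub> v = (n \<oplus>\<^bsub>Z\<^esub> n') \<oplus>\<^bsub>Z\<^esub> rgt (b \<oplus>\<^bsub>\<Lambda>\<^esub> b') \<odot>\<^bsub>Z\<^esub> ?y"
        using * s(2) yc by (simp add: Z.M.a_ac)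
      moreover have "n \<oplus>\<^bsub>Z\<^esub> n' \<in> N" "b \<oplus>\<^bsub>\<Lambda>\<^esub> b' \<in> carrier \<Lambda>" using s(4) * by auto
      ultimately show "u \<oplus>\<^bsub>?R\<^esub> v \<in> ?N" unfolding pullback_simps by blast
    next
      fix c u assume c: "c \<in> carrier (op_algebra \<Lambda>)" and "u \<in> ?N"
      then obtain n b where *: "n \<in> N" "b \<in> carrier \<Lambda>" "u = n \<oplus>\<^bsub>Z\<^esub> rgt b \<odot>\<^bsub>Z\<^esub> ?y" by auto
      have "rgt c \<odot>\<^bsub>Z\<^esub> (rgt b \<odot>\<^bsub>Z\<^esub> ?y) = rgt (b \<otimes>\<^bsub>\<Lambda>\<^esub> c) \<odot>\<^bsub>Z\<^esub> ?y"
        using R.smult_assoc[of c b ?y] * c yc by simp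
      then have "rgt c \<odot>\<^bsub>Z\<^esub> u = rgt c \<odot>\<^bsub>Z\<^esub> n \<oplus>\<^bsub>Z\<^esub> rgt (b \<otimes>\<^bsub>\<Lambda>\<^esub> c) \<odot>\<^bsub>Z\<^esub> ?y"
        using * s(2) yc c by (simp add: Z.smult_r_distr)
      moreover have "rgt c \<odot>\<^bsub>Z\<^esub> n \<in> N" "b \<otimes>\<^bsub>\<Lambda>\<^esub> c \<in> carrier \<Lambda>" using s(5) c * by auto
      ultimately show "c \<odot>\<^bsub>?R\<^esub> u \<in> ?N" unfolding pullback_simps by blast
    qed
    have "N \<subseteq> ?N"
    proof
      fix n assume n: "n \<in> N"
      have "n = n \<oplus>\<^bsub>Z\<^esub> rgt \<zero>\<^bsub>\<Lambda>\<^esub> \<odot>\<^bsub>Z\<^esub> ?y" using R.smult_zero_left[of ?y] yc s(2)[OF n] by simp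
      then show "n \<in> ?N" using n by blast
    qed
    moreover have "?y \<in> ?N"
    proof -
      have "?y = \<zero>\<^bsub>Z\<^esub> \<oplus>\<^bsub>Z\<^esub> rgt \<one>\<^bsub>\<Lambda>\<^esub> \<odot>\<^bsub>Z\<^esub> ?y" using R.smult_one[of ?y] yc by simp
      then show ?thesis using s(3) by blast
    qed
    ultimately have "?N = carrier Z" using N(2)[of ?N] sub y by auto
    then have "z \<in> ?N" using z by simp
    then obtain n b where nb: "n \<in> N" "b \<in> carrier \<Lambda>" "z = n \<oplus>\<^bsub>Z\<^esub> rgt b \<odot>\<^bsub>Z\<^esub> ?y" by blast
    have jb: "j \<otimes>\<^bsub>\<Lambda>\<^esub> b \<in> rad" by (rule L.rad_right_ideal[OF fd j nb(2)])
    note jbc = radc[OF jb]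
    have "rgt b \<odot>\<^bsub>Z\<^esub> ?y = rgt (j \<otimes>\<^bsub>\<Lambda>\<^esub> b) \<odot>\<^bsub>Z\<^esub> z"
      using R.smult_assoc[of b j z] nb(2) radc[OF j] z by simp
    then have z': "z = n \<oplus>\<^bsub>Z\<^esub> rgt (j \<otimes>\<^bsub>\<Lambda>\<^esub> b) \<odot>\<^bsub>Z\<^esub> z" using nb(3) by simp
    have nc: "n \<in> carrier Z" using s(2)[OF nb(1)] .
    have rz: "rgt (j \<otimes>\<^bsub>\<Lambda>\<^esub> b) \<odot>\<^bsub>Z\<^esub> z \<in> carrier Z" using jbc z by simp
    have "rgt (\<one>\<^bsub>\<Lambda>\<^esub> \<ominus>\<^bsub>\<Lambda>\<^esub> j \<otimes>\<^bsub>\<Lambda>\<^esub> b) \<odot>\<^bsub>Z\<^esub> z = z \<oplus>\<^bsub>Z\<^esub> \<ominus>\<^bsub>Z\<^esub> (rgt (j \<otimes>\<^bsub>\<Lambda>\<^esub> b) \<odot>\<^bsub>Z\<^esub> z)"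
    proof -
      have "a_inv (op_algebra \<Lambda>) = a_inv \<Lambda>" "a_inv ?R = a_inv Z"
        by (simp_all add: a_inv_def m_inv_def fun_eq_iff)
      then show ?thesis
        using R.smult_l_distr[of "\<one>\<^bsub>\<Lambda>\<^esub>" "\<ominus>\<^bsub>\<Lambda>\<^esub> (j \<otimes>\<^bsub>\<Lambda>\<^esub> b)" z] R.smult_one[of z] R.smult_minus_left[of "j \<otimes>\<^bsub>\<Lambda>\<^esub> b" z] jbc z
        by (simp add: a_minus_def)
    qed
    also have "\<dots> = n"
    proof -
      have "(n \<oplus>\<^bsub>Z\<^esub> rgt (j \<otimes>\<^bsub>\<Lambda>\<^esub> b) \<odot>\<^bsub>Z\<^esub> z) \<oplus>\<^bsub>Z\<^esub> \<ominus>\<^bsub>Z\<^esub> (rgt (j \<otimes>\<^bsub>\<Lambda>\<^esub> b) \<odot>\<^bsub>Z\<^esub> z) = n"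
        using nc rz by (simp add: Z.M.a_assoc Z.M.r_neg)
      then show ?thesis using z' by simp
    qed
    finally have *: "rgt (\<one>\<^bsub>\<Lambda>\<^esub> \<ominus>\<^bsub>\<Lambda>\<^esub> j \<otimes>\<^bsub>\<Lambda>\<^esub> b) \<odot>\<^bsub>Z\<^esub> z = n" .
    obtain v where v: "v \<in> carrier \<Lambda>" "(\<one>\<^bsub>\<Lambda>\<^esub> \<ominus>\<^bsub>\<Lambda>\<^esub> j \<otimes>\<^bsub>\<Lambda>\<^esub> b) \<otimes>\<^bsub>\<Lambda>\<^esub> v = \<one>\<^bsub>\<Lambda>\<^esub>"
      using L.rad_right_inverse[OF fd jb] by blast
    have "rgt v \<odot>\<^bsub>Z\<^esub> n = z"
      using R.smult_assoc[of v "\<one>\<^bsub>\<Lambda>\<^esub> \<ominus>\<^bsub>\<Lambda>\<^esub> j \<otimes>\<^bsub>\<Lambda>\<^esub> b" z] R.smult_one[of z] v jbc z * by simp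
    then have "z \<in> N" using s(5)[OF v(1) nb(1)] by simp
    then show False using y s(5)[OF radc[OF j]] by blast
  qed
  define W where "W = {z \<in> carrier Z. \<forall>\<xi>\<in>carrier E. \<xi> \<odot>\<^bsub>Z\<^esub> z \<in> N}"
  have WN: "W \<subseteq> N" unfolding W_def using Z.smult_one E.A.one_closed by force
  show ?thesis
  proof (rule that[of W])
    show "submod E Z W"
      unfolding W_def
      by (rule submodI) (auto simp: s Z.smult_r_distr Z.smult_assoc[symmetric])
    show "W \<noteq> carrier Z" using WN s(1) N(1) by auto
  next
    fix j z assume j: "j \<in> rad" and z: "z \<in> carrier Z"
    have "\<xi> \<odot>\<^bsub>Z\<^esub> (rgt j \<odot>\<^bsub>Z\<^esub> z) \<in> N" if "\<xi> \<in> carrier E" for \<xi>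
      using that
    proof (induction \<xi> rule: E_induct)
      case (pure a b)
      \<comment> \<open>In bimodule notation \<open>a (z j) b = (a z) (j b)\<close>, and
        \<open>j b\<close> is again in the radical; so the claim for \<open>N\<close> also covers
        all multiples of \<open>z j\<close> by the enveloping algebra.\<close>
      have "pe a b \<otimes>\<^bsub>E\<^esub> rgt j = rgt (j \<otimes>\<^bsub>\<Lambda>\<^esub> b) \<otimes>\<^bsub>E\<^esub> lft a"
        using pure radc[OF j] by (simp add: rgt_def lft_def pe_mult)
      then have "pe a b \<odot>\<^bsub>Z\<^esub> (rgt j \<odot>\<^bsub>Z\<^esub> z) = rgt (j \<otimes>\<^bsub>\<Lambda>\<^esub> b) \<odot>\<^bsub>Z\<^esub> (lft a \<odot>\<^bsub>Z\<^esub> z)"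
        using pure radc[OF j] z by (simp add: Z.smult_assoc[symmetric])
      then show ?case using claim[OF L.rad_right_ideal[OF fd j pure(2)]] pure z by simp
    qed (use s(4) radc[OF j] z in \<open>simp add: Z.smult_l_distr\<close>)
    then show "rgt j \<odot>\<^bsub>Z\<^esub> z \<in> W" unfolding W_def using radc[OF j] z by simp
  qed
qed

end

subsection \<open>Separability\<close>

context algebra_over_field
begin

abbreviation "S \<equiv> quotient_algebra A rad"
abbreviation "res a \<equiv> rad +>\<^bsub>A\<^esub> a"

lemma submod_rad: "submod K A rad"
  by (rule left_ideal_subspace[OF left_ideal_rad])

lemma S_simps:
  "carrier S = res ` carrier A" "add S = set_add A" "zero S = rad" "\<one>\<^bsub>S\<^esub> = res \<one>\<^bsub>A\<^esub>"
  "mult S = rcoset_mult A rad" "smult S = (\<lambda>c F. (\<Union>x\<in>F. rad +>\<^bsub>A\<^esub> (c \<odot>\<^bsub>A\<^esub> x)))"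
  by (auto simp: quotient_algebra_def ring.defs module.defs FactRing_def A_RCOSETS_def RCOSETS_def a_r_coset_def)

lemma res_ops:
  assumes "fd_space K A"
  shows "\<lbrakk>a \<in> carrier A; b \<in> carrier A\<rbrakk> \<Longrightarrow> res a \<oplus>\<^bsub>S\<^esub> res b = res (a \<oplus>\<^bsub>A\<^esub> b)"
    "\<lbrakk>a \<in> carrier A; b \<in> carrier A\<rbrakk> \<Longrightarrow> res a \<otimes>\<^bsub>S\<^esub> res b = res (a \<otimes>\<^bsub>A\<^esub> b)"
    "\<lbrakk>c \<in> carrier K; a \<in> carrier A\<rbrakk> \<Longrightarrow> c \<odot>\<^bsub>S\<^esub> res a = res (c \<odot>\<^bsub>A\<^esub> a)"
    "a \<in> carrier A \<Longrightarrow> res a \<in> carrier S"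
proof -
  interpret V: left_module K A by (rule left_module_self)
  interpret I: ideal rad A by (rule ideal_rad[OF assms])
  show "\<lbrakk>a \<in> carrier A; b \<in> carrier A\<rbrakk> \<Longrightarrow> res a \<oplus>\<^bsub>S\<^esub> res b = res (a \<oplus>\<^bsub>A\<^esub> b)"
    by (simp add: S_simps V.coset_add[OF submod_rad])
  show "\<lbrakk>a \<in> carrier A; b \<in> carrier A\<rbrakk> \<Longrightarrow> res a \<otimes>\<^bsub>S\<^esub> res b = res (a \<otimes>\<^bsub>A\<^esub> b)"
    by (simp add: S_simps I.rcoset_mult_add)
  show "\<lbrakk>c \<in> carrier K; a \<in> carrier A\<rbrakk> \<Longrightarrow> c \<odot>\<^bsub>S\<^esub> res a = res (c \<odot>\<^bsub>A\<^esub> a)"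
    by (simp add: S_simps V.coset_smult[OF submod_rad])
  show "a \<in> carrier A \<Longrightarrow> res a \<in> carrier S" by (simp add: S_simps)
qed

lemma S_cases:
  assumes "s \<in> carrier S"
  obtains a where "a \<in> carrier A" "s = res a"
  using assms by (auto simp: S_simps)

lemma algebra_S:
  assumes "fd_space K A"
  shows "algebra_over_field K S" "fd_space K S"
proof -
  note ops = res_ops[OF assms]
  interpret V: left_module K A by (rule left_module_self)
  have zero: "res \<zero>\<^bsub>A\<^esub> = \<zero>\<^bsub>S\<^esub>"
    using V.coset_eq_zero_iff[OF submod_rad, of "\<zero>\<^bsub>A\<^esub>"] submodD(3)[OF submod_rad] by (simp add: S_simps)
  have m: "left_module K S"
    by (rule left_module_surj[OF left_module_self, where \<pi> = "\<lambda>a. res a"]) (simp_all add: zero ops, simp add: S_simps)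
  have mm: "Module.module K S" using m left_module_iff_module[OF K.is_cring] by blast
  have "ring S"
  proof (intro ringI monoidI left_module.axioms(2)[OF m])
    show "\<one>\<^bsub>S\<^esub> \<in> carrier S" by (simp add: S_simps)
  qed (auto elim!: S_cases simp: ops S_simps(4) A.m_assoc A.l_distr A.r_distr)
  then show "algebra_over_field K S"
    by (intro algebra_over_field.intro K.field_axioms assoc_algebra.intro mm assoc_algebra_axioms.intro)
      (auto elim!: S_cases simp: ops A.smult_mult_left A.smult_mult_right)
  show "fd_space K S"
    by (rule fd_space_image[OF assms m, of "\<lambda>a. res a"]) (auto intro!: mhomI simp: ops S_simps(1))
qed

text \<open>The multiplication map from the enveloping algebra of \<open>S\<close> onto
  \<open>S\<close> splits by projectivity, and \<open>e\<close> is the image of the unit under a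
  section \<open>\<sigma>\<close>. Since \<open>\<sigma>\<close> is a bimodule map,
  \<open>(s \<otimes> 1) e\<close> and \<open>(1 \<otimes> s) e\<close> both equal
  \<open>\<sigma> s\<close>.\<close>

lemma separability_idempotent:
  assumes "fd_space K A" and sep: "separable_algebra K S"
  obtains e where "e \<in> carrier (enveloping_algebra K S)"
    "e \<odot>\<^bsub>env_left K S (regular_bimodule S)\<^esub> \<one>\<^bsub>S\<^esub> = \<one>\<^bsub>S\<^esub>"
    "\<And>s. s \<in> carrier S \<Longrightarrow>
      pure_tensor K (regular_module K) S (op_algebra S) s \<one>\<^bsub>S\<^esub> \<otimes>\<^bsub>enveloping_algebra K S\<^esub> e =
      pure_tensor K (regular_module K) S (op_algebra S) \<one>\<^bsub>S\<^esub> s \<otimes>\<^bsub>enveloping_algebra K S\<^esub> e"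
proof -
  interpret S: enveloping K S by (intro enveloping.intro algebra_S[OF assms(1)])
  interpret X: bimodule_over K S "regular_bimodule S" by unfold_locales (rule S.bimodule_regular)
  have Xs: "carrier X.XL = carrier S" "smult (regular_bimodule S) = mult S" "rsmult (regular_bimodule S) = mult S"
    "carrier (regular_bimodule S) = carrier S"
    by (simp_all add: regular_bimodule_def)
  have proj: "fg_projective S.E X.XL"
    using sep S.E.projective_imp_fg_projective[OF S.fd_space_E[OF algebra_S(2)[OF assms(1)]]]
    by (simp add: separable_algebra_def)
  have lE: "left_module S.E (regular_module S.E)" by (rule left_module_regular[OF S.E.is_ring_A])
  have act: "S.pe a b \<odot>\<^bsub>X.XL\<^esub> x = a \<otimes>\<^bsub>S\<^esub> x \<otimes>\<^bsub>S\<^esub> b" if "a \<in> carrier S" "b \<in> carrier S" "x \<in> carrier S" for a b x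
    using that by (simp add: X.env_left_pure Xs)
  \<comment> \<open>Acting on the unit is the multiplication map
    \<open>a \<otimes> b \<mapsto> a b\<close>.\<close>
  let ?\<mu> = "\<lambda>\<xi>. \<xi> \<odot>\<^bsub>X.XL\<^esub> \<one>\<^bsub>S\<^esub>"
  have \<mu>: "?\<mu> \<in> mhom S.E (regular_module S.E) X.XL"
    by (rule mhom_smult_const[OF X.left_module_env_left mhom_id]) (simp add: Xs)
  have "x \<in> ?\<mu> ` carrier (regular_module S.E)" if "x \<in> carrier X.XL" for x
    using that by (intro image_eqI[of _ _ "S.pe x \<one>\<^bsub>S\<^esub>"]) (auto simp: act Xs)
  then obtain \<sigma> where \<sigma>: "\<sigma> \<in> mhom S.E X.XL (regular_module S.E)" "\<And>x. x \<in> carrier X.XL \<Longrightarrow> ?\<mu> (\<sigma> x) = x"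
    using fg_projective_lift[OF X.left_module_env_left lE X.left_module_env_left proj \<mu> mhom_id] by metis
  have pe: "S.pe a b \<otimes>\<^bsub>S.E\<^esub> \<sigma> \<one>\<^bsub>S\<^esub> = \<sigma> (a \<otimes>\<^bsub>S\<^esub> b)" if "a \<in> carrier S" "b \<in> carrier S" for a b
    using mhom_smult[OF \<sigma>(1), of "S.pe a b" "\<one>\<^bsub>S\<^esub>"] that by (simp add: act Xs)
  show ?thesis
  proof (rule that[of "\<sigma> \<one>\<^bsub>S\<^esub>"])
    show "\<sigma> \<one>\<^bsub>S\<^esub> \<in> carrier S.E" using mhom_closed[OF \<sigma>(1), of "\<one>\<^bsub>S\<^esub>"] by (simp add: Xs)
    show "?\<mu> (\<sigma> \<one>\<^bsub>S\<^esub>) = \<one>\<^bsub>S\<^esub>" using \<sigma>(2)[of "\<one>\<^bsub>S\<^esub>"] by (simp add: Xs)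
  qed (simp add: pe)
qed

end

subsection \<open>Vanishing of extension groups\<close>

text \<open>Exactness at \<open>P (m + 1)\<close> of the complex of homomorphisms from \<open>P\<close> to \<open>Y\<close>; for a projective
  resolution \<open>P\<close> of \<open>M\<close> this says \<open>Ext\<^sup>m\<^sup>+\<^sup>1(M, Y) = 0\<close>.\<close>

definition acyc where
  "acyc A P D m Y \<longleftrightarrow> (\<forall>f\<in>mhom A (P (Suc m)) Y.
     (\<forall>x\<in>carrier (P (Suc (Suc m))). f (D (Suc m) x) = \<zero>\<^bsub>Y\<^esub>) \<longrightarrow>
     (\<exists>g\<in>mhom A (P m) Y. \<forall>x\<in>carrier (P (Suc m)). f x = g (D m x)))"

lemma acycI:
  assumes "\<And>f. \<lbrakk>f \<in> mhom A (P (Suc m)) Y; \<And>x. x \<in> carrier (P (Suc (Suc m))) \<Longrightarrow> f (D (Suc m) x) = \<zero>\<^bsub>Y\<^esub>\<rbrakk>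
    \<Longrightarrow> \<exists>g\<in>mhom A (P m) Y. \<forall>x\<in>carrier (P (Suc m)). f x = g (D m x)"
  shows "acyc A P D m Y"
  using assms by (simp add: acyc_def)

lemma acycE:
  assumes "acyc A P D m Y" "f \<in> mhom A (P (Suc m)) Y"
    "\<And>x. x \<in> carrier (P (Suc (Suc m))) \<Longrightarrow> f (D (Suc m) x) = \<zero>\<^bsub>Y\<^esub>"
  obtains g where "g \<in> mhom A (P m) Y" "\<And>x. x \<in> carrier (P (Suc m)) \<Longrightarrow> f x = g (D m x)"
  using assms by (auto simp: acyc_def)

text \<open>Exactness is not demanded: the fragments of long exact sequences below hold for every
  complex of projectives. It enters later, through \<open>projective_resolution\<close>.\<close>

locale projective_complex =
  fixes A :: "('a, 'r) ring_scheme" and P :: "nat \<Rightarrow> ('a, 'p) module" and D :: "nat \<Rightarrow> 'p \<Rightarrow> 'p"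
  assumes left_module_P: "left_module A (P n)" and fg_projective_P: "fg_projective A (P n)"
    and D_hom: "D n \<in> mhom A (P (Suc n)) (P n)"
    and D_D: "x \<in> carrier (P (Suc (Suc n))) \<Longrightarrow> D n (D (Suc n) x) = \<zero>\<^bsub>P n\<^esub>"
begin

lemma D_closed: "x \<in> carrier (P (Suc n)) \<Longrightarrow> D n x \<in> carrier (P n)"
  by (rule mhom_closed[OF D_hom])

text \<open>Push a cocycle along \<open>i\<close> into \<open>Y\<close>, bound it there, and bring
  the bounding cochain back along \<open>r\<close>.\<close>

lemma acyc_retract:
  assumes Y: "left_module A Y" and Y': "left_module A Y'" and i: "i \<in> mhom A Y' Y" and r: "r \<in> mhom A Y Y'"
    and ri: "\<And>y. y \<in> carrier Y' \<Longrightarrow> r (i y) = y" and ac: "acyc A P D m Y"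
  shows "acyc A P D m Y'"
proof (rule acycI)
  fix f assume f: "f \<in> mhom A (P (Suc m)) Y'"
    and z: "\<And>x. x \<in> carrier (P (Suc (Suc m))) \<Longrightarrow> f (D (Suc m) x) = \<zero>\<^bsub>Y'\<^esub>"
  obtain g where g: "g \<in> mhom A (P m) Y" "\<And>x. x \<in> carrier (P (Suc m)) \<Longrightarrow> i (f x) = g (D m x)"
    using acycE[OF ac mhom_comp[OF f i]] z mhom_zero[OF Y' Y i] by metis
  have "f x = r (g (D m x))" if "x \<in> carrier (P (Suc m))" for x
    using g(2)[OF that] ri[OF mhom_closed[OF f that]] by simp
  then show "\<exists>g\<in>mhom A (P m) Y'. \<forall>x\<in>carrier (P (Suc m)). f x = g (D m x)"
    using mhom_comp[OF g(1) r] by (intro bexI[of _ "\<lambda>x. r (g x)"]) auto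
qed

text \<open>The step shared by both long exact sequence arguments. A cochain that bounds
  \<open>q f\<close> is lifted to \<open>Y\<close> by projectivity; after its coboundary is
  subtracted, \<open>f\<close> takes values in the kernel of \<open>q\<close>, that is in
  \<open>Y'\<close>.\<close>

lemma lift_difference:
  assumes Y: "left_module A Y" and Y': "left_module A Y'" and Y'': "left_module A Y''"
    and i: "i \<in> mhom A Y' Y" "inj_on i (carrier Y')"
    and q: "q \<in> mhom A Y Y''" "q ` carrier Y = carrier Y''"
    and ker: "\<And>y. \<lbrakk>y \<in> carrier Y; q y = \<zero>\<^bsub>Y''\<^esub>\<rbrakk> \<Longrightarrow> y \<in> i ` carrier Y'"
    and f: "f \<in> mhom A (P (Suc m)) Y" and g'': "g'' \<in> mhom A (P m) Y''"
    and eq: "\<And>x. x \<in> carrier (P (Suc m)) \<Longrightarrow> q (f x) = g'' (D m x)"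
  obtains g h where "g \<in> mhom A (P m) Y" "h \<in> mhom A (P (Suc m)) Y'"
    "\<And>x. x \<in> carrier (P (Suc m)) \<Longrightarrow> i (h x) = f x \<ominus>\<^bsub>Y\<^esub> g (D m x)"
proof -
  interpret Y: left_module A Y by fact
  interpret Y'': left_module A Y'' by fact
  obtain g where g: "g \<in> mhom A (P m) Y" "\<And>x. x \<in> carrier (P m) \<Longrightarrow> q (g x) = g'' x"
    using fg_projective_lift[OF left_module_P Y Y'' fg_projective_P q(1) g''] q(2) mhom_closed[OF g''] by metis
  have d: "(\<lambda>x. f x \<ominus>\<^bsub>Y\<^esub> g (D m x)) \<in> mhom A (P (Suc m)) Y"
    by (rule mhom_minus_fun[OF Y f mhom_comp[OF D_hom g(1)]])
  have "f x \<ominus>\<^bsub>Y\<^esub> g (D m x) \<in> i ` carrier Y'" if x: "x \<in> carrier (P (Suc m))" for x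
  proof (rule ker[OF mhom_closed[OF d x]])
    have "q (f x \<ominus>\<^bsub>Y\<^esub> g (D m x)) = q (f x) \<ominus>\<^bsub>Y''\<^esub> q (g (D m x))"
      by (rule mhom_diff[OF Y Y'' q(1) mhom_closed[OF f x] mhom_closed[OF g(1) D_closed[OF x]]])
    also have "\<dots> = \<zero>\<^bsub>Y''\<^esub>"
      using eq[OF x] g(2)[OF D_closed[OF x]] mhom_closed[OF g'' D_closed[OF x]]
      by (simp add: a_minus_def Y''.M.r_neg)
    finally show "q (f x \<ominus>\<^bsub>Y\<^esub> g (D m x)) = \<zero>\<^bsub>Y''\<^esub>" .
  qed
  then obtain h where "h \<in> mhom A (P (Suc m)) Y'" "\<And>x. x \<in> carrier (P (Suc m)) \<Longrightarrow> i (h x) = f x \<ominus>\<^bsub>Y\<^esub> g (D m x)"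
    using mhom_factor[OF left_module_P Y Y' d i] by metis
  with g(1) show ?thesis by (rule that)
qed

text \<open>Exactness of the long sequence at its middle term: if Ext in degree \<open>m + 1\<close>
  vanishes for both ends of \<open>0 \<rightarrow> Y' \<rightarrow> Y \<rightarrow> Y''
  \<rightarrow> 0\<close>, it vanishes for \<open>Y\<close>.\<close>

lemma acyc_extension:
  assumes Y: "left_module A Y" and Y': "left_module A Y'" and Y'': "left_module A Y''"
    and i: "i \<in> mhom A Y' Y" "inj_on i (carrier Y')"
    and q: "q \<in> mhom A Y Y''" "q ` carrier Y = carrier Y''"
    and ker: "\<And>y. \<lbrakk>y \<in> carrier Y; q y = \<zero>\<^bsub>Y''\<^esub>\<rbrakk> \<Longrightarrow> y \<in> i ` carrier Y'"
    and ac': "acyc A P D m Y'" and ac'': "acyc A P D m Y''"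
  shows "acyc A P D m Y"
proof (rule acycI)
  interpret Y: left_module A Y by fact
  interpret Y': left_module A Y' by fact
  fix f assume f: "f \<in> mhom A (P (Suc m)) Y"
    and z: "\<And>x. x \<in> carrier (P (Suc (Suc m))) \<Longrightarrow> f (D (Suc m) x) = \<zero>\<^bsub>Y\<^esub>"
  obtain g'' where g'': "g'' \<in> mhom A (P m) Y''" "\<And>x. x \<in> carrier (P (Suc m)) \<Longrightarrow> q (f x) = g'' (D m x)"
    using acycE[OF ac'' mhom_comp[OF f q(1)]] z mhom_zero[OF Y Y'' q(1)] by metis
  obtain g h where g: "g \<in> mhom A (P m) Y" and h: "h \<in> mhom A (P (Suc m)) Y'"
    and ih: "\<And>x. x \<in> carrier (P (Suc m)) \<Longrightarrow> i (h x) = f x \<ominus>\<^bsub>Y\<^esub> g (D m x)"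
    using lift_difference[OF Y Y' Y'' i q ker f g''] by metis
  have "h (D (Suc m) x) = \<zero>\<^bsub>Y'\<^esub>" if x: "x \<in> carrier (P (Suc (Suc m)))" for x
  proof -
    have "i (h (D (Suc m) x)) = \<zero>\<^bsub>Y\<^esub> \<ominus>\<^bsub>Y\<^esub> \<zero>\<^bsub>Y\<^esub>"
      using ih[OF D_closed[OF x]] z[OF x] D_D[OF x] mhom_zero[OF left_module_P Y g] by simp
    also have "\<dots> = i \<zero>\<^bsub>Y'\<^esub>" using mhom_zero[OF Y' Y i(1)] by (simp add: a_minus_def Y.M.r_neg)
    finally show ?thesis
      using i(2) mhom_closed[OF h D_closed[OF x]] Y'.M.zero_closed by (auto dest: inj_onD)
  qed
  then obtain g' where g': "g' \<in> mhom A (P m) Y'" "\<And>x. x \<in> carrier (P (Suc m)) \<Longrightarrow> h x = g' (D m x)"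
    using acycE[OF ac' h] by metis
  have "f x = i (g' (D m x)) \<oplus>\<^bsub>Y\<^esub> g (D m x)" if x: "x \<in> carrier (P (Suc m))" for x
    using ih[OF x] g'(2)[OF x] mhom_closed[OF f x] mhom_closed[OF g D_closed[OF x]]
    by (simp add: a_minus_def Y.M.a_assoc Y.M.l_neg)
  then show "\<exists>g\<in>mhom A (P m) Y. \<forall>x\<in>carrier (P (Suc m)). f x = g (D m x)"
    using mhom_plus[OF Y mhom_comp[OF g'(1) i(1)] g] by (intro bexI[of _ "\<lambda>x. i (g' x) \<oplus>\<^bsub>Y\<^esub> g x"]) auto
qed

text \<open>Exactness around the connecting map: Ext of \<open>Y'\<close> in degree
  \<open>m + 2\<close> lies between Ext of \<open>Y''\<close> in degree \<open>m + 1\<close> and Ext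
  of \<open>Y\<close> in degree \<open>m + 2\<close>.\<close>

lemma acyc_shift:
  assumes Y: "left_module A Y" and Y': "left_module A Y'" and Y'': "left_module A Y''"
    and i: "i \<in> mhom A Y' Y" "inj_on i (carrier Y')"
    and q: "q \<in> mhom A Y Y''" "q ` carrier Y = carrier Y''"
    and ker: "\<And>y. \<lbrakk>y \<in> carrier Y; q y = \<zero>\<^bsub>Y''\<^esub>\<rbrakk> \<Longrightarrow> y \<in> i ` carrier Y'"
    and qi: "\<And>y. y \<in> carrier Y' \<Longrightarrow> q (i y) = \<zero>\<^bsub>Y''\<^esub>"
    and ac: "acyc A P D (Suc m) Y" and ac'': "acyc A P D m Y''"
  shows "acyc A P D (Suc m) Y'"
proof (rule acycI)
  interpret Y: left_module A Y by fact
  interpret Y': left_module A Y' by fact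
  fix f assume f: "f \<in> mhom A (P (Suc (Suc m))) Y'"
    and z: "\<And>x. x \<in> carrier (P (Suc (Suc (Suc m)))) \<Longrightarrow> f (D (Suc (Suc m)) x) = \<zero>\<^bsub>Y'\<^esub>"
  obtain g0 where g0: "g0 \<in> mhom A (P (Suc m)) Y" "\<And>x. x \<in> carrier (P (Suc (Suc m))) \<Longrightarrow> i (f x) = g0 (D (Suc m) x)"
    using acycE[OF ac mhom_comp[OF f i(1)]] z mhom_zero[OF Y' Y i(1)] by metis
  have "q (g0 (D (Suc m) x)) = \<zero>\<^bsub>Y''\<^esub>" if "x \<in> carrier (P (Suc (Suc m)))" for x
    using g0(2)[OF that, symmetric] qi[OF mhom_closed[OF f that]] by simp
  then obtain g'' where g'': "g'' \<in> mhom A (P m) Y''" "\<And>x. x \<in> carrier (P (Suc m)) \<Longrightarrow> q (g0 x) = g'' (D m x)"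
    using acycE[OF ac'' mhom_comp[OF g0(1) q(1)]] by metis
  obtain g h where g: "g \<in> mhom A (P m) Y" and h: "h \<in> mhom A (P (Suc m)) Y'"
    and ih: "\<And>x. x \<in> carrier (P (Suc m)) \<Longrightarrow> i (h x) = g0 x \<ominus>\<^bsub>Y\<^esub> g (D m x)"
    using lift_difference[OF Y Y' Y'' i q ker g0(1) g''] by metis
  have "f x = h (D (Suc m) x)" if x: "x \<in> carrier (P (Suc (Suc m)))" for x
  proof -
    have "\<ominus>\<^bsub>Y\<^esub> \<zero>\<^bsub>Y\<^esub> = \<zero>\<^bsub>Y\<^esub>" by (rule Y.M.minus_equality) simp_all
    then have "i (h (D (Suc m) x)) = i (f x)"
      using ih[OF D_closed[OF x]] g0(2)[OF x] D_D[OF x] mhom_zero[OF left_module_P Y g]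
        mhom_closed[OF g0(1) D_closed[OF x]]
      by (simp add: a_minus_def)
    then show ?thesis
      using i(2) mhom_closed[OF h D_closed[OF x]] mhom_closed[OF f x] by (auto dest: inj_onD)
  qed
  then show "\<exists>g\<in>mhom A (P (Suc m)) Y'. \<forall>x\<in>carrier (P (Suc (Suc m))). f x = g (D (Suc m) x)"
    using h by blast
qed

end

subsection \<open>Coinduced bimodules\<close>

context enveloping
begin

text \<open>The bimodule of linear maps from a left \<open>\<Lambda>\<close>-module \<open>U\<close> to \<open>Y\<close>; it depends only on the left
  \<open>\<Lambda>\<close>-module structure of \<open>Y\<close>.\<close>

definition coind ::
    "('a, 'u) module \<Rightarrow> (('a \<times> 'a \<Rightarrow> 'k) set, 'y) module \<Rightarrow> ('a, 'u \<Rightarrow> 'y) bimodule" where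
  "coind U Y =
    \<lparr>carrier = mhom K (scalars \<Lambda> U) (scalars E Y) \<inter> extensional (carrier U),
     mult = undefined, one = undefined, zero = (\<lambda>u\<in>carrier U. \<zero>\<^bsub>Y\<^esub>),
     add = \<lambda>f g. \<lambda>u\<in>carrier U. f u \<oplus>\<^bsub>Y\<^esub> g u,
     smult = \<lambda>a f. \<lambda>u\<in>carrier U. lft a \<odot>\<^bsub>Y\<^esub> f u,
     rsmult = \<lambda>f b. \<lambda>u\<in>carrier U. f (b \<odot>\<^bsub>U\<^esub> u)\<rparr>"

abbreviation "coindE U Y \<equiv> env_left K \<Lambda> (coind U Y)"

lemma coindD:
  assumes "f \<in> carrier (coind U Y)"
  shows "u \<in> carrier U \<Longrightarrow> f u \<in> carrier Y"
    "\<lbrakk>u \<in> carrier U; v \<in> carrier U\<rbrakk> \<Longrightarrow> f (u \<oplus>\<^bsub>U\<^esub> v) = f u \<oplus>\<^bsub>Y\<^esub> f v"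
    "\<lbrakk>c \<in> carrier K; u \<in> carrier U\<rbrakk> \<Longrightarrow> f ((c \<odot>\<^bsub>\<Lambda>\<^esub> \<one>\<^bsub>\<Lambda>\<^esub>) \<odot>\<^bsub>U\<^esub> u) = (c \<odot>\<^bsub>E\<^esub> \<one>\<^bsub>E\<^esub>) \<odot>\<^bsub>Y\<^esub> f u"
    "u \<notin> carrier U \<Longrightarrow> f u = undefined"
proof -
  have f: "f \<in> mhom K (scalars \<Lambda> U) (scalars E Y)" "f \<in> extensional (carrier U)"
    using assms by (auto simp: coind_def)
  show "u \<in> carrier U \<Longrightarrow> f u \<in> carrier Y" using mhom_closed[OF f(1), of u] by simp
  show "\<lbrakk>u \<in> carrier U; v \<in> carrier U\<rbrakk> \<Longrightarrow> f (u \<oplus>\<^bsub>U\<^esub> v) = f u \<oplus>\<^bsub>Y\<^esub> f v"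
    using mhom_add[OF f(1), of u v] by simp
  show "\<lbrakk>c \<in> carrier K; u \<in> carrier U\<rbrakk> \<Longrightarrow> f ((c \<odot>\<^bsub>\<Lambda>\<^esub> \<one>\<^bsub>\<Lambda>\<^esub>) \<odot>\<^bsub>U\<^esub> u) = (c \<odot>\<^bsub>E\<^esub> \<one>\<^bsub>E\<^esub>) \<odot>\<^bsub>Y\<^esub> f u"
    using mhom_smult[OF f(1), of c u] by simp
  show "u \<notin> carrier U \<Longrightarrow> f u = undefined" using f(2) by (simp add: extensional_def)
qed

lemma coindI:
  assumes "left_module \<Lambda> U"
    and "\<And>u. u \<in> carrier U \<Longrightarrow> f u \<in> carrier Y"
    "\<And>u v. \<lbrakk>u \<in> carrier U; v \<in> carrier U\<rbrakk> \<Longrightarrow> f (u \<oplus>\<^bsub>U\<^esub> v) = f u \<oplus>\<^bsub>Y\<^esub> f v"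
    "\<And>c u. \<lbrakk>c \<in> carrier K; u \<in> carrier U\<rbrakk> \<Longrightarrow> f ((c \<odot>\<^bsub>\<Lambda>\<^esub> \<one>\<^bsub>\<Lambda>\<^esub>) \<odot>\<^bsub>U\<^esub> u) = (c \<odot>\<^bsub>E\<^esub> \<one>\<^bsub>E\<^esub>) \<odot>\<^bsub>Y\<^esub> f u"
  shows "(\<lambda>u\<in>carrier U. f u) \<in> carrier (coind U Y)"
proof -
  interpret U: left_module \<Lambda> U by fact
  have "(\<lambda>u\<in>carrier U. f u) \<in> mhom K (scalars \<Lambda> U) (scalars E Y)"
    by (rule mhomI) (simp_all add: assms)
  then show ?thesis by (simp add: coind_def)
qed

lemma coind_eqI:
  assumes "f \<in> carrier (coind U Y)" "g \<in> carrier (coind U Y)" "\<And>u. u \<in> carrier U \<Longrightarrow> f u = g u"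
  shows "f = g"
  using assms by (intro extensionalityI[of f "carrier U" g]) (auto simp: coind_def)

lemma coind_simps [simp]:
  "zero (coind U Y) = (\<lambda>u\<in>carrier U. \<zero>\<^bsub>Y\<^esub>)"
  "f \<oplus>\<^bsub>coind U Y\<^esub> g = (\<lambda>u\<in>carrier U. f u \<oplus>\<^bsub>Y\<^esub> g u)"
  "a \<odot>\<^bsub>coind U Y\<^esub> f = (\<lambda>u\<in>carrier U. lft a \<odot>\<^bsub>Y\<^esub> f u)"
  "rsmult (coind U Y) f b = (\<lambda>u\<in>carrier U. f (b \<odot>\<^bsub>U\<^esub> u))"
  by (simp_all add: coind_def)

lemma scalar_central: "\<lbrakk>c \<in> carrier K; \<xi> \<in> carrier E\<rbrakk> \<Longrightarrow> \<xi> \<otimes>\<^bsub>E\<^esub> (c \<odot>\<^bsub>E\<^esub> \<one>\<^bsub>E\<^esub>) = (c \<odot>\<^bsub>E\<^esub> \<one>\<^bsub>E\<^esub>) \<otimes>\<^bsub>E\<^esub> \<xi>"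
  by simp

lemma bimodule_coind:
  assumes U: "left_module \<Lambda> U" and Y: "left_module E Y"
  shows "bimodule K \<Lambda> (coind U Y)"
proof -
  interpret U: left_module \<Lambda> U by (rule U)
  interpret Y: left_module E Y by (rule Y)
  note d = coindD[where U = U and Y = Y]
  have smc: "(c \<odot>\<^bsub>E\<^esub> \<one>\<^bsub>E\<^esub>) \<odot>\<^bsub>Y\<^esub> (\<xi> \<odot>\<^bsub>Y\<^esub> y) = \<xi> \<odot>\<^bsub>Y\<^esub> ((c \<odot>\<^bsub>E\<^esub> \<one>\<^bsub>E\<^esub>) \<odot>\<^bsub>Y\<^esub> y)"
    if "c \<in> carrier K" "\<xi> \<in> carrier E" "y \<in> carrier Y" for c \<xi> y
    using that by (simp only: Y.smult_assoc[symmetric] E.unit_closed scalar_central)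
  have smU: "b \<odot>\<^bsub>U\<^esub> ((c \<odot>\<^bsub>\<Lambda>\<^esub> \<one>\<^bsub>\<Lambda>\<^esub>) \<odot>\<^bsub>U\<^esub> u) = (c \<odot>\<^bsub>\<Lambda>\<^esub> \<one>\<^bsub>\<Lambda>\<^esub>) \<odot>\<^bsub>U\<^esub> (b \<odot>\<^bsub>U\<^esub> u)"
    if "c \<in> carrier K" "b \<in> carrier \<Lambda>" "u \<in> carrier U" for c b u
    using that by (simp add: U.smult_assoc[symmetric])
  have c_zero: "(\<lambda>u\<in>carrier U. \<zero>\<^bsub>Y\<^esub>) \<in> carrier (coind U Y)"
    by (rule coindI[OF U]) (simp_all del: E.unit_mult)
  have c_add: "(\<lambda>u\<in>carrier U. f u \<oplus>\<^bsub>Y\<^esub> g u) \<in> carrier (coind U Y)"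
    if "f \<in> carrier (coind U Y)" "g \<in> carrier (coind U Y)" for f g
    by (rule coindI[OF U])
      (use that E.unit_closed in \<open>simp_all add: d Y.M.a_ac Y.smult_r_distr del: E.unit_closed\<close>)
  have c_neg: "(\<lambda>u\<in>carrier U. \<ominus>\<^bsub>Y\<^esub> f u) \<in> carrier (coind U Y)"
    if "f \<in> carrier (coind U Y)" for f
    by (rule coindI[OF U])
      (use that E.unit_closed in \<open>simp_all add: d Y.M.minus_add Y.smult_minus_right del: E.unit_closed\<close>)
  have c_l: "(\<lambda>u\<in>carrier U. lft a \<odot>\<^bsub>Y\<^esub> f u) \<in> carrier (coind U Y)"
    if "a \<in> carrier \<Lambda>" "f \<in> carrier (coind U Y)" for a f
    by (rule coindI[OF U]) (use that in \<open>simp_all add: d Y.smult_r_distr smc\<close>)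
  have c_r: "(\<lambda>u\<in>carrier U. f (b \<odot>\<^bsub>U\<^esub> u)) \<in> carrier (coind U Y)"
    if "b \<in> carrier \<Lambda>" "f \<in> carrier (coind U Y)" for b f
    by (rule coindI[OF U]) (use that in \<open>simp_all add: d U.smult_r_distr smU\<close>)
  have ext: "f u = undefined" if "f \<in> carrier (coind U Y)" "u \<notin> carrier U" for f u
    using d(4)[OF that] .
  have ab: "abelian_group (coind U Y)"
  proof (rule abelian_groupI, goal_cases)
    case (6 f)
    then show ?case
      using c_neg[OF 6] by (intro bexI[of _ "\<lambda>u\<in>carrier U. \<ominus>\<^bsub>Y\<^esub> f u"]) (auto simp: d Y.M.l_neg)
  next
    case (5 f)
    then show ?case by (auto simp: d fun_eq_iff restrict_def)
  next
    case (3 f g h)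
    then show ?case by (auto simp: d Y.M.a_assoc)
  next
    case (4 f g)
    then show ?case by (auto simp: d Y.M.a_comm)
  qed (simp_all add: c_zero c_add)
  note lh = ring_hom_add[OF lft_hom] ring_hom_mult[OF lft_hom] ring_hom_one[OF lft_hom]
  have "left_module \<Lambda> (coind U Y)"
    using ab by (intro left_moduleI L.is_ring_A)
      (auto simp: c_l[unfolded restrict_def] d lh Y.smult_l_distr Y.smult_r_distr Y.smult_assoc fun_eq_iff ext restrict_def)
  moreover have "left_module (op_algebra \<Lambda>) (bimodule_right (coind U Y))"
    using abelian_group_cong[OF ab, of "bimodule_right (coind U Y)"]
    by (intro left_moduleI op.is_ring_A)
      (auto simp: c_r[unfolded restrict_def] d U.smult_l_distr U.smult_assoc fun_eq_iff ext restrict_def)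
  moreover have "lft (c \<odot>\<^bsub>\<Lambda>\<^esub> \<one>\<^bsub>\<Lambda>\<^esub>) = c \<odot>\<^bsub>E\<^esub> \<one>\<^bsub>E\<^esub>" if "c \<in> carrier K" for c
    using that by (simp add: lft_def E_unit)
  ultimately show ?thesis
    unfolding bimodule_def by (auto simp: d)
qed

lemma left_module_coindE:
  assumes "left_module \<Lambda> U" "left_module E Y"
  shows "left_module E (coindE U Y)"
proof -
  interpret B: bimodule_over K \<Lambda> "coind U Y" by unfold_locales (rule bimodule_coind[OF assms])
  show ?thesis by (rule B.left_module_env_left)
qed

lemma coindE_pure:
  assumes "left_module \<Lambda> U" "left_module E Y" "a \<in> carrier \<Lambda>" "b \<in> carrier \<Lambda>" "f \<in> carrier (coind U Y)"
  shows "pe a b \<odot>\<^bsub>coindE U Y\<^esub> f = (\<lambda>u\<in>carrier U. lft a \<odot>\<^bsub>Y\<^esub> f (b \<odot>\<^bsub>U\<^esub> u))"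
proof -
  interpret U: left_module \<Lambda> U by fact
  interpret B: bimodule_over K \<Lambda> "coind U Y" by unfold_locales (rule bimodule_coind[OF assms(1,2)])
  show ?thesis using assms(3-5) by (simp add: B.env_left_pure cong: restrict_cong)
qed

text \<open>A map into the coinduced bimodule, given in uncurried form. Linearity over the field in
  \<open>u\<close> is deduced, which saves this check for every concrete map.\<close>

lemma coind_homI:
  assumes P: "left_module E P" and U: "left_module \<Lambda> U" and Y: "left_module E Y"
    and cl: "\<And>p u. \<lbrakk>p \<in> carrier P; u \<in> carrier U\<rbrakk> \<Longrightarrow> g p u \<in> carrier Y"
    and add1: "\<And>p p' u. \<lbrakk>p \<in> carrier P; p' \<in> carrier P; u \<in> carrier U\<rbrakk> \<Longrightarrow> g (p \<oplus>\<^bsub>P\<^esub> p') u = g p u \<oplus>\<^bsub>Y\<^esub> g p' u"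
    and add2: "\<And>p u u'. \<lbrakk>p \<in> carrier P; u \<in> carrier U; u' \<in> carrier U\<rbrakk> \<Longrightarrow> g p (u \<oplus>\<^bsub>U\<^esub> u') = g p u \<oplus>\<^bsub>Y\<^esub> g p u'"
    and pure: "\<And>a b p u. \<lbrakk>a \<in> carrier \<Lambda>; b \<in> carrier \<Lambda>; p \<in> carrier P; u \<in> carrier U\<rbrakk>
      \<Longrightarrow> g (pe a b \<odot>\<^bsub>P\<^esub> p) u = lft a \<odot>\<^bsub>Y\<^esub> g p (b \<odot>\<^bsub>U\<^esub> u)"
  shows "(\<lambda>p. \<lambda>u\<in>carrier U. g p u) \<in> mhom E P (coindE U Y)"
proof -
  interpret P: left_module E P by (rule P)
  interpret U: left_module \<Lambda> U by (rule U)
  interpret Y: left_module E Y by (rule Y)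
  have "g p ((c \<odot>\<^bsub>\<Lambda>\<^esub> \<one>\<^bsub>\<Lambda>\<^esub>) \<odot>\<^bsub>U\<^esub> u) = (c \<odot>\<^bsub>E\<^esub> \<one>\<^bsub>E\<^esub>) \<odot>\<^bsub>Y\<^esub> g p u"
    if "c \<in> carrier K" "p \<in> carrier P" "u \<in> carrier U" for c p u
  proof -
    \<comment> \<open>A scalar is the same element of \<open>E\<close> whether it is put into the
      left or the right factor. Reading \<open>pure\<close> both ways moves it from \<open>u\<close>
      to the value.\<close>
    have "pe \<one>\<^bsub>\<Lambda>\<^esub> (c \<odot>\<^bsub>\<Lambda>\<^esub> \<one>\<^bsub>\<Lambda>\<^esub>) = pe (c \<odot>\<^bsub>\<Lambda>\<^esub> \<one>\<^bsub>\<Lambda>\<^esub>) \<one>\<^bsub>\<Lambda>\<^esub>"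
      using that by (simp add: pe_smult_left pe_smult_right)
    then have "lft \<one>\<^bsub>\<Lambda>\<^esub> \<odot>\<^bsub>Y\<^esub> g p ((c \<odot>\<^bsub>\<Lambda>\<^esub> \<one>\<^bsub>\<Lambda>\<^esub>) \<odot>\<^bsub>U\<^esub> u) = lft (c \<odot>\<^bsub>\<Lambda>\<^esub> \<one>\<^bsub>\<Lambda>\<^esub>) \<odot>\<^bsub>Y\<^esub> g p (\<one>\<^bsub>\<Lambda>\<^esub> \<odot>\<^bsub>U\<^esub> u)"
      using pure[of "\<one>\<^bsub>\<Lambda>\<^esub>" "c \<odot>\<^bsub>\<Lambda>\<^esub> \<one>\<^bsub>\<Lambda>\<^esub>" p u] pure[of "c \<odot>\<^bsub>\<Lambda>\<^esub> \<one>\<^bsub>\<Lambda>\<^esub>" "\<one>\<^bsub>\<Lambda>\<^esub>" p u] that by simp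
    moreover have "lft (c \<odot>\<^bsub>\<Lambda>\<^esub> \<one>\<^bsub>\<Lambda>\<^esub>) = c \<odot>\<^bsub>E\<^esub> \<one>\<^bsub>E\<^esub>" using that by (simp add: lft_def E_unit)
    ultimately show ?thesis
      using that cl[of p "(c \<odot>\<^bsub>\<Lambda>\<^esub> \<one>\<^bsub>\<Lambda>\<^esub>) \<odot>\<^bsub>U\<^esub> u"] by (simp add: ring_hom_one[OF lft_hom])
  qed
  then have mem: "(\<lambda>u\<in>carrier U. g p u) \<in> carrier (coind U Y)" if "p \<in> carrier P" for p
    using that by (intro coindI[OF U]) (simp_all add: cl add2)
  show ?thesis
  proof (rule mhom_EI[OF _ _ _ _ P left_module_coindE[OF U Y]])
    fix a b p assume "a \<in> carrier \<Lambda>" "b \<in> carrier \<Lambda>" "p \<in> carrier P"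
    then show "(\<lambda>u\<in>carrier U. g (pe a b \<odot>\<^bsub>P\<^esub> p) u) = pe a b \<odot>\<^bsub>coindE U Y\<^esub> (\<lambda>u\<in>carrier U. g p u)"
      by (simp add: coindE_pure[OF U Y _ _ mem] pure cong: restrict_cong)
  qed (simp_all add: mem add1 cong: restrict_cong)
qed

lemma coind_homD:
  assumes P: "left_module E P" and U: "left_module \<Lambda> U" and Y: "left_module E Y"
    and f: "f \<in> mhom E P (coindE U Y)"
  shows "p \<in> carrier P \<Longrightarrow> f p \<in> carrier (coind U Y)"
    "\<lbrakk>p \<in> carrier P; p' \<in> carrier P; u \<in> carrier U\<rbrakk> \<Longrightarrow> f (p \<oplus>\<^bsub>P\<^esub> p') u = f p u \<oplus>\<^bsub>Y\<^esub> f p' u"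
    "\<lbrakk>a \<in> carrier \<Lambda>; b \<in> carrier \<Lambda>; p \<in> carrier P; u \<in> carrier U\<rbrakk>
      \<Longrightarrow> f (pe a b \<odot>\<^bsub>P\<^esub> p) u = lft a \<odot>\<^bsub>Y\<^esub> f p (b \<odot>\<^bsub>U\<^esub> u)"
proof -
  show c: "p \<in> carrier P \<Longrightarrow> f p \<in> carrier (coind U Y)" for p using mhom_closed[OF f] by simp
  show "\<lbrakk>p \<in> carrier P; p' \<in> carrier P; u \<in> carrier U\<rbrakk> \<Longrightarrow> f (p \<oplus>\<^bsub>P\<^esub> p') u = f p u \<oplus>\<^bsub>Y\<^esub> f p' u"
    using mhom_add[OF f] by simp
  show "\<lbrakk>a \<in> carrier \<Lambda>; b \<in> carrier \<Lambda>; p \<in> carrier P; u \<in> carrier U\<rbrakk>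
      \<Longrightarrow> f (pe a b \<odot>\<^bsub>P\<^esub> p) u = lft a \<odot>\<^bsub>Y\<^esub> f p (b \<odot>\<^bsub>U\<^esub> u)"
    using mhom_smult[OF f, of "pe a b" p] by (simp add: coindE_pure[OF U Y _ _ c])
qed

text \<open>Contravariance in \<open>U\<close>. It provides both maps of the exact sequence of
  coinduced bimodules in \<open>acyc_coind_step\<close>.\<close>

lemma coind_precomp:
  assumes U: "left_module \<Lambda> U" and U': "left_module \<Lambda> U'" and Y: "left_module E Y" and \<theta>: "\<theta> \<in> mhom \<Lambda> U' U"
  shows "(\<lambda>h. \<lambda>u\<in>carrier U'. h (\<theta> u)) \<in> mhom E (coindE U Y) (coindE U' Y)"
  by (rule coind_homI[OF left_module_coindE[OF U Y] U' Y])
    (simp_all add: coindD[where U = U and Y = Y] mhom_closed[OF \<theta>] mhom_add[OF \<theta>] mhom_smult[OF \<theta>] coindE_pure[OF U Y])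

end

subsection \<open>The projective dimension of the regular bimodule\<close>

text \<open>If \<open>A\<close> is projective over \<open>R\<close> through \<open>\<theta>\<close>,
  then so is every projective \<open>A\<close>-module: the products \<open>q j p i\<close> with the
  coefficients \<open>\<omega> j (\<phi> i x)\<close> form a dual basis over \<open>R\<close>. The
  lift is built directly from this basis.\<close>

lemma fg_projective_pullback_lift:
  assumes \<theta>: "\<theta> \<in> ring_hom R A" and P: "left_module A P" and "fg_projective A P"
    and "fg_projective R (pullback \<theta> (regular_module A))"
    and R: "ring R" and M: "left_module R M" and N: "left_module R N"
    and g: "g \<in> mhom R M N" and h: "h \<in> mhom R (pullback \<theta> P) N"
    and im: "\<And>x. x \<in> carrier P \<Longrightarrow> h x \<in> g ` carrier M"
  obtains h' where "h' \<in> mhom R (pullback \<theta> P) M" "\<And>x. x \<in> carrier P \<Longrightarrow> g (h' x) = h x"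
proof -
  interpret P: left_module A P by (rule P)
  interpret M: left_module R M by (rule M)
  interpret N: left_module R N by (rule N)
  let ?P = "pullback \<theta> P"
  have P': "left_module R ?P" by (rule left_module_pullback[OF P R \<theta>])
  obtain n p \<phi> where p: "\<And>i. i < n \<Longrightarrow> p i \<in> carrier P" and \<phi>: "\<And>i. i < n \<Longrightarrow> \<phi> i \<in> mhom A P (regular_module A)"
    and eqP: "\<And>x. x \<in> carrier P \<Longrightarrow> (\<Oplus>\<^bsub>P\<^esub>i\<in>{..<n::nat}. \<phi> i x \<odot>\<^bsub>P\<^esub> p i) = x"
    by (rule fg_projectiveE[OF assms(3)]) blast
  obtain k q \<omega> where q': "\<And>j. j < k \<Longrightarrow> q j \<in> carrier (pullback \<theta> (regular_module A))"
    and \<omega>: "\<And>j. j < k \<Longrightarrow> \<omega> j \<in> mhom R (pullback \<theta> (regular_module A)) (regular_module R)"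
    and eqA: "\<And>x. x \<in> carrier (pullback \<theta> (regular_module A)) \<Longrightarrow>
      (\<Oplus>\<^bsub>pullback \<theta> (regular_module A)\<^esub>j\<in>{..<k::nat}. \<omega> j x \<odot>\<^bsub>pullback \<theta> (regular_module A)\<^esub> q j) = x"
    by (rule fg_projectiveE[OF assms(4)]) blast
  have q: "q j \<in> carrier A" if "j < k" for j using q'[OF that] by simp
  have eqA': "(\<Oplus>\<^bsub>A\<^esub>j\<in>{..<k}. \<theta> (\<omega> j a) \<otimes>\<^bsub>A\<^esub> q j) = a" if "a \<in> carrier A" for a
    using eqA[of a] that by (simp add: finsum_cong_add[of "regular_module A" A])
  have \<phi>c: "\<phi> i x \<in> carrier A" if "i < n" "x \<in> carrier P" for i x using mhom_closed[OF \<phi>[OF that(1)] that(2)] by simp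
  have \<omega>c: "\<omega> j a \<in> carrier R" if "j < k" "a \<in> carrier A" for j a using mhom_closed[OF \<omega>[OF that(1)]] that(2) by simp
  note \<theta>c = ring_hom_closed[OF \<theta>]
  have "\<forall>i j. \<exists>m. i < n \<longrightarrow> j < k \<longrightarrow> m \<in> carrier M \<and> g m = h (q j \<odot>\<^bsub>P\<^esub> p i)"
    using im p q P.smult_closed by (metis imageE)
  then obtain m where m: "\<And>i j. \<lbrakk>i < n; j < k\<rbrakk> \<Longrightarrow> m i j \<in> carrier M" "\<And>i j. \<lbrakk>i < n; j < k\<rbrakk> \<Longrightarrow> g (m i j) = h (q j \<odot>\<^bsub>P\<^esub> p i)"
    by metis
  have \<phi>': "\<phi> i \<in> mhom R ?P (pullback \<theta> (regular_module A))" if "i < n" for i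
    by (rule mhom_pullback[OF \<phi>[OF that] \<theta>c])
  define h' where "h' x = (\<Oplus>\<^bsub>M\<^esub>i\<in>{..<n}. \<Oplus>\<^bsub>M\<^esub>j\<in>{..<k}. \<omega> j (\<phi> i x) \<odot>\<^bsub>M\<^esub> m i j)" for x
  have "h' \<in> mhom R ?P M"
    unfolding h'_def
  proof (intro mhom_sum M)
    fix i j assume "i \<in> {..<n}" "j \<in> {..<k}"
    then show "(\<lambda>x. \<omega> j (\<phi> i x) \<odot>\<^bsub>M\<^esub> m i j) \<in> mhom R ?P M"
      by (intro mhom_smult_const[OF M mhom_comp[OF \<phi>' \<omega>]] m) auto
  qed
  moreover have "g (h' x) = h x" if x: "x \<in> carrier P" for x
  proof -
    have "g (h' x) = (\<Oplus>\<^bsub>N\<^esub>i\<in>{..<n}. g (\<Oplus>\<^bsub>M\<^esub>j\<in>{..<k}. \<omega> j (\<phi> i x) \<odot>\<^bsub>M\<^esub> m i j))"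
      unfolding h'_def by (rule mhom_finsum[OF M N g]) (auto intro!: M.M.finsum_closed simp: \<omega>c \<phi>c x m)
    also have "\<dots> = (\<Oplus>\<^bsub>N\<^esub>i\<in>{..<n}. h (\<phi> i x \<odot>\<^bsub>P\<^esub> p i))"
    proof (rule N.M.finsum_cong')
      fix i assume "i \<in> {..<n}"
      then have i: "i < n" by simp
      have "g (\<Oplus>\<^bsub>M\<^esub>j\<in>{..<k}. \<omega> j (\<phi> i x) \<odot>\<^bsub>M\<^esub> m i j) = (\<Oplus>\<^bsub>N\<^esub>j\<in>{..<k}. g (\<omega> j (\<phi> i x) \<odot>\<^bsub>M\<^esub> m i j))"
        by (rule mhom_finsum[OF M N g]) (auto simp: \<omega>c \<phi>c x i m)
      also have "\<dots> = (\<Oplus>\<^bsub>N\<^esub>j\<in>{..<k}. h (\<omega> j (\<phi> i x) \<odot>\<^bsub>?P\<^esub> (q j \<odot>\<^bsub>P\<^esub> p i)))"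
        by (rule N.M.finsum_cong')
          (auto simp: mhom_smult[OF g] mhom_smult[OF h] \<omega>c \<phi>c x i m p q mhom_closed[OF h] simp del: pullback_simps(4))
      also have "\<dots> = h (\<Oplus>\<^bsub>?P\<^esub>j\<in>{..<k}. \<omega> j (\<phi> i x) \<odot>\<^bsub>?P\<^esub> (q j \<odot>\<^bsub>P\<^esub> p i))"
        by (rule mhom_finsum[OF P' N h, symmetric]) (auto simp: \<omega>c \<phi>c \<theta>c x i p q)
      also have "(\<Oplus>\<^bsub>?P\<^esub>j\<in>{..<k}. \<omega> j (\<phi> i x) \<odot>\<^bsub>?P\<^esub> (q j \<odot>\<^bsub>P\<^esub> p i)) = (\<Oplus>\<^bsub>P\<^esub>j\<in>{..<k}. (\<theta> (\<omega> j (\<phi> i x)) \<otimes>\<^bsub>A\<^esub> q j) \<odot>\<^bsub>P\<^esub> p i)"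
        by (simp, rule P.M.finsum_cong') (auto simp: P.smult_assoc \<omega>c \<phi>c \<theta>c x i p q)
      also have "\<dots> = (\<Oplus>\<^bsub>A\<^esub>j\<in>{..<k}. \<theta> (\<omega> j (\<phi> i x)) \<otimes>\<^bsub>A\<^esub> q j) \<odot>\<^bsub>P\<^esub> p i"
        by (rule P.finsum_smult[symmetric]) (auto simp: \<omega>c \<phi>c \<theta>c x i p q)
      finally show "g (\<Oplus>\<^bsub>M\<^esub>j\<in>{..<k}. \<omega> j (\<phi> i x) \<odot>\<^bsub>M\<^esub> m i j) = h (\<phi> i x \<odot>\<^bsub>P\<^esub> p i)"
        by (simp add: eqA' \<phi>c x i)
    qed (auto simp: mhom_closed[OF h] \<phi>c x p)
    also have "\<dots> = h (\<Oplus>\<^bsub>?P\<^esub>i\<in>{..<n}. \<phi> i x \<odot>\<^bsub>P\<^esub> p i)"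
      by (rule mhom_finsum[OF P' N h, symmetric]) (auto simp: \<phi>c x p)
    finally show ?thesis using eqP[OF x] by simp
  qed
  ultimately show ?thesis by (rule that)
qed

context enveloping
begin

text \<open>Expand the second tensor factor in a dual basis \<open>b\<close>, \<open>\<chi>\<close>
  of \<Lambda> over the field. The elements \<open>1 \<otimes> b i\<close> generate over the left
  copy of \<Lambda>.\<close>

lemma fg_projective_E_left:
  assumes "fd_space K \<Lambda>"
  shows "fg_projective \<Lambda> (pullback lft (regular_module E))"
proof -
  obtain n b \<chi> where b: "\<And>i. i < n \<Longrightarrow> b i \<in> carrier \<Lambda>" and \<chi>: "\<And>i. i < n \<Longrightarrow> \<chi> i \<in> mhom K \<Lambda> (regular_module K)"
    and eq: "\<And>x. x \<in> carrier \<Lambda> \<Longrightarrow> (\<Oplus>\<^bsub>\<Lambda>\<^esub>i\<in>{..<n::nat}. \<chi> i x \<odot>\<^bsub>\<Lambda>\<^esub> b i) = x"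
    by (rule fg_projectiveE[OF fd_space_fg_projective[OF assms]]) blast
  have \<chi>c: "\<chi> i x \<in> carrier K" if "i < n" "x \<in> carrier \<Lambda>" for i x
    using mhom_closed[OF \<chi>[OF that(1)] that(2)] by simp
  interpret V: left_module K \<Lambda> by (rule L.left_module_self)
  \<comment> \<open>The coordinate of \<open>x \<otimes> y\<close> at
    \<open>1 \<otimes> b i\<close>: the scalar coordinate of \<open>y\<close> moves onto
    \<open>x\<close>, and the result is left linear in \<open>x\<close>.\<close>
  define \<omega> where "\<omega> i = tensor_lift K \<Lambda> (\<lambda>(x, y). \<chi> i y \<odot>\<^bsub>\<Lambda>\<^esub> x)" for i
  have bal: "balanced K (regular_module K) \<Lambda> (op_algebra \<Lambda>) \<Lambda> (\<lambda>x y. \<chi> i y \<odot>\<^bsub>\<Lambda>\<^esub> x)" if "i < n" for i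
    by (rule TE.bilinearI)
      (use that in \<open>simp_all add: \<chi>c mhom_add[OF \<chi>] mhom_smult[OF \<chi>] V.smult_r_distr V.smult_l_distr
        V.smult_assoc[symmetric] L.K.m_comm\<close>)
  have \<omega>: "\<omega> i \<in> mhom K E \<Lambda>" if "i < n" for i
    unfolding \<omega>_def by (rule E_lift(1)[OF V.is_left_module bal[OF that]])
  have \<omega>p: "\<omega> i (pe x y) = \<chi> i y \<odot>\<^bsub>\<Lambda>\<^esub> x" if "i < n" "x \<in> carrier \<Lambda>" "y \<in> carrier \<Lambda>" for i x y
    unfolding \<omega>_def using E_lift(2)[OF V.is_left_module bal[OF that(1)] that(2,3)] .
  have lE: "left_module \<Lambda> (pullback lft (regular_module E))"
    by (rule left_module_pullback[OF left_module_regular[OF E.is_ring_A] L.is_ring_A lft_hom])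
  have \<omega>l: "\<omega> i (lft a \<otimes>\<^bsub>E\<^esub> \<xi>) = a \<otimes>\<^bsub>\<Lambda>\<^esub> \<omega> i \<xi>" if i: "i < n" and a: "a \<in> carrier \<Lambda>" and "\<xi> \<in> carrier E" for i a \<xi>
    using that(3)
  proof (induction \<xi> rule: E_induct)
    case (pure x y)
    then show ?case using i a by (simp add: lft_def pe_mult \<omega>p \<chi>c L.A.smult_mult_right)
  next
    case (add \<xi> \<zeta>)
    then show ?case using i a mhom_closed[OF \<omega>[OF i]] by (simp add: E.A.r_distr mhom_add[OF \<omega>[OF i]] L.A.r_distr)
  qed
  have \<omega>h: "\<omega> i \<in> mhom \<Lambda> (pullback lft (regular_module E)) (regular_module \<Lambda>)" if "i < n" for i
    by (rule mhomI) (use that in \<open>simp_all add: mhom_closed[OF \<omega>] mhom_add[OF \<omega>] \<omega>l\<close>)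
  have exp: "(\<Oplus>\<^bsub>E\<^esub>i\<in>{..<n}. lft (\<omega> i \<xi>) \<otimes>\<^bsub>E\<^esub> rgt (b i)) = \<xi>" if "\<xi> \<in> carrier E" for \<xi>
    using that
  proof (induction \<xi> rule: E_induct)
    case (pure x y)
    have "(\<Oplus>\<^bsub>E\<^esub>i\<in>{..<n}. lft (\<omega> i (pe x y)) \<otimes>\<^bsub>E\<^esub> rgt (b i)) = (\<Oplus>\<^bsub>E\<^esub>i\<in>{..<n}. pe x (\<chi> i y \<odot>\<^bsub>\<Lambda>\<^esub> b i))"
      using pure by (intro E.A.finsum_cong')
        (auto simp: \<omega>p \<chi>c b pe_eq_lft_rgt[symmetric] pe_smult_left pe_smult_right)
    also have "\<dots> = pe x (\<Oplus>\<^bsub>\<Lambda>\<^esub>i\<in>{..<n}. \<chi> i y \<odot>\<^bsub>\<Lambda>\<^esub> b i)"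
      using pure by (intro finsum_additive[symmetric] L.A.abelian_group_axioms E.A.abelian_group_axioms)
        (auto simp: \<chi>c b pe_add_right)
    finally show ?case using eq pure by simp
  next
    case (add \<xi> \<zeta>)
    have "(\<Oplus>\<^bsub>E\<^esub>i\<in>{..<n}. lft (\<omega> i (\<xi> \<oplus>\<^bsub>E\<^esub> \<zeta>)) \<otimes>\<^bsub>E\<^esub> rgt (b i)) =
        (\<Oplus>\<^bsub>E\<^esub>i\<in>{..<n}. lft (\<omega> i \<xi>) \<otimes>\<^bsub>E\<^esub> rgt (b i) \<oplus>\<^bsub>E\<^esub> lft (\<omega> i \<zeta>) \<otimes>\<^bsub>E\<^esub> rgt (b i))"
      using add mhom_closed[OF \<omega>] by (intro E.A.finsum_cong')
        (auto simp: mhom_add[OF \<omega>] ring_hom_add[OF lft_hom] b E.A.l_distr)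
    also have "\<dots> = (\<Oplus>\<^bsub>E\<^esub>i\<in>{..<n}. lft (\<omega> i \<xi>) \<otimes>\<^bsub>E\<^esub> rgt (b i)) \<oplus>\<^bsub>E\<^esub> (\<Oplus>\<^bsub>E\<^esub>i\<in>{..<n}. lft (\<omega> i \<zeta>) \<otimes>\<^bsub>E\<^esub> rgt (b i))"
      using add mhom_closed[OF \<omega>] by (intro E.A.finsum_addf) (auto simp: b)
    finally show ?case using add by simp
  qed
  show ?thesis
  proof (rule fg_projectiveI[OF lE, of "{..<n}" "\<lambda>i. rgt (b i)" \<omega>])
    fix \<xi> assume "\<xi> \<in> carrier (pullback lft (regular_module E))"
    then show "(\<Oplus>\<^bsub>pullback lft (regular_module E)\<^esub>i\<in>{..<n}. \<omega> i \<xi> \<odot>\<^bsub>pullback lft (regular_module E)\<^esub> rgt (b i)) = \<xi>"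
      using exp by (simp add: finsum_cong_add[of "regular_module E" E])
  qed (use b \<omega>h in auto)
qed

end

section \<open>Resolutions of the regular bimodule and vanishing for coinduced coefficients\<close>

locale bimodule_resolution = enveloping K \<Lambda>
  for K :: "('k, 'z) ring_scheme" and \<Lambda> :: "('k, 'a) module" +
  fixes P :: "nat \<Rightarrow> (('a \<times> 'a \<Rightarrow> 'k) set, nat \<Rightarrow> 'k) module" and D and \<epsilon>
  assumes fd: "fd_space K \<Lambda>"
    and res: "projective_resolution K E (env_left K \<Lambda> (regular_bimodule \<Lambda>)) P D \<epsilon>"
begin

abbreviation "RB \<equiv> env_left K \<Lambda> (regular_bimodule \<Lambda>)"

lemma res_facts:
  "projective_module K E (P n)" "D n \<in> mhom E (P (Suc n)) (P n)" "\<epsilon> \<in> mhom E (P 0) RB"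
  "\<epsilon> ` carrier (P 0) = carrier RB" "D 0 ` carrier (P (Suc 0)) = {x \<in> carrier (P 0). \<epsilon> x = \<zero>\<^bsub>RB\<^esub>}"
  "D (Suc n) ` carrier (P (Suc (Suc n))) = {x \<in> carrier (P (Suc n)). D n x = \<zero>\<^bsub>P n\<^esub>}"
  using res by (simp_all add: projective_resolution_def)

lemma fd_P: "fd_left_module K E (P n)"
  using res_facts(1)[of n] by (simp add: projective_module_def)

lemma fd_E: "fd_space K E"
  by (rule fd_space_E[OF fd])

sublocale projective_complex E P D
proof (rule projective_complex.intro)
  show "left_module E (P n)" for n by (rule fd_left_moduleD(1)[OF fd_P])
  show "fg_projective E (P n)" for n by (rule E.projective_imp_fg_projective[OF fd_E res_facts(1)])
  show "D n \<in> mhom E (P (Suc n)) (P n)" for n by (rule res_facts(2))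
  show "D n (D (Suc n) x) = \<zero>\<^bsub>P n\<^esub>" if "x \<in> carrier (P (Suc (Suc n)))" for n x
    using res_facts(6)[of n] that by blast
qed

sublocale P: left_module E "P n" for n by (rule left_module_P)

sublocale RB: bimodule_over K \<Lambda> "regular_bimodule \<Lambda>"
  by unfold_locales (rule bimodule_regular)

lemma RB_simps [simp]: "carrier (regular_bimodule \<Lambda>) = carrier \<Lambda>" "zero (regular_bimodule \<Lambda>) = \<zero>\<^bsub>\<Lambda>\<^esub>"
  "add (regular_bimodule \<Lambda>) = add \<Lambda>" "smult (regular_bimodule \<Lambda>) = mult \<Lambda>" "rsmult (regular_bimodule \<Lambda>) = mult \<Lambda>"
  by (simp_all add: regular_bimodule_def)

abbreviation "PL n \<equiv> pullback lft (P n)"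

lemma left_module_PL: "left_module \<Lambda> (PL n)"
  by (rule left_module_pullback[OF left_module_P L.is_ring_A lft_hom])

lemma mhom_PL: "f \<in> mhom E (P n) (P m) \<Longrightarrow> f \<in> mhom \<Lambda> (PL n) (PL m)"
  by (rule mhom_pullback) auto

text \<open>The terms of the resolution are projective also over the left copy of \<Lambda>, because
  the enveloping algebra is.\<close>

lemma PL_lift:
  assumes "g \<in> mhom \<Lambda> (PL m) (PL k)" "h \<in> mhom \<Lambda> (PL n) (PL k)" "\<And>x. x \<in> carrier (P n) \<Longrightarrow> h x \<in> g ` carrier (P m)"
  obtains h' where "h' \<in> mhom \<Lambda> (PL n) (PL m)" "\<And>x. x \<in> carrier (P n) \<Longrightarrow> g (h' x) = h x"
  using fg_projective_pullback_lift[OF lft_hom left_module_P fg_projective_P fg_projective_E_left[OF fd] L.is_ring_A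
      left_module_PL left_module_PL assms(1,2)] assms(3) by (auto intro: that)

text \<open>As a complex of left modules the resolution splits, because the regular bimodule is projective
  as a left module.\<close>

lemma left_contraction:
  obtains s where "\<And>n. s n \<in> mhom \<Lambda> (PL n) (PL (Suc n))"
    "\<And>n x. x \<in> carrier (P (Suc n)) \<Longrightarrow> D (Suc n) (s (Suc n) x) = x \<ominus>\<^bsub>P (Suc n)\<^esub> s n (D n x)"
proof -
  \<comment> \<open>The invariant \<open>D s D = D\<close> makes \<open>x - s (D x)\<close> a cycle,
    hence a boundary, so that it can be lifted through the next differential. That lift is the next
    \<open>s\<close>.\<close>
  let ?ok = "\<lambda>(n::nat) s. s \<in> mhom \<Lambda> (PL n) (PL (Suc n)) \<and> (\<forall>y\<in>carrier (P (Suc n)). D n (s (D n y)) = D n y)"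
  let ?next = "\<lambda>(n::nat) s s'. \<forall>x\<in>carrier (P (Suc n)). D (Suc n) (s' x) = x \<ominus>\<^bsub>P (Suc n)\<^esub> s (D n x)"
  have minus_PL: "x \<ominus>\<^bsub>PL n\<^esub> y = x \<ominus>\<^bsub>P n\<^esub> y" for n x y
    by (simp add: a_minus_def a_inv_def m_inv_def)
  have neg0: "\<ominus>\<^bsub>P n\<^esub> \<zero>\<^bsub>P n\<^esub> = \<zero>\<^bsub>P n\<^esub>" for n by (rule P.M.minus_equality) simp_all
  have "\<exists>f. \<forall>n. ?ok n (f n) \<and> ?next n (f n) (f (Suc n))"
  proof (rule dependent_nat_choice)
    \<comment> \<open>A preimage of the unit splits the augmentation on the left by
      \<open>a \<mapsto> a p0\<close>. In degree zero the element to be lifted is therefore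
      \<open>x - \<epsilon>(x) p0\<close>.\<close>
    obtain p0 where p0: "p0 \<in> carrier (P 0)" "\<epsilon> p0 = \<one>\<^bsub>\<Lambda>\<^esub>"
      using res_facts(4) by (metis L.A.one_closed RB_simps(1) env_left_simps(1) imageE)
    have el: "\<epsilon> (lft a \<odot>\<^bsub>P 0\<^esub> x) = a \<otimes>\<^bsub>\<Lambda>\<^esub> \<epsilon> x" if "a \<in> carrier \<Lambda>" "x \<in> carrier (P 0)" for a x
      using mhom_smult[OF res_facts(3), of "lft a" x] mhom_closed[OF res_facts(3), of x] that
      by (simp add: lft_def RB.env_left_pure)
    have ec: "\<epsilon> x \<in> carrier \<Lambda>" if "x \<in> carrier (P 0)" for x
      using mhom_closed[OF res_facts(3), of x] that by simp
    have e: "\<epsilon> \<in> mhom \<Lambda> (PL 0) (regular_module \<Lambda>)"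
      by (rule mhomI) (use mhom_add[OF res_facts(3)] in \<open>simp_all add: ec el\<close>)
    let ?h = "\<lambda>x. x \<ominus>\<^bsub>PL 0\<^esub> \<epsilon> x \<odot>\<^bsub>PL 0\<^esub> p0"
    have h: "?h \<in> mhom \<Lambda> (PL 0) (PL 0)"
      using p0(1) by (intro mhom_minus_fun left_module_PL mhom_id mhom_smult_const e) simp_all
    have him: "?h x \<in> D 0 ` carrier (P (Suc 0))" if x: "x \<in> carrier (P 0)" for x
    proof -
      have "\<epsilon> (?h x) = \<epsilon> x \<ominus>\<^bsub>\<Lambda>\<^esub> \<epsilon> x \<otimes>\<^bsub>\<Lambda>\<^esub> \<epsilon> p0"
        using mhom_diff[OF left_module_PL left_module_regular[OF L.is_ring_A] e, of x "\<epsilon> x \<odot>\<^bsub>PL 0\<^esub> p0"] x p0(1) ec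
        by (simp add: el) (simp add: a_minus_def a_inv_def m_inv_def)
      also have "\<dots> = \<zero>\<^bsub>\<Lambda>\<^esub>" using p0(2) ec[OF x] by (simp add: a_minus_def L.A.r_neg)
      finally show ?thesis unfolding res_facts(5) using mhom_closed[OF h, of x] x by simp
    qed
    obtain s where s: "s \<in> mhom \<Lambda> (PL 0) (PL (Suc 0))" "\<And>x. x \<in> carrier (P 0) \<Longrightarrow> D 0 (s x) = ?h x"
      using PL_lift[OF mhom_PL[OF D_hom] h him] by blast
    have "D 0 (s (D 0 y)) = D 0 y" if y: "y \<in> carrier (P (Suc 0))" for y
    proof -
      have "\<epsilon> (D 0 y) = \<zero>\<^bsub>\<Lambda>\<^esub>" using res_facts(5) y by auto
      moreover have "lft \<zero>\<^bsub>\<Lambda>\<^esub> \<odot>\<^bsub>P 0\<^esub> p0 = \<zero>\<^bsub>P 0\<^esub>"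
        using left_module.smult_zero_left[OF left_module_PL[of 0], of p0] p0(1) by simp
      ultimately show ?thesis
        using s(2)[OF D_closed[OF y]] D_closed[OF y] by (simp add: minus_PL) (simp add: a_minus_def neg0)
    qed
    then show "\<exists>s. ?ok 0 s" using s(1) by blast
  next
    fix s and n :: nat assume ok: "?ok n s"
    then have s: "s \<in> mhom \<Lambda> (PL n) (PL (Suc n))" "\<And>y. y \<in> carrier (P (Suc n)) \<Longrightarrow> D n (s (D n y)) = D n y" by auto
    let ?h = "\<lambda>x. x \<ominus>\<^bsub>PL (Suc n)\<^esub> s (D n x)"
    have h: "?h \<in> mhom \<Lambda> (PL (Suc n)) (PL (Suc n))"
      by (intro mhom_minus_fun left_module_PL mhom_id mhom_comp[OF mhom_PL[OF D_hom] s(1)])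
    have him: "?h x \<in> D (Suc n) ` carrier (P (Suc (Suc n)))" if x: "x \<in> carrier (P (Suc n))" for x
    proof -
      have sc: "s (D n x) \<in> carrier (P (Suc n))" using mhom_closed[OF s(1), of "D n x"] D_closed[OF x] by simp
      have "D n (?h x) = D n x \<ominus>\<^bsub>P n\<^esub> D n x"
        using mhom_diff[OF left_module_P left_module_P D_hom x sc] s(2)[OF x] by (simp add: minus_PL)
      also have "\<dots> = \<zero>\<^bsub>P n\<^esub>" using D_closed[OF x] by (simp add: a_minus_def P.M.r_neg)
      finally show ?thesis unfolding res_facts(6) using mhom_closed[OF h, of x] x by simp
    qed
    obtain s' where s': "s' \<in> mhom \<Lambda> (PL (Suc n)) (PL (Suc (Suc n)))" "\<And>x. x \<in> carrier (P (Suc n)) \<Longrightarrow> D (Suc n) (s' x) = ?h x"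
      using PL_lift[OF mhom_PL[OF D_hom] h him] by blast
    have "D (Suc n) (s' (D (Suc n) y)) = D (Suc n) y" if y: "y \<in> carrier (P (Suc (Suc n)))" for y
    proof -
      have "s \<zero>\<^bsub>P n\<^esub> = \<zero>\<^bsub>P (Suc n)\<^esub>" using mhom_zero[OF left_module_PL left_module_PL s(1)] by simp
      then show ?thesis
        using s'(2)[OF D_closed[OF y]] D_D[OF y] D_closed[OF y] by (simp add: minus_PL) (simp add: a_minus_def neg0)
    qed
    then have "?ok (Suc n) s' \<and> ?next n s s'" using s' by (simp add: minus_PL)
    then show "\<exists>s'. ?ok (Suc n) s' \<and> ?next n s s'" by blast
  qed
  then obtain f where f: "\<forall>n. ?ok n (f n) \<and> ?next n (f n) (f (Suc n))" ..
  show ?thesis by (rule that[of f]) (use f in auto)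
qed

text \<open>The contraction \<open>s\<close> is linear on the left only, so
  \<open>f \<circ> s\<close> bounds \<open>f\<close> without being a bimodule map. The dual basis
  \<open>q\<close>, \<open>\<psi>\<close> of \<open>Q\<close> repairs this:
  \<open>\<psi> i u\<close> acts on \<open>p\<close> from the right before \<open>s\<close> is
  applied, and the outcome is evaluated at \<open>q i\<close>.\<close>

lemma acyc_coind_projective:
  assumes Q: "left_module \<Lambda> Q" "fg_projective \<Lambda> Q" and Y: "left_module E Y"
  shows "acyc E P D m (coindE Q Y)"
proof (rule acycI)
  interpret Q: left_module \<Lambda> Q by (rule Q(1))
  interpret Y: left_module E Y by (rule Y)
  have H: "left_module E (coindE Q Y)" by (rule left_module_coindE[OF Q(1) Y])
  interpret H: left_module E "coindE Q Y" by (rule H)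
  fix f assume f: "f \<in> mhom E (P (Suc m)) (coindE Q Y)"
    and z: "\<And>x. x \<in> carrier (P (Suc (Suc m))) \<Longrightarrow> f (D (Suc m) x) = \<zero>\<^bsub>coindE Q Y\<^esub>"
  obtain n q \<psi> where q: "\<And>i. i < n \<Longrightarrow> q i \<in> carrier Q" and \<psi>: "\<And>i. i < n \<Longrightarrow> \<psi> i \<in> mhom \<Lambda> Q (regular_module \<Lambda>)"
    and eq: "\<And>x. x \<in> carrier Q \<Longrightarrow> (\<Oplus>\<^bsub>Q\<^esub>i\<in>{..<n::nat}. \<psi> i x \<odot>\<^bsub>Q\<^esub> q i) = x"
    by (rule fg_projectiveE[OF Q(2)]) blast
  have \<psi>c: "\<psi> i x \<in> carrier \<Lambda>" if "i < n" "x \<in> carrier Q" for i x using mhom_closed[OF \<psi>[OF that(1)] that(2)] by simp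
  obtain s where s: "\<And>n. s n \<in> mhom \<Lambda> (PL n) (PL (Suc n))"
    "\<And>n x. x \<in> carrier (P (Suc n)) \<Longrightarrow> D (Suc n) (s (Suc n) x) = x \<ominus>\<^bsub>P (Suc n)\<^esub> s n (D n x)"
    using left_contraction by blast
  have sc: "s k x \<in> carrier (P (Suc k))" if "x \<in> carrier (P k)" for k x using mhom_closed[OF s(1), of x k] that by simp
  have sl: "s k (lft a \<odot>\<^bsub>P k\<^esub> x) = lft a \<odot>\<^bsub>P (Suc k)\<^esub> s k x" if "a \<in> carrier \<Lambda>" "x \<in> carrier (P k)" for k a x
    using mhom_smult[OF s(1), of a x k] that by simp
  have sa: "s k (x \<oplus>\<^bsub>P k\<^esub> y) = s k x \<oplus>\<^bsub>P (Suc k)\<^esub> s k y" if "x \<in> carrier (P k)" "y \<in> carrier (P k)" for k x y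
    using mhom_add[OF s(1), of x k y] that by simp
  note fD = coind_homD[OF left_module_P Q(1) Y f]
  have fc: "f x u \<in> carrier Y" if "x \<in> carrier (P (Suc m))" "u \<in> carrier Q" for x u
    using coindD(1)[OF fD(1)] that by blast
  have fl: "f (lft a \<odot>\<^bsub>P (Suc m)\<^esub> x) u = lft a \<odot>\<^bsub>Y\<^esub> f x u" if "a \<in> carrier \<Lambda>" "x \<in> carrier (P (Suc m))" "u \<in> carrier Q" for a x u
    using fD(3)[of a "\<one>\<^bsub>\<Lambda>\<^esub>" x u] that by (simp add: lft_def)
  have fr: "f (rgt b \<odot>\<^bsub>P (Suc m)\<^esub> x) u = f x (b \<odot>\<^bsub>Q\<^esub> u)" if "b \<in> carrier \<Lambda>" "x \<in> carrier (P (Suc m))" "u \<in> carrier Q" for b x u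
    using fD(3)[of "\<one>\<^bsub>\<Lambda>\<^esub>" b x u] that fc[of x "b \<odot>\<^bsub>Q\<^esub> u"] by (simp add: rgt_def ring_hom_one[OF lft_hom])
  \<comment> \<open>In positive degree \<open>x = D (s x) + s (D x)\<close>, and a cocycle vanishes
    on the first summand.\<close>
  have fs: "f (s m (D m x)) = f x" if x: "x \<in> carrier (P (Suc m))" for x
  proof -
    have "x = D (Suc m) (s (Suc m) x) \<oplus>\<^bsub>P (Suc m)\<^esub> s m (D m x)"
      using s(2)[OF x] x sc[OF D_closed[OF x]] by (simp add: a_minus_def P.M.a_assoc P.M.l_neg)
    then have "f x = f (D (Suc m) (s (Suc m) x)) \<oplus>\<^bsub>coindE Q Y\<^esub> f (s m (D m x))"
      using mhom_add[OF f D_closed[OF sc[OF x]] sc[OF D_closed[OF x]]] by simp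
    then show ?thesis
      using z[OF sc[OF x]] mhom_closed[OF f sc[OF D_closed[OF x]]] H.M.l_zero by simp
  qed
  \<comment> \<open>In bimodule notation the \<open>i\<close>-th summand is
    \<open>f(s(p \<psi> i(u)))\<close> evaluated at \<open>q i\<close>.\<close>
  define t where "t i p u = f (s m (rgt (\<psi> i u) \<odot>\<^bsub>P m\<^esub> p)) (q i)" for i p u
  have t: "(\<lambda>p. \<lambda>u\<in>carrier Q. t i p u) \<in> mhom E (P m) (coindE Q Y)" if i: "i < n" for i
  proof (rule coind_homI[OF left_module_P Q(1) Y])
    fix p u assume pu: "p \<in> carrier (P m)" "u \<in> carrier Q"
    show "t i p u \<in> carrier Y" using pu i by (simp add: t_def fc sc \<psi>c q)
    show "t i (p \<oplus>\<^bsub>P m\<^esub> p') u = t i p u \<oplus>\<^bsub>Y\<^esub> t i p' u" if "p' \<in> carrier (P m)" for p'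
      using pu i that by (simp add: t_def sc \<psi>c q P.smult_r_distr sa fD(2))
    show "t i p (u \<oplus>\<^bsub>Q\<^esub> u') = t i p u \<oplus>\<^bsub>Y\<^esub> t i p u'" if "u' \<in> carrier Q" for u'
      using pu i that ring_hom_add[OF rgt_hom]
      by (simp add: t_def sc \<psi>c q mhom_add[OF \<psi>] P.smult_l_distr sa fD(2))
    fix a b assume ab: "a \<in> carrier \<Lambda>" "b \<in> carrier \<Lambda>"
    \<comment> \<open>Right linearity is restored here:
      \<open>(a p b) \<psi> i(u) = a (p \<psi> i(b u))\<close>, by left linearity of
      \<open>\<psi> i\<close>; then \<open>a\<close> passes through \<open>s\<close>.\<close>
    have "rgt (\<psi> i u) \<odot>\<^bsub>P m\<^esub> (pe a b \<odot>\<^bsub>P m\<^esub> p) = lft a \<odot>\<^bsub>P m\<^esub> (rgt (\<psi> i (b \<odot>\<^bsub>Q\<^esub> u)) \<odot>\<^bsub>P m\<^esub> p)"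
      using pu i ab by (simp add: P.smult_assoc[symmetric] \<psi>c mhom_smult[OF \<psi>] rgt_def lft_def pe_mult)
    then show "t i (pe a b \<odot>\<^bsub>P m\<^esub> p) u = lft a \<odot>\<^bsub>Y\<^esub> t i p (b \<odot>\<^bsub>Q\<^esub> u)"
      using pu i ab by (simp add: t_def sl fl sc \<psi>c q)
  qed
  define g where "g p = (\<Oplus>\<^bsub>coindE Q Y\<^esub>i\<in>{..<n}. (\<lambda>u\<in>carrier Q. t i p u))" for p
  have g: "g \<in> mhom E (P m) (coindE Q Y)"
    unfolding g_def by (rule mhom_sum[OF H]) (simp add: t)
  have "f x = g (D m x)" if x: "x \<in> carrier (P (Suc m))" for x
  proof (rule coind_eqI[OF fD(1)[OF x]])
    show "g (D m x) \<in> carrier (coind Q Y)" using mhom_closed[OF g D_closed[OF x]] by simp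
    fix u assume u: "u \<in> carrier Q"
    have "g (D m x) u = (\<Oplus>\<^bsub>Y\<^esub>i\<in>{..<n}. (\<lambda>u\<in>carrier Q. t i (D m x) u) u)"
      unfolding g_def using u mhom_closed[OF t D_closed[OF x]]
      by (intro finsum_additive[where f = "\<lambda>h. h u", OF H.M.abelian_group_axioms Y.M.abelian_group_axioms])
        (auto simp: coindD(1))
    \<comment> \<open>As \<open>s D\<close> is invisible to \<open>f\<close>, the right factor
      \<open>\<psi> i u\<close> can be moved through \<open>f\<close> to the argument
      \<open>q i\<close>; then the dual basis sums to \<open>u\<close>.\<close>
    also have "\<dots> = (\<Oplus>\<^bsub>Y\<^esub>i\<in>{..<n}. f x (\<psi> i u \<odot>\<^bsub>Q\<^esub> q i))"
    proof (rule Y.M.finsum_cong')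
      fix i assume "i \<in> {..<n}"
      then have i: "i < n" by simp
      have "rgt (\<psi> i u) \<odot>\<^bsub>P m\<^esub> D m x = D m (rgt (\<psi> i u) \<odot>\<^bsub>P (Suc m)\<^esub> x)"
        using mhom_smult[OF D_hom, of "rgt (\<psi> i u)" x m] x \<psi>c[OF i u] by simp
      then show "(\<lambda>u\<in>carrier Q. t i (D m x) u) u = f x (\<psi> i u \<odot>\<^bsub>Q\<^esub> q i)"
        using u x i by (simp add: t_def fs fr \<psi>c q)
    qed (auto simp: fc x \<psi>c u q)
    also have "\<dots> = f x (\<Oplus>\<^bsub>Q\<^esub>i\<in>{..<n}. \<psi> i u \<odot>\<^bsub>Q\<^esub> q i)"
      by (rule finsum_additive[symmetric, OF Q.M.abelian_group_axioms Y.M.abelian_group_axioms])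
        (auto simp: fc x \<psi>c u q coindD(2)[OF fD(1)[OF x]])
    finally show "f x u = g (D m x) u" using eq[OF u] by simp
  qed
  then show "\<exists>g\<in>mhom E (P m) (coindE Q Y). \<forall>x\<in>carrier (P (Suc m)). f x = g (D m x)" using g by blast
qed

text \<open>With \<open>V\<close> the kernel of \<open>\<delta>\<close>, linear maps into
  \<open>Y\<close> turn \<open>0 \<rightarrow> V \<rightarrow> Q \<rightarrow> U \<rightarrow>
  0\<close> into an exact sequence of bimodules, because it splits over the field. The claim is then
  the degree shift \<open>acyc_shift\<close>. The section \<open>\<sigma>\<close> and the projection
  \<open>r\<close> are linear over the field only; they never serve as bimodule maps.\<close>

lemma acyc_coind_step:
  assumes Q: "left_module \<Lambda> Q" and U: "fd_left_module K \<Lambda> U" and Y: "left_module E Y"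
    and \<delta>: "\<delta> \<in> mhom \<Lambda> Q U" "\<delta> ` carrier Q = carrier U"
    and acQ: "acyc E P D (Suc m) (coindE Q Y)"
    and acV: "acyc E P D m (coindE (Q\<lparr>carrier := {x \<in> carrier Q. \<delta> x = \<zero>\<^bsub>U\<^esub>}\<rparr>) Y)"
  shows "acyc E P D (Suc m) (coindE U Y)"
proof -
  note lU = fd_left_moduleD(1)[OF U]
  interpret Q: left_module \<Lambda> Q by (rule Q)
  interpret U: left_module \<Lambda> U by (rule lU)
  interpret Y: left_module E Y by (rule Y)
  let ?V = "{x \<in> carrier Q. \<delta> x = \<zero>\<^bsub>U\<^esub>}"
  let ?QV = "Q\<lparr>carrier := ?V\<rparr>"
  have lV: "left_module \<Lambda> ?QV" by (rule Q.left_module_sub[OF submod_ker[OF Q lU \<delta>(1)]])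
  have sQ: "left_module K (scalars \<Lambda> Q)" and sU: "left_module K (scalars \<Lambda> U)"
    by (rule L.left_module_scalars, fact)+
  have "\<And>x. x \<in> carrier (scalars \<Lambda> U) \<Longrightarrow> x \<in> \<delta> ` carrier (scalars \<Lambda> Q)" using \<delta>(2) by simp
  then obtain \<sigma> where \<sigma>: "\<sigma> \<in> mhom K (scalars \<Lambda> U) (scalars \<Lambda> Q)" "\<And>x. x \<in> carrier (scalars \<Lambda> U) \<Longrightarrow> \<delta> (\<sigma> x) = x"
    using fg_projective_lift[OF sU sQ sU fd_space_fg_projective[OF fd_left_moduleD(2)[OF U]] L.mhom_scalars[OF \<delta>(1)] mhom_id]
    by metis
  have \<sigma>c: "\<sigma> u \<in> carrier Q" if "u \<in> carrier U" for u using mhom_closed[OF \<sigma>(1), of u] that by simp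
  have \<sigma>a: "\<sigma> (u \<oplus>\<^bsub>U\<^esub> v) = \<sigma> u \<oplus>\<^bsub>Q\<^esub> \<sigma> v" if "u \<in> carrier U" "v \<in> carrier U" for u v
    using mhom_add[OF \<sigma>(1), of u v] that by simp
  have \<sigma>s: "\<sigma> ((c \<odot>\<^bsub>\<Lambda>\<^esub> \<one>\<^bsub>\<Lambda>\<^esub>) \<odot>\<^bsub>U\<^esub> u) = (c \<odot>\<^bsub>\<Lambda>\<^esub> \<one>\<^bsub>\<Lambda>\<^esub>) \<odot>\<^bsub>Q\<^esub> \<sigma> u" if "c \<in> carrier K" "u \<in> carrier U" for c u
    using mhom_smult[OF \<sigma>(1), of c u] that by simp
  have \<sigma>0: "\<sigma> \<zero>\<^bsub>U\<^esub> = \<zero>\<^bsub>Q\<^esub>" using mhom_zero[OF sU sQ \<sigma>(1)] by simp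
  note \<delta>c = mhom_closed[OF \<delta>(1)]
  define r where "r x = x \<ominus>\<^bsub>Q\<^esub> \<sigma> (\<delta> x)" for x
  have rc: "r x \<in> ?V" if x: "x \<in> carrier Q" for x
  proof -
    have "\<delta> (r x) = \<delta> x \<ominus>\<^bsub>U\<^esub> \<delta> x"
      unfolding r_def using mhom_diff[OF Q lU \<delta>(1) x \<sigma>c[OF \<delta>c[OF x]]] \<sigma>(2) \<delta>c[OF x] by simp
    then show ?thesis using x \<sigma>c \<delta>c by (simp add: r_def a_minus_def U.M.r_neg)
  qed
  have ra: "r (x \<oplus>\<^bsub>Q\<^esub> y) = r x \<oplus>\<^bsub>Q\<^esub> r y" if "x \<in> carrier Q" "y \<in> carrier Q" for x y
    using that \<sigma>c \<delta>c by (simp add: r_def mhom_add[OF \<delta>(1)] \<sigma>a a_minus_def Q.M.minus_add Q.M.a_ac)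
  have rs: "r ((c \<odot>\<^bsub>\<Lambda>\<^esub> \<one>\<^bsub>\<Lambda>\<^esub>) \<odot>\<^bsub>Q\<^esub> x) = (c \<odot>\<^bsub>\<Lambda>\<^esub> \<one>\<^bsub>\<Lambda>\<^esub>) \<odot>\<^bsub>Q\<^esub> r x" if "c \<in> carrier K" "x \<in> carrier Q" for c x
    using that \<sigma>c \<delta>c by (simp add: r_def mhom_smult[OF \<delta>(1)] \<sigma>s a_minus_def Q.smult_r_distr Q.smult_minus_right)
  have rV: "r x = x" if "x \<in> ?V" for x
  proof -
    have "\<ominus>\<^bsub>Q\<^esub> \<zero>\<^bsub>Q\<^esub> = \<zero>\<^bsub>Q\<^esub>" by (rule Q.M.minus_equality) simp_all
    then show ?thesis using that by (simp add: r_def \<sigma>0 a_minus_def)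
  qed
  have dec: "x = r x \<oplus>\<^bsub>Q\<^esub> \<sigma> (\<delta> x)" if "x \<in> carrier Q" for x
    using that \<sigma>c \<delta>c by (simp add: r_def a_minus_def Q.M.a_assoc Q.M.l_neg)
  let ?i = "\<lambda>h. \<lambda>x\<in>carrier Q. h (\<delta> x)" and ?q = "\<lambda>h. \<lambda>x\<in>carrier ?QV. h x"
  have i: "?i \<in> mhom E (coindE U Y) (coindE Q Y)" by (rule coind_precomp[OF lU Q Y \<delta>(1)])
  have incl: "(\<lambda>x. x) \<in> mhom \<Lambda> ?QV Q" by (rule mhomI) auto
  have q: "?q \<in> mhom E (coindE Q Y) (coindE ?QV Y)" by (rule coind_precomp[OF Q lV Y incl])
  have inj: "inj_on ?i (carrier (coindE U Y))"
  proof (rule inj_onI)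
    fix h h' assume h: "h \<in> carrier (coindE U Y)" "h' \<in> carrier (coindE U Y)" "?i h = ?i h'"
    have "h (\<delta> x) = h' (\<delta> x)" if "x \<in> carrier Q" for x using fun_cong[OF h(3), of x] that by simp
    then have "h u = h' u" if "u \<in> carrier U" for u using \<delta>(2) that by (metis imageE)
    then show "h = h'" using h(1,2) by (intro coind_eqI[of h U Y h']) simp_all
  qed
  have surj: "?q ` carrier (coindE Q Y) = carrier (coindE ?QV Y)"
  proof (intro subset_antisym subsetI)
    fix h assume "h \<in> carrier (coindE ?QV Y)"
    then have h: "h \<in> carrier (coind ?QV Y)" by simp
    note hD = coindD[OF h]
    \<comment> \<open>The extension of \<open>h\<close> by zero on the complement
      \<open>\<sigma>(U)\<close> of \<open>V\<close>.\<close>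
    have m: "(\<lambda>x\<in>carrier Q. h (r x)) \<in> carrier (coind Q Y)"
    proof (rule coindI[OF Q])
      fix x assume x: "x \<in> carrier Q"
      show "h (r x) \<in> carrier Y" using hD(1)[of "r x"] rc[OF x] by simp
      show "h (r (x \<oplus>\<^bsub>Q\<^esub> y)) = h (r x) \<oplus>\<^bsub>Y\<^esub> h (r y)" if "y \<in> carrier Q" for y
        using hD(2)[of "r x" "r y"] rc[OF x] rc[OF that] ra[OF x that] by simp
      show "h (r ((c \<odot>\<^bsub>\<Lambda>\<^esub> \<one>\<^bsub>\<Lambda>\<^esub>) \<odot>\<^bsub>Q\<^esub> x)) = (c \<odot>\<^bsub>E\<^esub> \<one>\<^bsub>E\<^esub>) \<odot>\<^bsub>Y\<^esub> h (r x)" if "c \<in> carrier K" for c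
        using hD(3)[of c "r x"] rc[OF x] rs[OF that x] that by simp
    qed
    have "?q (\<lambda>x\<in>carrier Q. h (r x)) = h"
      by (rule coind_eqI[of _ ?QV Y]) (use mhom_closed[OF q, of "\<lambda>x\<in>carrier Q. h (r x)"] m h rV in auto)
    then show "h \<in> ?q ` carrier (coindE Q Y)" using m by (intro image_eqI[of _ _ "\<lambda>x\<in>carrier Q. h (r x)"]) simp_all
  qed (use mhom_closed[OF q] in auto)
  have ker: "h \<in> ?i ` carrier (coindE U Y)" if "h \<in> carrier (coindE Q Y)" "?q h = \<zero>\<^bsub>coindE ?QV Y\<^esub>" for h
  proof -
    have h: "h \<in> carrier (coind Q Y)" using that(1) by simp
    note hD = coindD[OF h]
    have h0: "h x = \<zero>\<^bsub>Y\<^esub>" if "x \<in> ?V" for x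
      using fun_cong[OF \<open>?q h = \<zero>\<^bsub>coindE ?QV Y\<^esub>\<close>, of x] that by simp
    \<comment> \<open>A map that vanishes on \<open>V\<close> factors through
      \<open>\<delta>\<close>; composing it with the section gives the factor.\<close>
    have m: "(\<lambda>u\<in>carrier U. h (\<sigma> u)) \<in> carrier (coind U Y)"
      by (rule coindI[OF lU]) (simp_all add: \<sigma>c \<sigma>a \<sigma>s hD)
    have "h (\<sigma> (\<delta> x)) = h x" if x: "x \<in> carrier Q" for x
    proof -
      have "h x = h (r x) \<oplus>\<^bsub>Y\<^esub> h (\<sigma> (\<delta> x))" using hD(2)[of "r x" "\<sigma> (\<delta> x)"] dec[OF x] rc[OF x] \<sigma>c[OF \<delta>c[OF x]] by simp
      then show ?thesis using h0[OF rc[OF x]] hD(1)[OF \<sigma>c[OF \<delta>c[OF x]]] by simp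
    qed
    then have "?i (\<lambda>u\<in>carrier U. h (\<sigma> u)) = h"
      by (intro coind_eqI[of _ Q Y]) (use mhom_closed[OF i, of "\<lambda>u\<in>carrier U. h (\<sigma> u)"] m h \<delta>c in auto)
    then show ?thesis using m by (intro image_eqI[of _ _ "\<lambda>u\<in>carrier U. h (\<sigma> u)"]) simp_all
  qed
  have qi: "?q (?i h) = \<zero>\<^bsub>coindE ?QV Y\<^esub>" if "h \<in> carrier (coindE U Y)" for h
  proof -
    have h: "h \<in> carrier (coind U Y)" using that by simp
    interpret HU: bimodule_over K \<Lambda> "coind U Y" by unfold_locales (rule bimodule_coind[OF lU Y])
    have "h \<zero>\<^bsub>U\<^esub> = \<zero>\<^bsub>Y\<^esub>"
      using coindD(1,2)[OF h, of "\<zero>\<^bsub>U\<^esub>"] Y.M.add.r_cancel_one'[of "h \<zero>\<^bsub>U\<^esub>" "h \<zero>\<^bsub>U\<^esub>"] by simp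
    then show ?thesis by (auto simp: fun_eq_iff restrict_def)
  qed
  show ?thesis
    by (rule acyc_shift[OF left_module_coindE[OF Q Y] left_module_coindE[OF lU Y] left_module_coindE[OF lV Y] i inj q surj ker qi acQ acV])
qed

text \<open>Dimension shifting along a finite resolution of \<open>U\<close>: its tail resolves the
  first syzygy and is shorter by one. All degrees \<open>m \<ge> n\<close> are treated together
  because each step lowers \<open>n\<close> and \<open>m\<close> at the same time.\<close>

lemma acyc_coind_resolution:
  fixes U :: "('a, nat \<Rightarrow> 'k) module" and Q :: "nat \<Rightarrow> ('a, nat \<Rightarrow> 'k) module"
  assumes "fd_left_module K \<Lambda> U" "projective_resolution K \<Lambda> U Q d \<delta>"
    and "\<And>i. i > n \<Longrightarrow> carrier (Q i) = {\<zero>\<^bsub>Q i\<^esub>}" and Y: "left_module E Y" and "n \<le> m"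
  shows "acyc E P D m (coindE U Y)"
  using assms(1-3,5)
proof (induction n arbitrary: U Q d \<delta> m)
  case 0
  have r: "projective_module K \<Lambda> (Q i)" "\<delta> \<in> mhom \<Lambda> (Q 0) U" "\<delta> ` carrier (Q 0) = carrier U"
    "d 0 ` carrier (Q 1) = {x \<in> carrier (Q 0). \<delta> x = \<zero>\<^bsub>U\<^esub>}" "d 0 \<in> mhom \<Lambda> (Q 1) (Q 0)" for i
    using 0(2) by (simp_all add: projective_resolution_def)
  have lQ: "left_module \<Lambda> (Q i)" for i using r(1)[of i] by (simp add: projective_module_def fd_left_module_def)
  have lU: "left_module \<Lambda> U" using 0(1) by (simp add: fd_left_module_def)
  \<comment> \<open>Length zero: the kernel of \<open>\<delta>\<close> is the image of the zero
    module \<open>Q 1\<close>. So \<open>\<delta>\<close> is an isomorphism and \<open>U\<close> is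
    itself projective.\<close>
  have k: "{x \<in> carrier (Q 0). \<delta> x = \<zero>\<^bsub>U\<^esub>} = {\<zero>\<^bsub>Q 0\<^esub>}"
    using r(4) 0(3)[of 1] mhom_zero[OF lQ lQ r(5)] by simp
  interpret Q0: left_module \<Lambda> "Q 0" by (rule lQ)
  interpret U: left_module \<Lambda> U by (rule lU)
  have "inj_on \<delta> (carrier (Q 0))"
  proof (rule inj_onI)
    fix x y assume xy: "x \<in> carrier (Q 0)" "y \<in> carrier (Q 0)" "\<delta> x = \<delta> y"
    then have "\<delta> (x \<ominus>\<^bsub>Q 0\<^esub> y) = \<zero>\<^bsub>U\<^esub>"
      using mhom_diff[OF lQ lU r(2) xy(1,2)] mhom_closed[OF r(2) xy(2)] by (simp add: a_minus_def U.M.r_neg)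
    then have "x \<ominus>\<^bsub>Q 0\<^esub> y \<in> {x \<in> carrier (Q 0). \<delta> x = \<zero>\<^bsub>U\<^esub>}" using xy by simp
    then have "x \<ominus>\<^bsub>Q 0\<^esub> y = \<zero>\<^bsub>Q 0\<^esub>" unfolding k by simp
    then show "x = y" using xy by simp
  qed
  then have "fg_projective \<Lambda> U"
    using r(3) by (intro fg_projective_iso[OF lQ lU L.projective_imp_fg_projective[OF fd r(1)[of 0]] r(2)])
      (simp add: bij_betw_def)
  then show ?case by (rule acyc_coind_projective[OF lU _ Y])
next
  case (Suc n)
  have r: "projective_module K \<Lambda> (Q i)" "\<delta> \<in> mhom \<Lambda> (Q 0) U" "\<delta> ` carrier (Q 0) = carrier U"
    "d 0 ` carrier (Q 1) = {x \<in> carrier (Q 0). \<delta> x = \<zero>\<^bsub>U\<^esub>}" "d i \<in> mhom \<Lambda> (Q (Suc i)) (Q i)"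
    "d (Suc i) ` carrier (Q (Suc (Suc i))) = {x \<in> carrier (Q (Suc i)). d i x = \<zero>\<^bsub>Q i\<^esub>}" for i
    using Suc.prems(2) by (simp_all add: projective_resolution_def)
  have fQ: "fd_left_module K \<Lambda> (Q i)" for i using r(1)[of i] by (simp add: projective_module_def)
  have lQ: "left_module \<Lambda> (Q i)" for i using fQ[of i] by (simp add: fd_left_module_def)
  have lU: "left_module \<Lambda> U" using Suc.prems(1) by (simp add: fd_left_module_def)
  let ?V = "{x \<in> carrier (Q 0). \<delta> x = \<zero>\<^bsub>U\<^esub>}"
  \<comment> \<open>The syzygy is a restriction of \<open>Q 0\<close> and stays on the universe
    type, as the induction hypothesis requires.\<close>
  let ?QV = "Q 0\<lparr>carrier := ?V\<rparr>"
  have fV: "fd_left_module K \<Lambda> ?QV" by (rule L.fd_left_module_sub[OF fQ submod_ker[OF lQ lU r(2)]])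
  have "d 0 \<in> mhom \<Lambda> (Q (Suc 0)) ?QV"
    using r(4) by (intro mhomI) (use mhom_add[OF r(5)[of 0]] mhom_smult[OF r(5)[of 0]] in auto)
  then have "projective_resolution K \<Lambda> ?QV (\<lambda>i. Q (Suc i)) (\<lambda>i. d (Suc i)) (d 0)"
    unfolding projective_resolution_def using r(1,4-6) by simp
  then have V: "acyc E P D k (coindE ?QV Y)" if "n \<le> k" for k
    using Suc.IH[OF fV, of "\<lambda>i. Q (Suc i)"] Suc.prems(3) that by auto
  obtain k where k: "m = Suc k" "n \<le> k" using Suc.prems(4) by (cases m) auto
  have pQ: "acyc E P D (Suc k) (coindE (Q 0) Y)"
    by (rule acyc_coind_projective[OF lQ L.projective_imp_fg_projective[OF fd r(1)] Y])
  show ?case unfolding k(1)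
    by (rule acyc_coind_step[OF lQ Suc.prems(1) Y r(2,3) pQ V[OF k(2)]])
qed

end

section \<open>Vanishing for all finite-dimensional coefficients and the retraction\<close>

lemma (in algebra_over_field) fd_regular:
  assumes "fd_space K A"
  shows "fd_left_module K A (regular_module A)"
proof -
  have "(\<lambda>x. x) \<in> mhom K A (scalars A (regular_module A))"
    by (rule mhomI) simp_all
  then show ?thesis
    using fd_space_image[OF assms left_module_scalars_regular, of "\<lambda>x. x"] left_module_regular[OF is_ring_A]
    by (simp add: fd_left_module_def)
qed

context bimodule_resolution
begin

text \<open>If \<open>Y rad = 0\<close>, then \<open>y \<mapsto> (u \<mapsto> y u)\<close> embeds \<open>Y\<close> into the bimodule of linear maps from
  \<open>U = \<Lambda> / rad\<close> to \<open>Y\<close>, and a separability idempotent \<open>\<Sum> u\<^sub>i \<otimes> v\<^sub>i\<close> provides the retraction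
  \<open>h \<mapsto> \<Sum> h(u\<^sub>i) v\<^sub>i\<close>.\<close>

lemma acyc_killed_by_rad:
  assumes Y: "left_module E Y" and kill: "\<And>j y. \<lbrakk>j \<in> rad; y \<in> carrier Y\<rbrakk> \<Longrightarrow> rgt j \<odot>\<^bsub>Y\<^esub> y = \<zero>\<^bsub>Y\<^esub>"
    and sep: "separable_algebra K (quotient_algebra \<Lambda> rad)"
    and U: "left_module \<Lambda> U" and \<pi>: "\<pi> \<in> mhom \<Lambda> (regular_module \<Lambda>) U" "\<pi> ` carrier \<Lambda> = carrier U"
    and \<pi>0: "\<And>a. a \<in> carrier \<Lambda> \<Longrightarrow> \<pi> a = \<zero>\<^bsub>U\<^esub> \<longleftrightarrow> a \<in> rad"
    and ac: "acyc E P D m (coindE U Y)"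
  shows "acyc E P D m Y"
proof -
  interpret Y: left_module E Y by (rule Y)
  interpret U: left_module \<Lambda> U by (rule U)
  interpret VL: left_module K \<Lambda> by (rule L.left_module_self)
  interpret S: enveloping K "L.S" by (intro enveloping.intro L.algebra_S[OF fd])
  interpret SR: bimodule_over K "L.S" "regular_bimodule L.S" by unfold_locales (rule S.bimodule_regular)
  have SRs: "carrier (regular_bimodule L.S) = carrier L.S" "smult (regular_bimodule L.S) = mult L.S"
    "rsmult (regular_bimodule L.S) = mult L.S" "add (regular_bimodule L.S) = add L.S"
    by (simp_all add: regular_bimodule_def)
  let ?R = "pullback rgt Y"
  interpret R: left_module "op_algebra \<Lambda>" ?R by (rule left_module_pullback[OF Y op.is_ring_A rgt_hom])
  note ops = L.res_ops[OF fd]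
  note lh = ring_hom_add[OF lft_hom] ring_hom_mult[OF lft_hom] ring_hom_one[OF lft_hom]
  have r_add: "rgt (a \<oplus>\<^bsub>\<Lambda>\<^esub> b) \<odot>\<^bsub>Y\<^esub> y = rgt a \<odot>\<^bsub>Y\<^esub> y \<oplus>\<^bsub>Y\<^esub> rgt b \<odot>\<^bsub>Y\<^esub> y"
    if "a \<in> carrier \<Lambda>" "b \<in> carrier \<Lambda>" "y \<in> carrier Y" for a b y
    using R.smult_l_distr[of a b y] that by simp
  have r_mult: "rgt (a \<otimes>\<^bsub>\<Lambda>\<^esub> b) \<odot>\<^bsub>Y\<^esub> y = rgt b \<odot>\<^bsub>Y\<^esub> (rgt a \<odot>\<^bsub>Y\<^esub> y)"
    if "a \<in> carrier \<Lambda>" "b \<in> carrier \<Lambda>" "y \<in> carrier Y" for a b y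
    using R.smult_assoc[of b a y] that by simp
  have r_one: "rgt \<one>\<^bsub>\<Lambda>\<^esub> \<odot>\<^bsub>Y\<^esub> y = y" if "y \<in> carrier Y" for y
    using R.smult_one[of y] that by simp
  have r_smult: "rgt (c \<odot>\<^bsub>\<Lambda>\<^esub> b) \<odot>\<^bsub>Y\<^esub> y = (c \<odot>\<^bsub>E\<^esub> \<one>\<^bsub>E\<^esub>) \<odot>\<^bsub>Y\<^esub> (rgt b \<odot>\<^bsub>Y\<^esub> y)"
    "rgt b \<odot>\<^bsub>Y\<^esub> ((c \<odot>\<^bsub>E\<^esub> \<one>\<^bsub>E\<^esub>) \<odot>\<^bsub>Y\<^esub> y) = (c \<odot>\<^bsub>E\<^esub> \<one>\<^bsub>E\<^esub>) \<odot>\<^bsub>Y\<^esub> (rgt b \<odot>\<^bsub>Y\<^esub> y)"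
    if "c \<in> carrier K" "b \<in> carrier \<Lambda>" "y \<in> carrier Y" for c b y
    using that by (simp_all add: Y.smult_assoc[symmetric] del: E.unit_closed) (simp_all add: rgt_def pe_smult_right)
  have lr: "rgt b \<odot>\<^bsub>Y\<^esub> (lft a \<odot>\<^bsub>Y\<^esub> y) = lft a \<odot>\<^bsub>Y\<^esub> (rgt b \<odot>\<^bsub>Y\<^esub> y)"
    "pe a b \<odot>\<^bsub>Y\<^esub> y = lft a \<odot>\<^bsub>Y\<^esub> (rgt b \<odot>\<^bsub>Y\<^esub> y)"
    if "a \<in> carrier \<Lambda>" "b \<in> carrier \<Lambda>" "y \<in> carrier Y" for a b y
    using that by (simp_all add: Y.smult_assoc[symmetric]) (simp_all add: pe_eq_rgt_lft[symmetric] pe_eq_lft_rgt[symmetric])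
  have r_eq: "rgt a \<odot>\<^bsub>Y\<^esub> y = rgt b \<odot>\<^bsub>Y\<^esub> y" if ab: "a \<in> carrier \<Lambda>" "b \<in> carrier \<Lambda>" "a \<ominus>\<^bsub>\<Lambda>\<^esub> b \<in> rad" and y: "y \<in> carrier Y" for a b y
  proof -
    have "a = (a \<ominus>\<^bsub>\<Lambda>\<^esub> b) \<oplus>\<^bsub>\<Lambda>\<^esub> b" using ab by (simp add: a_minus_def L.A.a_assoc L.A.l_neg)
    then have "rgt a \<odot>\<^bsub>Y\<^esub> y = rgt (a \<ominus>\<^bsub>\<Lambda>\<^esub> b) \<odot>\<^bsub>Y\<^esub> y \<oplus>\<^bsub>Y\<^esub> rgt b \<odot>\<^bsub>Y\<^esub> y"
      using r_add[of "a \<ominus>\<^bsub>\<Lambda>\<^esub> b" b y] ab y by simp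
    then show ?thesis using kill[OF ab(3) y] ab y by simp
  qed
  have \<pi>c: "\<pi> a \<in> carrier U" if "a \<in> carrier \<Lambda>" for a using mhom_closed[OF \<pi>(1), of a] that by simp
  have \<pi>a: "\<pi> (a \<oplus>\<^bsub>\<Lambda>\<^esub> b) = \<pi> a \<oplus>\<^bsub>U\<^esub> \<pi> b" if "a \<in> carrier \<Lambda>" "b \<in> carrier \<Lambda>" for a b
    using mhom_add[OF \<pi>(1), of a b] that by simp
  have \<pi>m: "\<pi> (a \<otimes>\<^bsub>\<Lambda>\<^esub> b) = a \<odot>\<^bsub>U\<^esub> \<pi> b" if "a \<in> carrier \<Lambda>" "b \<in> carrier \<Lambda>" for a b
    using mhom_smult[OF \<pi>(1), of a b] that by simp
  have \<pi>s: "\<pi> (c \<odot>\<^bsub>\<Lambda>\<^esub> b) = (c \<odot>\<^bsub>\<Lambda>\<^esub> \<one>\<^bsub>\<Lambda>\<^esub>) \<odot>\<^bsub>U\<^esub> \<pi> b" if "c \<in> carrier K" "b \<in> carrier \<Lambda>" for c b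
    using \<pi>m[of "c \<odot>\<^bsub>\<Lambda>\<^esub> \<one>\<^bsub>\<Lambda>\<^esub>" b] that by simp
  have \<pi>_eq: "\<pi> a = \<pi> b \<longleftrightarrow> a \<ominus>\<^bsub>\<Lambda>\<^esub> b \<in> rad" if ab: "a \<in> carrier \<Lambda>" "b \<in> carrier \<Lambda>" for a b
  proof -
    have "\<pi> (a \<ominus>\<^bsub>\<Lambda>\<^esub> b) \<oplus>\<^bsub>U\<^esub> \<pi> b = \<pi> a"
      using \<pi>a[of "a \<ominus>\<^bsub>\<Lambda>\<^esub> b" b] ab by (simp add: a_minus_def L.A.a_assoc L.A.l_neg)
    then have "\<pi> a = \<pi> b \<longleftrightarrow> \<pi> (a \<ominus>\<^bsub>\<Lambda>\<^esub> b) = \<zero>\<^bsub>U\<^esub>"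
      using U.M.add.r_cancel_one[of "\<pi> b" "\<pi> (a \<ominus>\<^bsub>\<Lambda>\<^esub> b)"] \<pi>c ab by auto
    then show ?thesis using \<pi>0 ab by simp
  qed
  have res_eq: "L.res a = L.res b \<longleftrightarrow> a \<ominus>\<^bsub>\<Lambda>\<^esub> b \<in> rad" if "a \<in> carrier \<Lambda>" "b \<in> carrier \<Lambda>" for a b
    by (rule VL.coset_eq_iff[OF L.submod_rad that])
  \<comment> \<open>The right action of \<Lambda> on \<open>Y\<close> factors through the quotient
    by the radical. \<open>U\<close> is only a copy of that quotient as a left module, on the
    universe type, so a preimage under \<open>\<pi>\<close> has to be chosen; \<open>r_eq\<close>
    makes the choice harmless.\<close>
  define act where "act y u = rgt (SOME a. a \<in> carrier \<Lambda> \<and> \<pi> a = u) \<odot>\<^bsub>Y\<^esub> y" for y u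
  have act: "act y (\<pi> a) = rgt a \<odot>\<^bsub>Y\<^esub> y" if "a \<in> carrier \<Lambda>" "y \<in> carrier Y" for a y
  proof -
    have "(SOME b. b \<in> carrier \<Lambda> \<and> \<pi> b = \<pi> a) \<in> carrier \<Lambda> \<and> \<pi> (SOME b. b \<in> carrier \<Lambda> \<and> \<pi> b = \<pi> a) = \<pi> a"
      by (rule someI[of _ a]) (use that in simp)
    then show ?thesis unfolding act_def using that \<pi>_eq by (intro r_eq) auto
  qed
  have Uc: "\<exists>a\<in>carrier \<Lambda>. u = \<pi> a" if "u \<in> carrier U" for u using that \<pi>(2) by auto
  let ?i = "\<lambda>y. \<lambda>u\<in>carrier U. act y u"
  have i: "?i \<in> mhom E Y (coindE U Y)"
  proof (rule coind_homI[OF Y U Y])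
    fix y u assume y: "y \<in> carrier Y" and "u \<in> carrier U"
    then obtain a where a: "a \<in> carrier \<Lambda>" "u = \<pi> a" using Uc by blast
    show "act y u \<in> carrier Y" using a y by (simp add: act)
    show "act (y \<oplus>\<^bsub>Y\<^esub> y') u = act y u \<oplus>\<^bsub>Y\<^esub> act y' u" if "y' \<in> carrier Y" for y'
      using a y that by (simp add: act Y.smult_r_distr)
    show "act y (u \<oplus>\<^bsub>U\<^esub> u') = act y u \<oplus>\<^bsub>Y\<^esub> act y u'" if "u' \<in> carrier U" for u'
    proof -
      obtain a' where a': "a' \<in> carrier \<Lambda>" "u' = \<pi> a'" using Uc \<open>u' \<in> carrier U\<close> by blast
      then show ?thesis using a y by (simp add: \<pi>a[symmetric] act r_add)
    qed
    fix b c assume bc: "b \<in> carrier \<Lambda>" "c \<in> carrier \<Lambda>"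
    show "act (pe b c \<odot>\<^bsub>Y\<^esub> y) u = lft b \<odot>\<^bsub>Y\<^esub> act y (c \<odot>\<^bsub>U\<^esub> u)"
      using a y bc by (simp add: \<pi>m[symmetric] act r_mult lr)
  qed
  \<comment> \<open>A second copy of the quotient, now as the algebra over which the separability
    idempotent lives. \<open>rep\<close> picks representatives of its cosets and so connects the two
    copies.\<close>
  define rep where "rep F = (SOME a. a \<in> carrier \<Lambda> \<and> L.res a = F)" for F
  have rep: "rep (L.res a) \<in> carrier \<Lambda>" "rep (L.res a) \<ominus>\<^bsub>\<Lambda>\<^esub> a \<in> rad" if "a \<in> carrier \<Lambda>" for a
  proof -
    have "rep (L.res a) \<in> carrier \<Lambda> \<and> L.res (rep (L.res a)) = L.res a"
      unfolding rep_def by (rule someI[of _ a]) (use that in simp)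
    then show "rep (L.res a) \<in> carrier \<Lambda>" "rep (L.res a) \<ominus>\<^bsub>\<Lambda>\<^esub> a \<in> rad" using res_eq that by auto
  qed
  have rep_r: "rgt (rep (L.res a)) \<odot>\<^bsub>Y\<^esub> y = rgt a \<odot>\<^bsub>Y\<^esub> y" if "a \<in> carrier \<Lambda>" "y \<in> carrier Y" for a y
    using rep that by (intro r_eq) auto
  have rep_\<pi>: "\<pi> (rep (L.res a)) = \<pi> a" if "a \<in> carrier \<Lambda>" for a
    using rep that \<pi>_eq by auto
  \<comment> \<open>The retraction formula for a variable tensor: \<open>u \<otimes> v\<close> goes
    to \<open>h(u) v\<close>. It is evaluated at the idempotent only at the end, so that its
    identities can be shown by induction on tensors.\<close>
  define Lh where "Lh h = tensor_lift K (scalars E Y) (\<lambda>(F, G). rgt (rep G) \<odot>\<^bsub>Y\<^esub> h (\<pi> (rep F)))" for h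
  have sY: "left_module K (scalars E Y)" by (rule E.left_module_scalars[OF Y])
  have bal: "balanced K (regular_module K) L.S (op_algebra L.S) (scalars E Y) (\<lambda>F G. rgt (rep G) \<odot>\<^bsub>Y\<^esub> h (\<pi> (rep F)))"
    if h: "h \<in> carrier (coind U Y)" for h
  proof (rule S.TE.bilinearI)
    note hD = coindD[OF h]
    fix F G assume "F \<in> carrier L.S" "G \<in> carrier (op_algebra L.S)"
    then obtain a b where a: "a \<in> carrier \<Lambda>" "F = L.res a" and b: "b \<in> carrier \<Lambda>" "G = L.res b"
      by (auto elim!: L.S_cases)
    show "rgt (rep G) \<odot>\<^bsub>Y\<^esub> h (\<pi> (rep F)) \<in> carrier (scalars E Y)"
      using a b hD(1) \<pi>c by (simp add: rep_r rep_\<pi>)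
    show "rgt (rep G) \<odot>\<^bsub>Y\<^esub> h (\<pi> (rep (F \<oplus>\<^bsub>L.S\<^esub> F'))) =
        rgt (rep G) \<odot>\<^bsub>Y\<^esub> h (\<pi> (rep F)) \<oplus>\<^bsub>scalars E Y\<^esub> rgt (rep G) \<odot>\<^bsub>Y\<^esub> h (\<pi> (rep F'))" if F': "F' \<in> carrier L.S" for F'
    proof -
      obtain a' where "a' \<in> carrier \<Lambda>" "F' = L.res a'" using F' by (auto elim!: L.S_cases)
      then show ?thesis using a b hD(1,2) \<pi>c by (simp add: ops rep_r rep_\<pi> \<pi>a Y.smult_r_distr)
    qed
    show "rgt (rep (G \<oplus>\<^bsub>op_algebra L.S\<^esub> G')) \<odot>\<^bsub>Y\<^esub> h (\<pi> (rep F)) =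
        rgt (rep G) \<odot>\<^bsub>Y\<^esub> h (\<pi> (rep F)) \<oplus>\<^bsub>scalars E Y\<^esub> rgt (rep G') \<odot>\<^bsub>Y\<^esub> h (\<pi> (rep F))" if G': "G' \<in> carrier (op_algebra L.S)" for G'
    proof -
      obtain b' where "b' \<in> carrier \<Lambda>" "G' = L.res b'" using G' by (auto elim!: L.S_cases)
      then show ?thesis using a b hD(1) \<pi>c by (simp add: ops rep_r rep_\<pi> r_add)
    qed
    fix c assume c: "c \<in> carrier K"
    show "rgt (rep G) \<odot>\<^bsub>Y\<^esub> h (\<pi> (rep (c \<odot>\<^bsub>L.S\<^esub> F))) = c \<odot>\<^bsub>scalars E Y\<^esub> (rgt (rep G) \<odot>\<^bsub>Y\<^esub> h (\<pi> (rep F)))"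
      using a b c hD(1,3) \<pi>c by (simp add: ops rep_r rep_\<pi> \<pi>s r_smult)
    show "rgt (rep (c \<odot>\<^bsub>op_algebra L.S\<^esub> G)) \<odot>\<^bsub>Y\<^esub> h (\<pi> (rep F)) = c \<odot>\<^bsub>scalars E Y\<^esub> (rgt (rep G) \<odot>\<^bsub>Y\<^esub> h (\<pi> (rep F)))"
      using a b c hD(1) \<pi>c by (simp add: ops rep_r rep_\<pi> r_smult)
  qed
  have Lhom: "Lh h \<in> mhom K S.E (scalars E Y)" if "h \<in> carrier (coind U Y)" for h
    unfolding Lh_def by (rule S.E_lift(1)[OF sY bal[OF that]])
  have Lc: "Lh h \<xi> \<in> carrier Y" if "h \<in> carrier (coind U Y)" "\<xi> \<in> carrier S.E" for h \<xi>
    using mhom_closed[OF Lhom[OF that(1)] that(2)] by simp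
  have La: "Lh h (\<xi> \<oplus>\<^bsub>S.E\<^esub> \<zeta>) = Lh h \<xi> \<oplus>\<^bsub>Y\<^esub> Lh h \<zeta>" if "h \<in> carrier (coind U Y)" "\<xi> \<in> carrier S.E" "\<zeta> \<in> carrier S.E" for h \<xi> \<zeta>
    using mhom_add[OF Lhom[OF that(1)] that(2,3)] by simp
  have Lp: "Lh h (S.pe (L.res a) (L.res b)) = rgt b \<odot>\<^bsub>Y\<^esub> h (\<pi> a)" if "h \<in> carrier (coind U Y)" "a \<in> carrier \<Lambda>" "b \<in> carrier \<Lambda>" for h a b
    using S.E_lift(2)[OF sY bal[OF that(1)], of "L.res a" "L.res b"] that coindD(1)[OF that(1)] \<pi>c
    by (simp add: Lh_def ops rep_r rep_\<pi>)
  interpret C: bimodule_over K \<Lambda> "coind U Y" by unfold_locales (rule bimodule_coind[OF U Y])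
  have S1: "\<one>\<^bsub>L.S\<^esub> = L.res \<one>\<^bsub>\<Lambda>\<^esub>" by (simp add: L.S_simps)
  have L_add: "Lh (h \<oplus>\<^bsub>coind U Y\<^esub> h') \<xi> = Lh h \<xi> \<oplus>\<^bsub>Y\<^esub> Lh h' \<xi>"
    if h: "h \<in> carrier (coind U Y)" "h' \<in> carrier (coind U Y)" and "\<xi> \<in> carrier S.E" for h h' \<xi>
    using that(3)
  proof (induction \<xi> rule: S.E_induct)
    case (pure F G)
    then obtain a b where ab: "a \<in> carrier \<Lambda>" "F = L.res a" "b \<in> carrier \<Lambda>" "G = L.res b" by (auto elim!: L.S_cases)
    have "(h \<oplus>\<^bsub>coind U Y\<^esub> h') (\<pi> a) = h (\<pi> a) \<oplus>\<^bsub>Y\<^esub> h' (\<pi> a)" using \<pi>c ab by simp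
    then show ?case
      using ab \<pi>c coindD(1)[OF h(1)] coindD(1)[OF h(2)]
      by (simp add: Lp[OF C.X.M.a_closed[OF h]] Lp[OF h(1)] Lp[OF h(2)] Y.smult_r_distr del: coind_simps)
  next
    case (add \<xi> \<zeta>)
    then show ?case using h C.X.M.a_closed[OF h] by (simp add: La Lc Y.M.a_ac del: coind_simps)
  qed
  \<comment> \<open>The right action on \<open>h\<close> multiplies the first tensor factor from the
    left. Together with \<open>L_right\<close> and the defining property of the idempotent, this
    gives right linearity of the retraction.\<close>
  have L_left: "Lh (pe a b \<odot>\<^bsub>coindE U Y\<^esub> h) \<xi> = lft a \<odot>\<^bsub>Y\<^esub> Lh h (S.pe (L.res b) \<one>\<^bsub>L.S\<^esub> \<otimes>\<^bsub>S.E\<^esub> \<xi>)"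
    if ab: "a \<in> carrier \<Lambda>" "b \<in> carrier \<Lambda>" and h: "h \<in> carrier (coind U Y)" and "\<xi> \<in> carrier S.E" for a b h \<xi>
  proof -
    have hc: "pe a b \<odot>\<^bsub>coindE U Y\<^esub> h \<in> carrier (coind U Y)" using C.env_left_closed[of "pe a b" h] ab h by simp
    show ?thesis using that(4)
    proof (induction \<xi> rule: S.E_induct)
      case (pure F G)
      then obtain c d where cd: "c \<in> carrier \<Lambda>" "F = L.res c" "d \<in> carrier \<Lambda>" "G = L.res d" by (auto elim!: L.S_cases)
      have "S.pe (L.res b) \<one>\<^bsub>L.S\<^esub> \<otimes>\<^bsub>S.E\<^esub> S.pe F G = S.pe (L.res (b \<otimes>\<^bsub>\<Lambda>\<^esub> c)) (L.res d)"
        using cd ab by (simp add: S.pe_mult ops S1)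
      then show ?case
        using cd ab hc h \<pi>c coindD(1)[OF h] by (simp add: Lp) (simp add: coindE_pure[OF U Y] \<pi>m lr)
    next
      case (add \<xi> \<zeta>)
      have m: "S.pe (L.res b) \<one>\<^bsub>L.S\<^esub> \<in> carrier S.E" using ab by (simp add: S1 ops)
      show ?case using add m ab h hc by (simp add: La S.E.A.r_distr Y.smult_r_distr Lc)
    qed
  qed
  have L_right: "Lh h (S.pe \<one>\<^bsub>L.S\<^esub> (L.res b) \<otimes>\<^bsub>S.E\<^esub> \<xi>) = rgt b \<odot>\<^bsub>Y\<^esub> Lh h \<xi>"
    if b: "b \<in> carrier \<Lambda>" and h: "h \<in> carrier (coind U Y)" and "\<xi> \<in> carrier S.E" for b h \<xi>
    using that(3)
  proof (induction \<xi> rule: S.E_induct)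
    case (pure F G)
    then obtain c d where cd: "c \<in> carrier \<Lambda>" "F = L.res c" "d \<in> carrier \<Lambda>" "G = L.res d" by (auto elim!: L.S_cases)
    have "S.pe \<one>\<^bsub>L.S\<^esub> (L.res b) \<otimes>\<^bsub>S.E\<^esub> S.pe F G = S.pe (L.res c) (L.res (d \<otimes>\<^bsub>\<Lambda>\<^esub> b))"
      using cd b by (simp add: S.pe_mult ops S1)
    then show ?case using cd b h \<pi>c coindD(1)[OF h] by (simp add: Lp r_mult)
  next
    case (add \<xi> \<zeta>)
    have m: "S.pe \<one>\<^bsub>L.S\<^esub> (L.res b) \<in> carrier S.E" using b by (simp add: S1 ops)
    show ?case using add m b h by (simp add: La S.E.A.r_distr Y.smult_r_distr Lc)
  qed
  \<comment> \<open>On an embedded element \<open>y\<close> the result is \<open>y\<close> times the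
    product of the two tensor factors; at the idempotent this product is the unit.\<close>
  have L_emb: "Lh (?i y) \<xi> = rgt (rep (\<xi> \<odot>\<^bsub>SR.XL\<^esub> \<one>\<^bsub>L.S\<^esub>)) \<odot>\<^bsub>Y\<^esub> y" if y: "y \<in> carrier Y" and "\<xi> \<in> carrier S.E" for y \<xi>
  proof -
    define w where "w = ?i y"
    have iy: "w \<in> carrier (coind U Y)" using mhom_closed[OF i y] by (simp add: w_def)
    have w\<pi>: "w (\<pi> c) = rgt c \<odot>\<^bsub>Y\<^esub> y" if "c \<in> carrier \<Lambda>" for c using that y \<pi>c by (simp add: act w_def)
    have S1c: "\<one>\<^bsub>L.S\<^esub> \<in> carrier L.S" by simp
    have "Lh w \<xi> = rgt (rep (\<xi> \<odot>\<^bsub>SR.XL\<^esub> \<one>\<^bsub>L.S\<^esub>)) \<odot>\<^bsub>Y\<^esub> y" using that(2)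
    proof (induction \<xi> rule: S.E_induct)
      case (pure F G)
      then obtain c d where cd: "c \<in> carrier \<Lambda>" "F = L.res c" "d \<in> carrier \<Lambda>" "G = L.res d" by (auto elim!: L.S_cases)
      have "S.pe F G \<odot>\<^bsub>SR.XL\<^esub> \<one>\<^bsub>L.S\<^esub> = L.res (c \<otimes>\<^bsub>\<Lambda>\<^esub> d)"
        using pure S1c cd by (simp add: SR.env_left_pure SRs) (simp add: ops)
      then show ?case using Lp[OF iy, of c d] cd y by (simp add: rep_r r_mult w\<pi>)
    next
      case (add \<xi> \<zeta>)
      have c: "\<xi> \<odot>\<^bsub>SR.XL\<^esub> \<one>\<^bsub>L.S\<^esub> \<in> carrier L.S" "\<zeta> \<odot>\<^bsub>SR.XL\<^esub> \<one>\<^bsub>L.S\<^esub> \<in> carrier L.S"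
        using SR.env_left_closed[of _ "\<one>\<^bsub>L.S\<^esub>"] add S1c by (simp_all add: SRs)
      then obtain a b where ab: "a \<in> carrier \<Lambda>" "\<xi> \<odot>\<^bsub>SR.XL\<^esub> \<one>\<^bsub>L.S\<^esub> = L.res a" "b \<in> carrier \<Lambda>" "\<zeta> \<odot>\<^bsub>SR.XL\<^esub> \<one>\<^bsub>L.S\<^esub> = L.res b"
        by (auto elim!: L.S_cases)
      have "(\<xi> \<oplus>\<^bsub>S.E\<^esub> \<zeta>) \<odot>\<^bsub>SR.XL\<^esub> \<one>\<^bsub>L.S\<^esub> = L.res (a \<oplus>\<^bsub>\<Lambda>\<^esub> b)"
        using SR.env_left_add[of \<xi> \<zeta> "\<one>\<^bsub>L.S\<^esub>"] add S1c ab by (simp add: SRs ops)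
      then show ?case using add ab iy y by (simp add: La rep_r r_add)
    qed
    then show ?thesis by (simp only: w_def)
  qed
  obtain e where e: "e \<in> carrier S.E" "e \<odot>\<^bsub>SR.XL\<^esub> \<one>\<^bsub>L.S\<^esub> = \<one>\<^bsub>L.S\<^esub>"
    "\<And>s. s \<in> carrier L.S \<Longrightarrow> S.pe s \<one>\<^bsub>L.S\<^esub> \<otimes>\<^bsub>S.E\<^esub> e = S.pe \<one>\<^bsub>L.S\<^esub> s \<otimes>\<^bsub>S.E\<^esub> e"
    using L.separability_idempotent[OF fd sep] by blast
  have r: "(\<lambda>h. Lh h e) \<in> mhom E (coindE U Y) Y"
  proof (rule mhom_EI[OF _ _ _ _ left_module_coindE[OF U Y] Y])
    fix h assume "h \<in> carrier (coindE U Y)"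
    then have h: "h \<in> carrier (coind U Y)" by simp
    show "Lh h e \<in> carrier Y" by (rule Lc[OF h e(1)])
    show "Lh (h \<oplus>\<^bsub>coindE U Y\<^esub> h') e = Lh h e \<oplus>\<^bsub>Y\<^esub> Lh h' e" if "h' \<in> carrier (coindE U Y)" for h'
      using L_add[OF h _ e(1), of h'] that by simp
    fix a b assume ab: "a \<in> carrier \<Lambda>" "b \<in> carrier \<Lambda>"
    have "Lh (pe a b \<odot>\<^bsub>coindE U Y\<^esub> h) e = lft a \<odot>\<^bsub>Y\<^esub> Lh h (S.pe (L.res b) \<one>\<^bsub>L.S\<^esub> \<otimes>\<^bsub>S.E\<^esub> e)"
      by (rule L_left[OF ab h e(1)])
    also have "S.pe (L.res b) \<one>\<^bsub>L.S\<^esub> \<otimes>\<^bsub>S.E\<^esub> e = S.pe \<one>\<^bsub>L.S\<^esub> (L.res b) \<otimes>\<^bsub>S.E\<^esub> e"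
      by (rule e(3)) (simp add: ops ab)
    also have "Lh h (S.pe \<one>\<^bsub>L.S\<^esub> (L.res b) \<otimes>\<^bsub>S.E\<^esub> e) = rgt b \<odot>\<^bsub>Y\<^esub> Lh h e"
      by (rule L_right[OF ab(2) h e(1)])
    also have "lft a \<odot>\<^bsub>Y\<^esub> (rgt b \<odot>\<^bsub>Y\<^esub> Lh h e) = pe a b \<odot>\<^bsub>Y\<^esub> Lh h e"
      using lr(2)[OF ab Lc[OF h e(1)]] by simp
    finally show "Lh (pe a b \<odot>\<^bsub>coindE U Y\<^esub> h) e = pe a b \<odot>\<^bsub>Y\<^esub> Lh h e" .
  qed simp
  have "Lh (?i y) e = y" if y: "y \<in> carrier Y" for y
    using L_emb[OF y e(1), unfolded e(2), unfolded S1] rep_r[of "\<one>\<^bsub>\<Lambda>\<^esub>" y] r_one[OF y] y by simp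
  then show ?thesis
    using acyc_retract[OF left_module_coindE[OF U Y] Y i r _ ac] by simp
qed

text \<open>Here \<open>m\<close> is the global dimension itself, so the conclusion concerns Ext in
  degree \<open>m + 1\<close>. A minimal failing submodule \<open>Z\<close> has a proper submodule
  \<open>W\<close> with \<open>Z / W\<close> killed by the radical. The result holds for
  \<open>W\<close> by minimality and for the quotient by the killed case, hence for
  \<open>Z\<close>.\<close>

lemma acyc_fd_module:
  assumes sep: "separable_algebra K (quotient_algebra \<Lambda> rad)" and gl: "gl_dim K \<Lambda> = enat m"
    and Y: "fd_left_module K E Y"
  shows "acyc E P D m Y"
proof -
  interpret RL: left_module \<Lambda> "regular_module \<Lambda>" by (rule left_module_regular[OF L.is_ring_A])
  have rad: "submod \<Lambda> (regular_module \<Lambda>) rad"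
    using L.left_ideal_rad left_ideal_iff[OF L.is_ring_A] by blast
  interpret Q: subquotient_module \<Lambda> "regular_module \<Lambda>" "carrier (regular_module \<Lambda>)" rad
    by (intro subquotient_module.intro RL.is_left_module subquotient_module_axioms.intro RL.submod_carrier rad submodD(1)[OF rad])
  let ?U0 = "subquotient (regular_module \<Lambda>) (carrier (regular_module \<Lambda>)) rad"
  have cls: "Q.cls \<in> mhom \<Lambda> (regular_module \<Lambda>) ?U0" using Q.cls_mhom by (simp del: regular_module_simps)
  have fU0: "fd_left_module K \<Lambda> ?U0"
    by (rule L.fd_left_module_image[OF L.fd_regular[OF fd] Q.left_module_subquotient cls]) (simp add: carrier_subquotient)
  \<comment> \<open>\<open>gl_dim\<close> ranges over modules on the universe type, so the quotient
    by the radical is moved there before its projective dimension can be bounded.\<close>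
  obtain U :: "('a, nat \<Rightarrow> 'k) module" and h where U: "fd_left_module K \<Lambda> U" "h \<in> mhom \<Lambda> ?U0 U" "bij_betw h (carrier ?U0) (carrier U)"
    using L.fd_transport[OF fU0] by blast
  note lU = fd_left_moduleD(1)[OF U(1)]
  have \<pi>: "(\<lambda>a. h (Q.cls a)) \<in> mhom \<Lambda> (regular_module \<Lambda>) U" by (rule mhom_comp[OF cls U(2)])
  have \<pi>s: "(\<lambda>a. h (Q.cls a)) ` carrier \<Lambda> = carrier U"
    using U(3) by (simp add: bij_betw_def carrier_subquotient image_image)
  have \<pi>0: "h (Q.cls a) = \<zero>\<^bsub>U\<^esub> \<longleftrightarrow> a \<in> rad" if a: "a \<in> carrier \<Lambda>" for a
  proof -
    have "h (Q.cls a) = h \<zero>\<^bsub>?U0\<^esub> \<longleftrightarrow> Q.cls a = \<zero>\<^bsub>?U0\<^esub>"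
      using U(3) Q.cls_closed[of a] a left_module.axioms(2)[OF Q.left_module_subquotient]
      by (intro inj_on_eq_iff[of h "carrier ?U0"]) (auto simp: bij_betw_def abelian_group_def abelian_monoid.zero_closed)
    then show ?thesis using mhom_zero[OF Q.left_module_subquotient lU U(2)] Q.cls_eq_zero_iff[of a] a by simp
  qed
  let ?X = "{enat n | n. \<exists>(Q :: nat \<Rightarrow> ('a, nat \<Rightarrow> 'k) module) d \<delta>.
    projective_resolution K \<Lambda> U Q d \<delta> \<and> (\<forall>i>n. carrier (Q i) = {\<zero>\<^bsub>Q i\<^esub>})}"
  have "proj_dim K \<Lambda> U \<le> enat m"
    unfolding gl[symmetric] gl_dim_def by (rule Sup_upper) (use U(1) in blast)
  then have le: "Inf ?X \<le> enat m" by (simp add: proj_dim_def)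
  \<comment> \<open>The infimum of the empty set is infinite; a nonempty set of extended naturals
    contains its infimum, which yields an actual resolution of length at most
    \<open>m\<close>.\<close>
  have "?X \<noteq> {}"
  proof
    assume "?X = {}"
    then have "Inf ?X = \<infinity>" unfolding Inf_enat_def by (rule if_P)
    then show False using le by simp
  qed
  then obtain x where "x \<in> ?X" by blast
  then have "Inf ?X \<in> ?X" unfolding Inf_enat_def using LeastI[of "\<lambda>x. x \<in> ?X" x] \<open>?X \<noteq> {}\<close> by (simp only: if_False)
  then obtain n and QQ :: "nat \<Rightarrow> ('a, nat \<Rightarrow> 'k) module" and dd \<delta> where
    n: "Inf ?X = enat n" and QQ: "projective_resolution K \<Lambda> U QQ dd \<delta>" "\<And>i. i > n \<Longrightarrow> carrier (QQ i) = {\<zero>\<^bsub>QQ i\<^esub>}"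
    by blast
  have nm: "n \<le> m" using le unfolding n by simp
  \<comment> \<open>Stated for modules whose elements are sets, the type of the quotients
    \<open>Z / W\<close> to which it is applied.\<close>
  have killed: "acyc E P D m Y'" if "left_module E Y'" "\<And>j y. \<lbrakk>j \<in> rad; y \<in> carrier Y'\<rbrakk> \<Longrightarrow> rgt j \<odot>\<^bsub>Y'\<^esub> y = \<zero>\<^bsub>Y'\<^esub>"
    for Y' :: "(('a \<times> 'a \<Rightarrow> 'k) set, 'b set) module"
    by (rule acyc_killed_by_rad[OF that sep lU \<pi> \<pi>s \<pi>0 acyc_coind_resolution[OF U(1) QQ that(1) nm]])
  note lY = fd_left_moduleD(1)[OF Y]
  interpret Y: left_module E Y by (rule lY)
  let ?S = "{Z. submod E Y Z \<and> \<not> acyc E P D m (Y\<lparr>carrier := Z\<rparr>)}"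
  show ?thesis
  proof (rule ccontr)
    assume "\<not> ?thesis"
    then have "carrier Y \<in> ?S" using Y.submod_carrier by simp
    then obtain Z where Z: "Z \<in> ?S" "\<And>W. \<lbrakk>W \<in> ?S; W \<subseteq> Z\<rbrakk> \<Longrightarrow> W = Z"
      using fd_space_minimal[OF fd_left_moduleD(2)[OF Y], of "carrier Y" ?S] E.submod_scalars by blast
    let ?Z = "Y\<lparr>carrier := Z\<rparr>"
    have sZ: "submod E Y Z" and nZ: "\<not> acyc E P D m ?Z" using Z(1) by auto
    have fZ: "fd_left_module K E ?Z" by (rule E.fd_left_module_sub[OF Y sZ])
    note lZ = fd_left_moduleD(1)[OF fZ]
    interpret Z: left_module E ?Z by (rule lZ)
    have "carrier ?Z \<noteq> {\<zero>\<^bsub>?Z\<^esub>}"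
    proof
      assume z: "carrier ?Z = {\<zero>\<^bsub>?Z\<^esub>}"
      have "acyc E P D m ?Z"
      proof (rule acycI)
        fix f assume "f \<in> mhom E (P (Suc m)) ?Z"
        then have "f x = \<zero>\<^bsub>?Z\<^esub>" if "x \<in> carrier (P (Suc m))" for x
          using mhom_closed[of f E _ ?Z x] that z by blast
        then show "\<exists>g\<in>mhom E (P m) ?Z. \<forall>x\<in>carrier (P (Suc m)). f x = g (D m x)"
          using mhom_const_zero[OF lZ] by (intro bexI[of _ "\<lambda>x. \<zero>\<^bsub>?Z\<^esub>"]) auto
      qed
      then show False using nZ by simp
    qed
    then obtain W where W: "submod E ?Z W" "W \<noteq> carrier ?Z" "\<And>j z. \<lbrakk>j \<in> rad; z \<in> carrier ?Z\<rbrakk> \<Longrightarrow> rgt j \<odot>\<^bsub>?Z\<^esub> z \<in> W"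
      using nakayama[OF fd fZ] by blast
    have WZ: "W \<subseteq> Z" using submodD(1)[OF W(1)] by simp
    have sW: "submod E Y W" using W(1) submodD[OF sZ] by (auto simp: submod_def)
    have "W \<notin> ?S" using Z(2)[of W] WZ W(2) by auto
    then have aW: "acyc E P D m (Y\<lparr>carrier := W\<rparr>)" using sW by simp
    interpret C: subquotient_module E ?Z "carrier ?Z" W
      by (intro subquotient_module.intro lZ subquotient_module_axioms.intro Z.submod_carrier W(1)) (use WZ in simp)
    let ?C = "subquotient ?Z (carrier ?Z) W"
    have "rgt j \<odot>\<^bsub>?C\<^esub> y = \<zero>\<^bsub>?C\<^esub>" if "j \<in> rad" "y \<in> carrier ?C" for j y
    proof -
      obtain z where z: "z \<in> carrier ?Z" "y = C.cls z" using \<open>y \<in> carrier ?C\<close> by (rule C.cls_cases)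
      have j: "j \<in> carrier \<Lambda>" using that(1) by (simp add: jacobson_radical_def)
      have "C.cls (rgt j \<odot>\<^bsub>?Z\<^esub> z) = \<zero>\<^bsub>?C\<^esub>"
        using C.cls_eq_zero_iff[of "rgt j \<odot>\<^bsub>?Z\<^esub> z"] W(3)[OF that(1) z(1)] Z.smult_closed[of "rgt j" z] j z(1) by simp
      then show ?thesis using z C.cls_smult[of "rgt j" z] j by simp
    qed
    then have aC: "acyc E P D m ?C" by (rule killed[OF C.left_module_subquotient])
    have lW: "left_module E (Y\<lparr>carrier := W\<rparr>)" by (rule Y.left_module_sub[OF sW])
    have "acyc E P D m ?Z"
    proof (rule acyc_extension[OF lZ lW C.left_module_subquotient _ _ _ _ _ aW aC])
      show "(\<lambda>x. x) \<in> mhom E (Y\<lparr>carrier := W\<rparr>) ?Z" using WZ by (intro mhomI) auto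
      show "inj_on (\<lambda>x. x) (carrier (Y\<lparr>carrier := W\<rparr>))" by simp
      show "C.cls \<in> mhom E ?Z ?C" using C.cls_mhom by simp
      show "C.cls ` carrier ?Z = carrier ?C" by (simp add: carrier_subquotient)
      show "y \<in> (\<lambda>x. x) ` carrier (Y\<lparr>carrier := W\<rparr>)" if "y \<in> carrier ?Z" "C.cls y = \<zero>\<^bsub>?C\<^esub>" for y
        using C.cls_eq_zero_iff[OF that(1)] that(2) by simp
    qed
    then show False using nZ by simp
  qed
qed

text \<open>Take the image of \<open>D m\<close> as coefficients and \<open>D m\<close> itself as a
  cocycle in degree \<open>m + 1\<close>. A cochain \<open>g\<close> that bounds it satisfies
  \<open>g D = D\<close>, so it retracts \<open>P m\<close> onto that image.\<close>

lemma retraction_onto_boundaries: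
  assumes sep: "separable_algebra K (quotient_algebra \<Lambda> rad)" and gl: "gl_dim K \<Lambda> = enat m"
  obtains g where "g \<in> mhom E (P m) (P m)" "\<And>x. x \<in> carrier (P m) \<Longrightarrow> g x \<in> D m ` carrier (P (Suc m))"
    "\<And>x. x \<in> carrier (P (Suc m)) \<Longrightarrow> g (D m x) = D m x"
proof -
  let ?B = "D m ` carrier (P (Suc m))"
  have sB: "submod E (P m) ?B"
    by (rule submod_image[OF left_module_P left_module_P D_hom P.submod_carrier])
  let ?Y = "P m\<lparr>carrier := ?B\<rparr>"
  have ac: "acyc E P D m ?Y" by (rule acyc_fd_module[OF sep gl E.fd_left_module_sub[OF fd_P sB]])
  have Dm: "D m \<in> mhom E (P (Suc m)) ?Y"
    by (intro mhomI) (use mhom_add[OF D_hom] mhom_smult[OF D_hom] in auto)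
  have DD: "D m (D (Suc m) x) = \<zero>\<^bsub>?Y\<^esub>" if "x \<in> carrier (P (Suc (Suc m)))" for x
    using D_D[OF that] by simp
  obtain g where g: "g \<in> mhom E (P m) ?Y" "\<And>x. x \<in> carrier (P (Suc m)) \<Longrightarrow> D m x = g (D m x)"
    using acycE[of E P D m ?Y "D m", OF ac Dm DD] by blast
  have "g \<in> mhom E (P m) (P m)"
    using mhom_add[OF g(1)] mhom_smult[OF g(1)] mhom_closed[OF g(1)] submodD(1)[OF sB]
    by (intro mhomI) auto
  moreover have "g x \<in> ?B" if "x \<in> carrier (P m)" for x using mhom_closed[OF g(1) that] by simp
  ultimately show ?thesis using that g(2) by metis
qed

end

subsection \<open>Top-degree Ext and Tor\<close>

lemma mhom_bij_betwI:
  assumes "left_module R M" "left_module R N" "f \<in> mhom R M N"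
    and ker: "\<And>x. \<lbrakk>x \<in> carrier M; f x = \<zero>\<^bsub>N\<^esub>\<rbrakk> \<Longrightarrow> x = \<zero>\<^bsub>M\<^esub>" and surj: "carrier N \<subseteq> f ` carrier M"
  shows "bij_betw f (carrier M) (carrier N)"
proof -
  interpret M: left_module R M by fact
  interpret N: left_module R N by fact
  have "inj_on f (carrier M)"
  proof (rule inj_onI)
    fix x y assume xy: "x \<in> carrier M" "y \<in> carrier M" "f x = f y"
    then have "f (x \<ominus>\<^bsub>M\<^esub> y) = \<zero>\<^bsub>N\<^esub>"
      using mhom_diff[OF assms(1-3) xy(1,2)] mhom_closed[OF assms(3) xy(2)] by (simp add: a_minus_def N.M.r_neg)
    then have "x \<ominus>\<^bsub>M\<^esub> y = \<zero>\<^bsub>M\<^esub>" using ker xy by simp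
    then show "x = y" using xy by simp
  qed
  then show ?thesis using surj mhom_closed[OF assms(3)] by (auto simp: bij_betw_def)
qed

text \<open>\<open>Ext_map\<close> and \<open>Tor_map\<close> are unions over all representatives of
  a class; if the terms agree, the union is any one of them.\<close>

lemma (in subquotient_module) union_cls:
  assumes "z \<in> Z" "\<And>w. \<lbrakk>w \<in> Z; w \<ominus>\<^bsub>V\<^esub> z \<in> B\<rbrakk> \<Longrightarrow> G w = G z"
  shows "(\<Union>w\<in>cls z. G w) = G z"
proof -
  have zc: "z \<in> carrier V" using assms(1) submodD(2)[OF Z] by blast
  have "w \<in> Z \<and> w \<ominus>\<^bsub>V\<^esub> z \<in> B" if "w \<in> cls z" for w
  proof -
    have w: "w \<in> carrier V" "w \<ominus>\<^bsub>V\<^esub> z \<in> B"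
      using that V.mem_coset_iff[OF B zc] V.coset_eq_iff[OF B _ zc] by auto
    then have "(w \<ominus>\<^bsub>V\<^esub> z) \<oplus>\<^bsub>V\<^esub> z \<in> Z" using submodD(4)[OF Z _ assms(1)] BZ by blast
    moreover have "(w \<ominus>\<^bsub>V\<^esub> z) \<oplus>\<^bsub>V\<^esub> z = w" using w(1) zc by (simp add: a_minus_def V.M.a_assoc V.M.l_neg)
    ultimately show ?thesis using w(2) by simp
  qed
  then have "\<And>w. w \<in> cls z \<Longrightarrow> G w = G z" using assms(2) by blast
  moreover have "cls z \<noteq> {}" using V.coset_self[OF B zc] by blast
  ultimately show ?thesis by (simp only: SUP_cong UN_constant if_False)
qed

lemma hom_space_simps:
  "carrier (hom_space A M N) = mhom A M N \<inter> extensional (carrier M)"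
  "zero (hom_space A M N) = (\<lambda>x\<in>carrier M. \<zero>\<^bsub>N\<^esub>)"
  "f \<oplus>\<^bsub>hom_space A M N\<^esub> g = (\<lambda>x\<in>carrier M. f x \<oplus>\<^bsub>N\<^esub> g x)"
  "c \<odot>\<^bsub>hom_space A M N\<^esub> f = (\<lambda>x\<in>carrier M. (c \<odot>\<^bsub>A\<^esub> \<one>\<^bsub>A\<^esub>) \<odot>\<^bsub>N\<^esub> f x)"
  by (simp_all add: hom_space_def)

lemma mhom_restrict: "left_module R M \<Longrightarrow> f \<in> mhom R M N \<Longrightarrow> (\<lambda>x\<in>carrier M. f x) \<in> mhom R M N"
  by (rule mhom_cong) auto

lemma hom_space_mem: "left_module R M \<Longrightarrow> f \<in> mhom R M N \<Longrightarrow> (\<lambda>x\<in>carrier M. f x) \<in> carrier (hom_space R M N)"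
  using mhom_restrict[of R M f N] by (simp add: hom_space_simps)

lemma hom_space_eqI:
  "\<lbrakk>f \<in> carrier (hom_space R M N); g \<in> carrier (hom_space R M N); \<And>x. x \<in> carrier M \<Longrightarrow> f x = g x\<rbrakk> \<Longrightarrow> f = g"
  by (intro extensionalityI[of f "carrier M" g]) (auto simp: hom_space_simps)

lemma abelian_group_hom_space:
  assumes "left_module R M" "left_module R N"
  shows "abelian_group (hom_space R M N)"
proof -
  interpret M: left_module R M by fact
  interpret N: left_module R N by fact
  have h: "f \<in> mhom R M N" "\<And>x. x \<in> carrier M \<Longrightarrow> f x \<in> carrier N" "\<And>x. x \<notin> carrier M \<Longrightarrow> f x = undefined"
    if "f \<in> carrier (hom_space R M N)" for f
    using that mhom_closed[of f R M N] by (auto simp: hom_space_simps extensional_def)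
  show ?thesis
  proof (rule abelian_groupI, goal_cases)
    case (1 f g)
    then show ?case unfolding hom_space_simps(3) by (intro hom_space_mem mhom_plus assms h(1))
  next
    case 2
    show ?case unfolding hom_space_simps(2) by (intro hom_space_mem mhom_const_zero assms)
  next
    case (3 f g k)
    then show ?case unfolding hom_space_simps(3) by (auto simp: h N.M.a_assoc)
  next
    case (4 f g)
    then show ?case unfolding hom_space_simps(3) by (auto simp: h N.M.a_comm)
  next
    case (5 f)
    then show ?case unfolding hom_space_simps(2,3) by (auto simp: h fun_eq_iff restrict_def)
  next
    case (6 f)
    then show ?case
      by (intro bexI[of _ "\<lambda>x\<in>carrier M. \<ominus>\<^bsub>N\<^esub> f x"] hom_space_mem mhom_uminus assms h(1))
        (auto simp: hom_space_simps(2,3) h N.M.l_neg)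
  qed
qed

text \<open>Scalar multiples of homomorphisms remain linear over \<open>A\<close> because the field
  acts through central elements of \<open>A\<close>.\<close>

lemma (in algebra_over_field) left_module_hom_space:
  assumes "left_module A M" "left_module A N"
  shows "left_module K (hom_space A M N)"
proof -
  interpret M: left_module A M by fact
  interpret N: left_module A N by fact
  have h: "f \<in> mhom A M N" "\<And>x. x \<in> carrier M \<Longrightarrow> f x \<in> carrier N" "\<And>x. x \<notin> carrier M \<Longrightarrow> f x = undefined"
    if "f \<in> carrier (hom_space A M N)" for f
    using that mhom_closed[of f A M N] by (auto simp: hom_space_simps extensional_def)
  note u = ring_hom_add[OF unit_hom] ring_hom_mult[OF unit_hom] ring_hom_one[OF unit_hom]
  show ?thesis
  proof (rule left_moduleI[OF K.ring_axioms abelian_group_hom_space[OF assms]])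
    fix c f assume c: "c \<in> carrier K" and f: "f \<in> carrier (hom_space A M N)"
    have "(\<lambda>x. (c \<odot>\<^bsub>A\<^esub> \<one>\<^bsub>A\<^esub>) \<odot>\<^bsub>N\<^esub> f x) \<in> mhom A M N"
      using c h[OF f]
      by (intro mhomI) (simp_all add: mhom_add[OF h(1)[OF f]] mhom_smult[OF h(1)[OF f]] N.smult_r_distr
          N.smult_assoc[symmetric])
    then show "c \<odot>\<^bsub>hom_space A M N\<^esub> f \<in> carrier (hom_space A M N)"
      unfolding hom_space_simps(4) by (rule hom_space_mem[OF assms(1)])
  qed (auto simp: hom_space_simps(3,4) h N.smult_l_distr N.smult_r_distr N.smult_assoc u fun_eq_iff restrict_def
      simp del: unit_mult mult_unit A.smult_closed)
qed

text \<open>The existence of \<open>g\<close> expresses that \<open>M\<close> has projective dimension at most \<open>m + 1\<close>.\<close>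

locale split_resolution = algebra_over_field K A
  for K :: "('k, 'z) ring_scheme" and A :: "('k, 'a) module" +
  fixes M :: "('a, 'm) module" and m :: nat and g :: "(nat \<Rightarrow> 'k) \<Rightarrow> (nat \<Rightarrow> 'k)"
    and n :: nat and p and \<phi>
  assumes complex: "projective_complex A (res_module K A M) (res_diff K A M)"
    and g_hom: "g \<in> mhom A (res_module K A M (Suc m)) (res_module K A M (Suc m))"
    and g_im: "x \<in> carrier (res_module K A M (Suc m)) \<Longrightarrow>
      g x \<in> res_diff K A M (Suc m) ` carrier (res_module K A M (Suc (Suc m)))"
    and g_D: "x \<in> carrier (res_module K A M (Suc (Suc m))) \<Longrightarrow>
      g (res_diff K A M (Suc m) x) = res_diff K A M (Suc m) x"
    and p: "i < n \<Longrightarrow> p i \<in> carrier (res_module K A M (Suc m))"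
    and \<phi>: "i < n \<Longrightarrow> \<phi> i \<in> mhom A (res_module K A M (Suc m)) (regular_module A)"
    and dual_basis: "x \<in> carrier (res_module K A M (Suc m)) \<Longrightarrow>
      (\<Oplus>\<^bsub>res_module K A M (Suc m)\<^esub>i\<in>{..<n}. \<phi> i x \<odot>\<^bsub>res_module K A M (Suc m)\<^esub> p i) = x"
begin

abbreviation "P \<equiv> res_module K A M"
abbreviation "D \<equiv> res_diff K A M"
abbreviation "d \<equiv> Suc m"
abbreviation "AA \<equiv> regular_module A"

sublocale projective_complex A P D by (rule complex)
sublocale P: left_module A "P i" for i by (rule left_module_P)
sublocale AA: left_module A AA by (rule left_module_regular[OF is_ring_A])
sublocale op: algebra_over_field K "op_algebra A" by (rule algebra_op)

text \<open>\<open>g\<close> maps into the boundaries and fixes them, so \<open>g\<close> and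
  \<open>e\<close> are complementary idempotents and \<open>e\<close> kills the boundaries.\<close>

definition "e x = x \<ominus>\<^bsub>P d\<^esub> g x"

lemma e_hom: "e \<in> mhom A (P d) (P d)"
  unfolding e_def by (rule mhom_minus_fun[OF left_module_P mhom_id g_hom])

lemma g_closed: "x \<in> carrier (P d) \<Longrightarrow> g x \<in> carrier (P d)"
  and e_closed: "x \<in> carrier (P d) \<Longrightarrow> e x \<in> carrier (P d)"
  using mhom_closed[OF g_hom] mhom_closed[OF e_hom] by auto

lemma e_plus_g: "x \<in> carrier (P d) \<Longrightarrow> e x \<oplus>\<^bsub>P d\<^esub> g x = x"
  by (simp add: e_def a_minus_def P.M.a_assoc P.M.l_neg g_closed)

lemma e_D: "x \<in> carrier (P (Suc d)) \<Longrightarrow> e (D d x) = \<zero>\<^bsub>P d\<^esub>"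
  using D_closed[of x d] by (simp add: e_def g_D a_minus_def P.M.r_neg)

text \<open>\<open>g x\<close> is a boundary, on which a cocycle vanishes.\<close>

lemma cocycle_e:
  assumes "left_module A N" "f \<in> mhom A (P d) N" "\<And>x. x \<in> carrier (P (Suc d)) \<Longrightarrow> f (D d x) = \<zero>\<^bsub>N\<^esub>" "x \<in> carrier (P d)"
  shows "f (e x) = f x"
proof -
  interpret N: left_module A N by fact
  have "f (g x) = \<zero>\<^bsub>N\<^esub>" using g_im[OF assms(4)] assms(3) by auto
  then have "f (e x \<oplus>\<^bsub>P d\<^esub> g x) = f (e x)"
    using mhom_add[OF assms(2) e_closed[OF assms(4)] g_closed[OF assms(4)]] mhom_closed[OF assms(2) e_closed[OF assms(4)]] by simp
  then show ?thesis using e_plus_g[OF assms(4)] by simp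
qed

lemma \<phi>_closed: "\<lbrakk>i < n; x \<in> carrier (P d)\<rbrakk> \<Longrightarrow> \<phi> i x \<in> carrier A"
  using mhom_closed[OF \<phi>, of i x] by simp

lemma hom_expand:
  assumes "left_module A N" "f \<in> mhom A (P d) N" "x \<in> carrier (P d)"
  shows "(\<Oplus>\<^bsub>N\<^esub>i\<in>{..<n}. \<phi> i x \<odot>\<^bsub>N\<^esub> f (p i)) = f x"
proof -
  interpret N: left_module A N by fact
  have "f (\<Oplus>\<^bsub>P d\<^esub>i\<in>{..<n}. \<phi> i x \<odot>\<^bsub>P d\<^esub> p i) = (\<Oplus>\<^bsub>N\<^esub>i\<in>{..<n}. f (\<phi> i x \<odot>\<^bsub>P d\<^esub> p i))"
    by (rule mhom_finsum[OF left_module_P assms(1,2)]) (auto simp: \<phi>_closed assms(3) p)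
  also have "\<dots> = (\<Oplus>\<^bsub>N\<^esub>i\<in>{..<n}. \<phi> i x \<odot>\<^bsub>N\<^esub> f (p i))"
    by (rule N.M.finsum_cong') (auto simp: \<phi>_closed assms(3) p mhom_smult[OF assms(2)] mhom_closed[OF assms(2)])
  finally show ?thesis using dual_basis[OF assms(3)] by simp
qed

section \<open>Cocycles and coboundaries in top degree, and the right module \<Theta> with its
  generators\<close>

abbreviation "HS N \<equiv> hom_space A (P d) N"
abbreviation "ZE N \<equiv> Ext_cocycles K A d M N"
abbreviation "BE N \<equiv> Ext_coboundaries K A d M N"

lemma cocycles_iff:
  "f \<in> ZE N \<longleftrightarrow> f \<in> carrier (HS N) \<and> (\<forall>x\<in>carrier (P (Suc d)). f (D d x) = \<zero>\<^bsub>N\<^esub>)"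
  unfolding Ext_cocycles_def Ext_coboundary_def hom_space_simps(2)
  by (auto simp: compose_def fun_eq_iff restrict_def)

lemma cocycleD:
  assumes "f \<in> ZE N"
  shows "f \<in> mhom A (P d) N" "x \<in> carrier (P (Suc d)) \<Longrightarrow> f (D d x) = \<zero>\<^bsub>N\<^esub>" "f \<in> extensional (carrier (P d))"
    "f \<in> carrier (HS N)"
  using assms by (auto simp: cocycles_iff hom_space_simps)

lemma cocycleI:
  assumes "f \<in> mhom A (P d) N" "\<And>x. x \<in> carrier (P (Suc d)) \<Longrightarrow> f (D d x) = \<zero>\<^bsub>N\<^esub>"
  shows "(\<lambda>x\<in>carrier (P d). f x) \<in> ZE N"
  using hom_space_mem[OF left_module_P assms(1)] assms(2) by (simp add: cocycles_iff D_closed)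

lemma coboundaryE:
  assumes "f \<in> BE N"
  obtains k where "k \<in> mhom A (P m) N" "f = (\<lambda>x\<in>carrier (P d). k (D m x))"
  using assms by (auto simp: Ext_coboundaries_def Ext_coboundary_def hom_space_simps compose_def)

lemma coboundaryI:
  assumes "k \<in> mhom A (P m) N"
  shows "(\<lambda>x\<in>carrier (P d). k (D m x)) \<in> BE N"
  unfolding Ext_coboundaries_def Ext_coboundary_def
  using hom_space_mem[OF left_module_P assms]
  by (auto intro!: image_eqI[of _ _ "\<lambda>x\<in>carrier (P m). k x"] simp: compose_def D_closed cong: restrict_cong)

lemma ext_subquotient:
  assumes N: "left_module A N"
  shows "subquotient_module K (HS N) (ZE N) (BE N)"
proof -
  interpret N: left_module A N by (rule N)
  have lH: "left_module K (HS N)" by (rule left_module_hom_space[OF left_module_P N])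
  interpret H: left_module K "HS N" by (rule lH)
  have DDm: "k (D m (D d x)) = \<zero>\<^bsub>N\<^esub>" if "k \<in> mhom A (P m) N" "x \<in> carrier (P (Suc d))" for k x
    using D_D[OF that(2)] mhom_zero[OF left_module_P N that(1)] by simp
  have c1: "(c \<odot>\<^bsub>A\<^esub> \<one>\<^bsub>A\<^esub>) \<odot>\<^bsub>N\<^esub> \<zero>\<^bsub>N\<^esub> = \<zero>\<^bsub>N\<^esub>" if "c \<in> carrier K" for c
    using that by (intro N.smult_zero_right) simp
  have Z: "submod K (HS N) (ZE N)"
  proof (rule submodI)
    show "f \<in> ZE N \<Longrightarrow> f \<in> carrier (HS N)" for f by (simp add: cocycles_iff)
    show "\<zero>\<^bsub>HS N\<^esub> \<in> ZE N" using H.M.zero_closed D_closed by (simp add: cocycles_iff hom_space_simps(2))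
    show "f \<oplus>\<^bsub>HS N\<^esub> f' \<in> ZE N" if "f \<in> ZE N" "f' \<in> ZE N" for f f'
      using H.M.a_closed[OF cocycleD(4)[OF that(1)] cocycleD(4)[OF that(2)]] cocycleD(2)[OF that(1)] cocycleD(2)[OF that(2)] D_closed
      by (simp add: cocycles_iff hom_space_simps(3))
    show "c \<odot>\<^bsub>HS N\<^esub> f \<in> ZE N" if "c \<in> carrier K" "f \<in> ZE N" for c f
      using H.smult_closed[OF that(1) cocycleD(4)[OF that(2)]] cocycleD(2)[OF that(2)] D_closed c1[OF that(1)]
      by (simp add: cocycles_iff hom_space_simps(4))
  qed
  have BZ: "BE N \<subseteq> ZE N"
  proof
    fix f assume "f \<in> BE N"
    then obtain k where k: "k \<in> mhom A (P m) N" "f = (\<lambda>x\<in>carrier (P d). k (D m x))" by (rule coboundaryE)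
    show "f \<in> ZE N" unfolding k(2) by (rule cocycleI[OF mhom_comp[OF D_hom k(1)] DDm[OF k(1)]])
  qed
  have B: "submod K (HS N) (BE N)"
  proof (rule submodI)
    show "f \<in> BE N \<Longrightarrow> f \<in> carrier (HS N)" for f using BZ cocycleD(4) by blast
    show "\<zero>\<^bsub>HS N\<^esub> \<in> BE N"
      using coboundaryI[OF mhom_const_zero[OF N]] by (simp add: hom_space_simps(2))
  next
    fix f f' assume "f \<in> BE N" "f' \<in> BE N"
    then obtain k k' where k: "k \<in> mhom A (P m) N" "f = (\<lambda>x\<in>carrier (P d). k (D m x))"
      "k' \<in> mhom A (P m) N" "f' = (\<lambda>x\<in>carrier (P d). k' (D m x))" by (elim coboundaryE)
    then show "f \<oplus>\<^bsub>HS N\<^esub> f' \<in> BE N"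
      using coboundaryI[OF mhom_plus[OF N k(1,3)]] by (simp add: hom_space_simps(3) cong: restrict_cong)
  next
    fix c f assume c: "c \<in> carrier K" and "f \<in> BE N"
    then obtain k where k: "k \<in> mhom A (P m) N" "f = (\<lambda>x\<in>carrier (P d). k (D m x))" by (elim coboundaryE)
    have "(\<lambda>x. (c \<odot>\<^bsub>A\<^esub> \<one>\<^bsub>A\<^esub>) \<odot>\<^bsub>N\<^esub> k x) \<in> mhom A (P m) N"
      using c mhom_closed[OF k(1)]
      by (intro mhomI) (simp_all add: mhom_add[OF k(1)] mhom_smult[OF k(1)] N.smult_r_distr N.smult_assoc[symmetric])
    then show "c \<odot>\<^bsub>HS N\<^esub> f \<in> BE N"
      using coboundaryI k(2) by (simp add: hom_space_simps(4) cong: restrict_cong)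
  qed
  show ?thesis by (intro subquotient_module.intro lH subquotient_module_axioms.intro Z B BZ)
qed

lemma Ext_eq: "Ext K A d M N = subquotient (HS N) (ZE N) (BE N)"
  by (simp add: Ext_def)

text \<open>\<open>hom_space\<close> keeps only the action of the field. Here the same homomorphisms
  carry the action of \<open>A\<close> by right multiplication on values, which makes them a module
  over the opposite algebra with \<Theta> as a subquotient.\<close>

definition "RM =
  \<lparr>carrier = carrier (HS AA), mult = undefined, one = undefined, zero = \<zero>\<^bsub>HS AA\<^esub>, add = add (HS AA),
   smult = \<lambda>a f. compose (carrier (P d)) (\<lambda>b. b \<otimes>\<^bsub>A\<^esub> a) f\<rparr>"

lemma RM_simps: "carrier RM = carrier (HS AA)" "zero RM = \<zero>\<^bsub>HS AA\<^esub>" "add RM = add (HS AA)"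
  "a \<odot>\<^bsub>RM\<^esub> f = (\<lambda>x\<in>carrier (P d). f x \<otimes>\<^bsub>A\<^esub> a)"
  by (simp_all add: RM_def compose_def)

abbreviation "\<Theta> \<equiv> Ext_algebra K A d M"

lemma coset_RM: "a_r_coset RM = a_r_coset (HS AA)" "set_add RM = set_add (HS AA)"
  by (simp_all add: fun_eq_iff a_r_coset_def' set_add_def' RM_simps)

text \<open>The action on \<Theta> is given by \<open>Ext_map\<close> as a union of cosets of
  composites with right multiplications. \<open>RM\<close> is arranged so that the action of
  \<open>subquotient\<close> unfolds to the same union.\<close>

lemma Theta_eq: "\<Theta> = subquotient RM (ZE AA) (BE AA)"
  unfolding Ext_algebra_def Let_def Ext_eq subquotient_def coset_RM
  by (simp add: Ext_map_def RM_def fun_eq_iff)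

lemma hom_A_closed: "\<lbrakk>f \<in> carrier (HS AA); x \<in> carrier (P d)\<rbrakk> \<Longrightarrow> f x \<in> carrier A"
  using mhom_closed[of f A "P d" AA x] by (simp add: hom_space_simps)

lemma mhom_A_mult:
  assumes "f \<in> mhom A V AA" "a \<in> carrier A"
  shows "(\<lambda>x. f x \<otimes>\<^bsub>A\<^esub> a) \<in> mhom A V AA"
  using mhom_closed[OF assms(1)] assms(2) mhom_add[OF assms(1)] mhom_smult[OF assms(1)]
  by (intro mhomI) (simp_all add: A.l_distr A.m_assoc)

lemma left_module_RM: "left_module (op_algebra A) RM"
proof -
  have c: "(\<lambda>x\<in>carrier (P d). f x \<otimes>\<^bsub>A\<^esub> a) \<in> carrier (HS AA)" if "f \<in> carrier (HS AA)" "a \<in> carrier A" for f a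
    using that by (intro hom_space_mem left_module_P mhom_A_mult) (auto simp: hom_space_simps)
  have un: "f x = undefined" if "f \<in> carrier (HS AA)" "x \<notin> carrier (P d)" for f x
    using that by (auto simp: hom_space_simps extensional_def)
  have ab: "abelian_group RM"
    by (rule abelian_group_cong[OF abelian_group_hom_space[OF left_module_P AA.is_left_module]]) (simp_all add: RM_simps)
  show ?thesis
    using c by (intro left_moduleI op.is_ring_A ab)
      (auto simp: RM_simps hom_space_simps(3) hom_A_closed A.l_distr A.r_distr A.m_assoc un fun_eq_iff restrict_def)
qed

sublocale RM: left_module "op_algebra A" RM by (rule left_module_RM)
sublocale EA: subquotient_module K "HS AA" "ZE AA" "BE AA" by (rule ext_subquotient[OF AA.is_left_module])

sublocale Th: subquotient_module "op_algebra A" RM "ZE AA" "BE AA"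
proof (intro subquotient_module.intro left_module_RM subquotient_module_axioms.intro EA.BZ)
  show "submod (op_algebra A) RM (ZE AA)"
  proof (rule submodI)
    fix a f assume a: "a \<in> carrier (op_algebra A)" and f: "f \<in> ZE AA"
    have "(\<lambda>x\<in>carrier (P d). f x \<otimes>\<^bsub>A\<^esub> a) \<in> ZE AA"
      using a cocycleD(2)[OF f] by (intro cocycleI mhom_A_mult cocycleD(1)[OF f]) simp_all
    then show "a \<odot>\<^bsub>RM\<^esub> f \<in> ZE AA" by (simp add: RM_simps)
  qed (use submodD[OF EA.Z] in \<open>simp_all add: RM_simps\<close>)
  show "submod (op_algebra A) RM (BE AA)"
  proof (rule submodI)
    fix a f assume a: "a \<in> carrier (op_algebra A)" and "f \<in> BE AA"
    then obtain k where k: "k \<in> mhom A (P m) AA" "f = (\<lambda>x\<in>carrier (P d). k (D m x))" by (elim coboundaryE)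
    have "(\<lambda>x\<in>carrier (P d). k (D m x) \<otimes>\<^bsub>A\<^esub> a) \<in> BE AA"
      using coboundaryI[OF mhom_A_mult[OF k(1)]] a by simp
    then show "a \<odot>\<^bsub>RM\<^esub> f \<in> BE AA" by (simp add: RM_simps k(2) cong: restrict_cong)
  qed (use submodD[OF EA.B] in \<open>simp_all add: RM_simps\<close>)
qed

lemma cls_RM: "Th.cls = EA.cls"
  by (simp add: coset_RM)

lemma left_module_Theta: "left_module (op_algebra A) \<Theta>"
  unfolding Theta_eq by (rule Th.left_module_subquotient)

sublocale \<Theta>: left_module "op_algebra A" \<Theta> by (rule left_module_Theta)

lemma Theta_cases:
  assumes "\<tau> \<in> carrier \<Theta>"
  obtains f where "f \<in> ZE AA" "\<tau> = Th.cls f"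
  using assms unfolding Theta_eq by (rule Th.cls_cases)

definition "\<theta> i = Th.cls (\<lambda>x\<in>carrier (P d). \<phi> i (e x))"

lemma \<phi>_e_cocycle: "i < n \<Longrightarrow> (\<lambda>x\<in>carrier (P d). \<phi> i (e x)) \<in> ZE AA"
  using mhom_zero[OF left_module_P AA.is_left_module \<phi>]
  by (intro cocycleI mhom_comp[OF e_hom \<phi>]) (simp_all add: e_D)

lemma \<theta>_closed: "i < n \<Longrightarrow> \<theta> i \<in> carrier \<Theta>"
  unfolding \<theta>_def Theta_eq by (rule Th.cls_closed[OF \<phi>_e_cocycle])

text \<open>Expand \<open>f (e x)\<close> in the dual basis and use \<open>f e = f\<close>. The
  coefficient \<open>f (p i)\<close> is written on the left but acts on the right, \<Theta> being a
  module over the opposite algebra.\<close>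

lemma \<theta>_expand:
  assumes f: "f \<in> ZE AA"
  shows "(\<Oplus>\<^bsub>\<Theta>\<^esub>i\<in>{..<n}. f (p i) \<odot>\<^bsub>\<Theta>\<^esub> \<theta> i) = Th.cls f"
proof -
  note fA = hom_A_closed[OF cocycleD(4)[OF f]]
  have sm: "f (p i) \<odot>\<^bsub>\<Theta>\<^esub> \<theta> i = Th.cls (\<lambda>x\<in>carrier (P d). \<phi> i (e x) \<otimes>\<^bsub>A\<^esub> f (p i))" if "i < n" for i
    unfolding \<theta>_def Theta_eq using that fA[OF p[OF that]]
    by (subst Th.cls_smult[OF _ \<phi>_e_cocycle]) (simp_all add: RM_simps cong: restrict_cong)
  have c: "(\<lambda>x\<in>carrier (P d). \<phi> i (e x) \<otimes>\<^bsub>A\<^esub> f (p i)) \<in> ZE AA" if "i < n" for i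
    using submodD(5)[OF Th.Z _ \<phi>_e_cocycle[OF that], of "f (p i)"] fA[OF p[OF that]] by (simp add: RM_simps cong: restrict_cong)
  have "(\<Oplus>\<^bsub>\<Theta>\<^esub>i\<in>{..<n}. f (p i) \<odot>\<^bsub>\<Theta>\<^esub> \<theta> i) = (\<Oplus>\<^bsub>\<Theta>\<^esub>i\<in>{..<n}. Th.cls (\<lambda>x\<in>carrier (P d). \<phi> i (e x) \<otimes>\<^bsub>A\<^esub> f (p i)))"
    using Th.cls_closed[OF c, folded Theta_eq] by (intro \<Theta>.M.finsum_cong') (auto simp: sm)
  also have "\<dots> = Th.cls (\<Oplus>\<^bsub>RM\<^esub>i\<in>{..<n}. (\<lambda>x\<in>carrier (P d). \<phi> i (e x) \<otimes>\<^bsub>A\<^esub> f (p i)))"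
    unfolding Theta_eq by (rule Th.cls_finsum[symmetric]) (simp add: c)
  also have "(\<Oplus>\<^bsub>RM\<^esub>i\<in>{..<n}. (\<lambda>x\<in>carrier (P d). \<phi> i (e x) \<otimes>\<^bsub>A\<^esub> f (p i))) = f"
  proof (rule hom_space_eqI[of _ A "P d" AA])
    show "(\<Oplus>\<^bsub>RM\<^esub>i\<in>{..<n}. (\<lambda>x\<in>carrier (P d). \<phi> i (e x) \<otimes>\<^bsub>A\<^esub> f (p i))) \<in> carrier (HS AA)"
      using RM.M.finsum_closed[of "\<lambda>i. \<lambda>x\<in>carrier (P d). \<phi> i (e x) \<otimes>\<^bsub>A\<^esub> f (p i)" "{..<n}"] cocycleD(4)[OF c] by (auto simp: RM_simps)
    show "f \<in> carrier (HS AA)" by (rule cocycleD(4)[OF f])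
    fix x assume x: "x \<in> carrier (P d)"
    have "(\<Oplus>\<^bsub>RM\<^esub>i\<in>{..<n}. (\<lambda>x\<in>carrier (P d). \<phi> i (e x) \<otimes>\<^bsub>A\<^esub> f (p i))) x = (\<Oplus>\<^bsub>AA\<^esub>i\<in>{..<n}. (\<lambda>x\<in>carrier (P d). \<phi> i (e x) \<otimes>\<^bsub>A\<^esub> f (p i)) x)"
      using x cocycleD(4)[OF c]
      by (intro finsum_additive[where f = "\<lambda>h. h x", OF RM.M.abelian_group_axioms AA.M.abelian_group_axioms])
        (auto simp: RM_simps hom_space_simps(3) hom_A_closed)
    also have "\<dots> = (\<Oplus>\<^bsub>AA\<^esub>i\<in>{..<n}. \<phi> i (e x) \<odot>\<^bsub>AA\<^esub> f (p i))"
      using x fA p by (intro AA.M.finsum_cong') (auto simp: \<phi>_closed e_closed)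
    also have "\<dots> = f (e x)" by (rule hom_expand[OF AA.is_left_module cocycleD(1)[OF f] e_closed[OF x]])
    also have "\<dots> = f x" by (rule cocycle_e[OF AA.is_left_module cocycleD(1,2)[OF f] x])
    finally show "(\<Oplus>\<^bsub>RM\<^esub>i\<in>{..<n}. (\<lambda>x\<in>carrier (P d). \<phi> i (e x) \<otimes>\<^bsub>A\<^esub> f (p i))) x = f x" .
  qed
  finally show ?thesis .
qed

text \<open>The sum is the class of the coboundary of \<open>k\<close>. These relations make
  \<open>ext_tensor\<close> vanish on coboundaries and make the chain that inverts the Tor
  isomorphism a cycle.\<close>

lemma \<theta>_relation:
  assumes "k \<in> mhom A (P m) AA"
  shows "(\<Oplus>\<^bsub>\<Theta>\<^esub>i\<in>{..<n}. k (D m (p i)) \<odot>\<^bsub>\<Theta>\<^esub> \<theta> i) = \<zero>\<^bsub>\<Theta>\<^esub>"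
proof -
  let ?f = "\<lambda>x\<in>carrier (P d). k (D m x)"
  have B: "?f \<in> BE AA" by (rule coboundaryI[OF assms])
  then have Z: "?f \<in> ZE AA" using Th.BZ by blast
  have kc: "k (D m (p i)) \<in> carrier A" if "i < n" for i
    using mhom_closed[OF assms D_closed[OF p[OF that]]] by simp
  have "(\<Oplus>\<^bsub>\<Theta>\<^esub>i\<in>{..<n}. k (D m (p i)) \<odot>\<^bsub>\<Theta>\<^esub> \<theta> i) = (\<Oplus>\<^bsub>\<Theta>\<^esub>i\<in>{..<n}. ?f (p i) \<odot>\<^bsub>\<Theta>\<^esub> \<theta> i)"
    using kc \<theta>_closed p by (intro \<Theta>.M.finsum_cong') auto
  also have "\<dots> = Th.cls ?f" by (rule \<theta>_expand[OF Z])
  also have "\<dots> = \<zero>\<^bsub>\<Theta>\<^esub>" unfolding Theta_eq using Th.cls_eq_zero_iff[OF Z] B by simp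
  finally show ?thesis .
qed

end

text \<open>The coefficients cross the tensor sign and the double sum is reordered. The result
  collects linear combinations of the \<open>x i\<close> in the left factor, where relations among
  them apply.\<close>

lemma (in tensor_pair) pt_exchange:
  assumes "finite I" and x: "\<And>i. i \<in> I \<Longrightarrow> x i \<in> carrier M" and y: "\<And>j. j \<in> J \<Longrightarrow> y j \<in> carrier N"
    and c: "\<And>i j. \<lbrakk>i \<in> I; j \<in> J\<rbrakk> \<Longrightarrow> c i j \<in> carrier A"
  shows "(\<Oplus>\<^bsub>T\<^esub>i\<in>I. pt (x i) (\<Oplus>\<^bsub>N\<^esub>j\<in>J. c i j \<odot>\<^bsub>N\<^esub> y j)) =
    (\<Oplus>\<^bsub>T\<^esub>j\<in>J. pt (\<Oplus>\<^bsub>M\<^esub>i\<in>I. c i j \<odot>\<^bsub>M\<^esub> x i) (y j))"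
proof -
  have cx: "c i j \<odot>\<^bsub>M\<^esub> x i \<in> carrier M" if "i \<in> I" "j \<in> J" for i j
    using M.smult_closed[of "c i j" "x i"] c[OF that] x[OF that(1)] by simp
  have "(\<Oplus>\<^bsub>T\<^esub>i\<in>I. pt (x i) (\<Oplus>\<^bsub>N\<^esub>j\<in>J. c i j \<odot>\<^bsub>N\<^esub> y j)) = (\<Oplus>\<^bsub>T\<^esub>i\<in>I. \<Oplus>\<^bsub>T\<^esub>j\<in>J. pt (c i j \<odot>\<^bsub>M\<^esub> x i) (y j))"
  proof (rule T.M.finsum_cong')
    fix i assume i: "i \<in> I"
    have "pt (x i) (\<Oplus>\<^bsub>N\<^esub>j\<in>J. c i j \<odot>\<^bsub>N\<^esub> y j) = (\<Oplus>\<^bsub>T\<^esub>j\<in>J. pt (x i) (c i j \<odot>\<^bsub>N\<^esub> y j))"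
      using i x y c by (intro pt_finsum_right) auto
    also have "\<dots> = (\<Oplus>\<^bsub>T\<^esub>j\<in>J. pt (c i j \<odot>\<^bsub>M\<^esub> x i) (y j))"
      using i x y c cx by (intro T.M.finsum_cong') (auto simp: pt_middle)
    finally show "pt (x i) (\<Oplus>\<^bsub>N\<^esub>j\<in>J. c i j \<odot>\<^bsub>N\<^esub> y j) = (\<Oplus>\<^bsub>T\<^esub>j\<in>J. pt (c i j \<odot>\<^bsub>M\<^esub> x i) (y j))" .
  qed (use cx y in \<open>auto intro!: T.M.finsum_closed\<close>)
  also have "\<dots> = (\<Oplus>\<^bsub>T\<^esub>j\<in>J. \<Oplus>\<^bsub>T\<^esub>i\<in>I. pt (c i j \<odot>\<^bsub>M\<^esub> x i) (y j))"
    using cx y by (intro T.M.finsum_swap assms(1)) simp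
  also have "\<dots> = (\<Oplus>\<^bsub>T\<^esub>j\<in>J. pt (\<Oplus>\<^bsub>M\<^esub>i\<in>I. c i j \<odot>\<^bsub>M\<^esub> x i) (y j))"
    using cx y by (intro T.M.finsum_cong' pt_finsum_left[symmetric]) auto
  finally show ?thesis .
qed

context split_resolution
begin

lemma Theta_ops:
  "\<lbrakk>f \<in> ZE AA; f' \<in> ZE AA\<rbrakk> \<Longrightarrow> Th.cls f \<oplus>\<^bsub>\<Theta>\<^esub> Th.cls f' = Th.cls (f \<oplus>\<^bsub>RM\<^esub> f')"
  "\<lbrakk>a \<in> carrier A; f \<in> ZE AA\<rbrakk> \<Longrightarrow> a \<odot>\<^bsub>\<Theta>\<^esub> Th.cls f = Th.cls (a \<odot>\<^bsub>RM\<^esub> f)"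
  "\<lbrakk>f \<in> ZE AA; f' \<in> ZE AA\<rbrakk> \<Longrightarrow> f \<oplus>\<^bsub>RM\<^esub> f' \<in> ZE AA"
  "\<lbrakk>a \<in> carrier A; f \<in> ZE AA\<rbrakk> \<Longrightarrow> a \<odot>\<^bsub>RM\<^esub> f \<in> ZE AA"
  "f \<in> ZE AA \<Longrightarrow> Th.cls f \<in> carrier \<Theta>"
  using Th.cls_add[of f f'] Th.cls_smult[of a f] submodD(4,5)[OF Th.Z] Th.cls_closed[of f]
  by (simp_all add: Theta_eq)

text \<open>A dual basis one degree below the one fixed in the locale. It writes
  \<open>D m (p i)\<close> with coefficients \<open>\<psi> j (D m (p i))\<close>, which is the shape
  of \<open>\<theta>_relation\<close>.\<close>

lemma boundary_expansion:
  obtains k :: nat and q \<psi> where "\<And>j. j < k \<Longrightarrow> q j \<in> carrier (P m)" "\<And>j. j < k \<Longrightarrow> \<psi> j \<in> mhom A (P m) AA"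
    "\<And>j y. \<lbrakk>j < k; y \<in> carrier (P m)\<rbrakk> \<Longrightarrow> \<psi> j y \<in> carrier A"
    "\<And>y. y \<in> carrier (P m) \<Longrightarrow> (\<Oplus>\<^bsub>P m\<^esub>j\<in>{..<k}. \<psi> j y \<odot>\<^bsub>P m\<^esub> q j) = y"
proof -
  obtain k :: nat and q \<psi> where *: "\<And>j. j < k \<Longrightarrow> q j \<in> carrier (P m)" "\<And>j. j < k \<Longrightarrow> \<psi> j \<in> mhom A (P m) AA"
    "\<And>y. y \<in> carrier (P m) \<Longrightarrow> (\<Oplus>\<^bsub>P m\<^esub>j\<in>{..<k}. \<psi> j y \<odot>\<^bsub>P m\<^esub> q j) = y"
    by (rule fg_projectiveE[OF fg_projective_P[of m]]) blast
  have "\<psi> j y \<in> carrier A" if "j < k" "y \<in> carrier (P m)" for j y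
    using mhom_closed[OF *(2)[OF that(1)] that(2)] by simp
  with * show ?thesis using that by blast
qed

subsubsection \<open>The isomorphism for Ext\<close>

lemma tensor_pair_Theta: "left_module A N \<Longrightarrow> tensor_pair K A \<Theta> N"
  by (intro tensor_pair.intro tensor_pair_axioms.intro algebra_over_field_axioms left_module_Theta)

definition "ext_tensor N f =
  (\<Oplus>\<^bsub>tensor_space K A \<Theta> N\<^esub>i\<in>{..<n}. pure_tensor K A \<Theta> N (\<theta> i) (f (p i)))"

definition "ext_iso N \<xi> = the_elem (ext_tensor N ` \<xi>)"

lemma ext_tensor_hom:
  assumes N: "left_module A N"
  shows "ext_tensor N \<in> mhom K (HS N\<lparr>carrier := ZE N\<rparr>) (tensor_space K A \<Theta> N)"
proof -
  interpret N: left_module A N by (rule N)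
  interpret T: tensor_pair K A \<Theta> N by (rule tensor_pair_Theta[OF N])
  have fc: "f y \<in> carrier N" if "f \<in> ZE N" "y \<in> carrier (P d)" for f y
    using mhom_closed[OF cocycleD(1)[OF that(1)] that(2)] .
  have "(\<lambda>f. T.pt (\<theta> i) (f (p i))) \<in> mhom K (HS N\<lparr>carrier := ZE N\<rparr>) T.T" if i: "i < n" for i
    using p[OF i] \<theta>_closed[OF i]
    by (intro mhomI) (simp_all add: fc hom_space_simps(3,4) T.pt_add_right T.pt_smult_right)
  then show ?thesis unfolding ext_tensor_def[abs_def] by (intro mhom_sum T.left_module_T) simp
qed

text \<open>Expand \<open>h (D m (p i))\<close> through the dual basis of \<open>P m\<close> and
  move the coefficients to the left factor; there they meet the generators \<open>\<theta> i\<close>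
  and cancel by \<open>\<theta>_relation\<close>.\<close>

lemma ext_tensor_coboundary:
  assumes N: "left_module A N" and f: "f \<in> BE N"
  shows "ext_tensor N f = \<zero>\<^bsub>tensor_space K A \<Theta> N\<^esub>"
proof -
  interpret N: left_module A N by (rule N)
  interpret T: tensor_pair K A \<Theta> N by (rule tensor_pair_Theta[OF N])
  obtain h where h: "h \<in> mhom A (P m) N" "f = (\<lambda>x\<in>carrier (P d). h (D m x))" using f by (rule coboundaryE)
  obtain k :: nat and q \<psi> where q: "\<And>j. j < k \<Longrightarrow> q j \<in> carrier (P m)" and \<psi>: "\<And>j. j < k \<Longrightarrow> \<psi> j \<in> mhom A (P m) AA"
    and \<psi>c: "\<And>j y. \<lbrakk>j < k; y \<in> carrier (P m)\<rbrakk> \<Longrightarrow> \<psi> j y \<in> carrier A"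
    and eq: "\<And>y. y \<in> carrier (P m) \<Longrightarrow> (\<Oplus>\<^bsub>P m\<^esub>j\<in>{..<k}. \<psi> j y \<odot>\<^bsub>P m\<^esub> q j) = y"
    using boundary_expansion by blast
  note hc = mhom_closed[OF h(1)]
  have hD: "h (D m (p i)) = (\<Oplus>\<^bsub>N\<^esub>j\<in>{..<k}. \<psi> j (D m (p i)) \<odot>\<^bsub>N\<^esub> h (q j))" if i: "i < n" for i
  proof -
    note Dp = D_closed[OF p[OF i]]
    have "h (\<Oplus>\<^bsub>P m\<^esub>j\<in>{..<k}. \<psi> j (D m (p i)) \<odot>\<^bsub>P m\<^esub> q j) = (\<Oplus>\<^bsub>N\<^esub>j\<in>{..<k}. h (\<psi> j (D m (p i)) \<odot>\<^bsub>P m\<^esub> q j))"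
      by (rule mhom_finsum[OF left_module_P N h(1)]) (auto simp: \<psi>c Dp q)
    also have "\<dots> = (\<Oplus>\<^bsub>N\<^esub>j\<in>{..<k}. \<psi> j (D m (p i)) \<odot>\<^bsub>N\<^esub> h (q j))"
      by (rule N.M.finsum_cong') (auto simp: \<psi>c Dp q hc mhom_smult[OF h(1)])
    finally show ?thesis using eq[OF Dp] by simp
  qed
  have "ext_tensor N f = (\<Oplus>\<^bsub>T.T\<^esub>i\<in>{..<n}. T.pt (\<theta> i) (\<Oplus>\<^bsub>N\<^esub>j\<in>{..<k}. \<psi> j (D m (p i)) \<odot>\<^bsub>N\<^esub> h (q j)))"
    unfolding ext_tensor_def
    by (intro T.T.M.finsum_cong') (auto simp: h(2) p hD \<psi>c D_closed q hc \<theta>_closed intro!: T.pt_closed N.M.finsum_closed)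
  also have "\<dots> = (\<Oplus>\<^bsub>T.T\<^esub>j\<in>{..<k}. T.pt (\<Oplus>\<^bsub>\<Theta>\<^esub>i\<in>{..<n}. \<psi> j (D m (p i)) \<odot>\<^bsub>\<Theta>\<^esub> \<theta> i) (h (q j)))"
    by (rule T.pt_exchange) (auto simp: \<psi>c D_closed p q hc \<theta>_closed)
  also have "\<dots> = (\<Oplus>\<^bsub>T.T\<^esub>j\<in>{..<k}. \<zero>\<^bsub>T.T\<^esub>)"
    by (rule T.T.M.finsum_cong') (auto simp: \<theta>_relation[OF \<psi>] T.pt_zero_left hc q)
  finally show ?thesis by simp
qed

lemma ext_iso:
  assumes N: "left_module A N"
  shows "ext_iso N \<in> mhom K (Ext K A d M N) (tensor_space K A \<Theta> N)"
    and "f \<in> ZE N \<Longrightarrow> ext_iso N (BE N +>\<^bsub>HS N\<^esub> f) = ext_tensor N f"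
proof -
  interpret E: subquotient_module K "HS N" "ZE N" "BE N" by (rule ext_subquotient[OF N])
  interpret T: tensor_pair K A \<Theta> N by (rule tensor_pair_Theta[OF N])
  note i = E.induced_map[OF T.left_module_T ext_tensor_hom[OF N] ext_tensor_coboundary[OF N]]
  show "ext_iso N \<in> mhom K (Ext K A d M N) (tensor_space K A \<Theta> N)"
    unfolding Ext_eq ext_iso_def[abs_def] by (rule i(1))
  show "f \<in> ZE N \<Longrightarrow> ext_iso N (BE N +>\<^bsub>HS N\<^esub> f) = ext_tensor N f"
    unfolding ext_iso_def by (rule i(2))
qed

definition "mult_by N f x = (\<lambda>y\<in>carrier (P d). f y \<odot>\<^bsub>N\<^esub> x)"

lemma mult_by_cocycle:
  assumes "left_module A N" "f \<in> ZE AA" "x \<in> carrier N"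
  shows "mult_by N f x \<in> ZE N"
proof -
  interpret N: left_module A N by fact
  show ?thesis
    unfolding mult_by_def using cocycleD(2)[OF assms(2)] assms(3)
    by (intro cocycleI mhom_smult_const assms(1,3) cocycleD(1)[OF assms(2)]) simp
qed

text \<open>The inverse of \<^const>\<open>ext_iso\<close> is induced by \<open>(f, x) \<mapsto> (y \<mapsto> f(y) x)\<close>.\<close>

lemma ext_iso_left_inverse:
  assumes N: "left_module A N"
  obtains \<Psi> where "\<Psi> \<in> mhom K (tensor_space K A \<Theta> N) (Ext K A d M N)"
    "\<And>f. f \<in> ZE N \<Longrightarrow> \<Psi> (ext_tensor N f) = BE N +>\<^bsub>HS N\<^esub> f"
proof -
  interpret N: left_module A N by (rule N)
  interpret E: subquotient_module K "HS N" "ZE N" "BE N" by (rule ext_subquotient[OF N])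
  interpret T: tensor_pair K A \<Theta> N by (rule tensor_pair_Theta[OF N])
  let ?E = "subquotient (HS N) (ZE N) (BE N)"
  have lE: "left_module K ?E" by (rule E.left_module_subquotient)
  interpret EM: left_module K ?E by (rule lE)
  let ?z = "mult_by N"
  note zc = mult_by_cocycle[OF N]
  have fA: "f y \<in> carrier A" if "f \<in> ZE AA" "y \<in> carrier (P d)" for f y
    using hom_A_closed[OF cocycleD(4)[OF that(1)] that(2)] .
  have z_add: "?z (f \<oplus>\<^bsub>HS AA\<^esub> f') x = ?z f x \<oplus>\<^bsub>HS N\<^esub> ?z f' x" if "f \<in> ZE AA" "f' \<in> ZE AA" "x \<in> carrier N" for f f' x
    unfolding mult_by_def hom_space_simps(3) using that by (auto simp: fA N.smult_l_distr)
  have z_add': "?z f (x \<oplus>\<^bsub>N\<^esub> x') = ?z f x \<oplus>\<^bsub>HS N\<^esub> ?z f x'" if "f \<in> ZE AA" "x \<in> carrier N" "x' \<in> carrier N" for f x x'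
    unfolding mult_by_def hom_space_simps(3) using that by (auto simp: fA N.smult_r_distr)
  have z_smult: "?z (c \<odot>\<^bsub>HS AA\<^esub> f) x = c \<odot>\<^bsub>HS N\<^esub> ?z f x" if "f \<in> ZE AA" "c \<in> carrier K" "x \<in> carrier N" for f c x
    unfolding mult_by_def hom_space_simps(4) using that
    by (auto simp: fA N.smult_assoc[symmetric])
  have z_middle: "?z (a \<odot>\<^bsub>RM\<^esub> f) x = ?z f (a \<odot>\<^bsub>N\<^esub> x)" if "f \<in> ZE AA" "a \<in> carrier A" "x \<in> carrier N" for f a x
    unfolding mult_by_def RM_simps(4) using that by (auto simp: fA N.smult_assoc)
  have z_scalar: "?z ((c \<odot>\<^bsub>A\<^esub> \<one>\<^bsub>A\<^esub>) \<odot>\<^bsub>RM\<^esub> f) x = c \<odot>\<^bsub>HS N\<^esub> ?z f x" if "f \<in> ZE AA" "c \<in> carrier K" "x \<in> carrier N" for f c x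
    unfolding mult_by_def RM_simps(4) hom_space_simps(4) using that
    by (auto simp: fA N.smult_assoc[symmetric])
  \<comment> \<open>For fixed \<open>x\<close> the map descends from cocycles to \<Theta>, since
    multiplying by \<open>x\<close> turns coboundaries into coboundaries. Only then is the
    dependence on both arguments lifted to the tensor product.\<close>
  define \<beta> where "\<beta> x \<tau> = the_elem ((\<lambda>f. E.cls (?z f x)) ` \<tau>)" for x \<tau>
  have h: "(\<lambda>f. E.cls (?z f x)) \<in> mhom K (HS AA\<lparr>carrier := ZE AA\<rparr>) ?E" if x: "x \<in> carrier N" for x
    by (rule mhomI) (simp_all add: x zc z_add z_smult E.cls_add E.cls_smult E.cls_closed)
  have hB: "E.cls (?z f x) = \<zero>\<^bsub>?E\<^esub>" if x: "x \<in> carrier N" and f: "f \<in> BE AA" for x f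
  proof -
    obtain k where k: "k \<in> mhom A (P m) AA" "f = (\<lambda>x\<in>carrier (P d). k (D m x))" using f by (rule coboundaryE)
    have "?z f x = (\<lambda>y\<in>carrier (P d). k (D m y) \<odot>\<^bsub>N\<^esub> x)" by (simp add: mult_by_def k(2) cong: restrict_cong)
    also have "\<dots> \<in> BE N" by (rule coboundaryI[OF mhom_smult_const[OF N k(1) x]])
    finally show ?thesis using E.cls_eq_zero_iff[of "?z f x"] E.BZ by blast
  qed
  have \<beta>: "\<beta> x (Th.cls f) = E.cls (?z f x)" if "x \<in> carrier N" "f \<in> ZE AA" for x f
    unfolding \<beta>_def cls_RM by (rule EA.induced_map(2)[OF lE h[OF that(1)] hB[OF that(1)] that(2)])
  have bal: "balanced K A \<Theta> N ?E (\<lambda>\<tau> x. (\<lambda>(\<tau>, x). \<beta> x \<tau>) (\<tau>, x))"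
  proof (rule balancedI)
    fix \<tau> x assume "\<tau> \<in> carrier \<Theta>" and x: "x \<in> carrier N"
    then obtain f where f: "f \<in> ZE AA" "\<tau> = Th.cls f" by (elim Theta_cases)
    show "(\<lambda>(\<tau>, x). \<beta> x \<tau>) (\<tau>, x) \<in> carrier ?E" using f x by (simp add: \<beta> zc E.cls_closed)
    show "(\<lambda>(\<tau>, x). \<beta> x \<tau>) (\<tau> \<oplus>\<^bsub>\<Theta>\<^esub> \<tau>', x) = (\<lambda>(\<tau>, x). \<beta> x \<tau>) (\<tau>, x) \<oplus>\<^bsub>?E\<^esub> (\<lambda>(\<tau>, x). \<beta> x \<tau>) (\<tau>', x)"
      if \<tau>': "\<tau>' \<in> carrier \<Theta>" for \<tau>'
    proof -
      obtain f' where f': "f' \<in> ZE AA" "\<tau>' = Th.cls f'" using \<tau>' by (elim Theta_cases)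
      have "\<tau> \<oplus>\<^bsub>\<Theta>\<^esub> \<tau>' = Th.cls (f \<oplus>\<^bsub>RM\<^esub> f')" by (simp only: f f' Theta_ops(1))
      moreover have "?z (f \<oplus>\<^bsub>RM\<^esub> f') x = ?z f x \<oplus>\<^bsub>HS N\<^esub> ?z f' x" using z_add[OF f(1) f'(1) x] by (simp only: RM_simps(3))
      ultimately show ?thesis
        using f f' x by (simp add: \<beta> Theta_ops(3) E.cls_add zc)
    qed
    show "(\<lambda>(\<tau>, x). \<beta> x \<tau>) (\<tau>, x \<oplus>\<^bsub>N\<^esub> x') = (\<lambda>(\<tau>, x). \<beta> x \<tau>) (\<tau>, x) \<oplus>\<^bsub>?E\<^esub> (\<lambda>(\<tau>, x). \<beta> x \<tau>) (\<tau>, x')"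
      if "x' \<in> carrier N" for x'
      using f x that by (simp add: \<beta> z_add' E.cls_add zc)
    show "(\<lambda>(\<tau>, x). \<beta> x \<tau>) (a \<odot>\<^bsub>\<Theta>\<^esub> \<tau>, x) = (\<lambda>(\<tau>, x). \<beta> x \<tau>) (\<tau>, a \<odot>\<^bsub>N\<^esub> x)" if a: "a \<in> carrier A" for a
      using \<beta>[OF x Theta_ops(4)[OF a f(1)]] \<beta>[of "a \<odot>\<^bsub>N\<^esub> x" f] z_middle[OF f(1) a x] Theta_ops(2)[OF a f(1)] f x a by simp
    show "(\<lambda>(\<tau>, x). \<beta> x \<tau>) ((c \<odot>\<^bsub>A\<^esub> \<one>\<^bsub>A\<^esub>) \<odot>\<^bsub>\<Theta>\<^esub> \<tau>, x) = c \<odot>\<^bsub>?E\<^esub> (\<lambda>(\<tau>, x). \<beta> x \<tau>) (\<tau>, x)" if c: "c \<in> carrier K" for c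
      using \<beta>[OF x Theta_ops(4)[OF unit_closed[OF c] f(1)]] \<beta>[OF x f(1)] z_scalar[OF f(1) c x]
        Theta_ops(2)[OF unit_closed[OF c] f(1)] f(2) E.cls_smult[OF c zc[OF f(1) x]] by simp
  qed
  define \<Psi> where "\<Psi> = tensor_lift K ?E (\<lambda>(\<tau>, x). \<beta> x \<tau>)"
  have \<Psi>: "\<Psi> \<in> mhom K T.T ?E" unfolding \<Psi>_def by (rule T.tensor_lift(1)[OF lE bal])
  have \<Psi>p: "\<Psi> (T.pt \<tau> x) = \<beta> x \<tau>" if "\<tau> \<in> carrier \<Theta>" "x \<in> carrier N" for \<tau> x
    unfolding \<Psi>_def using T.tensor_lift(2)[OF lE bal that] by simp
  \<comment> \<open>The image is the class of \<open>\<Sum> \<phi> i(e(-)) f(p i)\<close>, which is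
    \<open>f e\<close> by the dual basis and hence \<open>f\<close>.\<close>
  have "\<Psi> (ext_tensor N f) = E.cls f" if f: "f \<in> ZE N" for f
  proof -
    note fN = mhom_closed[OF cocycleD(1)[OF f]]
    let ?e = "\<lambda>i. ?z (\<lambda>x\<in>carrier (P d). \<phi> i (e x)) (f (p i))"
    have ec: "?e i \<in> ZE N" if "i < n" for i by (rule zc[OF \<phi>_e_cocycle[OF that] fN[OF p[OF that]]])
    have \<Psi>\<theta>: "\<Psi> (T.pt (\<theta> i) (f (p i))) = E.cls (?e i)" if "i < n" for i
      using \<Psi>p[OF \<theta>_closed[OF that] fN[OF p[OF that]]] \<beta>[OF fN[OF p[OF that]] \<phi>_e_cocycle[OF that]]
      by (simp only: \<theta>_def)
    have "\<Psi> (ext_tensor N f) = (\<Oplus>\<^bsub>?E\<^esub>i\<in>{..<n}. \<Psi> (T.pt (\<theta> i) (f (p i))))"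
      unfolding ext_tensor_def by (rule mhom_finsum[OF T.left_module_T lE \<Psi>]) (auto simp: \<theta>_closed fN p)
    also have "\<dots> = (\<Oplus>\<^bsub>?E\<^esub>i\<in>{..<n}. E.cls (?e i))"
      using E.cls_closed[OF ec] by (intro EM.M.finsum_cong') (auto simp: \<Psi>\<theta>)
    also have "\<dots> = E.cls (\<Oplus>\<^bsub>HS N\<^esub>i\<in>{..<n}. ?e i)" by (rule E.cls_finsum[symmetric]) (simp add: ec)
    also have "(\<Oplus>\<^bsub>HS N\<^esub>i\<in>{..<n}. ?e i) = f"
    proof (rule hom_space_eqI)
      show "(\<Oplus>\<^bsub>HS N\<^esub>i\<in>{..<n}. ?e i) \<in> carrier (HS N)"
        using E.V.submod_finsum[OF E.Z, of "{..<n}" ?e] ec cocycleD(4) by blast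
      show "f \<in> carrier (HS N)" by (rule cocycleD(4)[OF f])
      fix x assume x: "x \<in> carrier (P d)"
      have "(\<Oplus>\<^bsub>HS N\<^esub>i\<in>{..<n}. ?e i) x = (\<Oplus>\<^bsub>N\<^esub>i\<in>{..<n}. ?e i x)"
        using x cocycleD(4)[OF ec] mhom_closed[of _ A "P d" N x]
        by (intro finsum_additive[where f = "\<lambda>h. h x", OF E.V.M.abelian_group_axioms N.M.abelian_group_axioms])
          (auto simp: hom_space_simps(1,3))
      also have "\<dots> = (\<Oplus>\<^bsub>N\<^esub>i\<in>{..<n}. \<phi> i (e x) \<odot>\<^bsub>N\<^esub> f (p i))"
        using x by (intro N.M.finsum_cong') (auto simp: mult_by_def \<phi>_closed e_closed fN p)
      also have "\<dots> = f (e x)" by (rule hom_expand[OF N cocycleD(1)[OF f] e_closed[OF x]])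
      also have "\<dots> = f x" by (rule cocycle_e[OF N cocycleD(1,2)[OF f] x])
      finally show "(\<Oplus>\<^bsub>HS N\<^esub>i\<in>{..<n}. ?e i) x = f x" .
    qed
    finally show ?thesis .
  qed
  with \<Psi> show ?thesis using that by (simp only: Ext_eq)
qed

text \<open>The left inverse gives injectivity. For surjectivity let \<open>f\<close> represent
  \<open>\<tau>\<close>: the cocycle \<open>y \<mapsto> f(y) x\<close> goes to
  \<open>\<Sum> \<theta> i \<otimes> f(p i) x\<close>, and moving the coefficients to the left
  factor turns this into \<open>\<tau> \<otimes> x\<close> by
  \<open>\<theta>_expand\<close>.\<close>

lemma ext_iso_bij:
  assumes N: "left_module A N"
  shows "bij_betw (ext_iso N) (carrier (Ext K A d M N)) (carrier (tensor_space K A \<Theta> N))"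
proof -
  interpret N: left_module A N by (rule N)
  interpret E: subquotient_module K "HS N" "ZE N" "BE N" by (rule ext_subquotient[OF N])
  interpret T: tensor_pair K A \<Theta> N by (rule tensor_pair_Theta[OF N])
  have lE: "left_module K (Ext K A d M N)" unfolding Ext_eq by (rule E.left_module_subquotient)
  obtain \<Psi> where \<Psi>: "\<Psi> \<in> mhom K T.T (Ext K A d M N)" "\<And>f. f \<in> ZE N \<Longrightarrow> \<Psi> (ext_tensor N f) = E.cls f"
    using ext_iso_left_inverse[OF N] by blast
  note iso = ext_iso[OF N]
  show ?thesis
  proof (rule mhom_bij_betwI[OF lE T.left_module_T iso(1)])
    fix \<xi> assume "\<xi> \<in> carrier (Ext K A d M N)" and z: "ext_iso N \<xi> = \<zero>\<^bsub>T.T\<^esub>"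
    then obtain f where f: "f \<in> ZE N" "\<xi> = E.cls f" unfolding Ext_eq by (elim E.cls_cases)
    have "\<xi> = \<Psi> (ext_tensor N f)" using f \<Psi>(2) by simp
    also have "ext_tensor N f = \<zero>\<^bsub>T.T\<^esub>" using z iso(2)[OF f(1)] f(2) by simp
    also have "\<Psi> \<zero>\<^bsub>T.T\<^esub> = \<zero>\<^bsub>Ext K A d M N\<^esub>" by (rule mhom_zero[OF T.left_module_T lE \<Psi>(1)])
    finally show "\<xi> = \<zero>\<^bsub>Ext K A d M N\<^esub>" .
  next
    have im: "submod K T.T (ext_iso N ` carrier (Ext K A d M N))"
      by (rule submod_image[OF lE T.left_module_T iso(1) left_module.submod_carrier[OF lE]])
    show "carrier T.T \<subseteq> ext_iso N ` carrier (Ext K A d M N)"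
    proof
      fix \<zeta> assume "\<zeta> \<in> carrier T.T"
      then show "\<zeta> \<in> ext_iso N ` carrier (Ext K A d M N)"
      proof (induction \<zeta> rule: T.tensor_induct)
        case (pure \<tau> x)
        obtain f where f: "f \<in> ZE AA" "\<tau> = Th.cls f" using pure(1) by (rule Theta_cases)
        note fA = hom_A_closed[OF cocycleD(4)[OF f(1)]]
        note zc = mult_by_cocycle[OF N f(1) pure(2)]
        have "ext_tensor N (mult_by N f x) = (\<Oplus>\<^bsub>T.T\<^esub>i\<in>{..<n}. T.pt (f (p i) \<odot>\<^bsub>\<Theta>\<^esub> \<theta> i) x)"
          unfolding ext_tensor_def using pure(2)
          by (intro T.T.M.finsum_cong') (auto simp: mult_by_def p fA \<theta>_closed T.pt_middle)
        also have "\<dots> = T.pt (\<Oplus>\<^bsub>\<Theta>\<^esub>i\<in>{..<n}. f (p i) \<odot>\<^bsub>\<Theta>\<^esub> \<theta> i) x"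
          using pure(2) by (intro T.pt_finsum_left[symmetric]) (auto simp: p fA \<theta>_closed)
        also have "\<dots> = T.pt \<tau> x" using \<theta>_expand[OF f(1)] f(2) by simp
        finally have "T.pt \<tau> x = ext_iso N (E.cls (mult_by N f x))" using iso(2)[OF zc] by simp
        then show ?case using E.cls_closed[OF zc] by (simp add: Ext_eq)
      next
        case (add \<xi> \<zeta>)
        then show ?case using submodD(4)[OF im] by blast
      qed
    qed
  qed
qed

text \<open>Both sides are \<open>\<Sum> \<theta> i \<otimes> u(f(p i))\<close> for any
  representative \<open>f\<close>; the work lies in freeing \<open>Ext_map\<close> from the choice
  of \<open>f\<close>.\<close>

lemma ext_iso_natural:
  assumes N: "left_module A N" and N': "left_module A N'" and u: "u \<in> mhom A N N'"
    and \<xi>: "\<xi> \<in> carrier (Ext K A d M N)"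
  shows "ext_iso N' (Ext_map K A d M N' u \<xi>) = tensor_map K A \<Theta> N' (\<lambda>\<theta>. \<theta>) u (ext_iso N \<xi>)"
proof -
  interpret N: left_module A N by (rule N)
  interpret E: subquotient_module K "HS N" "ZE N" "BE N" by (rule ext_subquotient[OF N])
  interpret E': subquotient_module K "HS N'" "ZE N'" "BE N'" by (rule ext_subquotient[OF N'])
  interpret T: tensor_pair K A \<Theta> N by (rule tensor_pair_Theta[OF N])
  interpret T': tensor_pair K A \<Theta> N' by (rule tensor_pair_Theta[OF N'])
  obtain f where f: "f \<in> ZE N" "\<xi> = E.cls f" using \<xi> unfolding Ext_eq by (rule E.cls_cases)
  let ?c = "\<lambda>f. \<lambda>x\<in>carrier (P d). u (f x)"
  have cZ: "?c w \<in> ZE N'" if "w \<in> ZE N" for w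
    using cocycleD(2)[OF that] mhom_zero[OF N N' u] by (intro cocycleI mhom_comp[OF cocycleD(1)[OF that] u]) simp
  have eq: "E'.cls (?c w) = E'.cls (?c f)" if w: "w \<in> ZE N" "w \<ominus>\<^bsub>HS N\<^esub> f \<in> BE N" for w
  proof -
    obtain k where k: "k \<in> mhom A (P m) N" "w \<ominus>\<^bsub>HS N\<^esub> f = (\<lambda>x\<in>carrier (P d). k (D m x))"
      using w(2) by (rule coboundaryE)
    have w_eq: "w = (w \<ominus>\<^bsub>HS N\<^esub> f) \<oplus>\<^bsub>HS N\<^esub> f"
      using cocycleD(4)[OF w(1)] cocycleD(4)[OF f(1)] by (simp add: a_minus_def E.V.M.a_assoc E.V.M.l_neg)
    have wx: "w x = k (D m x) \<oplus>\<^bsub>N\<^esub> f x" if "x \<in> carrier (P d)" for x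
      using fun_cong[OF w_eq, of x] by (simp only: hom_space_simps(3) k(2) restrict_apply'[OF that])
    let ?b = "\<lambda>x\<in>carrier (P d). u (k (D m x))"
    have b: "?b \<in> BE N'" by (rule coboundaryI[OF mhom_comp[OF k(1) u]])
    have "?c w = ?b \<oplus>\<^bsub>HS N'\<^esub> ?c f"
      unfolding hom_space_simps(3)
      using mhom_closed[OF k(1) D_closed] mhom_closed[OF cocycleD(1)[OF f(1)]]
      by (auto simp: wx mhom_add[OF u])
    then have "?c w \<ominus>\<^bsub>HS N'\<^esub> ?c f = ?b"
      using submodD(2)[OF E'.B b] cocycleD(4)[OF cZ[OF f(1)]] by (simp add: a_minus_def E'.V.M.a_assoc E'.V.M.r_neg)
    then show ?thesis using E'.cls_eq_iff[OF cZ[OF w(1)] cZ[OF f(1)]] b by simp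
  qed
  have "Ext_map K A d M N' u \<xi> = E'.cls (?c f)"
    unfolding Ext_map_def f(2) compose_def by (rule E.union_cls[where G = "\<lambda>f. E'.cls (?c f)", OF f(1) eq])
  then have "ext_iso N' (Ext_map K A d M N' u \<xi>) = ext_tensor N' (?c f)" using ext_iso(2)[OF N' cZ[OF f(1)]] by simp
  also have "\<dots> = (\<Oplus>\<^bsub>T'.T\<^esub>i\<in>{..<n}. tensor_map K A \<Theta> N' (\<lambda>\<theta>. \<theta>) u (T.pt (\<theta> i) (f (p i))))"
    unfolding ext_tensor_def using mhom_closed[OF cocycleD(1)[OF f(1)]] mhom_closed[OF u]
    by (intro T'.T.M.finsum_cong')
      (auto simp: tensor_map(2)[OF tensor_pair_Theta[OF N'] tensor_pair_Theta[OF N] mhom_id u] \<theta>_closed p)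
  also have "\<dots> = tensor_map K A \<Theta> N' (\<lambda>\<theta>. \<theta>) u (ext_tensor N f)"
    unfolding ext_tensor_def using mhom_closed[OF cocycleD(1)[OF f(1)]]
    by (intro mhom_finsum[symmetric, OF T.left_module_T T'.left_module_T tensor_map(1)[OF tensor_pair_Theta[OF N'] tensor_pair_Theta[OF N] mhom_id u]])
      (auto simp: \<theta>_closed p)
  finally show ?thesis using ext_iso(2)[OF N f(1)] f(2) by simp
qed

end

subsubsection \<open>The isomorphism for Tor\<close>

locale tor_coefficients = split_resolution K A M m g n p \<phi>
  for K :: "('k, 'z) ring_scheme" and A :: "('k, 'a) module" and M :: "('a, 'm) module" and m g n p \<phi> +
  fixes X :: "('a, 'x) module"
  assumes left_module_X: "left_module (op_algebra A) X"
begin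

sublocale X: left_module "op_algebra A" X by (rule left_module_X)
sublocale T: tensor_pair K A X "P j" for j
  by (intro tensor_pair.intro tensor_pair_axioms.intro algebra_over_field_axioms left_module_X left_module_P)

abbreviation "C j \<equiv> tensor_space K A X (P j)"
abbreviation "pure j \<equiv> pure_tensor K A X (P j)"
abbreviation "bd j \<equiv> tensor_map K A X (P j) (\<lambda>x. x) (D j)"
abbreviation "XK \<equiv> scalars A X"

lemma left_module_XK: "left_module K XK"
  using op.left_module_scalars[OF left_module_X] by simp

lemma X_smult_closed: "\<lbrakk>a \<in> carrier A; x \<in> carrier X\<rbrakk> \<Longrightarrow> a \<odot>\<^bsub>X\<^esub> x \<in> carrier X"
  using X.smult_closed[of a x] by simp

lemma X_assoc: "\<lbrakk>a \<in> carrier A; b \<in> carrier A; x \<in> carrier X\<rbrakk> \<Longrightarrow> a \<odot>\<^bsub>X\<^esub> (b \<odot>\<^bsub>X\<^esub> x) = (b \<otimes>\<^bsub>A\<^esub> a) \<odot>\<^bsub>X\<^esub> x"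
  using X.smult_assoc[of a b x] by simp

lemma X_distr:
  "\<lbrakk>a \<in> carrier A; x \<in> carrier X; x' \<in> carrier X\<rbrakk> \<Longrightarrow> a \<odot>\<^bsub>X\<^esub> (x \<oplus>\<^bsub>X\<^esub> x') = a \<odot>\<^bsub>X\<^esub> x \<oplus>\<^bsub>X\<^esub> a \<odot>\<^bsub>X\<^esub> x'"
  "\<lbrakk>a \<in> carrier A; b \<in> carrier A; x \<in> carrier X\<rbrakk> \<Longrightarrow> (a \<oplus>\<^bsub>A\<^esub> b) \<odot>\<^bsub>X\<^esub> x = a \<odot>\<^bsub>X\<^esub> x \<oplus>\<^bsub>X\<^esub> b \<odot>\<^bsub>X\<^esub> x"
  using X.smult_r_distr[of a x x'] X.smult_l_distr[of a b x] by simp_all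

lemma bd_hom: "bd j \<in> mhom K (C (Suc j)) (C j)"
  and bd_pure: "\<lbrakk>x \<in> carrier X; y \<in> carrier (P (Suc j))\<rbrakk> \<Longrightarrow> bd j (pure (Suc j) x y) = pure j x (D j y)"
  by (rule tensor_map[OF T.tensor_pair_axioms T.tensor_pair_axioms mhom_id D_hom]; assumption)+

lemma bd_bd: "\<zeta> \<in> carrier (C (Suc (Suc j))) \<Longrightarrow> bd j (bd (Suc j) \<zeta>) = \<zero>\<^bsub>C j\<^esub>"
  by (rule T.mhom_T_eqI[OF T.left_module_T mhom_comp[OF bd_hom bd_hom] mhom_const_zero[OF T.left_module_T]])
    (simp_all add: bd_pure D_closed D_D T.pt_zero_right)

definition "ev f = tensor_lift K XK (\<lambda>(x, y). f y \<odot>\<^bsub>X\<^esub> x)"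

lemma ev:
  assumes f: "f \<in> mhom A (P j) AA"
  shows "ev f \<in> mhom K (C j) XK"
    and "\<lbrakk>x \<in> carrier X; y \<in> carrier (P j)\<rbrakk> \<Longrightarrow> ev f (pure j x y) = f y \<odot>\<^bsub>X\<^esub> x"
proof -
  have fc: "f y \<in> carrier A" if "y \<in> carrier (P j)" for y using mhom_closed[OF f that] by simp
  have "balanced K A X (P j) XK (\<lambda>x y. (\<lambda>(x, y). f y \<odot>\<^bsub>X\<^esub> x) (x, y))"
    by (rule balancedI)
      (simp_all add: fc X_smult_closed X_assoc X_distr mhom_add[OF f] mhom_smult[OF f])
  note l = T.tensor_lift[OF left_module_XK this]
  show "ev f \<in> mhom K (C j) XK" unfolding ev_def by (rule l(1))
  show "\<lbrakk>x \<in> carrier X; y \<in> carrier (P j)\<rbrakk> \<Longrightarrow> ev f (pure j x y) = f y \<odot>\<^bsub>X\<^esub> x"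
    unfolding ev_def using l(2) by simp
qed

lemma ev_closed: "\<lbrakk>f \<in> mhom A (P j) AA; \<zeta> \<in> carrier (C j)\<rbrakk> \<Longrightarrow> ev f \<zeta> \<in> carrier X"
  using mhom_closed[OF ev(1)] by fastforce

lemma mhom_AA_closed: "\<lbrakk>f \<in> mhom A V AA; y \<in> carrier V\<rbrakk> \<Longrightarrow> f y \<in> carrier A"
  using mhom_closed[of f A V AA y] by simp

lemma ev_cong:
  assumes "f \<in> mhom A (P j) AA" "f' \<in> mhom A (P j) AA" "\<And>y. y \<in> carrier (P j) \<Longrightarrow> f y = f' y" "\<zeta> \<in> carrier (C j)"
  shows "ev f \<zeta> = ev f' \<zeta>"
  by (rule T.mhom_T_eqI[OF left_module_XK ev(1)[OF assms(1)] ev(1)[OF assms(2)] _ assms(4)])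
    (simp add: ev(2)[OF assms(1)] ev(2)[OF assms(2)] assms(3))

text \<open>Evaluation makes the boundary of \<open>X \<otimes> P\<close> adjoint to the coboundary
  of the complex of homomorphisms into \<open>A\<close>. Hence boundaries pair to zero with
  cocycles, and cycles with coboundaries.\<close>

lemma ev_comp:
  assumes "f \<in> mhom A (P j) AA" "\<zeta> \<in> carrier (C (Suc j))"
  shows "ev (\<lambda>y. f (D j y)) \<zeta> = ev f (bd j \<zeta>)"
  by (rule T.mhom_T_eqI[OF left_module_XK ev(1)[OF mhom_comp[OF D_hom assms(1)]] mhom_comp[OF bd_hom ev(1)[OF assms(1)]] _ assms(2)])
    (simp add: ev(2)[OF assms(1)] ev(2)[OF mhom_comp[OF D_hom assms(1)]] bd_pure D_closed)

lemma ev_plus: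
  assumes "f \<in> mhom A (P j) AA" "f' \<in> mhom A (P j) AA" "\<zeta> \<in> carrier (C j)"
  shows "ev (\<lambda>y. f y \<oplus>\<^bsub>A\<^esub> f' y) \<zeta> = ev f \<zeta> \<oplus>\<^bsub>X\<^esub> ev f' \<zeta>"
proof -
  have pl: "(\<lambda>y. f y \<oplus>\<^bsub>A\<^esub> f' y) \<in> mhom A (P j) AA" using mhom_plus[OF AA.is_left_module assms(1,2)] by simp
  have pl': "(\<lambda>\<zeta>. ev f \<zeta> \<oplus>\<^bsub>X\<^esub> ev f' \<zeta>) \<in> mhom K (C j) XK"
    using mhom_plus[OF left_module_XK ev(1)[OF assms(1)] ev(1)[OF assms(2)]] by simp
  show ?thesis
    by (rule T.mhom_T_eqI[OF left_module_XK ev(1)[OF pl] pl' _ assms(3)])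
      (simp add: ev(2)[OF pl] ev(2)[OF assms(1)] ev(2)[OF assms(2)] X_distr mhom_AA_closed[OF assms(1)] mhom_AA_closed[OF assms(2)])
qed

lemma ev_mult:
  assumes f: "f \<in> mhom A (P j) AA" and a: "a \<in> carrier A" and \<zeta>: "\<zeta> \<in> carrier (C j)"
  shows "ev (\<lambda>y. f y \<otimes>\<^bsub>A\<^esub> a) \<zeta> = a \<odot>\<^bsub>X\<^esub> ev f \<zeta>"
proof -
  have "(\<lambda>x. a \<odot>\<^bsub>X\<^esub> x) \<in> mhom K XK XK"
    using a by (intro mhomI) (simp_all add: X_smult_closed X_distr X_assoc)
  note s = mhom_comp[OF ev(1)[OF f] this]
  show ?thesis
    by (rule T.mhom_T_eqI[OF left_module_XK ev(1)[OF mhom_A_mult[OF f a]] s _ \<zeta>])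
      (simp add: ev(2)[OF mhom_A_mult[OF f a]] ev(2)[OF f] X_assoc a mhom_AA_closed[OF f])
qed

abbreviation "ZT \<equiv> Tor_cycles K A d X M"
abbreviation "BT \<equiv> Tor_boundaries K A d X M"

lemma cycles_eq: "ZT = {\<zeta> \<in> carrier (C d). bd m \<zeta> = \<zero>\<^bsub>C m\<^esub>}"
  and boundaries_eq: "BT = bd d ` carrier (C (Suc d))"
  and Tor_eq: "Tor K A d X M = subquotient (C d) ZT BT"
  by (simp_all add: Tor_cycles_def Tor_boundaries_def Tor_boundary_def Tor_chains_def Tor_def)

sublocale H: subquotient_module K "C d" ZT BT
proof (intro subquotient_module.intro T.left_module_T subquotient_module_axioms.intro)
  show "submod K (C d) ZT" unfolding cycles_eq by (rule submod_ker[OF T.left_module_T T.left_module_T bd_hom])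
  show "submod K (C d) BT"
    unfolding boundaries_eq by (rule submod_image[OF T.left_module_T T.left_module_T bd_hom T.T.submod_carrier])
  show "BT \<subseteq> ZT" using mhom_closed[OF bd_hom] bd_bd by (auto simp: cycles_eq boundaries_eq)
qed

lemma cycleD: "\<zeta> \<in> ZT \<Longrightarrow> \<zeta> \<in> carrier (C d)" "\<zeta> \<in> ZT \<Longrightarrow> bd m \<zeta> = \<zero>\<^bsub>C m\<^esub>"
  by (simp_all add: cycles_eq)

lemma ev_boundary:
  assumes f: "f \<in> ZE AA" and "\<zeta> \<in> BT"
  shows "ev f \<zeta> = \<zero>\<^bsub>X\<^esub>"
proof -
  obtain w where w: "w \<in> carrier (C (Suc d))" "\<zeta> = bd d w" using assms(2) by (auto simp: boundaries_eq)
  have z: "(\<lambda>y. \<zero>\<^bsub>A\<^esub>) \<in> mhom A (P (Suc d)) AA" using mhom_const_zero[OF AA.is_left_module] by simp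
  note fD = mhom_comp[OF D_hom cocycleD(1)[OF f]]
  have "ev f \<zeta> = ev (\<lambda>y. f (D d y)) w" using ev_comp[OF cocycleD(1)[OF f] w(1)] w(2) by simp
  also have "\<dots> = \<zero>\<^bsub>XK\<^esub>"
    using cocycleD(2)[OF f] X.smult_zero_left
    by (intro T.mhom_T_eqI[OF left_module_XK ev(1)[OF fD] mhom_const_zero[OF left_module_XK] _ w(1)])
      (simp add: ev(2)[OF fD])
  finally show ?thesis by simp
qed

lemma ev_coboundary:
  assumes "f \<in> BE AA" and \<zeta>: "\<zeta> \<in> ZT"
  shows "ev f \<zeta> = \<zero>\<^bsub>X\<^esub>"
proof -
  obtain k where k: "k \<in> mhom A (P m) AA" "f = (\<lambda>x\<in>carrier (P d). k (D m x))" using assms(1) by (rule coboundaryE)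
  have fz: "f \<in> mhom A (P d) AA" using assms(1) EA.BZ cocycleD(1) by blast
  have "ev f \<zeta> = ev (\<lambda>x. k (D m x)) \<zeta>"
    by (rule ev_cong[OF fz mhom_comp[OF D_hom k(1)] _ cycleD(1)[OF \<zeta>]]) (simp add: k(2))
  also have "\<dots> = ev k \<zero>\<^bsub>C m\<^esub>" using ev_comp[OF k(1) cycleD(1)[OF \<zeta>]] cycleD(2)[OF \<zeta>] by simp
  also have "\<dots> = \<zero>\<^bsub>X\<^esub>" using mhom_zero[OF T.left_module_T left_module_XK ev(1)[OF k(1)]] by simp
  finally show ?thesis .
qed

abbreviation "HT \<equiv> hom_space (op_algebra A) \<Theta> X"

text \<open>Restricted to the carrier because \<open>hom_space\<close> contains extensional
  functions only.\<close>

definition "tor_pairing \<zeta> = (\<lambda>\<tau>\<in>carrier \<Theta>. the_elem ((\<lambda>f. ev f \<zeta>) ` \<tau>))"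

lemma tor_pairing:
  assumes \<zeta>: "\<zeta> \<in> ZT"
  shows "tor_pairing \<zeta> \<in> carrier HT" and "f \<in> ZE AA \<Longrightarrow> tor_pairing \<zeta> (Th.cls f) = ev f \<zeta>"
proof -
  note c = cycleD(1)[OF \<zeta>]
  have plus: "ev (f \<oplus>\<^bsub>RM\<^esub> f') \<zeta> = ev f \<zeta> \<oplus>\<^bsub>X\<^esub> ev f' \<zeta>" if "f \<in> ZE AA" "f' \<in> ZE AA" for f f'
  proof -
    note h = cocycleD(1)[OF that(1)] cocycleD(1)[OF that(2)]
    have "ev (f \<oplus>\<^bsub>RM\<^esub> f') \<zeta> = ev (\<lambda>y. f y \<oplus>\<^bsub>A\<^esub> f' y) \<zeta>"
      using cocycleD(1)[OF Theta_ops(3)[OF that]] mhom_plus[OF AA.is_left_module h]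
      by (intro ev_cong[OF _ _ _ c]) (simp_all add: RM_simps hom_space_simps(3))
    then show ?thesis by (simp add: ev_plus[OF h c])
  qed
  have mult: "ev (a \<odot>\<^bsub>RM\<^esub> f) \<zeta> = a \<odot>\<^bsub>X\<^esub> ev f \<zeta>" if "a \<in> carrier A" "f \<in> ZE AA" for a f
  proof -
    note h = cocycleD(1)[OF that(2)]
    have "ev (a \<odot>\<^bsub>RM\<^esub> f) \<zeta> = ev (\<lambda>y. f y \<otimes>\<^bsub>A\<^esub> a) \<zeta>"
      using cocycleD(1)[OF Theta_ops(4)[OF that]] mhom_A_mult[OF h that(1)]
      by (intro ev_cong[OF _ _ _ c]) (simp_all add: RM_simps)
    then show ?thesis by (simp add: ev_mult[OF h that(1) c])
  qed
  have "(\<lambda>f. ev f \<zeta>) \<in> mhom (op_algebra A) (RM\<lparr>carrier := ZE AA\<rparr>) X"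
    by (rule mhomI) (simp_all add: plus mult ev_closed[OF cocycleD(1) c])
  note i = Th.induced_map[OF left_module_X this ev_coboundary[OF _ \<zeta>]]
  show "tor_pairing \<zeta> \<in> carrier HT"
    unfolding tor_pairing_def by (rule hom_space_mem[OF left_module_Theta]) (unfold Theta_eq, rule i(1))
  show "f \<in> ZE AA \<Longrightarrow> tor_pairing \<zeta> (Th.cls f) = ev f \<zeta>"
    using Theta_ops(5)[of f] i(2)[of f] by (simp add: tor_pairing_def)
qed

lemma left_module_HT: "left_module K HT"
  by (rule op.left_module_hom_space[OF left_module_Theta left_module_X])

lemma HT_eqI:
  assumes "h \<in> carrier HT" "h' \<in> carrier HT" "\<And>f. f \<in> ZE AA \<Longrightarrow> h (Th.cls f) = h' (Th.cls f)"
  shows "h = h'"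
  by (rule hom_space_eqI[OF assms(1,2)]) (metis Theta_cases assms(3))

lemma tor_pairing_hom: "tor_pairing \<in> mhom K (C d\<lparr>carrier := ZT\<rparr>) HT"
proof -
  interpret HT: left_module K HT by (rule left_module_HT)
  show ?thesis
  proof (rule mhomI)
    fix \<zeta> \<zeta>' assume "\<zeta> \<in> carrier (C d\<lparr>carrier := ZT\<rparr>)" "\<zeta>' \<in> carrier (C d\<lparr>carrier := ZT\<rparr>)"
    then have z: "\<zeta> \<in> ZT" "\<zeta>' \<in> ZT" "\<zeta> \<oplus>\<^bsub>C d\<^esub> \<zeta>' \<in> ZT" using submodD(4)[OF H.Z] by auto
    have "tor_pairing (\<zeta> \<oplus>\<^bsub>C d\<^esub> \<zeta>') = tor_pairing \<zeta> \<oplus>\<^bsub>HT\<^esub> tor_pairing \<zeta>'"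
      using HT.M.a_closed tor_pairing(1)[OF z(1)] tor_pairing(1)[OF z(2)]
      by (intro HT_eqI tor_pairing(1)[OF z(3)])
        (auto simp: tor_pairing(2)[OF z(1)] tor_pairing(2)[OF z(2)] tor_pairing(2)[OF z(3)] hom_space_simps(3)
          Theta_ops(5) mhom_add[OF ev(1)[OF cocycleD(1)]] cycleD(1)[OF z(1)] cycleD(1)[OF z(2)])
    then show "tor_pairing (\<zeta> \<oplus>\<^bsub>C d\<lparr>carrier := ZT\<rparr>\<^esub> \<zeta>') = tor_pairing \<zeta> \<oplus>\<^bsub>HT\<^esub> tor_pairing \<zeta>'" by simp
  next
    fix c \<zeta> assume c: "c \<in> carrier K" and "\<zeta> \<in> carrier (C d\<lparr>carrier := ZT\<rparr>)"
    then have z: "\<zeta> \<in> ZT" "c \<odot>\<^bsub>C d\<^esub> \<zeta> \<in> ZT" using submodD(5)[OF H.Z] by auto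
    have "tor_pairing (c \<odot>\<^bsub>C d\<^esub> \<zeta>) = c \<odot>\<^bsub>HT\<^esub> tor_pairing \<zeta>"
      using HT.smult_closed[OF c tor_pairing(1)[OF z(1)]]
      by (intro HT_eqI tor_pairing(1)[OF z(2)])
        (auto simp: tor_pairing(2)[OF z(1)] tor_pairing(2)[OF z(2)] hom_space_simps(4)
          Theta_ops(5) mhom_smult[OF ev(1)[OF cocycleD(1)] c] cycleD(1)[OF z(1)])
    then show "tor_pairing (c \<odot>\<^bsub>C d\<lparr>carrier := ZT\<rparr>\<^esub> \<zeta>) = c \<odot>\<^bsub>HT\<^esub> tor_pairing \<zeta>" by simp
  qed (simp add: tor_pairing(1))
qed

lemma tor_pairing_boundary:
  assumes "\<zeta> \<in> BT"
  shows "tor_pairing \<zeta> = \<zero>\<^bsub>HT\<^esub>"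
proof -
  interpret HT: left_module K HT by (rule left_module_HT)
  have z: "\<zeta> \<in> ZT" using assms H.BZ by blast
  show ?thesis
    by (rule HT_eqI[OF tor_pairing(1)[OF z] HT.M.zero_closed])
      (simp add: tor_pairing(2)[OF z] ev_boundary[OF _ assms] hom_space_simps(2) Theta_ops(5))
qed

definition "tor_iso \<xi> = the_elem (tor_pairing ` \<xi>)"

lemma tor_iso:
  shows "tor_iso \<in> mhom K (Tor K A d X M) HT" and "\<zeta> \<in> ZT \<Longrightarrow> tor_iso (H.cls \<zeta>) = tor_pairing \<zeta>"
  using H.induced_map[OF left_module_HT tor_pairing_hom tor_pairing_boundary]
  by (simp_all add: Tor_eq tor_iso_def[abs_def])

lemma \<phi>_e_hom: "i < n \<Longrightarrow> (\<lambda>y. \<phi> i (e y)) \<in> mhom A (P d) AA"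
  by (rule mhom_comp[OF e_hom \<phi>])

text \<open>The decomposition of \<open>P d\<close> by \<open>e\<close> and \<open>g\<close>,
  tensored with \<open>X\<close>. The \<open>e\<close>-part is written with the dual basis,
  \<open>x \<otimes> e(y) = \<Sum> x \<phi> i(e(y)) \<otimes> p i\<close>, so that it depends only
  on the evaluations at \<open>\<phi> i e\<close>.\<close>

lemma chain_expand:
  assumes \<zeta>: "\<zeta> \<in> carrier (C d)"
  shows "(\<Oplus>\<^bsub>C d\<^esub>i\<in>{..<n}. pure d (ev (\<lambda>y. \<phi> i (e y)) \<zeta>) (p i)) \<oplus>\<^bsub>C d\<^esub> tensor_map K A X (P d) (\<lambda>x. x) g \<zeta> = \<zeta>"
proof -
  let ?g = "tensor_map K A X (P d) (\<lambda>x. x) g"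
  note tm = tensor_map[OF T.tensor_pair_axioms T.tensor_pair_axioms mhom_id g_hom]
  have s: "(\<lambda>\<zeta>. pure d (ev (\<lambda>y. \<phi> i (e y)) \<zeta>) (p i)) \<in> mhom K (C d) (C d)" if i: "i < n" for i
    using ev_closed[OF \<phi>_e_hom[OF i]] mhom_add[OF ev(1)[OF \<phi>_e_hom[OF i]]] mhom_smult[OF ev(1)[OF \<phi>_e_hom[OF i]]] p[OF i]
    by (intro mhomI) (simp_all add: T.pt_add_left T.pt_smult)
  have "(\<lambda>\<zeta>. (\<Oplus>\<^bsub>C d\<^esub>i\<in>{..<n}. pure d (ev (\<lambda>y. \<phi> i (e y)) \<zeta>) (p i)) \<oplus>\<^bsub>C d\<^esub> ?g \<zeta>) \<in> mhom K (C d) (C d)"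
    using s by (intro mhom_plus mhom_sum tm(1) T.left_module_T) auto
  then show ?thesis
  proof (rule T.mhom_T_eqI[OF T.left_module_T _ mhom_id _ \<zeta>])
    fix x y assume x: "x \<in> carrier X" and y: "y \<in> carrier (P d)"
    have "(\<Oplus>\<^bsub>C d\<^esub>i\<in>{..<n}. pure d (ev (\<lambda>y. \<phi> i (e y)) (pure d x y)) (p i)) = (\<Oplus>\<^bsub>C d\<^esub>i\<in>{..<n}. pure d x (\<phi> i (e y) \<odot>\<^bsub>P d\<^esub> p i))"
      using x y by (intro T.T.M.finsum_cong') (auto simp: ev(2)[OF \<phi>_e_hom] T.pt_middle \<phi>_closed e_closed p)
    also have "\<dots> = pure d x (\<Oplus>\<^bsub>P d\<^esub>i\<in>{..<n}. \<phi> i (e y) \<odot>\<^bsub>P d\<^esub> p i)"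
      using x y by (intro T.pt_finsum_right[symmetric]) (auto simp: \<phi>_closed e_closed p)
    also have "\<dots> = pure d x (e y)" by (simp add: dual_basis e_closed y)
    finally show "(\<Oplus>\<^bsub>C d\<^esub>i\<in>{..<n}. pure d (ev (\<lambda>y. \<phi> i (e y)) (pure d x y)) (p i)) \<oplus>\<^bsub>C d\<^esub> ?g (pure d x y) = pure d x y"
      using x y by (simp add: tm(2) T.pt_add_right[symmetric] e_closed g_closed e_plus_g)
  qed
qed

lemma retraction_boundary:
  assumes "\<zeta> \<in> carrier (C d)"
  shows "tensor_map K A X (P d) (\<lambda>x. x) g \<zeta> \<in> BT"
  using assms
proof (induction \<zeta> rule: T.tensor_induct)
  case (pure x y)
  obtain w where w: "w \<in> carrier (P (Suc d))" "g y = D d w" using g_im[OF pure(2)] by auto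
  have "tensor_map K A X (P d) (\<lambda>x. x) g (pure d x y) = bd d (pure (Suc d) x w)"
    using pure w tensor_map(2)[OF T.tensor_pair_axioms T.tensor_pair_axioms mhom_id g_hom] by (simp add: bd_pure)
  then show ?case using T.pt_closed[OF pure(1) w(1)] by (simp add: boundaries_eq)
next
  case (add \<xi> \<zeta>)
  then show ?case
    using submodD(4)[OF H.B] mhom_add[OF tensor_map(1)[OF T.tensor_pair_axioms T.tensor_pair_axioms mhom_id g_hom]] by simp
qed

text \<open>If a cycle pairs to zero with all \<open>\<theta> i\<close>, its \<open>e\<close>-part
  vanishes in \<open>chain_expand\<close>; what remains is its image under \<open>g\<close>, a
  boundary. For surjectivity, \<Theta> is generated by the \<open>\<theta> i\<close>, so a
  homomorphism is recovered from its values there.\<close>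

lemma tor_iso_bij: "bij_betw tor_iso (carrier (Tor K A d X M)) (carrier HT)"
proof (rule mhom_bij_betwI[OF _ left_module_HT tor_iso(1)])
  show "left_module K (Tor K A d X M)" unfolding Tor_eq by (rule H.left_module_subquotient)
next
  fix \<xi> assume "\<xi> \<in> carrier (Tor K A d X M)" and z: "tor_iso \<xi> = \<zero>\<^bsub>HT\<^esub>"
  then obtain \<zeta> where \<zeta>: "\<zeta> \<in> ZT" "\<xi> = H.cls \<zeta>" unfolding Tor_eq by (elim H.cls_cases)
  note c = cycleD(1)[OF \<zeta>(1)]
  have "ev (\<lambda>y. \<phi> i (e y)) \<zeta> = \<zero>\<^bsub>X\<^esub>" if i: "i < n" for i
  proof -
    have "ev (\<lambda>y. \<phi> i (e y)) \<zeta> = ev (\<lambda>y\<in>carrier (P d). \<phi> i (e y)) \<zeta>"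
      by (rule ev_cong[OF \<phi>_e_hom[OF i] cocycleD(1)[OF \<phi>_e_cocycle[OF i]] _ c]) simp
    also have "\<dots> = tor_pairing \<zeta> (\<theta> i)" unfolding \<theta>_def by (rule tor_pairing(2)[OF \<zeta>(1) \<phi>_e_cocycle[OF i], symmetric])
    also have "\<dots> = \<zero>\<^bsub>X\<^esub>" using z tor_iso(2)[OF \<zeta>(1)] \<zeta>(2) \<theta>_closed[OF i] by (simp add: hom_space_simps(2))
    finally show ?thesis .
  qed
  then have "(\<Oplus>\<^bsub>C d\<^esub>i\<in>{..<n}. pure d (ev (\<lambda>y. \<phi> i (e y)) \<zeta>) (p i)) = (\<Oplus>\<^bsub>C d\<^esub>i\<in>{..<n}. \<zero>\<^bsub>C d\<^esub>)"
    by (intro T.T.M.finsum_cong') (auto simp: T.pt_zero_left p)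
  then have "tensor_map K A X (P d) (\<lambda>x. x) g \<zeta> = \<zeta>"
    using chain_expand[OF c] submodD(2)[OF H.B retraction_boundary[OF c]] by simp
  then have "\<zeta> \<in> BT" using retraction_boundary[OF c] by simp
  then show "\<xi> = \<zero>\<^bsub>Tor K A d X M\<^esub>" using H.cls_eq_zero_iff[OF \<zeta>(1)] \<zeta>(2) by (simp add: Tor_eq)
next
  show "carrier HT \<subseteq> tor_iso ` carrier (Tor K A d X M)"
  proof
    fix h assume h: "h \<in> carrier HT"
    then have hh: "h \<in> mhom (op_algebra A) \<Theta> X" by (simp add: hom_space_simps)
    note hc = mhom_closed[OF hh]
    define \<zeta> where "\<zeta> = (\<Oplus>\<^bsub>C d\<^esub>i\<in>{..<n}. pure d (h (\<theta> i)) (p i))"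
    have pc: "pure d (h (\<theta> i)) (p i) \<in> carrier (C d)" if "i < n" for i
      using that by (simp add: hc \<theta>_closed p)
    have c: "\<zeta> \<in> carrier (C d)" unfolding \<zeta>_def using pc by (intro T.T.M.finsum_closed) auto
    have sum: "h (\<Oplus>\<^bsub>\<Theta>\<^esub>i\<in>{..<n}. a i \<odot>\<^bsub>\<Theta>\<^esub> \<theta> i) = (\<Oplus>\<^bsub>X\<^esub>i\<in>{..<n}. a i \<odot>\<^bsub>X\<^esub> h (\<theta> i))"
      if "\<And>i. i < n \<Longrightarrow> a i \<in> carrier A" for a
    proof -
      have "h (\<Oplus>\<^bsub>\<Theta>\<^esub>i\<in>{..<n}. a i \<odot>\<^bsub>\<Theta>\<^esub> \<theta> i) = (\<Oplus>\<^bsub>X\<^esub>i\<in>{..<n}. h (a i \<odot>\<^bsub>\<Theta>\<^esub> \<theta> i))"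
        using that by (intro mhom_finsum[OF left_module_Theta left_module_X hh] \<Theta>.smult_closed) (auto simp: \<theta>_closed)
      also have "\<dots> = (\<Oplus>\<^bsub>X\<^esub>i\<in>{..<n}. a i \<odot>\<^bsub>X\<^esub> h (\<theta> i))"
        using that by (intro X.M.finsum_cong') (auto simp: mhom_smult[OF hh] \<theta>_closed hc X_smult_closed)
      finally show ?thesis .
    qed
    \<comment> \<open>Expanding \<open>D m (p i)\<close> in \<open>P m\<close> and moving the
      coefficients to the left factor yields \<open>h\<close> applied to sums that vanish by
      \<open>\<theta>_relation\<close>.\<close>
    have "bd m \<zeta> = \<zero>\<^bsub>C m\<^esub>"
    proof -
      obtain k :: nat and q \<psi> where q: "\<And>j. j < k \<Longrightarrow> q j \<in> carrier (P m)" and \<psi>: "\<And>j. j < k \<Longrightarrow> \<psi> j \<in> mhom A (P m) AA"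
        and \<psi>c: "\<And>j y. \<lbrakk>j < k; y \<in> carrier (P m)\<rbrakk> \<Longrightarrow> \<psi> j y \<in> carrier A"
        and eq: "\<And>y. y \<in> carrier (P m) \<Longrightarrow> (\<Oplus>\<^bsub>P m\<^esub>j\<in>{..<k}. \<psi> j y \<odot>\<^bsub>P m\<^esub> q j) = y"
        using boundary_expansion by blast
      have "bd m \<zeta> = (\<Oplus>\<^bsub>C m\<^esub>i\<in>{..<n}. bd m (pure d (h (\<theta> i)) (p i)))"
        unfolding \<zeta>_def using pc by (intro mhom_finsum[OF T.left_module_T T.left_module_T bd_hom]) auto
      also have "\<dots> = (\<Oplus>\<^bsub>C m\<^esub>i\<in>{..<n}. pure m (h (\<theta> i)) (\<Oplus>\<^bsub>P m\<^esub>j\<in>{..<k}. \<psi> j (D m (p i)) \<odot>\<^bsub>P m\<^esub> q j))"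
        by (intro T.T.M.finsum_cong') (auto simp: bd_pure hc \<theta>_closed p D_closed eq)
      also have "\<dots> = (\<Oplus>\<^bsub>C m\<^esub>j\<in>{..<k}. pure m (\<Oplus>\<^bsub>X\<^esub>i\<in>{..<n}. \<psi> j (D m (p i)) \<odot>\<^bsub>X\<^esub> h (\<theta> i)) (q j))"
        by (rule T.pt_exchange) (auto simp: \<psi>c D_closed p q hc \<theta>_closed)
      also have "\<dots> = (\<Oplus>\<^bsub>C m\<^esub>j\<in>{..<k}. \<zero>\<^bsub>C m\<^esub>)"
        using mhom_zero[OF left_module_Theta left_module_X hh]
        by (intro T.T.M.finsum_cong') (auto simp: sum[symmetric] \<psi>c D_closed p \<theta>_relation[OF \<psi>] T.pt_zero_left q)
      finally show ?thesis by simp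
    qed
    with c have z: "\<zeta> \<in> ZT" by (simp add: cycles_eq)
    \<comment> \<open>Pairing with \<open>f\<close> gives
      \<open>\<Sum> h(\<theta> i) f(p i) = h(\<Sum> \<theta> i f(p i))\<close>, and the last
      argument is the class of \<open>f\<close>.\<close>
    have "tor_pairing \<zeta> = h"
    proof (rule HT_eqI[OF tor_pairing(1)[OF z] h])
      fix f assume f: "f \<in> ZE AA"
      note fA = hom_A_closed[OF cocycleD(4)[OF f]]
      have "tor_pairing \<zeta> (Th.cls f) = ev f \<zeta>" by (rule tor_pairing(2)[OF z f])
      also have "\<dots> = (\<Oplus>\<^bsub>XK\<^esub>i\<in>{..<n}. ev f (pure d (h (\<theta> i)) (p i)))"
        unfolding \<zeta>_def using pc by (intro mhom_finsum[OF T.left_module_T left_module_XK ev(1)[OF cocycleD(1)[OF f]]]) auto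
      also have "\<dots> = (\<Oplus>\<^bsub>X\<^esub>i\<in>{..<n}. ev f (pure d (h (\<theta> i)) (p i)))"
        by (rule finsum_cong_add) simp_all
      also have "\<dots> = (\<Oplus>\<^bsub>X\<^esub>i\<in>{..<n}. f (p i) \<odot>\<^bsub>X\<^esub> h (\<theta> i))"
        by (intro X.M.finsum_cong') (auto simp: ev(2)[OF cocycleD(1)[OF f]] hc \<theta>_closed p fA X_smult_closed)
      also have "\<dots> = h (Th.cls f)" using sum[of "\<lambda>i. f (p i)"] fA p \<theta>_expand[OF f] by simp
      finally show "tor_pairing \<zeta> (Th.cls f) = h (Th.cls f)" .
    qed
    then have "h = tor_iso (H.cls \<zeta>)" using tor_iso(2)[OF z] by simp
    then show "h \<in> tor_iso ` carrier (Tor K A d X M)" using H.cls_closed[OF z] by (simp add: Tor_eq)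
  qed
qed

text \<open>On the class of a cocycle \<open>f\<close> both sides give \<open>u\<close> of the
  evaluation of \<open>f\<close> at a representing cycle. The isomorphism for \<open>X'\<close> is
  built from the same retraction and dual basis, none of which involves the coefficients.\<close>

lemma tor_iso_natural:
  assumes X': "left_module (op_algebra A) X'" and u: "u \<in> mhom (op_algebra A) X X'"
    and \<xi>: "\<xi> \<in> carrier (Tor K A d X M)"
  shows "tor_coefficients.tor_iso K A M m X' (Tor_map K A d X' M u \<xi>) = compose (carrier \<Theta>) u (tor_iso \<xi>)"
proof -
  interpret X': tor_coefficients K A M m g n p \<phi> X'
    by (intro tor_coefficients.intro tor_coefficients_axioms.intro split_resolution_axioms X')
  let ?t = "\<lambda>j. tensor_map K A X' (P j) u (\<lambda>p. p)"
  note t = tensor_map[OF X'.T.tensor_pair_axioms T.tensor_pair_axioms u mhom_id]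
  note uc = mhom_closed[OF u]
  have t_bd: "?t j (bd j \<zeta>) = X'.bd j (?t (Suc j) \<zeta>)" if "\<zeta> \<in> carrier (C (Suc j))" for j \<zeta>
    by (rule T.mhom_T_eqI[OF X'.T.left_module_T mhom_comp[OF bd_hom t(1)] mhom_comp[OF t(1) X'.bd_hom] _ that])
      (simp add: t(2) bd_pure X'.bd_pure uc D_closed)
  have tZ: "?t d \<zeta> \<in> X'.ZT" if "\<zeta> \<in> ZT" for \<zeta>
    using t_bd[OF cycleD(1)[OF that]] cycleD(2)[OF that] mhom_closed[OF t(1) cycleD(1)[OF that]]
      mhom_zero[OF T.left_module_T X'.T.left_module_T t(1)] by (simp add: X'.cycles_eq)
  have tB: "?t d \<zeta> \<in> X'.BT" if "\<zeta> \<in> BT" for \<zeta>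
    using that mhom_closed[OF t(1)] by (auto simp: boundaries_eq X'.boundaries_eq t_bd)
  obtain \<zeta> where \<zeta>: "\<zeta> \<in> ZT" "\<xi> = H.cls \<zeta>" using \<xi> unfolding Tor_eq by (rule H.cls_cases)
  have eq: "X'.H.cls (?t d w) = X'.H.cls (?t d \<zeta>)" if w: "w \<in> ZT" "w \<ominus>\<^bsub>C d\<^esub> \<zeta> \<in> BT" for w
    using X'.H.cls_eq_iff[OF tZ[OF w(1)] tZ[OF \<zeta>(1)]] tB[OF w(2)]
      mhom_diff[OF T.left_module_T X'.T.left_module_T t(1) cycleD(1)[OF w(1)] cycleD(1)[OF \<zeta>(1)]] by simp
  have "Tor_map K A d X' M u \<xi> = X'.H.cls (?t d \<zeta>)"
    unfolding Tor_map_def Tor_chains_def \<zeta>(2) by (rule H.union_cls[where G = "\<lambda>\<zeta>. X'.H.cls (?t d \<zeta>)", OF \<zeta>(1) eq])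
  then have 1: "X'.tor_iso (Tor_map K A d X' M u \<xi>) = X'.tor_pairing (?t d \<zeta>)" using X'.tor_iso(2)[OF tZ[OF \<zeta>(1)]] by simp
  have hom: "tor_pairing \<zeta> \<in> mhom (op_algebra A) \<Theta> X" using tor_pairing(1)[OF \<zeta>(1)] by (simp add: hom_space_simps)
  have "X'.tor_pairing (?t d \<zeta>) = compose (carrier \<Theta>) u (tor_pairing \<zeta>)"
  proof (rule X'.HT_eqI[OF X'.tor_pairing(1)[OF tZ[OF \<zeta>(1)]]])
    show "compose (carrier \<Theta>) u (tor_pairing \<zeta>) \<in> carrier X'.HT"
      unfolding compose_def by (rule hom_space_mem[OF left_module_Theta mhom_comp[OF hom u]])
    fix f assume f: "f \<in> ZE AA"
    note ef = ev[OF cocycleD(1)[OF f]] X'.ev[OF cocycleD(1)[OF f]]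
    have uK: "u \<in> mhom K XK X'.XK" using op.mhom_scalars[OF u] by simp
    have fA: "f y \<in> carrier A" if "y \<in> carrier (P d)" for y using hom_A_closed[OF cocycleD(4)[OF f] that] .
    have us: "u (a \<odot>\<^bsub>X\<^esub> x) = a \<odot>\<^bsub>X'\<^esub> u x" if "a \<in> carrier A" "x \<in> carrier X" for a x
      using mhom_smult[OF u, of a x] that by simp
    have "X'.ev f (?t d \<zeta>) = u (ev f \<zeta>)"
      by (rule T.mhom_T_eqI[OF X'.left_module_XK mhom_comp[OF t(1) ef(3)] mhom_comp[OF ef(1) uK] _ cycleD(1)[OF \<zeta>(1)]])
        (simp add: t(2) ef(2,4) uc fA us)
    then show "X'.tor_pairing (?t d \<zeta>) (Th.cls f) = compose (carrier \<Theta>) u (tor_pairing \<zeta>) (Th.cls f)"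
      using f by (simp add: compose_def X'.tor_pairing(2)[OF tZ[OF \<zeta>(1)]] tor_pairing(2)[OF \<zeta>(1)] Theta_ops(5))
  qed
  then show ?thesis using 1 tor_iso(2)[OF \<zeta>(1)] \<zeta>(2) by simp
qed

end

subsection \<open>Hochschild cohomology and homology in top degree\<close>

lemma linear_mapI:
  assumes "field K" "left_module K V" "left_module K W" "f \<in> mhom K V W"
  shows "linear_map K V W f"
proof -
  have "vectorspace K V" "vectorspace K W" using assms(1-3) vectorspace_iff by blast+
  then show ?thesis
    using assms(4) by (simp add: linear_map_def mod_hom_def mod_hom_axioms_def vectorspace_def)
qed

text \<open>Existence of a resolution on the universe type gives the choice operator its meaning.
  The augmentation is recovered separately, since \<open>res_module\<close> and
  \<open>res_diff\<close> record only the complex.\<close>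

lemma (in algebra_over_field) the_resolution:
  assumes "fd_space K A" "fd_left_module K A M"
  obtains \<epsilon> where "projective_resolution K A M (res_module K A M) (res_diff K A M) \<epsilon>"
proof -
  obtain P :: "nat \<Rightarrow> ('a, nat \<Rightarrow> 'k) module" and D \<epsilon> where "projective_resolution K A M P D \<epsilon>"
    using projective_resolution_exists[OF assms] by blast
  then have "case the_resolution K A M of (P, D, \<epsilon>) \<Rightarrow> projective_resolution K A M P D \<epsilon>"
    unfolding the_resolution_def
    by (intro someI[of "\<lambda>(P, D, \<epsilon>). projective_resolution K A M P D \<epsilon>" "(P, D, \<epsilon>)"]) simp
  then show ?thesis
    using that[of "snd (snd (the_resolution K A M))"]
    by (simp add: res_module_def res_diff_def split_beta)
qed

theorem proposition4p3:
  fixes K :: "('k, 'z) ring_scheme" and \<Lambda> :: "('k, 'a) module" and d :: nat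
  assumes "field K"
    and "fd_algebra K \<Lambda>"
    and "separable_algebra K (quotient_algebra \<Lambda> (jacobson_radical \<Lambda>))"
    and "gl_dim K \<Lambda> = enat d"
    and "1 \<le> d"
  shows "(\<exists>\<eta> :: ('a, 'x) bimodule \<Rightarrow> _. natural_iso K \<Lambda>
            (HH_cohomology K \<Lambda> d)
            (HH_cohomology_map K \<Lambda> d)
            (\<lambda>X. tensor_space K (enveloping_algebra K \<Lambda>) (Theta K \<Lambda> d) (env_left K \<Lambda> X))
            (\<lambda>Y f. tensor_map K (enveloping_algebra K \<Lambda>) (Theta K \<Lambda> d) (env_left K \<Lambda> Y) (\<lambda>\<theta>. \<theta>) f)
            \<eta>) \<and>
         (\<exists>\<eta> :: ('a, 'x) bimodule \<Rightarrow> _. natural_iso K \<Lambda>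
            (HH_homology K \<Lambda> d)
            (HH_homology_map K \<Lambda> d)
            (\<lambda>X. hom_space (op_algebra (enveloping_algebra K \<Lambda>)) (Theta K \<Lambda> d) (env_right K \<Lambda> X))
            (\<lambda>Y f. compose (carrier (Theta K \<Lambda> d)) f)
            \<eta>)"
proof -
  have fd: "fd_space K \<Lambda>" and K: "field K" using assms(1,2) by (auto simp: fd_algebra_def)
  interpret enveloping K \<Lambda>
    using assms(1,2) by (intro enveloping.intro algebra_over_field.intro) (simp_all add: fd_algebra_def)
  let ?R = "env_left K \<Lambda> (regular_bimodule \<Lambda>)"
  \<comment> \<open>\<open>split_resolution\<close> works in degree \<open>Suc m\<close>, where
    coboundaries and cycles are described through a differential to or from
    \<open>P m\<close>.\<close>
  obtain m where d: "d = Suc m" using assms(5) by (cases d) auto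
  obtain \<epsilon> where res: "projective_resolution K E ?R (res_module K E ?R) (res_diff K E ?R) \<epsilon>"
    using E.the_resolution[OF fd_space_E[OF fd] fd_env_left_regular[OF fd]] by blast
  interpret R: bimodule_resolution K \<Lambda> "res_module K E ?R" "res_diff K E ?R" \<epsilon>
    by (intro bimodule_resolution.intro bimodule_resolution_axioms.intro enveloping_axioms fd res)
  \<comment> \<open>The vanishing result is used with the global dimension \<open>d\<close> as its
    index, not with \<open>m = d - 1\<close>: \<open>g\<close> retracts \<open>P d\<close> onto the
    image of \<open>P (Suc d)\<close>.\<close>
  obtain g where g: "g \<in> mhom E (res_module K E ?R d) (res_module K E ?R d)"
    "\<And>x. x \<in> carrier (res_module K E ?R d) \<Longrightarrow> g x \<in> res_diff K E ?R d ` carrier (res_module K E ?R (Suc d))"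
    "\<And>x. x \<in> carrier (res_module K E ?R (Suc d)) \<Longrightarrow> g (res_diff K E ?R d x) = res_diff K E ?R d x"
    using R.retraction_onto_boundaries[OF assms(3,4)] by blast
  obtain n :: nat and p \<phi> where p: "\<And>i. i < n \<Longrightarrow> p i \<in> carrier (res_module K E ?R d)"
    "\<And>i. i < n \<Longrightarrow> \<phi> i \<in> mhom E (res_module K E ?R d) (regular_module E)"
    "\<And>x. x \<in> carrier (res_module K E ?R d) \<Longrightarrow>
      (\<Oplus>\<^bsub>res_module K E ?R d\<^esub>i\<in>{..<n}. \<phi> i x \<odot>\<^bsub>res_module K E ?R d\<^esub> p i) = x"
    by (rule fg_projectiveE[OF R.fg_projective_P[of d]]) blast
  have split: "split_resolution K E ?R m g n p \<phi>"
    using g p unfolding d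
    by (intro split_resolution.intro split_resolution_axioms.intro E.algebra_over_field_axioms
        R.projective_complex_axioms) auto
  then interpret SR: split_resolution K E ?R m g n p \<phi> .
  have Theta: "Theta K \<Lambda> d = SR.\<Theta>" by (simp add: Theta_def d)
  have bim: "bimodule_over K \<Lambda> X" if "fd_bimodule K \<Lambda> X" for X :: "('a, 'x) bimodule"
    using that by (intro bimodule_over.intro bimodule_over_axioms.intro enveloping_axioms) (simp add: fd_bimodule_def)
  note left = bimodule_over.left_module_env_left[OF bim]
  have tor: "tor_coefficients K E ?R m g n p \<phi> (env_right K \<Lambda> X)" if "fd_bimodule K \<Lambda> X" for X :: "('a, 'x) bimodule"
    using split bimodule_over.left_module_env_right[OF bim[OF that]]
    by (intro tor_coefficients.intro tor_coefficients_axioms.intro)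
  note hom = bimodule_hom_env[OF bimodule_over.bimodule bimodule_over.bimodule, OF bim bim]
  have ext_lin: "linear_map K (HH_cohomology K \<Lambda> d X) (tensor_space K E SR.\<Theta> (env_left K \<Lambda> X)) (SR.ext_iso (env_left K \<Lambda> X))"
    and ext_bij: "bij_betw (SR.ext_iso (env_left K \<Lambda> X)) (carrier (HH_cohomology K \<Lambda> d X))
      (carrier (tensor_space K E SR.\<Theta> (env_left K \<Lambda> X)))"
    if "fd_bimodule K \<Lambda> X" for X :: "('a, 'x) bimodule"
  proof -
    note l = left[OF that]
    show "linear_map K (HH_cohomology K \<Lambda> d X) (tensor_space K E SR.\<Theta> (env_left K \<Lambda> X)) (SR.ext_iso (env_left K \<Lambda> X))"
      unfolding HH_cohomology_def d
      using SR.ext_iso(1)[OF l] tensor_pair.left_module_T[OF SR.tensor_pair_Theta[OF l]]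
        subquotient_module.left_module_subquotient[OF SR.ext_subquotient[OF l]]
      by (intro linear_mapI K) (simp_all add: SR.Ext_eq)
    show "bij_betw (SR.ext_iso (env_left K \<Lambda> X)) (carrier (HH_cohomology K \<Lambda> d X))
        (carrier (tensor_space K E SR.\<Theta> (env_left K \<Lambda> X)))"
      unfolding HH_cohomology_def d by (rule SR.ext_iso_bij[OF l])
  qed
  have ext_nat: "SR.ext_iso (env_left K \<Lambda> Y) (HH_cohomology_map K \<Lambda> d Y f u) =
      tensor_map K E SR.\<Theta> (env_left K \<Lambda> Y) (\<lambda>\<theta>. \<theta>) f (SR.ext_iso (env_left K \<Lambda> X) u)"
    if "fd_bimodule K \<Lambda> X" "fd_bimodule K \<Lambda> Y" "f \<in> bimodule_hom \<Lambda> X Y" "u \<in> carrier (HH_cohomology K \<Lambda> d X)"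
    for X Y :: "('a, 'x) bimodule" and f u
    using SR.ext_iso_natural[OF left[OF that(1)] left[OF that(2)] hom(1)[OF that(1-3)]] that(4)
    by (simp add: HH_cohomology_def HH_cohomology_map_def d)
  let ?T = "\<lambda>X. tor_coefficients.tor_iso K E ?R m (env_right K \<Lambda> X)"
  have tor_lin: "linear_map K (HH_homology K \<Lambda> d X) (hom_space (op_algebra E) SR.\<Theta> (env_right K \<Lambda> X)) (?T X)"
    and tor_bij: "bij_betw (?T X) (carrier (HH_homology K \<Lambda> d X))
      (carrier (hom_space (op_algebra E) SR.\<Theta> (env_right K \<Lambda> X)))"
    if "fd_bimodule K \<Lambda> X" for X :: "('a, 'x) bimodule"
  proof -
    interpret X: tor_coefficients K E ?R m g n p \<phi> "env_right K \<Lambda> X" by (rule tor[OF that])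
    show "linear_map K (HH_homology K \<Lambda> d X) (hom_space (op_algebra E) SR.\<Theta> (env_right K \<Lambda> X)) (?T X)"
      unfolding HH_homology_def d
      using X.tor_iso(1) X.left_module_HT X.H.left_module_subquotient
      by (intro linear_mapI K) (simp_all add: X.Tor_eq)
    show "bij_betw (?T X) (carrier (HH_homology K \<Lambda> d X))
        (carrier (hom_space (op_algebra E) SR.\<Theta> (env_right K \<Lambda> X)))"
      unfolding HH_homology_def d by (rule X.tor_iso_bij)
  qed
  have tor_nat: "?T Y (HH_homology_map K \<Lambda> d Y f u) = compose (carrier SR.\<Theta>) f (?T X u)"
    if "fd_bimodule K \<Lambda> X" "fd_bimodule K \<Lambda> Y" "f \<in> bimodule_hom \<Lambda> X Y" "u \<in> carrier (HH_homology K \<Lambda> d X)"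
    for X Y :: "('a, 'x) bimodule" and f u
    using tor_coefficients.tor_iso_natural[OF tor[OF that(1)]
        bimodule_over.left_module_env_right[OF bim[OF that(2)]] hom(2)[OF that(1-3)]] that(4)
    by (simp add: HH_homology_def HH_homology_map_def d)
  show ?thesis
    unfolding natural_iso_def Theta
    by (intro conjI exI[of _ "\<lambda>X. SR.ext_iso (env_left K \<Lambda> X)"] exI[of _ ?T] allI impI ballI)
      (use ext_lin ext_bij ext_nat tor_lin tor_bij tor_nat in auto)
qed

end
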